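(* Let $s\in\mathbb{C}$ with $\Re s>1$, let $a\in\mathbb{R}\setminus\{0\}$, $b\in\mathbb{R}$, $d>0$, and let $n\in\mathbb{Z}$ be minimal such that $n>|a|d+b\,\mathrm{sgn}(a)$. Set $$H_{a,b,d}(s)=\frac{\log2}{sd^s}+1_{\mathbb{R}\setminus\mathbb{Z}}(ad+b)\frac{\log\big((\sin(\pi(ad+b)))^2\big)}{2sd^s}+1_{\mathbb{Z}}(b)\frac1{s^2d^s}$$ $$+\frac{1}{sd^s}1_{\mathbb{Z}}(ad+b)\Big(\frac1s-\psi(1+s)-\gamma+\tfrac12\log\big((\pi ad)^2\big)\Big)-\frac1{d^s}\sum_{\substack{k\in\mathbb{Z}\\k\notin\{b,ad+b\}}}\frac{ad}{b-k}\,\frac{{}_2F_1\big(1,1-s;2-s;-\frac{ad}{b-k}\big)}{s(1-s)}$$ $$+i\,\frac{\pi|a|^s}{s}\Big(\zeta(s,1-\{b\,\mathrm{sgn}(a)\})-\zeta(s,n-b\,\mathrm{sgn}(a))\Big).$$ Then $$H_{a,b,d}(s)+\frac{\pi|a|^s}{s}\left(\frac{\zeta(s,1-\{-b\,\mathrm{sgn}(a)\})}{\sin(\pi s)}+\frac{\zeta(s,1-\{b\,\mathrm{sgn}(a)\})}{\tan(\pi s)}\right)$$ $$=-\sum_{k=1}^\infty\Bigg[\frac{\cos(2\pi bk)}{d^ssk}\,{}_1F_2\Big(-\tfrac s2;\tfrac12,1-\tfrac s2;-\pi^2a^2d^2k^2\Big)+\frac{2\pi ad^{1-s}\sin(2\pi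 bk)}{1-s}\,{}_1F_2\Big(\tfrac12(1-s);\tfrac32,1+\tfrac12(1-s);-\pi^2a^2d^2k^2\Big)$$ $$\qquad+k^{s-1}(2\pi)^s\Gamma(-s)\tfrac12\Big((-ia)^se^{2\pi ibk}+(ia)^se^{-2\pi ibk}\Big)\Bigg].$$ The series on the left-hand side (the sum over $k\in\mathbb{Z}$ in $H_{a,b,d}(s)$) converges to a meromorphic function (with poles in $s\in\mathbb{N}_{\ge2}$), where the summation in $k$ is understood from $0$ to $\infty$ in absolute value. The convergence on the left-hand side is absolute and uniform in $s$, for every $\epsilon>0$, such that $\Re s<\epsilon$ and $s$ is bounded away from $\mathbb{N}_{\le\epsilon}$, uniform in $b$ uniformly bounded away from $\mathbb{Z}$, and uniform in $a$ and $d$ with $ad+b$ bounded away from $\mathbb{Z}$ and $ad$ bounded. The series on the right-hand side converges to a holomorphic function in $s$. The convergence is absolute and uniform in $b$, in $a,d$ bounded away from $0$ and $\infty$, and, for every $\epsilon>0$, in $s$ with $\Re s>-\epsilon$ and $|\Im s|<\epsilon$. If $\Re s<1$ and $b\in\mathbb{R}\setminus\mathbb{Z}$, or $\Re s<0$ and $b\in\mathbb{Z}$, then $$\sum_{k=1}^\infty\left[\frac{2\pi a\sin(2\pi bk)}{1-s}\,{}_1F_2\Big(\tfrac12(1-s);\tfrac32,1+\tfrac12(1-s);-\pi^2a^2k^2\Big)+\frac{\cos(2\pi bk)}{sk}\,{}_1F_2\Big(-\tfrac s2;\tfrac12,1-\tfrac s2;-\pi^2a^2k^2\Big)\right]=-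H_{a,b,1}(s).$$
   Context: $1_A$ is the indicator function of $A$; $\mathbb{N}_{\ge2}$ and $\mathbb{N}_{\le\epsilon}$ are the natural numbers $\ge2$ and $\le\epsilon$; $\{x\}$ is the fractional part of $x\in\mathbb{R}$; $\mathrm{sgn}(x)=1$ for $x\ge0$ and $-1$ for $x<0$. $\gamma$ is the Euler–Mascheroni constant, $\psi$ the digamma function, and $\zeta(s,x)$ the Hurwitz zeta function, $\zeta(s,x)=\sum_{k\ge0}(k+x)^{-s}$ for $\Re s>1$, $x>0$, continued meromorphically in $s$. Complex powers are $u^v=e^{v\log u}$ with the principal logarithm (imaginary part in $(-\pi,\pi]$). ${}_1F_2(\alpha;\beta,\gamma';z)=\sum_{m\ge0}\frac{(\alpha)_m}{(\beta)_m(\gamma')_m}\frac{z^m}{m!}$ with $(x)_m=\Gamma(x+m)/\Gamma(x)$. ${}_2F_1$ is the Gauss hypergeometric function, with values at real arguments $x>1$ taken as the limit from the lower half-plane (at $x-i0$).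
   Formalization: If ad+b is an integer, π(cot(πs)+i)/(s d^s) is subtracted from the left side (d=1: from H); left uniformity in b needs b bounded; right uniformity needs |d^(-s)| bounded or a factor d^s; at integers s where terms have poles identities are limits; s=0 excluded in the last identity. *)

theory Defs
  imports "HOL-Complex_Analysis.Complex_Analysis"
begin

definition hyp1F2 :: "complex \<Rightarrow> complex \<Rightarrow> complex \<Rightarrow> complex \<Rightarrow> complex" where
  "hyp1F2 \<alpha> \<beta> \<gamma> z =
     (\<Sum>m. pochhammer \<alpha> m / (pochhammer \<beta> m * pochhammer \<gamma> m) * z ^ m / fact m)"

(* The branch on the plane slit along [1, oo); by the identity theorem the conditions determine it
   there, and they leave it arbitrary on the slit. *)
definition hyp2F1_slit :: "complex \<Rightarrow> complex \<Rightarrow> complex \<Rightarrow> complex \<Rightarrow> complex" where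
  "hyp2F1_slit \<alpha> \<beta> \<gamma> = (SOME f.
     f holomorphic_on {z. \<not> (Im z = 0 \<and> 1 \<le> Re z)} \<and>
     (\<forall>z. norm z < 1 \<longrightarrow>
        f z = (\<Sum>m. pochhammer \<alpha> m * pochhammer \<beta> m / pochhammer \<gamma> m * z ^ m / fact m)))"

(* On the slit the value is the one at x - i0. *)
definition hyp2F1 :: "complex \<Rightarrow> complex \<Rightarrow> complex \<Rightarrow> complex \<Rightarrow> complex" where
  "hyp2F1 \<alpha> \<beta> \<gamma> z =
     (if Im z = 0 \<and> 1 \<le> Re z
      then Lim (at z within {w. Im w < 0}) (hyp2F1_slit \<alpha> \<beta> \<gamma>)
      else hyp2F1_slit \<alpha> \<beta> \<gamma> z)"

(* The meromorphic continuation in s, whose only pole is s = 1; the value at the pole is arbitrary. *)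
definition hurwitz_zeta :: "complex \<Rightarrow> real \<Rightarrow> complex" where
  "hurwitz_zeta s x = (SOME f.
     f holomorphic_on (- {1}) \<and>
     (\<forall>s. Re s > 1 \<longrightarrow> f s = (\<Sum>k. of_real (real k + x) powr (- s)))) s"

(* Series over the integers are summed in order of increasing absolute value of the index. *)
definition paired :: "(int \<Rightarrow> complex) \<Rightarrow> nat \<Rightarrow> complex" where
  "paired f j = (if j = 0 then f 0 else f (int j) + f (- int j))"

definition abs_unif_convergent_on :: "'p set \<Rightarrow> (nat \<Rightarrow> 'p \<Rightarrow> complex) \<Rightarrow> bool" where
  "abs_unif_convergent_on X f \<longleftrightarrow>
     uniformly_convergent_on X (\<lambda>N x. \<Sum>j<N. f j x) \<and>
     uniformly_convergent_on X (\<lambda>N x. \<Sum>j<N. norm (f j x))"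

definition away_from_Ints :: "real \<Rightarrow> real set" where
  "away_from_Ints \<delta> = {x. \<forall>k::int. \<delta> \<le> \<bar>x - of_int k\<bar>}"

definition left_region :: "real \<Rightarrow> real \<Rightarrow> complex set" where
  "left_region \<epsilon> \<delta> = {s. Re s < \<epsilon> \<and> (\<forall>m::nat. real m \<le> \<epsilon> \<longrightarrow> \<delta> \<le> dist s (of_nat m))}"

definition lhs_term :: "real \<Rightarrow> real \<Rightarrow> real \<Rightarrow> complex \<Rightarrow> int \<Rightarrow> complex" where
  "lhs_term a b d s k =
     (if of_int k = b \<or> of_int k = a * d + b then 0
      else of_real (a * d / (b - of_int k)) *
           (hyp2F1 1 (1 - s) (2 - s) (of_real (- (a * d / (b - of_int k)))) / (s * (1 - s))))"

definition H :: "real \<Rightarrow> real \<Rightarrow> real \<Rightarrow> complex \<Rightarrow> complex" where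
  "H a b d s =
     of_real (ln 2) / (s * of_real d powr s)
     + indicator (- \<int>) (a * d + b) * of_real (ln ((sin (pi * (a * d + b)))\<^sup>2))
         / (2 * s * of_real d powr s)
     + indicator \<int> b * (1 / (s\<^sup>2 * of_real d powr s))
     + 1 / (s * of_real d powr s) * indicator \<int> (a * d + b) *
         (1 / s - Digamma (1 + s) - euler_mascheroni + of_real (1/2 * ln ((pi * a * d)\<^sup>2)))
     - 1 / of_real d powr s * (\<Sum>j. paired (lhs_term a b d s) j)
     + \<i> * (of_real pi * of_real \<bar>a\<bar> powr s / s) *
         (hurwitz_zeta s (1 - frac (b * sgn a))
          - hurwitz_zeta s (of_int (LEAST n::int. of_int n > \<bar>a\<bar> * d + b * sgn a) - b * sgn a))"

(* For ad + b = k an integer, the zeta values entering the identities (the one divided by tan (pi s),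
   and the difference inside H) contain the summand of index k, although the integral of
   log|2 sin(pi (a x + b))| x^(-s-1) over x > d that both sides represent has already received its
   contribution from k through the digamma summand of H.  This is what has to be taken away again;
   it is 0 if ad + b is not an integer. *)
definition endpoint_excess :: "real \<Rightarrow> real \<Rightarrow> real \<Rightarrow> complex \<Rightarrow> complex" where
  "endpoint_excess a b d s =
     indicator \<int> (a * d + b) *
       (of_real pi / (s * of_real d powr s) * (1 / tan (of_real pi * s) + \<i>))"

definition lhs :: "real \<Rightarrow> real \<Rightarrow> real \<Rightarrow> complex \<Rightarrow> complex" where
  "lhs a b d s =
     H a b d s
     + of_real pi * of_real \<bar>a\<bar> powr s / s *
         (hurwitz_zeta s (1 - frac (- b * sgn a)) / sin (of_real pi * s)
          + hurwitz_zeta s (1 - frac (b * sgn a)) / tan (of_real pi * s))"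

definition hyp_term :: "real \<Rightarrow> real \<Rightarrow> real \<Rightarrow> complex \<Rightarrow> nat \<Rightarrow> complex" where
  "hyp_term a b d s k =
     of_real (cos (2 * pi * b * k)) / (of_real d powr s * s * of_nat k) *
       hyp1F2 (- s / 2) (1/2) (1 - s / 2) (of_real (- (pi\<^sup>2 * a\<^sup>2 * d\<^sup>2 * (real k)\<^sup>2)))
     + of_real (2 * pi * a) * of_real d powr (1 - s) * of_real (sin (2 * pi * b * k)) / (1 - s) *
       hyp1F2 ((1 - s) / 2) (3/2) (1 + (1 - s) / 2) (of_real (- (pi\<^sup>2 * a\<^sup>2 * d\<^sup>2 * (real k)\<^sup>2)))"

definition rhs_term :: "real \<Rightarrow> real \<Rightarrow> real \<Rightarrow> complex \<Rightarrow> nat \<Rightarrow> complex" where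
  "rhs_term a b d s k =
     hyp_term a b d s k
     + of_nat k powr (s - 1) * of_real (2 * pi) powr s * Gamma (- s) * (1/2) *
       ((- \<i> * of_real a) powr s * exp (2 * of_real pi * \<i> * of_real b * of_nat k)
        + (\<i> * of_real a) powr s * exp (- (2 * of_real pi * \<i> * of_real b * of_nat k)))"

(* At s = 0, 1, 2, ... poles of the individual summands cancel and the singularity of the whole term
   is removable. *)
definition rhs_term_ext :: "real \<Rightarrow> real \<Rightarrow> real \<Rightarrow> complex \<Rightarrow> nat \<Rightarrow> complex" where
  "rhs_term_ext a b d s k = remove_sings (\<lambda>s. rhs_term a b d s k) s"

end

theory Submission
  imports Defs "HOL-Real_Asymp.Real_Asymp"
begin

text \<open>Both sides represent, up to the factor \<open>d\<close> to the power \<open>- s\<close>, the Mellin type integral of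
  \<open>ln (2 |sin (pi (a x + b))|)\<close> against \<open>x\<close> to the power \<open>- s - 1\<close>, where scaling and the symmetry
  \<open>(a, b) \<mapsto> (- a, - b)\<close> allow \<open>d = 1\<close> and \<open>a > 0\<close>. For \<open>Re s\<close> sufficiently negative the integral over
  \<open>0 < x < 1\<close> converges. Inserting the Fourier series of the logarithm gives the \<open>1F2\<close> summands, and
  inserting the sine product gives the \<open>2F1\<close> summands of \<open>H\<close>. Adding the Gamma summand turns the integral
  of \<open>exp (\<plusminus> 2 pi i a k x)\<close> over the unit interval into minus the integral over a ray starting at \<open>1\<close>, which
  is entire in \<open>s\<close> and of size \<open>1 / k\<close>; the Gamma summands alone add up to the zeta values by Hurwitz'
  formula. Every identity is then extended in \<open>s\<close> by the identity theorem.\<close>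

text \<open>One kernel, -ln (1 - exp (2 pi \<i> y)), serves twice: its even part in y is the
  logarithm of the sine and leads to \<open>H\<close>, its odd part is a sawtooth with elementary
  moments and leads to Hurwitz' formula. Its Fourier series is only conditionally convergent, so
  integrals are exchanged with Abel means. The bookkeeping is dictated by the zeros of sin (pi (a x
  + b)) in the unit interval: a zero at x = 0 yields 1 / s^2, a zero at x = 1 yields a Digamma
  value, and every zero strictly between puts the argument of the 2F1 on the slit, where the
  boundary value at x - i0 adds an imaginary term that the difference of zeta values in
  \<open>H\<close> takes away. If a + b is an integer, the poles of Digamma (1 + s) at the negative
  integers have to be matched by a cotangent, so the continuation is carried out on
  \<open>H_ext\<close> rather than on \<open>H\<close>. The integrals are evaluated only well to the
  left, for Re s < -1 or Re s < -2, where the weight is continuous and bounded by 1 on the closed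
  interval and dominated convergence is enough.\<close>

section \<open>Holomorphy of dominated integrals and series in a parameter\<close>

text \<open>Cauchy's estimate on small discs turns the majorant \<open>h\<close> of the integrand
  into the majorant \<open>h x / r\<close> of its derivative, hence of its difference quotients;
  dominated convergence along sequences then differentiates under the integral sign.\<close>

lemma holomorphic_on_integral_dominated:
  fixes f :: "real \<Rightarrow> complex \<Rightarrow> complex" and S :: "real set"
  assumes "open A"
    and holo: "\<And>x. x \<in> S \<Longrightarrow> f x holomorphic_on A"
    and int: "\<And>z. z \<in> A \<Longrightarrow> (\<lambda>x. f x z) integrable_on S"
    and dom: "\<And>z. z \<in> A \<Longrightarrow> \<exists>r>0. \<exists>h. h integrable_on S \<and> (\<forall>x\<in>S. \<forall>w\<in>ball z r \<inter> A. norm (f x w) \<le> h x)"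
  shows "(\<lambda>z. integral S (\<lambda>x. f x z)) holomorphic_on A"
proof -
  have "\<exists>D. ((\<lambda>z. integral S (\<lambda>x. f x z)) has_field_derivative D) (at z)" if z: "z \<in> A" for z
  proof -
    obtain r0 h where r0: "r0 > 0" "h integrable_on S"
      and h: "\<And>x w. x \<in> S \<Longrightarrow> w \<in> ball z r0 \<inter> A \<Longrightarrow> norm (f x w) \<le> h x"
      using dom[OF z] by blast
    obtain r1 where r1: "r1 > 0" "cball z r1 \<subseteq> A"
      using \<open>open A\<close> z open_contains_cball by blast
    \<comment> \<open>The circle of radius \<open>r\<close> about any point of
      \<open>ball z r\<close> must stay inside \<open>A\<close> and inside the disc where
      \<open>h\<close> dominates; the closed disc of radius \<open>2*r\<close> about
      \<open>z\<close> lies in both.\<close>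
    define r where "r = min (r0/2) r1 / 2"
    have r: "r > 0" "cball z (2*r) \<subseteq> A" "cball z (2*r) \<subseteq> ball z r0"
      using r0(1) r1 by (auto simp: r_def)
    have deriv_bound: "norm (deriv (f x) u) \<le> h x / r" if x: "x \<in> S" and u: "u \<in> ball z r" for x u
    proof -
      have sub: "cball u r \<subseteq> cball z (2*r)"
      proof
        fix y assume "y \<in> cball u r"
        then show "y \<in> cball z (2*r)" using u dist_triangle[of z y u] by simp
      qed
      have "norm ((deriv ^^ 1) (f x) u) \<le> fact 1 * h x / r ^ 1"
      proof (rule Cauchy_inequality)
        have hol: "f x holomorphic_on cball u r"
          using holo[OF x] order_trans[OF sub r(2)] by (rule holomorphic_on_subset)
        show "f x holomorphic_on ball u r" using hol ball_subset_cball by (rule holomorphic_on_subset)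
        show "continuous_on (cball u r) (f x)" using hol by (rule holomorphic_on_imp_continuous_on)
        show "norm (f x y) \<le> h x" if "norm (u - y) = r" for y
        proof (rule h[OF x])
          have "y \<in> cball u r" using that by (simp add: dist_norm)
          then show "y \<in> ball z r0 \<inter> A" using sub r(2,3) by blast
        qed
        show "0 < r" by (rule r(1))
      qed
      then show ?thesis by simp
    qed
    have quot: "norm ((f x w - f x z) / (w - z)) \<le> h x / r" if x: "x \<in> S" and w: "w \<in> ball z r" for x w
    proof -
      have "norm (f x w - f x z) \<le> h x / r * norm (w - z)"
      proof (rule field_differentiable_bound[of "ball z r" "f x" "deriv (f x)"])
        fix u assume u: "u \<in> ball z r"
        then have "u \<in> A" using r(1,2) by (auto simp: subset_iff)
        then show "(f x has_field_derivative deriv (f x) u) (at u within ball z r)"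
          using holo[OF x] \<open>open A\<close> by (meson has_field_derivative_at_within holomorphic_derivI)
        show "norm (deriv (f x) u) \<le> h x / r" using deriv_bound[OF x u] .
      qed (use w r in auto)
      then show ?thesis
        using order_trans[OF norm_ge_zero deriv_bound[OF x w]]
        by (cases "w = z") (auto simp: norm_divide divide_le_eq)
    qed
    have "((\<lambda>w. (integral S (\<lambda>x. f x w) - integral S (\<lambda>x. f x z)) / (w - z)) \<longlongrightarrow>
            integral S (\<lambda>x. deriv (f x) z)) (at z within ball z r)"
    proof (subst tendsto_at_iff_sequentially, intro allI impI)
      fix X assume X: "\<forall>i. X i \<in> ball z r - {z}" "X \<longlonglongrightarrow> z"
      have "ball z r \<subseteq> cball z (2*r)" using r(1) by auto
      then have XA: "X i \<in> A" for i using X(1) r(2) by blast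
      have lim: "(\<lambda>i. (f x (X i) - f x z) / (X i - z)) \<longlonglongrightarrow> deriv (f x) z" if x: "x \<in> S" for x
      proof -
        have "(f x has_field_derivative deriv (f x) z) (at z)"
          using holo[OF x] \<open>open A\<close> z by (rule holomorphic_derivI)
        then have "((\<lambda>w. (f x w - f x z) / (w - z)) \<longlongrightarrow> deriv (f x) z) (at z)"
          by (simp add: has_field_derivative_iff)
        then show ?thesis using X by (auto simp: tendsto_at_iff_sequentially o_def)
      qed
      have conv: "(\<lambda>i. integral S (\<lambda>x. (f x (X i) - f x z) / (X i - z))) \<longlonglongrightarrow> integral S (\<lambda>x. deriv (f x) z)"
      proof (rule dominated_convergence(2))
        show "(\<lambda>x. (f x (X i) - f x z) / (X i - z)) integrable_on S" for i
          by (intro integrable_on_divide integrable_diff int XA z)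
        show "(\<lambda>x. h x / r) integrable_on S" using r0(2) by (rule integrable_on_divide)
        show "norm ((f x (X i) - f x z) / (X i - z)) \<le> h x / r" if "x \<in> S" for i x
          using quot[OF that] X(1) by blast
      qed (use lim in auto)
      have eq: "integral S (\<lambda>x. (f x (X i) - f x z) / (X i - z)) =
          (integral S (\<lambda>x. f x (X i)) - integral S (\<lambda>x. f x z)) / (X i - z)" for i
        by (simp only: integral_divide integral_diff[OF int[OF XA] int[OF z]])
      show "((\<lambda>w. (integral S (\<lambda>x. f x w) - integral S (\<lambda>x. f x z)) / (w - z)) \<circ> X)
          \<longlonglongrightarrow> integral S (\<lambda>x. deriv (f x) z)" using conv unfolding eq o_def .
    qed
    then have "((\<lambda>w. (integral S (\<lambda>x. f x w) - integral S (\<lambda>x. f x z)) / (w - z)) \<longlongrightarrow>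
            integral S (\<lambda>x. deriv (f x) z)) (at z)"
      using r(1) by (simp add: at_within_open[of z "ball z r"])
    then show ?thesis by (auto simp: has_field_derivative_iff)
  qed
  then show ?thesis using \<open>open A\<close> by (simp add: holomorphic_on_open)
qed

text \<open>A local Weierstrass test. The majorant may depend on the point and may set in after
  finitely many summands, because the later estimates hold only beyond a threshold on the
  index.\<close>

lemma holomorphic_on_suminf_local:
  fixes f :: "nat \<Rightarrow> complex \<Rightarrow> complex"
  assumes "open A"
    and holo: "\<And>n. f n holomorphic_on A"
    and bound: "\<And>z. z \<in> A \<Longrightarrow> \<exists>r>0. \<exists>M N. summable M \<and> (\<forall>n\<ge>N. \<forall>w\<in>ball z r \<inter> A. norm (f n w) \<le> M n)"
  shows "(\<lambda>z. \<Sum>n. f n z) holomorphic_on A"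
proof (rule holomorphic_uniform_sequence[OF \<open>open A\<close>])
  show "(\<lambda>z. \<Sum>i<n. f i z) holomorphic_on A" for n
    by (intro holomorphic_intros holo)
next
  fix z assume z: "z \<in> A"
  obtain r M N where r: "r > 0" and M: "summable M"
    and b: "\<And>n w. n \<ge> N \<Longrightarrow> w \<in> ball z r \<inter> A \<Longrightarrow> norm (f n w) \<le> M n"
    using bound[OF z] by blast
  obtain d where d: "d > 0" "cball z d \<subseteq> A" using \<open>open A\<close> z open_contains_cball by blast
  have sub: "cball z (min d (r/2)) \<subseteq> ball z r \<inter> A" using r d by auto
  have "uniform_limit (cball z (min d (r/2))) (\<lambda>n w. \<Sum>i<n. f i w) (\<lambda>w. \<Sum>i. f i w) sequentially"
  proof (rule Weierstrass_m_test_ev[OF _ M])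
    show "\<forall>\<^sub>F n in sequentially. \<forall>x\<in>cball z (min d (r/2)). norm (f n x) \<le> M n"
      using eventually_ge_at_top[of N] by eventually_elim (use b sub in blast)
  qed
  then show "\<exists>d>0. cball z d \<subseteq> A \<and>
      uniform_limit (cball z d) (\<lambda>n w. \<Sum>i<n. f i w) (\<lambda>w. \<Sum>i. f i w) sequentially"
    using r d by (intro exI[of _ "min d (r/2)"]) auto
qed

section \<open>Incomplete Gamma integrals\<close>

text \<open>With \<open>u = 1 + \<sigma> t\<close> this is the integral of \<open>exp (\<sigma> \<omega> u)\<close> times \<open>u\<close> to the power \<open>- s - 1\<close> over the
  ray from \<open>1\<close> in the direction \<open>\<sigma>\<close>, on which it converges absolutely for every \<open>s\<close>.\<close>

definition upper_int :: "complex \<Rightarrow> real \<Rightarrow> complex \<Rightarrow> complex" where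
  "upper_int \<sigma> \<omega> s = \<sigma> * exp (\<sigma> * of_real \<omega>) *
     integral {0..} (\<lambda>t. of_real (exp (- \<omega> * t)) * (1 + \<sigma> * of_real t) powr (- s - 1))"

text \<open>The ray runs along the line Re = 1. This keeps it off the branch cut, and the modulus is
  at least 1, so that raising a real exponent only enlarges the power.\<close>

lemma norm_one_plus_sigma:
  assumes "\<sigma> \<in> {\<i>, -\<i>}" "t \<ge> 0"
  shows "1 \<le> norm (1 + \<sigma> * of_real t)" "norm (1 + \<sigma> * of_real t) \<le> 1 + t"
    "1 + \<sigma> * of_real t \<notin> \<real>\<^sub>\<le>\<^sub>0"
proof -
  show "1 \<le> norm (1 + \<sigma> * of_real t)"
    using assms(1) complex_Re_le_cmod[of "1 + \<sigma> * of_real t"] by auto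
  show "norm (1 + \<sigma> * of_real t) \<le> 1 + t"
    using assms norm_triangle_ineq[of 1 "\<sigma> * of_real t"] by (auto simp: norm_mult)
  show "1 + \<sigma> * of_real t \<notin> \<real>\<^sub>\<le>\<^sub>0"
    using assms(1) by (auto simp: complex_nonpos_Reals_iff)
qed

text \<open>Half of the decay rate \<open>\<omega>\<close> is spent on absorbing the polynomial
  growth of the power. The bound is uniform on a strip that is unbounded to the right, since only a
  large negative Re s makes the power grow.\<close>

lemma upper_int_integrand_bound:
  fixes \<epsilon> \<omega> :: real
  assumes "\<epsilon> > 0" "\<omega> > 0"
  shows "\<exists>K>0. \<forall>\<sigma>\<in>{\<i>, -\<i>}. \<forall>t\<ge>0. \<forall>s. Re s \<ge> - \<epsilon> \<longrightarrow> \<bar>Im s\<bar> \<le> \<epsilon> \<longrightarrow>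
           norm ((1 + \<sigma> * of_real t) powr (- s - 1)) \<le> K * exp (\<omega> / 2 * t)"
proof -
  \<comment> \<open>Chosen so that \<open>\<epsilon> * \<delta> = \<omega> / 2\<close> once
    \<open>ln ((1 + t) * \<delta>)\<close> is bounded by its argument minus 1.\<close>
  define \<delta> where "\<delta> = \<omega> / (2 * \<epsilon>)"
  have \<delta>: "\<delta> > 0" using assms by (simp add: \<delta>_def)
  define K where "K = exp (\<omega> / 2 - \<epsilon> - \<epsilon> * ln \<delta>) * exp (\<epsilon> * pi)"
  have "norm ((1 + \<sigma> * of_real t) powr (- s - 1)) \<le> K * exp (\<omega> / 2 * t)"
    if \<sigma>: "\<sigma> \<in> {\<i>, -\<i>}" and t: "t \<ge> 0" and s: "Re s \<ge> - \<epsilon>" "\<bar>Im s\<bar> \<le> \<epsilon>" for \<sigma> t s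
  proof -
    let ?z = "1 + \<sigma> * of_real t"
    have A: "norm ?z powr (- Re s - 1) \<le> exp (\<epsilon> * ln (1 + t))"
    proof -
      have "norm ?z powr (- Re s - 1) \<le> norm ?z powr \<epsilon>"
        using norm_one_plus_sigma[OF \<sigma> t] s by (intro powr_mono) auto
      also have "\<dots> \<le> (1 + t) powr \<epsilon>"
        using norm_one_plus_sigma[OF \<sigma> t] assms by (intro powr_mono2) auto
      finally show ?thesis using t by (simp add: powr_def)
    qed
    have "ln (1 + t) = ln ((1 + t) * \<delta>) - ln \<delta>" using \<delta> t by (simp add: ln_mult)
    also have "\<dots> \<le> (1 + t) * \<delta> - 1 - ln \<delta>" using \<delta> t by (simp add: ln_le_minus_one)
    finally have "\<epsilon> * ln (1 + t) \<le> \<epsilon> * ((1 + t) * \<delta> - 1 - ln \<delta>)" using assms by simp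
    also have "\<dots> = \<omega> / 2 - \<epsilon> - \<epsilon> * ln \<delta> + \<omega> / 2 * t"
      using assms by (simp add: \<delta>_def field_simps)
    finally have B: "exp (\<epsilon> * ln (1 + t)) \<le> exp (\<omega> / 2 - \<epsilon> - \<epsilon> * ln \<delta>) * exp (\<omega> / 2 * t)"
      by (simp flip: exp_add)
    have "Im s * Arg ?z \<le> \<bar>Im s\<bar> * \<bar>Arg ?z\<bar>" by (metis abs_ge_self abs_mult)
    also have "\<dots> \<le> \<epsilon> * pi" using s Arg_bounded[of ?z] assms by (intro mult_mono) auto
    finally have C: "exp (Im s * Arg ?z) \<le> exp (\<epsilon> * pi)" by simp
    have "norm (?z powr (- s - 1)) = norm ?z powr (- Re s - 1) * exp (Im s * Arg ?z)"
      by (simp add: norm_powr_complex)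
    also have "\<dots> \<le> (exp (\<omega> / 2 - \<epsilon> - \<epsilon> * ln \<delta>) * exp (\<omega> / 2 * t)) * exp (\<epsilon> * pi)"
      using A B C by (intro mult_mono) auto
    finally show ?thesis by (simp add: K_def mult_ac)
  qed
  moreover have "K > 0" by (simp add: K_def)
  ultimately show ?thesis by blast
qed

lemma upper_int_integrable:
  assumes "\<sigma> \<in> {\<i>, -\<i>}" "\<omega> > 0"
  shows "(\<lambda>t. of_real (exp (- \<omega> * t)) * (1 + \<sigma> * of_real t) powr (- s - 1)) integrable_on {0..}"
proof -
  define \<epsilon> where "\<epsilon> = 1 + norm s"
  have \<epsilon>: "\<epsilon> > 0" "Re s \<ge> -\<epsilon>" "\<bar>Im s\<bar> \<le> \<epsilon>"
    using abs_Re_le_cmod[of s] abs_Im_le_cmod[of s] by (auto simp: \<epsilon>_def add_pos_nonneg)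
  obtain K where K: "K > 0" "\<And>t. t \<ge> 0 \<Longrightarrow> norm ((1 + \<sigma> * of_real t) powr (- s - 1)) \<le> K * exp (\<omega> / 2 * t)"
    using upper_int_integrand_bound[OF \<epsilon>(1) assms(2)] assms(1) \<epsilon>(2,3) by blast
  show ?thesis
  proof (rule measurable_bounded_by_integrable_imp_integrable)
    show "(\<lambda>t. of_real (exp (- \<omega> * t)) * (1 + \<sigma> * of_real t) powr (- s - 1)) \<in> borel_measurable (lebesgue_on {0..})"
      using assms(1)
      by (intro continuous_imp_measurable_on_sets_lebesgue continuous_on_mult continuous_on_powr_complex
          continuous_intros subsetI) (auto simp: complex_eq_iff)
    show "(\<lambda>t. K * exp (-(\<omega>/2) * t)) integrable_on {0..}"
      using assms(2) by (intro integrable_on_mult_right integrable_on_exp_minus_to_infinity) auto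
    show "norm (of_real (exp (- \<omega> * t)) * (1 + \<sigma> * of_real t) powr (- s - 1)) \<le> K * exp (-(\<omega>/2) * t)"
      if "t \<in> {0..}" for t
    proof -
      have "norm (of_real (exp (- \<omega> * t)) * (1 + \<sigma> * of_real t) powr (- s - 1)) \<le>
          exp (- \<omega> * t) * (K * exp (\<omega> / 2 * t))"
        using K(2)[of t] that by (simp add: norm_mult)
      also have "\<dots> = K * exp (-(\<omega>/2) * t)" by (simp add: mult_exp_exp field_simps)
      finally show ?thesis .
    qed
  qed auto
qed

text \<open>This decay is the source of the convergence on the right-hand side:
  \<open>\<omega>\<close> will be proportional to \<open>k\<close>, and the summands carry a further
  factor \<open>1 / k\<close>, which makes them of order 1 / k^2.\<close>

lemma upper_int_bound:
  fixes \<epsilon> \<omega>0 :: real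
  assumes "\<epsilon> > 0" "\<omega>0 > 0"
  shows "\<exists>K>0. \<forall>\<sigma>\<in>{\<i>, -\<i>}. \<forall>\<omega>\<ge>\<omega>0. \<forall>s. Re s \<ge> - \<epsilon> \<longrightarrow> \<bar>Im s\<bar> \<le> \<epsilon> \<longrightarrow>
           norm (upper_int \<sigma> \<omega> s) \<le> K / \<omega>"
proof -
  obtain K where K: "K > 0" "\<And>\<sigma> t s. \<sigma> \<in> {\<i>, -\<i>} \<Longrightarrow> t \<ge> 0 \<Longrightarrow> Re s \<ge> - \<epsilon> \<Longrightarrow> \<bar>Im s\<bar> \<le> \<epsilon> \<Longrightarrow>
      norm ((1 + \<sigma> * of_real t) powr (- s - 1)) \<le> K * exp (\<omega>0 / 2 * t)"
    using upper_int_integrand_bound[OF assms] by blast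
  have "norm (upper_int \<sigma> \<omega> s) \<le> (2 * K) / \<omega>"
    if \<sigma>: "\<sigma> \<in> {\<i>, -\<i>}" and \<omega>: "\<omega> \<ge> \<omega>0" and s: "Re s \<ge> - \<epsilon>" "\<bar>Im s\<bar> \<le> \<epsilon>" for \<sigma> \<omega> s
  proof -
    have \<omega>0: "\<omega> > 0" using \<omega> assms by auto
    have "((\<lambda>x. exp (-(\<omega>/2)*x)) has_integral exp (-(\<omega>/2)*0)/(\<omega>/2)) {0..}"
      using \<omega>0 by (intro has_integral_exp_minus_to_infinity) auto
    then have hi: "((\<lambda>t. K * exp (-(\<omega>/2) * t)) has_integral K * (2 / \<omega>)) {0..}"
      by (intro has_integral_mult_right) simp
    have "norm (integral {0..} (\<lambda>t. of_real (exp (- \<omega> * t)) * (1 + \<sigma> * of_real t) powr (- s - 1)))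
        \<le> integral {0..} (\<lambda>t. K * exp (-(\<omega>/2) * t))"
    proof (rule integral_norm_bound_integral[OF upper_int_integrable[OF \<sigma> \<omega>0]])
      show "(\<lambda>t. K * exp (-(\<omega>/2) * t)) integrable_on {0..}" using hi by blast
      fix t :: real assume t: "t \<in> {0..}"
      have "norm (of_real (exp (- \<omega> * t)) * (1 + \<sigma> * of_real t) powr (- s - 1)) \<le>
          exp (- \<omega> * t) * (K * exp (\<omega>0 / 2 * t))"
        using K(2)[OF \<sigma> _ s, of t] t by (simp add: norm_mult)
      also have "\<dots> \<le> exp (- \<omega> * t) * (K * exp (\<omega> / 2 * t))"
        using K(1) \<omega> t by (intro mult_left_mono) (auto intro!: mult_right_mono)
      also have "\<dots> = K * exp (-(\<omega>/2) * t)" by (simp add: mult_exp_exp field_simps)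
      finally show "norm (of_real (exp (- \<omega> * t)) * (1 + \<sigma> * of_real t) powr (- s - 1)) \<le> K * exp (-(\<omega>/2) * t)" .
    qed
    also have "\<dots> = 2 * K / \<omega>" using integral_unique[OF hi] by (simp only: times_divide_eq_right mult.commute)
    finally show ?thesis using \<sigma> by (auto simp del: integral_mult_right simp: upper_int_def norm_mult)
  qed
  then show ?thesis using K(1) by (intro exI[of _ "2 * K"]) auto
qed

lemma upper_int_holomorphic:
  assumes "\<sigma> \<in> {\<i>, -\<i>}" "\<omega> > 0"
  shows "upper_int \<sigma> \<omega> holomorphic_on UNIV"
proof -
  let ?f = "\<lambda>t s. of_real (exp (- \<omega> * t)) * (1 + \<sigma> * of_real t) powr (- s - 1)"
  have "(\<lambda>s. integral {0..} (\<lambda>t. ?f t s)) holomorphic_on UNIV"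
  proof (rule holomorphic_on_integral_dominated)
    show "(\<lambda>s. ?f t s) holomorphic_on UNIV" if "t \<in> {0..}" for t
      using norm_one_plus_sigma[OF assms(1), of t] that
      by (intro holomorphic_intros) auto
    show "(\<lambda>t. ?f t s) integrable_on {0..}" for s
      using assms by (rule upper_int_integrable)
    fix z :: complex
    define \<epsilon> where "\<epsilon> = 1 + norm z"
    have \<epsilon>: "\<epsilon> > 0" by (simp add: \<epsilon>_def add_pos_nonneg)
    have 1: "Re s \<ge> -\<epsilon> \<and> \<bar>Im s\<bar> \<le> \<epsilon>" if "s \<in> ball z 1" for s
    proof -
      have "norm s \<le> \<epsilon>" using that norm_triangle_ineq2[of s z] by (simp add: \<epsilon>_def dist_norm norm_minus_commute)
      then show ?thesis using abs_Re_le_cmod[of s] abs_Im_le_cmod[of s] by linarith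
    qed
    obtain K where K: "K > 0" "\<And>t s. t \<ge> 0 \<Longrightarrow> Re s \<ge> - \<epsilon> \<Longrightarrow> \<bar>Im s\<bar> \<le> \<epsilon> \<Longrightarrow>
        norm ((1 + \<sigma> * of_real t) powr (- s - 1)) \<le> K * exp (\<omega> / 2 * t)"
      using upper_int_integrand_bound[OF \<epsilon>(1) assms(2)] assms(1) by blast
    have "norm (?f t s) \<le> K * exp (-(\<omega>/2) * t)" if "t \<ge> 0" "s \<in> ball z 1" for t s
    proof -
      have "norm (?f t s) \<le> exp (- \<omega> * t) * (K * exp (\<omega> / 2 * t))"
        using K(2)[of t s] 1[of s] that by (simp add: norm_mult)
      also have "\<dots> = K * exp (-(\<omega>/2) * t)" by (simp add: mult_exp_exp field_simps)
      finally show ?thesis .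
    qed
    moreover have "(\<lambda>t. K * exp (-(\<omega>/2) * t)) integrable_on {0..}"
      using assms(2) by (intro integrable_on_mult_right integrable_on_exp_minus_to_infinity) auto
    ultimately show "\<exists>r>0. \<exists>h. h integrable_on {0..} \<and> (\<forall>x\<in>{0..}. \<forall>w\<in>ball z r \<inter> UNIV. norm (?f x w) \<le> h x)"
      by (intro exI[of _ 1] conjI exI[of _ "\<lambda>t. K * exp (-(\<omega>/2) * t)"]) auto
  qed auto
  then show ?thesis unfolding upper_int_def by (intro holomorphic_intros)
qed

text \<open>For \<open>Re s < 0\<close> the integral of \<open>exp (\<sigma> \<omega> x)\<close> times \<open>x\<close> to the power \<open>- s - 1\<close> over the unit interval.\<close>

definition head_ser :: "complex \<Rightarrow> real \<Rightarrow> complex \<Rightarrow> complex" where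
  "head_ser \<sigma> \<omega> s = (\<Sum>m. (\<sigma> * of_real \<omega>) ^ m / (fact m * (of_nat m - s)))"

lemma powr_continuous_unit:
  assumes "Re w > 0"
  shows "continuous_on {0..1} (\<lambda>x. complex_of_real x powr w)"
  using assms by (intro continuous_on_powr_complex continuous_intros) auto

lemma has_integral_powr_unit:
  assumes "Re w > -1"
  shows "((\<lambda>x. complex_of_real x powr w) has_integral 1 / (w + 1)) {0..1}"
proof -
  have w: "w \<noteq> -1" using assms by auto
  have w0: "w + 1 \<noteq> 0" using w by (simp add: add_eq_0_iff2)
  have "((\<lambda>x. complex_of_real x powr w) has_integral
      of_real 1 powr (w+1) / (w+1) - of_real 0 powr (w+1) / (w+1)) {0..1}"
  proof (rule fundamental_theorem_of_calculus_interior)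
    show "continuous_on {0..1} (\<lambda>x. complex_of_real x powr (w+1) / (w+1))"
      using assms w0 by (intro continuous_on_divide powr_continuous_unit continuous_intros) auto
    fix x :: real assume x: "x \<in> {0<..<1}"
    have "((\<lambda>z. z powr (w+1) / (w+1)) has_field_derivative of_real x powr w) (at (of_real x))"
      using x w0 by (auto intro!: derivative_eq_intros)
    then show "((\<lambda>x. complex_of_real x powr (w+1) / (w+1)) has_vector_derivative of_real x powr w) (at x)"
      by (rule has_vector_derivative_real_field)
  qed auto
  then show ?thesis by simp
qed

lemma has_integral_powr_unit_mult:
  assumes "Re w > -1"
  shows "((\<lambda>x. complex_of_real x powr w * of_real x ^ m) has_integral 1 / (w + 1 + of_nat m)) {0..1}"
proof -
  have "((\<lambda>x. complex_of_real x powr (w + of_nat m)) has_integral 1 / (w + of_nat m + 1)) {0..1}"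
    using assms by (intro has_integral_powr_unit) auto
  then have "((\<lambda>x. complex_of_real x powr w * of_real x ^ m) has_integral 1 / (w + of_nat m + 1)) {0..1}"
    by (rule has_integral_spike[of "{0}", rotated 2]) (auto simp: powr_add powr_nat')
  then show ?thesis by (simp add: add_ac)
qed

lemma not_Nats_of_nat_diff:
  assumes "s \<notin> \<nat>" shows "of_nat m - s \<noteq> (0::complex)"
  using assms by (metis eq_iff_diff_eq_0 Nats_cases of_nat_in_Nats)

text \<open>One radius serves both as the size of the neighbourhood and as the distance kept from
  all naturals, which is the form that local majorants require.\<close>

lemma Nats_dist_pos:
  assumes "(s::complex) \<notin> \<nat>"
  obtains \<delta> where "\<delta> > 0" "\<And>m w. w \<in> ball s \<delta> \<Longrightarrow> norm (of_nat m - w) \<ge> \<delta>"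
proof -
  have "closed (\<nat> :: complex set)" by (rule closed_Nats)
  then obtain e where e: "e > 0" "ball s e \<inter> \<nat> = {}"
    using assms by (metis ComplI open_Compl open_contains_ball disjoint_eq_subset_Compl)
  show ?thesis
  proof (rule that[of "e/2"])
    fix m w assume w: "w \<in> ball s (e/2)"
    have "of_nat m \<notin> ball s e" using e(2) by (auto simp: of_nat_in_Nats)
    then have "e \<le> dist s (of_nat m)" by simp
    also have "\<dots> \<le> dist s w + dist w (of_nat m)" by (rule dist_triangle)
    finally show "norm (of_nat m - w) \<ge> e/2" using w by (auto simp: dist_norm norm_minus_commute)
  qed (use e in auto)
qed

lemma open_Compl_Nats: "open (- \<nat> :: complex set)"
  using closed_Nats by (simp add: open_Compl)

lemma head_ser_bound:
  fixes \<sigma> w :: complex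
  assumes "norm \<sigma> = 1" "\<omega> > 0" "\<delta> > 0" "norm (of_nat m - w) \<ge> \<delta>"
  shows "norm ((\<sigma> * of_real \<omega>) ^ m / (fact m * (of_nat m - w))) \<le> inverse (fact m) * \<omega> ^ m / \<delta>"
proof -
  have "norm ((\<sigma> * of_real \<omega>) ^ m / (fact m * (of_nat m - w))) = \<omega> ^ m / (fact m * norm (of_nat m - w))"
    using assms by (simp add: norm_divide norm_mult norm_power)
  also have "\<dots> \<le> \<omega> ^ m / (fact m * \<delta>)"
    using assms by (intro divide_left_mono mult_left_mono mult_pos_pos) auto
  finally show ?thesis by (simp add: field_simps)
qed

lemma head_ser_holomorphic:
  assumes "norm \<sigma> = 1" "\<omega> > 0"
  shows "head_ser \<sigma> \<omega> holomorphic_on (- \<nat>)"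
  unfolding head_ser_def
proof (rule holomorphic_on_suminf_local)
  show "(\<lambda>z. (\<sigma> * of_real \<omega>) ^ n / (fact n * (of_nat n - z))) holomorphic_on - \<nat>" for n
    by (intro holomorphic_intros) (auto simp: not_Nats_of_nat_diff)
  fix z :: complex assume "z \<in> - \<nat>"
  then obtain \<delta> where \<delta>: "\<delta> > 0" "\<And>m w. w \<in> ball z \<delta> \<Longrightarrow> norm (of_nat m - w) \<ge> \<delta>"
    using Nats_dist_pos by blast
  have "summable (\<lambda>n. inverse (fact n) * \<omega> ^ n / \<delta>)"
    by (intro summable_divide summable_exp)
  moreover have "norm ((\<sigma> * of_real \<omega>) ^ n / (fact n * (of_nat n - w))) \<le> inverse (fact n) * \<omega> ^ n / \<delta>"
    if "w \<in> ball z \<delta>" for n w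
    using assms \<delta> that by (intro head_ser_bound) auto
  ultimately show "\<exists>r>0. \<exists>M N. summable M \<and> (\<forall>n\<ge>N. \<forall>w\<in>ball z r \<inter> - \<nat>.
      norm ((\<sigma> * of_real \<omega>) ^ n / (fact n * (of_nat n - w))) \<le> M n)"
    using \<delta>(1) by (intro exI[of _ \<delta>] conjI exI[of _ "\<lambda>n. inverse (fact n) * \<omega> ^ n / \<delta>"]) auto
qed (simp add: open_Compl_Nats)

lemma head_ser_sums:
  assumes "norm \<sigma> = 1" "\<omega> > 0" "s \<notin> \<nat>"
  shows "(\<lambda>m. (\<sigma> * of_real \<omega>) ^ m / (fact m * (of_nat m - s))) sums head_ser \<sigma> \<omega> s"
proof -
  obtain \<delta> where \<delta>: "\<delta> > 0" "\<And>m w. w \<in> ball s \<delta> \<Longrightarrow> norm (of_nat m - w) \<ge> \<delta>"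
    using assms Nats_dist_pos by blast
  have "summable (\<lambda>m. (\<sigma> * of_real \<omega>) ^ m / (fact m * (of_nat m - s)))"
  proof (rule summable_comparison_test[OF exI[of _ 0]], intro allI impI)
    show "summable (\<lambda>n. inverse (fact n) * \<omega> ^ n / \<delta>)"
      by (intro summable_divide summable_exp)
  qed (use assms \<delta> in \<open>auto intro!: head_ser_bound\<close>)
  then show ?thesis unfolding head_ser_def by (rule summable_sums)
qed

text \<open>The exponential is expanded under the integral. For Re s < -1 the weight has modulus at
  most 1 on the interval, so the constant \<open>exp \<omega>\<close> dominates all partial
  sums.\<close>

lemma head_ser_integral:
  assumes "norm \<sigma> = 1" "\<omega> > 0" "Re s < -1"
  shows "((\<lambda>x. exp (\<sigma> * of_real (\<omega> * x)) * of_real x powr (- s - 1)) has_integral head_ser \<sigma> \<omega> s) {0..1}"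
proof -
  have s: "s \<notin> \<nat>" using assms(3) by (auto elim!: Nats_cases)
  define g where "g = (\<lambda>N x. \<Sum>m<N. (\<sigma> * of_real \<omega>) ^ m / fact m * (complex_of_real x powr (-s-1) * of_real x ^ m))"
  show ?thesis
  proof (rule has_integral_dominated_convergence)
    show "(g N has_integral (\<Sum>m<N. (\<sigma> * of_real \<omega>) ^ m / (fact m * (of_nat m - s)))) {0..1}" for N
    proof -
      have "(g N has_integral (\<Sum>m<N. (\<sigma> * of_real \<omega>) ^ m / fact m * (1 / (-s - 1 + 1 + of_nat m)))) {0..1}"
        unfolding g_def using assms
        by (intro has_integral_sum has_integral_mult_right has_integral_powr_unit_mult) auto
      then show ?thesis by simp
    qed
    show "(\<lambda>x::real. exp \<omega>) integrable_on {0..1}" by (rule integrable_const_ivl)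
    show "\<forall>x\<in>{0..1}. norm (g N x) \<le> exp \<omega>" for N
    proof
      fix x :: real assume x: "x \<in> {0..1}"
      have "norm (g N x) \<le> (\<Sum>m<N. norm ((\<sigma> * of_real \<omega>) ^ m / fact m * (complex_of_real x powr (-s-1) * of_real x ^ m)))"
        unfolding g_def by (rule norm_sum)
      also have "\<dots> \<le> (\<Sum>m<N. inverse (fact m) * \<omega> ^ m)"
      proof (rule sum_mono)
        fix m
        have "norm (complex_of_real x powr (-s-1)) \<le> 1"
          using x assms by (auto simp: norm_powr_real_powr intro!: powr_le1)
        moreover have "norm (complex_of_real x ^ m) \<le> 1"
          using x by (simp add: norm_power power_le_one)
        ultimately have "norm (complex_of_real x powr (-s-1) * of_real x ^ m) \<le> 1"
          by (simp add: norm_mult mult_le_one)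
        then have "norm ((\<sigma> * of_real \<omega>) ^ m / fact m) * norm (complex_of_real x powr (-s-1) * of_real x ^ m)
            \<le> norm ((\<sigma> * of_real \<omega>) ^ m / fact m) * 1"
          by (intro mult_left_mono) auto
        also have "\<dots> = inverse (fact m) * \<omega> ^ m"
          using assms by (simp add: norm_mult norm_divide norm_power field_simps)
        finally show "norm ((\<sigma> * of_real \<omega>) ^ m / fact m * (complex_of_real x powr (-s-1) * of_real x ^ m))
            \<le> inverse (fact m) * \<omega> ^ m" by (simp only: norm_mult)
      qed
      also have "\<dots> \<le> (\<Sum>m. inverse (fact m) * \<omega> ^ m)"
        using assms(2) by (intro sum_le_suminf summable_exp) auto
      also have "\<dots> = exp \<omega>" by (simp add: exp_def field_simps)
      finally show "norm (g N x) \<le> exp \<omega>" .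
    qed
    show "\<forall>x\<in>{0..1}. (\<lambda>N. g N x) \<longlonglongrightarrow> exp (\<sigma> * of_real (\<omega> * x)) * of_real x powr (- s - 1)"
    proof
      fix x :: real assume x: "x \<in> {0..1}"
      have "(\<lambda>m. (\<sigma> * of_real (\<omega> * x)) ^ m /\<^sub>R fact m) sums exp (\<sigma> * of_real (\<omega> * x))"
        by (rule exp_converges)
      then have "(\<lambda>m. (\<sigma> * of_real (\<omega> * x)) ^ m /\<^sub>R fact m * of_real x powr (-s-1)) sums
          (exp (\<sigma> * of_real (\<omega> * x)) * of_real x powr (-s-1))" by (rule sums_mult2)
      moreover have "(\<sigma> * of_real (\<omega> * x)) ^ m /\<^sub>R fact m * of_real x powr (-s-1) =
          (\<sigma> * of_real \<omega>) ^ m / fact m * (complex_of_real x powr (-s-1) * of_real x ^ m)" for m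
        by (simp add: power_mult_distrib scaleR_conv_of_real field_simps)
      ultimately show "(\<lambda>N. g N x) \<longlonglongrightarrow> exp (\<sigma> * of_real (\<omega> * x)) * of_real x powr (- s - 1)"
        unfolding g_def sums_def by simp
    qed
    show "(\<lambda>N. \<Sum>m<N. (\<sigma> * of_real \<omega>) ^ m / (fact m * (of_nat m - s))) \<longlonglongrightarrow> head_ser \<sigma> \<omega> s"
      using head_ser_sums[OF assms(1,2) s] by (simp add: sums_def)
  qed
qed

section \<open>Rotating the path of integration\<close>

lemma contour_integral_linepath_direction:
  assumes "T > 0" "continuous_on {0..T} (\<lambda>t. f (p + \<sigma> * of_real t))"
  shows "contour_integral (linepath p (p + \<sigma> * of_real T)) f = \<sigma> * integral {0..T} (\<lambda>t. f (p + \<sigma> * of_real t))"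
proof -
  define I where "I = integral {0..T} (\<lambda>t. f (p + \<sigma> * of_real t))"
  have "((\<lambda>t. f (p + \<sigma> * of_real t)) has_integral I) {0..T}"
    unfolding I_def using assms(2) by (intro integrable_integral integrable_continuous_real)
  from has_integral_stretch_real[OF this, of T] assms(1)
  have "((\<lambda>x. f (p + \<sigma> * of_real (T * x))) has_integral (1/T) *\<^sub>R I) {0..1}"
    by simp
  then have "((\<lambda>x. f (p + \<sigma> * of_real (T * x)) * (\<sigma> * of_real T)) has_integral ((1/T) *\<^sub>R I) * (\<sigma> * of_real T)) {0..1}"
    by (rule has_integral_mult_left)
  moreover have "p + \<sigma> * of_real (T * x) = linepath p (p + \<sigma> * of_real T) x" for x
    by (simp add: linepath_def scaleR_conv_of_real algebra_simps)
  moreover have "((1/T) *\<^sub>R I) * (\<sigma> * of_real T) = \<sigma> * I"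
    using assms(1) by (simp add: scaleR_conv_of_real)
  ultimately have "(f has_contour_integral (\<sigma> * I)) (linepath p (p + \<sigma> * of_real T))"
    by (simp add: has_contour_integral_linepath)
  then show ?thesis unfolding I_def by (rule contour_integral_unique)
qed

lemma integral_half_line_limit:
  fixes g :: "real \<Rightarrow> complex"
  assumes g: "g integrable_on {0..}" and h: "h integrable_on {0..}" "\<And>t. t \<ge> 0 \<Longrightarrow> norm (g t) \<le> h t"
    and T: "filterlim T at_top sequentially" "\<And>n. continuous_on {0..T n} g"
  shows "(\<lambda>n. integral {0..T n} g) \<longlonglongrightarrow> integral {0..} g"
proof -
  define G where "G = (\<lambda>n t. if t \<le> T n then g t else 0)"
  have eq: "(\<lambda>t. if t \<in> {0..T n} then g t else 0) = (\<lambda>t. if t \<in> {0..} then G n t else 0)" for n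
    by (auto simp: G_def)
  have int: "G n integrable_on {0..}" for n
  proof -
    have "(\<lambda>t. if t \<in> {0..T n} then g t else 0) integrable_on UNIV"
      using T(2)[of n] by (subst integrable_restrict_UNIV) (rule integrable_continuous_real)
    then show ?thesis unfolding eq by (subst (asm) integrable_restrict_UNIV)
  qed
  have "(\<lambda>n. integral {0..} (G n)) \<longlonglongrightarrow> integral {0..} g"
  proof (rule dominated_convergence(2)[OF int h(1)])
    show "norm (G n t) \<le> h t" if "t \<in> {0..}" for n t
      using h(2)[of t] that order_trans[OF norm_ge_zero h(2)[of t]] by (auto simp: G_def)
    show "(\<lambda>n. G n t) \<longlonglongrightarrow> g t" if "t \<in> {0..}" for t
    proof (rule tendsto_eventually)
      show "\<forall>\<^sub>F n in sequentially. G n t = g t"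
        using T(1)[unfolded filterlim_at_top, rule_format, of t]
        by eventually_elim (simp add: G_def)
    qed
  qed
  moreover have "integral {0..} (G n) = integral {0..T n} g" for n
    using eq[of n] by (metis integral_restrict_UNIV)
  ultimately show ?thesis by simp
qed

text \<open>Cauchy's theorem on the rectangle with corners 0, 1, 1 + \<sigma> T and \<sigma> T. The
  corner 0 is the branch point; for Re s < -1 the power tends to 0 there, so the integrand is
  continuous on the closed right half-plane and holomorphic inside, as the theorem for convex sets
  asks.\<close>

lemma Cauchy_half_plane:
  fixes \<omega> :: real
  assumes \<sigma>: "\<sigma> \<in> {\<i>, -\<i>}" and s: "Re s < -1" and T: "T > 0"
  defines "f \<equiv> \<lambda>z. exp (\<sigma> * of_real \<omega> * z) * z powr (- s - 1)"
  shows "integral {0..1} (\<lambda>x. f (of_real x)) + \<sigma> * integral {0..T} (\<lambda>t. f (1 + \<sigma> * of_real t))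
     = \<sigma> * integral {0..T} (\<lambda>t. f (\<sigma> * of_real t)) + integral {0..1} (\<lambda>x. f (\<sigma> * of_real T + of_real x))"
proof -
  define S where "S = {z :: complex. Re z \<ge> 0}"
  have conv: "convex S" unfolding S_def by (rule convex_halfspace_Re_ge)
  have contS: "continuous_on S f"
    unfolding f_def using s by (intro continuous_intros continuous_on_powr_complex) (auto simp: S_def)
  have int: "interior S = {z. Re z > 0}" 
    using interior_halfspace_ge[of "1::complex" 0] by (simp add: S_def inner_complex_def)
  have S: "0 \<in> S" "1 \<in> S" "1 + \<sigma> * of_real T \<in> S" "\<sigma> * of_real T \<in> S" using \<sigma> by (auto simp: S_def)
  have cs: "closed_segment x y \<subseteq> S" if "x \<in> S" "y \<in> S" for x y
    using that conv by (simp add: closed_segment_subset)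
  have ci: "f contour_integrable_on (linepath x y)" if "x \<in> S" "y \<in> S" for x y
    using continuous_on_subset[OF contS cs[OF that]] by (rule contour_integrable_continuous_linepath)
  let ?g = "linepath 0 1 +++ linepath 1 (1 + \<sigma> * of_real T) +++ linepath (1 + \<sigma> * of_real T) (\<sigma> * of_real T) +++ linepath (\<sigma> * of_real T) 0"
  have "(f has_contour_integral 0) ?g"
  proof (rule Cauchy_theorem_convex[OF contS conv, of "{}"])
    fix x assume "x \<in> interior S - {}"
    then have "x \<notin> \<real>\<^sub>\<le>\<^sub>0" by (auto simp: int complex_nonpos_Reals_iff)
    then show "f field_differentiable at x" unfolding f_def
      by (intro derivative_intros field_differentiable_mult
           holomorphic_on_imp_differentiable_at[of _ "-\<real>\<^sub>\<le>\<^sub>0"] holomorphic_intros) auto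
  next
    show "path_image ?g \<subseteq> S" using S cs by (auto simp: path_image_join)
  qed auto
  then have "contour_integral ?g f = 0" by (rule contour_integral_unique)
  then have 0: "contour_integral (linepath 0 1) f + (contour_integral (linepath 1 (1 + \<sigma> * of_real T)) f +
      (contour_integral (linepath (1 + \<sigma> * of_real T) (\<sigma> * of_real T)) f + contour_integral (linepath (\<sigma> * of_real T) 0) f)) = 0"
    using S by (simp add: ci)
  have c: "continuous_on {0..b} (\<lambda>t. f (p + q * of_real t))"
    if "\<And>t. t \<in> {0..b} \<Longrightarrow> p + q * of_real t \<in> S" for p q b
    using that by (intro continuous_on_compose2[OF contS] continuous_intros) auto
  have 1: "contour_integral (linepath 0 1) f = integral {0..1} (\<lambda>x. f (of_real x))"
    using contour_integral_linepath_direction[of 1 f 0 1] c[of 1 0 1] by (auto simp: S_def)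
  have 2: "contour_integral (linepath 1 (1 + \<sigma> * of_real T)) f = \<sigma> * integral {0..T} (\<lambda>t. f (1 + \<sigma> * of_real t))"
    using contour_integral_linepath_direction[of T f 1 \<sigma>] c[of T 1 \<sigma>] T \<sigma> by (auto simp: S_def)
  have "contour_integral (linepath 0 (0 + \<sigma> * of_real T)) f = \<sigma> * integral {0..T} (\<lambda>t. f (0 + \<sigma> * of_real t))"
    using contour_integral_linepath_direction[of T f 0 \<sigma>] c[of T 0 \<sigma>] T \<sigma> by (auto simp: S_def)
  moreover have "contour_integral (linepath (\<sigma> * of_real T) 0) f = - contour_integral (linepath 0 (\<sigma> * of_real T)) f"
    using contour_integral_reverse_linepath[of "\<sigma> * of_real T" 0 f] continuous_on_subset[OF contS cs[OF S(4,1)]] by simp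
  ultimately have 3: "contour_integral (linepath (\<sigma> * of_real T) 0) f = - (\<sigma> * integral {0..T} (\<lambda>t. f (\<sigma> * of_real t)))"
    by simp
  have "contour_integral (linepath (\<sigma> * of_real T) (\<sigma> * of_real T + 1 * of_real 1)) f = 1 * integral {0..1} (\<lambda>t. f (\<sigma> * of_real T + 1 * of_real t))"
    using contour_integral_linepath_direction[of 1 f "\<sigma> * of_real T" 1] c[of 1 "\<sigma> * of_real T" 1] \<sigma> by (auto simp: S_def)
  moreover have "contour_integral (linepath (1 + \<sigma> * of_real T) (\<sigma> * of_real T)) f = - contour_integral (linepath (\<sigma> * of_real T) (1 + \<sigma> * of_real T)) f"
    using contour_integral_reverse_linepath[of "1 + \<sigma> * of_real T" "\<sigma> * of_real T" f] continuous_on_subset[OF contS cs[OF S(3,4)]] by simp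
  ultimately have 4: "contour_integral (linepath (1 + \<sigma> * of_real T) (\<sigma> * of_real T)) f = - integral {0..1} (\<lambda>t. f (\<sigma> * of_real T + of_real t))"
    by (simp add: add.commute)
  show ?thesis using 0 unfolding 1 2 3 4 by (simp add: algebra_simps)
qed

lemma sigma_powr_exp:
  assumes "\<sigma> \<in> {\<i>, -\<i>}" "t \<ge> 0"
  shows "(\<sigma> * of_real t) powr w = \<sigma> powr w * of_real t powr w" "\<sigma> * \<sigma> powr (- s - 1) = (- \<sigma>) powr s"
    "norm \<sigma> = 1" "\<sigma> * \<sigma> = -1"
proof -
  show "(\<sigma> * of_real t) powr w = \<sigma> powr w * of_real t powr w"
    using assms powr_times_real_left[of "of_real t" \<sigma> w] by (auto simp: mult.commute)
  have "Ln (-\<sigma>) = - Ln \<sigma>" using assms(1) by auto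
  moreover have "\<sigma> \<noteq> 0" using assms(1) by auto
  ultimately show "\<sigma> * \<sigma> powr (- s - 1) = (- \<sigma>) powr s"
    by (simp add: powr_def exp_diff left_diff_distrib)
qed (use assms(1) in auto)

text \<open>As T grows, the far side of the rectangle carries the factor
  \<open>exp (- \<omega> * T)\<close> and vanishes, while on the imaginary side the exponential
  turns into a decaying real one and Euler's integral for \<open>Gamma (- s)\<close>
  appears.\<close>

lemma upper_int_formula_left:
  assumes \<sigma>: "\<sigma> \<in> {\<i>, -\<i>}" and \<omega>: "\<omega> > 0" and s: "Re s < -1"
  shows "upper_int \<sigma> \<omega> s = (- \<sigma> * of_real \<omega>) powr s * Gamma (- s) - head_ser \<sigma> \<omega> s"
proof -
  note sg = sigma_powr_exp(1)[OF \<sigma>] sigma_powr_exp(2-4)[OF \<sigma> order_refl]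
  define f where "f = (\<lambda>z. exp (\<sigma> * of_real \<omega> * z) * z powr (- s - 1))"
  \<comment> \<open>Dividing by \<open>\<omega>\<close> makes the rescaled Gamma integral end at
    \<open>real (Suc n)\<close>.\<close>
  define T where "T = (\<lambda>n. real (Suc n) / \<omega>)"
  have T: "T n > 0" for n using \<omega> by (simp add: T_def)
  have Tlim: "filterlim T at_top sequentially"
    unfolding T_def using \<omega> by real_asymp
  have eq: "integral {0..1} (\<lambda>x. f (of_real x)) + \<sigma> * integral {0..T n} (\<lambda>t. f (1 + \<sigma> * of_real t))
     = \<sigma> * integral {0..T n} (\<lambda>t. f (\<sigma> * of_real t)) + integral {0..1} (\<lambda>x. f (\<sigma> * of_real (T n) + of_real x))" for n
    unfolding f_def using Cauchy_half_plane[OF \<sigma> s T] by simp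
  have A: "integral {0..1} (\<lambda>x. f (of_real x)) = head_ser \<sigma> \<omega> s"
    using head_ser_integral[OF sg(3) \<omega> s] by (intro integral_unique) (simp add: f_def mult_ac)
  define g where "g = (\<lambda>t. of_real (exp (- \<omega> * t)) * (1 + \<sigma> * of_real t) powr (- s - 1))"
  have fg: "f (1 + \<sigma> * of_real t) = exp (\<sigma> * of_real \<omega>) * g t" for t
  proof -
    have "\<sigma> * of_real \<omega> * (1 + \<sigma> * of_real t) = \<sigma> * of_real \<omega> + (\<sigma> * \<sigma>) * of_real (\<omega> * t)"
      by (simp add: algebra_simps)
    also have "\<dots> = \<sigma> * of_real \<omega> + of_real (- \<omega> * t)" unfolding sg(4) by simp
    finally show ?thesis unfolding f_def g_def by (simp only: exp_add exp_of_real mult.assoc)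
  qed
  define \<epsilon> where "\<epsilon> = 1 + norm s"
  have \<epsilon>: "\<epsilon> > 0" "Re s \<ge> -\<epsilon>" "\<bar>Im s\<bar> \<le> \<epsilon>"
    using abs_Re_le_cmod[of s] abs_Im_le_cmod[of s] by (auto simp: \<epsilon>_def add_pos_nonneg)
  obtain K where K: "K > 0" "\<And>t. t \<ge> 0 \<Longrightarrow> norm ((1 + \<sigma> * of_real t) powr (- s - 1)) \<le> K * exp (\<omega> / 2 * t)"
    using upper_int_integrand_bound[OF \<epsilon>(1) \<omega>] \<sigma> \<epsilon>(2,3) by blast
  have gint: "g integrable_on {0..}" unfolding g_def using upper_int_integrable[OF \<sigma> \<omega>] .
  have gcont: "continuous_on {0..b} g" for b
    unfolding g_def using \<sigma>
    by (intro continuous_on_mult continuous_on_powr_complex continuous_intros subsetI) (auto simp: complex_eq_iff)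
  have gb: "norm (g t) \<le> K * exp (-(\<omega>/2) * t)" if "t \<ge> 0" for t
  proof -
    have "norm (g t) \<le> exp (- \<omega> * t) * (K * exp (\<omega> / 2 * t))"
      using K(2)[of t] that by (simp add: g_def norm_mult)
    also have "\<dots> = K * exp (-(\<omega>/2) * t)" by (simp add: mult_exp_exp field_simps)
    finally show ?thesis .
  qed
  have hint: "(\<lambda>t. K * exp (-(\<omega>/2) * t)) integrable_on {0..}"
    using \<omega> by (intro integrable_on_mult_right integrable_on_exp_minus_to_infinity) auto
  have B: "(\<lambda>n. \<sigma> * integral {0..T n} (\<lambda>t. f (1 + \<sigma> * of_real t))) \<longlonglongrightarrow> upper_int \<sigma> \<omega> s"
    unfolding fg upper_int_def g_def[symmetric] using integral_half_line_limit[OF gint hint gb Tlim gcont]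
    by (auto intro!: tendsto_intros simp: mult.assoc)
  have C: "(\<lambda>n. \<sigma> * integral {0..T n} (\<lambda>t. f (\<sigma> * of_real t))) \<longlonglongrightarrow> (- \<sigma> * of_real \<omega>) powr s * Gamma (- s)"
  proof -
    define k where "k = (\<lambda>t. complex_of_real t powr (- s - 1) / of_real (exp t))"
    have kcont: "continuous_on {0..b} k" for b
      unfolding k_def using s by (intro continuous_on_divide continuous_on_powr_complex continuous_intros) auto
    have G: "(k has_integral Gamma (-s)) {0..}"
      unfolding k_def using s by (intro Gamma_integral_complex) auto
    have "(\<lambda>t. norm (k t)) integrable_on {0..}"
    proof -
      have "((\<lambda>t. t powr (Re (-s) - 1) / exp t) has_integral Gamma (Re (-s))) {0..}"
        using s by (intro Gamma_integral_real) auto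
      moreover have "norm (k t) = t powr (Re (-s) - 1) / exp t" if "t \<in> {0..}" for t
        using that by (auto simp: k_def norm_divide norm_powr_real_powr)
      ultimately show ?thesis by (auto intro: integrable_eq)
    qed
    then have lim: "(\<lambda>n. integral {0..real (Suc n)} k) \<longlonglongrightarrow> integral {0..} k"
      using G kcont by (intro integral_half_line_limit[where h = "\<lambda>t. norm (k t)"]) (auto, real_asymp)
    have "integral {0..T n} (\<lambda>t. f (\<sigma> * of_real t)) =
        \<sigma> powr (-s-1) * of_real \<omega> powr s * integral {0..real (Suc n)} k" for n
    proof -
      have "(k has_integral integral {0..real (Suc n)} k) {0..real (Suc n)}"
        by (intro integrable_integral integrable_continuous_real kcont)
      from has_integral_stretch_real[OF this, of \<omega>] \<omega>
      have "((\<lambda>t. k (\<omega> * t)) has_integral (1/\<omega>) *\<^sub>R integral {0..real (Suc n)} k) {0..T n}"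
        by (simp add: T_def)
      then have "((\<lambda>t. \<sigma> powr (-s-1) * of_real \<omega> powr (s+1) * k (\<omega> * t)) has_integral
          \<sigma> powr (-s-1) * of_real \<omega> powr (s+1) * ((1/\<omega>) *\<^sub>R integral {0..real (Suc n)} k)) {0..T n}"
        by (rule has_integral_mult_right)
      moreover have "\<sigma> powr (-s-1) * of_real \<omega> powr (s+1) * k (\<omega> * t) = f (\<sigma> * of_real t)" if "t \<in> {0..T n}" for t
      proof -
        have "complex_of_real (\<omega> * t) powr (-s-1) = of_real \<omega> powr (-s-1) * of_real t powr (-s-1)"
          using \<omega> that by (simp add: powr_times_real)
        moreover have "complex_of_real \<omega> powr (s+1) * complex_of_real \<omega> powr (-s-1) = 1"
          using \<omega> by (simp add: powr_add[symmetric])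
        moreover have "exp (\<sigma> * of_real \<omega> * (\<sigma> * of_real t)) = 1 / of_real (exp (\<omega> * t))"
        proof -
          have "\<sigma> * of_real \<omega> * (\<sigma> * of_real t) = - of_real (\<omega> * t)"
          proof -
            have "\<sigma> * of_real \<omega> * (\<sigma> * of_real t) = (\<sigma> * \<sigma>) * of_real (\<omega> * t)"
              by (simp add: algebra_simps)
            then show ?thesis unfolding sg(4) by simp
          qed
          then show ?thesis by (simp only: exp_minus exp_of_real inverse_eq_divide)
        qed
        ultimately show ?thesis using that by (simp add: k_def f_def sg(1) field_simps)
      qed
      ultimately have "((\<lambda>t. f (\<sigma> * of_real t)) has_integral
          \<sigma> powr (-s-1) * of_real \<omega> powr (s+1) * ((1/\<omega>) *\<^sub>R integral {0..real (Suc n)} k)) {0..T n}"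
        by (rule has_integral_eq[rotated])
      then show ?thesis using \<omega> by (simp add: integral_unique powr_add scaleR_conv_of_real)
    qed
    then have "(\<lambda>n. \<sigma> * integral {0..T n} (\<lambda>t. f (\<sigma> * of_real t))) \<longlonglongrightarrow>
        \<sigma> * (\<sigma> powr (-s-1) * of_real \<omega> powr s * integral {0..} k)"
      using lim by (auto intro!: tendsto_intros)
    also have "\<sigma> * (\<sigma> powr (-s-1) * of_real \<omega> powr s * integral {0..} k) = (\<sigma> * \<sigma> powr (-s-1)) * of_real \<omega> powr s * Gamma (-s)"
      using G by (simp add: integral_unique)
    also have "\<sigma> * \<sigma> powr (-s-1) = (-\<sigma>) powr s" by (rule sg(2))
    also have "(-\<sigma>) powr s * of_real \<omega> powr s = (-\<sigma> * of_real \<omega>) powr s"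
      using sigma_powr_exp(1)[of "-\<sigma>" \<omega> s] \<sigma> \<omega> by auto
    finally show ?thesis .
  qed
  have D: "(\<lambda>n. integral {0..1} (\<lambda>x. f (\<sigma> * of_real (T n) + of_real x))) \<longlonglongrightarrow> 0"
  proof (rule Lim_null_comparison)
    define p where "p = - Re s - 1"
    have p: "p > 0" using s by (simp add: p_def)
    show "(\<lambda>n. exp (- \<omega> * T n) * ((1 + T n) powr p * exp (\<epsilon> * pi))) \<longlonglongrightarrow> 0"
      unfolding T_def using \<omega> p by (simp, real_asymp)
    show "\<forall>\<^sub>F n in sequentially. norm (integral {0..1} (\<lambda>x. f (\<sigma> * of_real (T n) + of_real x)))
        \<le> exp (- \<omega> * T n) * ((1 + T n) powr p * exp (\<epsilon> * pi))"
    proof (intro always_eventually allI)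
      fix n
      have cont: "continuous_on {0..1} (\<lambda>x. f (\<sigma> * of_real (T n) + of_real x))"
        unfolding f_def using \<sigma> s T[of n]
        by (intro continuous_on_mult continuous_on_powr_complex continuous_intros subsetI) (auto simp: complex_eq_iff)
      have "norm (f (\<sigma> * of_real (T n) + of_real x)) \<le> exp (- \<omega> * T n) * ((1 + T n) powr p * exp (\<epsilon> * pi))"
        if x: "x \<in> {0..1}" for x
      proof -
        let ?z = "\<sigma> * of_real (T n) + of_real x"
        have "norm (exp (\<sigma> * of_real \<omega> * ?z)) = exp (- \<omega> * T n)"
          using \<sigma> by auto
        moreover have "norm (?z powr (-s-1)) \<le> (1 + T n) powr p * exp (\<epsilon> * pi)"
        proof -
          have nz: "norm ?z \<le> 1 + T n"
            using norm_triangle_ineq[of "\<sigma> * of_real (T n)" "of_real x"] x T[of n] \<sigma> by (auto simp: norm_mult)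
          have "Im s * Arg ?z \<le> \<bar>Im s\<bar> * \<bar>Arg ?z\<bar>" by (metis abs_ge_self abs_mult)
          also have "\<dots> \<le> \<epsilon> * pi" using \<epsilon> Arg_bounded[of ?z] by (intro mult_mono) auto
          finally have "exp (Im s * Arg ?z) \<le> exp (\<epsilon> * pi)" by simp
          moreover have "norm ?z powr p \<le> (1 + T n) powr p" using nz p by (intro powr_mono2) auto
          ultimately show ?thesis by (auto simp: norm_powr_complex p_def intro!: mult_mono)
        qed
        ultimately show ?thesis unfolding f_def by (simp only: norm_mult mult_left_mono exp_ge_zero)
      qed
      then have "norm (integral {0..1} (\<lambda>x. f (\<sigma> * of_real (T n) + of_real x))) \<le>
          exp (- \<omega> * T n) * ((1 + T n) powr p * exp (\<epsilon> * pi)) * (1 - 0)"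
        by (intro integral_bound cont) auto
      then show "norm (integral {0..1} (\<lambda>x. f (\<sigma> * of_real (T n) + of_real x)))
        \<le> exp (- \<omega> * T n) * ((1 + T n) powr p * exp (\<epsilon> * pi))" by simp
    qed
  qed
  have "(\<lambda>n. integral {0..1} (\<lambda>x. f (of_real x)) + \<sigma> * integral {0..T n} (\<lambda>t. f (1 + \<sigma> * of_real t)))
      \<longlonglongrightarrow> head_ser \<sigma> \<omega> s + upper_int \<sigma> \<omega> s"
    unfolding A by (intro tendsto_intros B)
  moreover have "(\<lambda>n. integral {0..1} (\<lambda>x. f (of_real x)) + \<sigma> * integral {0..T n} (\<lambda>t. f (1 + \<sigma> * of_real t)))
      \<longlonglongrightarrow> (- \<sigma> * of_real \<omega>) powr s * Gamma (- s) + 0"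
    unfolding eq by (intro tendsto_add C D)
  ultimately have "head_ser \<sigma> \<omega> s + upper_int \<sigma> \<omega> s = (- \<sigma> * of_real \<omega>) powr s * Gamma (- s) + 0"
    by (rule LIMSEQ_unique)
  then show ?thesis by (simp add: algebra_simps)
qed

lemma uminus_Ints_le_0: "- s \<notin> \<int>\<^sub>\<le>\<^sub>0" if "s \<notin> \<nat>" for s :: complex
  using that by (auto elim!: nonpos_Ints_cases' simp: of_nat_in_Nats)

lemma connected_Compl_Nats: "connected (- \<nat> :: complex set)"
  using connected_open_diff_countable[of "UNIV :: complex set" \<nat>] convex_connected[OF convex_UNIV]
  by (simp add: Compl_eq_Diff_UNIV Nats_def)

text \<open>Both sides are holomorphic off the naturals, which leave a connected set, and they agree
  for Re s < -1.\<close>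

lemma upper_int_formula:
  assumes \<sigma>: "\<sigma> \<in> {\<i>, -\<i>}" and \<omega>: "\<omega> > 0" and s: "s \<notin> \<nat>"
  shows "upper_int \<sigma> \<omega> s = (- \<sigma> * of_real \<omega>) powr s * Gamma (- s) - head_ser \<sigma> \<omega> s"
proof (rule analytic_continuation_open[where s = "{s. Re s < -1}" and s' = "- \<nat>" and f = "upper_int \<sigma> \<omega>"
      and g = "\<lambda>s. (- \<sigma> * of_real \<omega>) powr s * Gamma (- s) - head_ser \<sigma> \<omega> s"])
  show "upper_int \<sigma> \<omega> holomorphic_on - \<nat>"
    using upper_int_holomorphic[OF \<sigma> \<omega>] by (rule holomorphic_on_subset) auto
  show "(\<lambda>s. (- \<sigma> * of_real \<omega>) powr s * Gamma (- s) - head_ser \<sigma> \<omega> s) holomorphic_on - \<nat>"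
    using sigma_powr_exp(3)[OF \<sigma>, of 0] \<omega>
    by (intro holomorphic_intros head_ser_holomorphic) (auto simp: uminus_Ints_le_0)
  show "{s. Re s < -1} \<noteq> {}" by (auto intro!: exI[of _ "-2"])
  show "{s. Re s < -1} \<subseteq> - \<nat>" by (auto elim!: Nats_cases)
qed (use s upper_int_formula_left[OF \<sigma> \<omega>] in \<open>auto simp: open_Compl_Nats connected_Compl_Nats open_halfspace_Re_lt\<close>)

section \<open>The summands of the right-hand side\<close>

text \<open>The two products share all factors except the first of one and the last of the
  other.\<close>

lemma pochhammer_quotient_Suc:
  fixes \<alpha> :: complex
  assumes "\<And>j. \<alpha> + 1 + of_nat j \<noteq> 0" "\<alpha> + of_nat m \<noteq> 0"
  shows "pochhammer \<alpha> m / pochhammer (\<alpha> + 1) m = \<alpha> / (\<alpha> + of_nat m)"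
proof -
  have "pochhammer (\<alpha> + 1) m \<noteq> 0"
    using assms(1) by (auto simp: pochhammer_eq_0_iff) (metis add_eq_0_iff minus_diff_eq add_diff_cancel_right' uminus_add_conv_diff)
  moreover have "\<alpha> * pochhammer (\<alpha> + 1) m = (\<alpha> + of_nat m) * pochhammer \<alpha> m"
    by (metis pochhammer_rec pochhammer_rec')
  ultimately show ?thesis using assms(2) by (simp add: field_simps)
qed

text \<open>Since (2m)! = 4^m (1/2)_m m!, the Pochhammer symbol of 1/2 and the power of 4 disappear,
  and the remaining quotient telescopes. Up to the factor -s, what is left comes from the even
  coefficients of \<open>head_ser\<close>.\<close>

lemma hyp1F2_even_term:
  fixes s :: complex and \<omega> :: real
  assumes s: "s \<notin> \<nat>"
  shows "pochhammer (- s / 2) m / (pochhammer (1/2) m * pochhammer (1 - s / 2) m) * (of_real (- (\<omega>\<^sup>2 / 4))) ^ m / fact m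
     = - s * ((-1) ^ m * of_real \<omega> ^ (2 * m) / (fact (2 * m) * (of_nat (2 * m) - s)))"
proof -
  have nz: "- s / 2 + of_nat j \<noteq> 0" for j
    using not_Nats_of_nat_diff[OF s, of "2 * j"] by (auto simp: field_simps)
  have "- s / 2 + 1 + of_nat j \<noteq> 0" for j
  proof -
    have "- s / 2 + 1 + of_nat j = - s / 2 + of_nat (Suc j)" by simp
    then show ?thesis using nz[of "Suc j"] by metis
  qed
  then have 1: "pochhammer (- s / 2) m / pochhammer (1 - s / 2) m = (- s / 2) / (- s / 2 + of_nat m)"
    using pochhammer_quotient_Suc[of "- s / 2" m] nz by (simp add: add_ac)
  have 2: "fact (2 * m) = (2 ^ (2 * m) * pochhammer (1/2) m * fact m :: complex)" by (rule fact_double)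
  have e1: "(of_real (- (\<omega>\<^sup>2 / 4)) :: complex) ^ m = (-1) ^ m * of_real \<omega> ^ (2 * m) / 2 ^ (2 * m)"
    by (simp add: power_minus[of "(complex_of_real \<omega>)\<^sup>2 / 4"] power_divide power_mult)
  have e2: "pochhammer (- s / 2) m / pochhammer (1 - s / 2) m = - s / (of_nat (2 * m) - s)"
  proof -
    have "- s / 2 + of_nat m = (of_nat (2 * m) - s) / 2" by (simp add: field_simps)
    then show ?thesis unfolding 1 by simp
  qed
  have "pochhammer (- s / 2) m / (pochhammer (1/2) m * pochhammer (1 - s / 2) m) * (of_real (- (\<omega>\<^sup>2 / 4))) ^ m / fact m
     = (pochhammer (- s / 2) m / pochhammer (1 - s / 2) m) * ((of_real (- (\<omega>\<^sup>2 / 4))) ^ m / (pochhammer (1/2) m * fact m))"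
    by simp
  also have "(of_real (- (\<omega>\<^sup>2 / 4)) :: complex) ^ m / (pochhammer (1/2) m * fact m) = (-1) ^ m * of_real \<omega> ^ (2 * m) / fact (2 * m)"
    by (simp only: e1 2 divide_divide_eq_left mult.assoc)
  finally show ?thesis unfolding e2 by (simp only: times_divide_times_eq times_divide_eq_right divide_divide_eq_left mult_ac)
qed

text \<open>The odd counterpart, where (2m + 1)! = 4^m (3/2)_m m! follows from the even formula by
  moving one factor from 1/2 to 3/2.\<close>

lemma hyp1F2_odd_term:
  fixes s :: complex and \<omega> :: real
  assumes s: "s \<notin> \<nat>"
  shows "pochhammer ((1 - s) / 2) m / (pochhammer (3/2) m * pochhammer (1 + (1 - s) / 2) m) * (of_real (- (\<omega>\<^sup>2 / 4))) ^ m / fact m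
     = (1 - s) * ((-1) ^ m * of_real \<omega> ^ (2 * m) / (fact (2 * m + 1) * (of_nat (2 * m + 1) - s)))"
proof -
  have nz: "(1 - s) / 2 + of_nat j \<noteq> 0" for j
    using not_Nats_of_nat_diff[OF s, of "2 * j + 1"] by (auto simp: field_simps)
  have "(1 - s) / 2 + 1 + of_nat j \<noteq> 0" for j
  proof -
    have "(1 - s) / 2 + 1 + of_nat j = (1 - s) / 2 + of_nat (Suc j)" by simp
    then show ?thesis using nz[of "Suc j"] by metis
  qed
  then have 1: "pochhammer ((1 - s) / 2) m / pochhammer (1 + (1 - s) / 2) m = ((1 - s) / 2) / ((1 - s) / 2 + of_nat m)"
    using pochhammer_quotient_Suc[of "(1 - s) / 2" m] nz by (simp add: add_ac)
  have "1/2 * pochhammer (1/2 + 1) m = (1/2 + of_nat m) * pochhammer (1/2 :: complex) m"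
    by (metis pochhammer_rec pochhammer_rec')
  then have "pochhammer (3/2 :: complex) m = of_nat (2 * m + 1) * pochhammer (1/2) m" by (simp add: field_simps)
  then have 2: "fact (2 * m + 1) = (2 ^ (2 * m) * pochhammer (3/2) m * fact m :: complex)"
    using fact_double[of m, where ?'a = complex] by (simp add: algebra_simps)
  have e1: "(of_real (- (\<omega>\<^sup>2 / 4)) :: complex) ^ m = (-1) ^ m * of_real \<omega> ^ (2 * m) / 2 ^ (2 * m)"
    by (simp add: power_minus[of "(complex_of_real \<omega>)\<^sup>2 / 4"] power_divide power_mult)
  have e2: "pochhammer ((1 - s) / 2) m / pochhammer (1 + (1 - s) / 2) m = (1 - s) / (of_nat (2 * m + 1) - s)"
  proof -
    have "(1 - s) / 2 + of_nat m = (of_nat (2 * m + 1) - s) / 2" by (simp add: field_simps)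
    then show ?thesis unfolding 1 by simp
  qed
  have "pochhammer ((1 - s) / 2) m / (pochhammer (3/2) m * pochhammer (1 + (1 - s) / 2) m) * (of_real (- (\<omega>\<^sup>2 / 4))) ^ m / fact m
     = (pochhammer ((1 - s) / 2) m / pochhammer (1 + (1 - s) / 2) m) * ((of_real (- (\<omega>\<^sup>2 / 4))) ^ m / (pochhammer (3/2) m * fact m))"
    by simp
  also have "(of_real (- (\<omega>\<^sup>2 / 4)) :: complex) ^ m / (pochhammer (3/2) m * fact m) = (-1) ^ m * of_real \<omega> ^ (2 * m) / fact (2 * m + 1)"
    by (simp only: e1 2 divide_divide_eq_left mult.assoc)
  finally show ?thesis unfolding e2 by (simp only: times_divide_times_eq times_divide_eq_right divide_divide_eq_left mult_ac)
qed

lemma imaginary_unit_powers: "\<i> ^ (2 * m) = (-1) ^ m" "(-\<i>) ^ (2 * m) = (-1) ^ m"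
  "\<i> ^ (2 * m + 1) = \<i> * (-1) ^ m" "(-\<i>) ^ (2 * m + 1) = - (\<i> * (-1) ^ m)"
  by (simp_all add: power_mult)

text \<open>Averaging over the two signs of \<open>\<i>\<close> kills the odd powers in
  \<open>head_ser\<close>; the surviving terms are reindexed by \<open>2 * m\<close>.\<close>

lemma hyp1F2_even:
  assumes s: "s \<notin> \<nat>" and \<omega>: "\<omega> > 0"
  shows "hyp1F2 (- s / 2) (1/2) (1 - s / 2) (of_real (- (\<omega>\<^sup>2 / 4))) = - s * ((head_ser \<i> \<omega> s + head_ser (-\<i>) \<omega> s) / 2)"
proof -
  let ?t = "\<lambda>\<sigma> m. (\<sigma> * of_real \<omega>) ^ m / (fact m * (of_nat m - s))"
  have "(\<lambda>m. (?t \<i> m + ?t (-\<i>) m) / 2) sums ((head_ser \<i> \<omega> s + head_ser (-\<i>) \<omega> s) / 2)"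
    using head_ser_sums[OF _ \<omega> s, of \<i>] head_ser_sums[OF _ \<omega> s, of "-\<i>"]
    by (intro sums_divide sums_add) auto
  moreover have "(?t \<i> n + ?t (-\<i>) n) / 2 = 0" if "n \<notin> range ((*) 2)" for n
  proof -
    have "odd n"
    proof
      assume "even n"
      then obtain m where "n = 2 * m" by (rule evenE)
      then show False using that by auto
    qed
    then obtain m where "n = 2 * m + 1" by (rule oddE)
    then show ?thesis by (simp only: power_mult_distrib imaginary_unit_powers) simp
  qed
  ultimately have "(\<lambda>m. (?t \<i> (2 * m) + ?t (-\<i>) (2 * m)) / 2) sums ((head_ser \<i> \<omega> s + head_ser (-\<i>) \<omega> s) / 2)"
    using sums_mono_reindex[of "(*) 2" "\<lambda>m. (?t \<i> m + ?t (-\<i>) m) / 2"] by (simp add: strict_mono_def)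
  then have "(\<lambda>m. - s * ((?t \<i> (2 * m) + ?t (-\<i>) (2 * m)) / 2)) sums (- s * ((head_ser \<i> \<omega> s + head_ser (-\<i>) \<omega> s) / 2))"
    by (rule sums_mult)
  moreover have "- s * ((?t \<i> (2 * m) + ?t (-\<i>) (2 * m)) / 2) =
      pochhammer (- s / 2) m / (pochhammer (1/2) m * pochhammer (1 - s / 2) m) * (of_real (- (\<omega>\<^sup>2 / 4))) ^ m / fact m" for m
    unfolding hyp1F2_even_term[OF s] by (simp only: power_mult_distrib imaginary_unit_powers) simp
  ultimately show ?thesis unfolding hyp1F2_def by (simp only: sums_iff)
qed

lemma hyp1F2_odd:
  assumes s: "s \<notin> \<nat>" and \<omega>: "\<omega> > 0"
  shows "of_real \<omega> / (1 - s) * hyp1F2 ((1 - s) / 2) (3/2) (1 + (1 - s) / 2) (of_real (- (\<omega>\<^sup>2 / 4)))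
     = (head_ser \<i> \<omega> s - head_ser (-\<i>) \<omega> s) / (2 * \<i>)"
proof -
  let ?t = "\<lambda>\<sigma> m. (\<sigma> * of_real \<omega>) ^ m / (fact m * (of_nat m - s))"
  have s1: "1 - s \<noteq> 0" using not_Nats_of_nat_diff[OF s, of 1] by simp
  have "(\<lambda>m. (?t \<i> m - ?t (-\<i>) m) / (2 * \<i>)) sums ((head_ser \<i> \<omega> s - head_ser (-\<i>) \<omega> s) / (2 * \<i>))"
    using head_ser_sums[OF _ \<omega> s, of \<i>] head_ser_sums[OF _ \<omega> s, of "-\<i>"]
    by (intro sums_divide sums_diff) auto
  moreover have "(?t \<i> n - ?t (-\<i>) n) / (2 * \<i>) = 0" if "n \<notin> range (\<lambda>m. 2 * m + 1)" for n
  proof -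
    have "even n"
    proof (rule ccontr)
      assume "odd n"
      then obtain m where "n = 2 * m + 1" by (rule oddE)
      then show False using that by auto
    qed
    then obtain m where "n = 2 * m" by (rule evenE)
    then show ?thesis by (simp only: power_mult_distrib imaginary_unit_powers) simp
  qed
  ultimately have "(\<lambda>m. (?t \<i> (2 * m + 1) - ?t (-\<i>) (2 * m + 1)) / (2 * \<i>)) sums ((head_ser \<i> \<omega> s - head_ser (-\<i>) \<omega> s) / (2 * \<i>))"
    using sums_mono_reindex[of "\<lambda>m. 2 * m + 1" "\<lambda>m. (?t \<i> m - ?t (-\<i>) m) / (2 * \<i>)"] by (simp add: strict_mono_def)
  then have "(\<lambda>m. (1 - s) / of_real \<omega> * ((?t \<i> (2 * m + 1) - ?t (-\<i>) (2 * m + 1)) / (2 * \<i>))) sums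
      ((1 - s) / of_real \<omega> * ((head_ser \<i> \<omega> s - head_ser (-\<i>) \<omega> s) / (2 * \<i>)))"
    by (rule sums_mult)
  moreover have "(1 - s) / of_real \<omega> * ((?t \<i> (2 * m + 1) - ?t (-\<i>) (2 * m + 1)) / (2 * \<i>)) =
      pochhammer ((1 - s) / 2) m / (pochhammer (3/2) m * pochhammer (1 + (1 - s) / 2) m) * (of_real (- (\<omega>\<^sup>2 / 4))) ^ m / fact m" for m
    unfolding hyp1F2_odd_term[OF s] using \<omega> by (simp only: power_mult_distrib imaginary_unit_powers) simp
  ultimately have "hyp1F2 ((1 - s) / 2) (3/2) (1 + (1 - s) / 2) (of_real (- (\<omega>\<^sup>2 / 4))) =
      (1 - s) / of_real \<omega> * ((head_ser \<i> \<omega> s - head_ser (-\<i>) \<omega> s) / (2 * \<i>))"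
    unfolding hyp1F2_def by (simp only: sums_iff)
  then show ?thesis using s1 \<omega> by simp
qed

definition phase :: "complex \<Rightarrow> real \<Rightarrow> nat \<Rightarrow> complex" where
  "phase \<sigma> b k = exp (\<sigma> * of_real (2 * pi * b * real k))"

lemma norm_phase: "\<sigma> \<in> {\<i>, -\<i>} \<Longrightarrow> norm (phase \<sigma> b k) = 1"
  by (auto simp: phase_def)

lemma phase_i: "phase \<i> b k = of_real (cos (2 * pi * b * real k)) + \<i> * of_real (sin (2 * pi * b * real k))"
  "phase (-\<i>) b k = of_real (cos (2 * pi * b * real k)) - \<i> * of_real (sin (2 * pi * b * real k))"
  unfolding phase_def by (simp_all only: cis_conv_exp[symmetric] minus_mult_left[symmetric] exp_minus cis_inverse[symmetric])
    (auto simp: complex_eq_iff)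

text \<open>With \<open>\<omega> = 2 * pi * a * real k\<close> the argument of both 1F2 is
  \<open>- (\<omega>^2 / 4)\<close>. The cosine multiplies the even part of \<open>head_ser\<close>
  and the sine the odd part, and together they form the two phases.\<close>

lemma hyp_term_head_ser:
  assumes s: "s \<notin> \<nat>" and "a > 0" "k > 0"
  shows "hyp_term a b 1 s k = - (phase \<i> b k * head_ser \<i> (2 * pi * a * real k) s
      + phase (-\<i>) b k * head_ser (-\<i>) (2 * pi * a * real k) s) / (2 * of_nat k)"
proof -
  define \<omega> where "\<omega> = 2 * pi * a * real k"
  have \<omega>: "\<omega> > 0" using assms by (simp add: \<omega>_def)
  have z: "pi\<^sup>2 * a\<^sup>2 * 1\<^sup>2 * (real k)\<^sup>2 = \<omega>\<^sup>2 / 4" by (simp add: \<omega>_def power_mult_distrib)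
  have s0: "s \<noteq> 0" using s by auto
  have "hyp_term a b 1 s k = of_real (cos (2 * pi * b * k)) / of_nat k * (hyp1F2 (- s / 2) (1/2) (1 - s / 2) (of_real (- (\<omega>\<^sup>2 / 4))) / s)
     + of_real (sin (2 * pi * b * k)) / of_nat k * (of_real \<omega> / (1 - s) *
       hyp1F2 ((1 - s) / 2) (3/2) (1 + (1 - s) / 2) (of_real (- (\<omega>\<^sup>2 / 4))))"
    unfolding hyp_term_def z using assms by (simp add: \<omega>_def field_simps)
  also have "\<dots> = - (phase \<i> b k * head_ser \<i> \<omega> s + phase (-\<i>) b k * head_ser (-\<i>) \<omega> s) / (2 * of_nat k)"
    unfolding hyp1F2_even[OF s \<omega>] hyp1F2_odd[OF s \<omega>] phase_i using s0 assms(3)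
    by (simp add: divide_simps) (simp add: algebra_simps)
  finally show ?thesis unfolding \<omega>_def .
qed

text \<open>What \<open>rhs_term\<close> becomes for positive \<open>a\<close> and
  \<open>d = 1\<close> when the Gamma summand is combined with \<open>head_ser\<close> by
  \<open>upper_int_formula\<close>. It is entire for \<open>k > 0\<close> and so supplies the values
  at the removable singularities as well.\<close>

definition rhs_entire :: "real \<Rightarrow> real \<Rightarrow> complex \<Rightarrow> nat \<Rightarrow> complex" where
  "rhs_entire a b s k = (phase \<i> b k * upper_int \<i> (2 * pi * a * real k) s
      + phase (-\<i>) b k * upper_int (-\<i>) (2 * pi * a * real k) s) / (2 * of_nat k)"

definition gamma_term :: "real \<Rightarrow> real \<Rightarrow> complex \<Rightarrow> nat \<Rightarrow> complex" where
  "gamma_term a b s k = of_nat k powr (s - 1) * of_real (2 * pi) powr s * Gamma (- s) * (1/2) *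
       ((- \<i> * of_real a) powr s * phase \<i> b k + (\<i> * of_real a) powr s * phase (-\<i>) b k)"

lemma rhs_term_hyp_gamma: "rhs_term a b d s k = hyp_term a b d s k + gamma_term a b s k"
  by (simp add: rhs_term_def gamma_term_def phase_def algebra_simps)

lemma rhs_term_eq_entire:
  assumes s: "s \<notin> \<nat>" and "a > 0" "k > 0"
  shows "rhs_term a b 1 s k = rhs_entire a b s k"
proof -
  define \<omega> where "\<omega> = 2 * pi * a * real k"
  have \<omega>: "\<omega> > 0" using assms by (simp add: \<omega>_def)
  \<comment> \<open>Positive real factors do not change the principal argument, so they can be split
    off the power of an imaginary number.\<close>
  have pw: "(\<sigma> * of_real \<omega>) powr s = of_nat k powr s * of_real (2 * pi) powr s * (\<sigma> * of_real a) powr s" for \<sigma>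
  proof -
    have "\<sigma> * of_real \<omega> = of_nat k * (of_real (2 * pi) * (\<sigma> * of_real a))" by (simp add: \<omega>_def)
    also have "\<dots> powr s = of_nat k powr s * (of_real (2 * pi) * (\<sigma> * of_real a)) powr s"
      by (rule powr_times_real_left) (auto simp: assms)
    also have "(of_real (2 * pi) * (\<sigma> * of_real a)) powr s = of_real (2 * pi) powr s * (\<sigma> * of_real a) powr s"
      by (rule powr_times_real_left) (auto simp: assms)
    finally show ?thesis by (simp only: mult.assoc)
  qed
  have k: "complex_of_nat k powr (s - 1) = of_nat k powr s / of_nat k"
    using assms by (simp add: powr_diff)
  show ?thesis
    unfolding rhs_term_hyp_gamma hyp_term_head_ser[OF assms] rhs_entire_def gamma_term_def \<omega>_def[symmetric] k
      upper_int_formula[of \<i>, OF _ \<omega> s, simplified] upper_int_formula[of "-\<i>", OF _ \<omega> s, simplified]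
    using pw[of \<i>] pw[of "-\<i>"] assms(3)
    by (simp add: field_simps)
qed

lemma rhs_entire_holomorphic:
  assumes "a > 0" "k > 0"
  shows "(\<lambda>s. rhs_entire a b s k) holomorphic_on A"
proof -
  have U: "(\<lambda>s. upper_int \<sigma> (2 * pi * a * real k) s) holomorphic_on A" if "\<sigma> \<in> {\<i>, -\<i>}" for \<sigma>
    by (rule holomorphic_on_subset[OF upper_int_holomorphic[OF that]]) (use assms in auto)
  have "2 * complex_of_nat k \<noteq> 0" using assms(2) by simp
  then show ?thesis
    unfolding rhs_entire_def
    by (intro holomorphic_on_divide holomorphic_on_add holomorphic_on_mult holomorphic_on_const U) simp_all
qed

text \<open>Uniform in \<open>b\<close>, because the phases have modulus one. One factor
  \<open>1 / k\<close> comes from \<open>upper_int_bound\<close>, the other is already in the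
  summand.\<close>

lemma rhs_entire_bound:
  fixes \<epsilon> \<delta> :: real
  assumes "\<epsilon> > 0" "\<delta> > 0"
  shows "\<exists>K>0. \<forall>a\<ge>\<delta>. \<forall>b s k. Re s \<ge> - \<epsilon> \<longrightarrow> \<bar>Im s\<bar> \<le> \<epsilon> \<longrightarrow> k > 0 \<longrightarrow>
           norm (rhs_entire a b s k) \<le> K / real k ^ 2"
proof -
  obtain K where K: "K > 0" "\<And>\<sigma> \<omega> s. \<sigma> \<in> {\<i>, -\<i>} \<Longrightarrow> \<omega> \<ge> 2 * pi * \<delta> \<Longrightarrow> Re s \<ge> - \<epsilon> \<Longrightarrow> \<bar>Im s\<bar> \<le> \<epsilon> \<Longrightarrow>
      norm (upper_int \<sigma> \<omega> s) \<le> K / \<omega>"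
    using upper_int_bound[OF assms(1), of "2 * pi * \<delta>"] assms(2) by (metis mult_pos_pos pi_gt_zero zero_less_numeral)
  have "norm (rhs_entire a b s k) \<le> (K / (2 * pi * \<delta>)) / real k ^ 2"
    if a: "a \<ge> \<delta>" and s: "Re s \<ge> - \<epsilon>" "\<bar>Im s\<bar> \<le> \<epsilon>" and k: "k > 0" for a b s k
  proof -
    define \<omega> where "\<omega> = 2 * pi * a * real k"
    have "1 * (2 * pi * \<delta>) \<le> real k * (2 * pi * a)" using a k assms by (intro mult_mono) auto
    then have \<omega>: "\<omega> \<ge> 2 * pi * \<delta>" by (simp add: \<omega>_def mult_ac)
    have "\<delta> * real k \<le> a * real k" using a by (intro mult_right_mono) auto
    then have \<omega>2: "2 * pi * \<delta> * real k \<le> \<omega>" by (simp add: \<omega>_def)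
    have "K / \<omega> \<le> K / (2 * pi * \<delta> * real k)"
      using K(1) \<omega>2 assms k by (intro divide_left_mono) (auto intro!: mult_pos_pos order.strict_trans2[OF _ \<omega>2])
    then have U: "norm (upper_int \<sigma> \<omega> s) \<le> K / (2 * pi * \<delta> * real k)" if "\<sigma> \<in> {\<i>, -\<i>}" for \<sigma>
      using K(2)[OF that \<omega> s] by linarith
    have "norm (phase \<i> b k * upper_int \<i> \<omega> s + phase (-\<i>) b k * upper_int (-\<i>) \<omega> s) \<le> norm (upper_int \<i> \<omega> s) + norm (upper_int (-\<i>) \<omega> s)"
      by (rule norm_triangle_le) (simp add: norm_mult norm_phase)
    also have "\<dots> \<le> 2 * (K / (2 * pi * \<delta> * real k))" using U[of \<i>] U[of "-\<i>"] by simp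
    finally have N: "norm (phase \<i> b k * upper_int \<i> \<omega> s + phase (-\<i>) b k * upper_int (-\<i>) \<omega> s) \<le> 2 * (K / (2 * pi * \<delta> * real k))" .
    have "norm (rhs_entire a b s k) \<le> 2 * (K / (2 * pi * \<delta> * real k)) / (2 * real k)"
    proof -
      have nk: "norm (2 * complex_of_nat k) = 2 * real k" by (simp add: norm_mult)
      show ?thesis unfolding rhs_entire_def \<omega>_def[symmetric] norm_divide nk
        using N by (rule divide_right_mono) simp
    qed
    also have "\<dots> = (K / (2 * pi * \<delta>)) / real k ^ 2" using k by (simp add: power2_eq_square)
    finally show ?thesis .
  qed
  moreover have "K / (2 * pi * \<delta>) > 0" using K assms by simp
  ultimately show ?thesis by blast
qed

text \<open>Inside the 1F2 arguments \<open>d\<close> occurs only in the product with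
  \<open>a\<close>; this is what permits working with \<open>d = 1\<close>.\<close>

lemma hyp_term_scale:
  assumes "d > 0"
  shows "hyp_term a b d s k = of_real d powr (- s) * hyp_term (a * d) b 1 s k"
proof -
  define P where "P = of_real d powr (- s)"
  define A where "A = hyp1F2 (- s / 2) (1/2) (1 - s / 2) (of_real (- (pi\<^sup>2 * a\<^sup>2 * d\<^sup>2 * (real k)\<^sup>2)))"
  define B where "B = hyp1F2 ((1 - s) / 2) (3/2) (1 + (1 - s) / 2) (of_real (- (pi\<^sup>2 * a\<^sup>2 * d\<^sup>2 * (real k)\<^sup>2)))"
  have 1: "complex_of_real d powr (1 - s) = of_real d * P"
    using assms by (simp add: P_def powr_diff powr_minus divide_inverse)
  have 2: "complex_of_real d powr s = inverse P"
    by (simp add: P_def powr_minus)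
  have 3: "pi\<^sup>2 * (a * d)\<^sup>2 * 1\<^sup>2 * (real k)\<^sup>2 = pi\<^sup>2 * a\<^sup>2 * d\<^sup>2 * (real k)\<^sup>2"
    by (simp add: power_mult_distrib)
  show ?thesis
    unfolding hyp_term_def 3 A_def[symmetric] B_def[symmetric] 1 2 P_def[symmetric]
    by (simp add: divide_inverse distrib_left mult_ac)
qed

lemma rhs_term_scale:
  assumes "d > 0"
  shows "rhs_term a b d s k = of_real d powr (- s) * rhs_term (a * d) b 1 s k"
proof -
  have "(\<sigma> * of_real (a * d)) powr s = of_real d powr s * (\<sigma> * of_real a) powr s" for \<sigma>
    using powr_times_real_left[of "of_real d" "\<sigma> * of_real a" s] assms by (simp add: mult_ac)
  from this[of \<i>] this[of "-\<i>"]
  have p: "(\<i> * of_real (a * d)) powr s = of_real d powr s * (\<i> * of_real a) powr s"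
    "(- \<i> * of_real (a * d)) powr s = of_real d powr s * (- \<i> * of_real a) powr s" by simp_all
  have q: "of_real d powr (- s) * (of_nat k powr (s - 1) * of_real (2 * pi) powr s * Gamma (- s) * (1/2) *
      (complex_of_real d powr s * x + complex_of_real d powr s * y)) =
      of_nat k powr (s - 1) * of_real (2 * pi) powr s * Gamma (- s) * (1/2) * (x + y)" for x y
    using assms by (simp add: powr_minus field_simps)
  have "gamma_term a b s k = of_real d powr (- s) * gamma_term (a * d) b s k"
    unfolding gamma_term_def p using q[of "(- \<i> * of_real a) powr s * phase \<i> b k" "(\<i> * of_real a) powr s * phase (-\<i>) b k"]
    by (simp only: mult.assoc)
  then show ?thesis unfolding rhs_term_hyp_gamma hyp_term_scale[OF assms] by (simp add: algebra_simps)
qed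

lemma hyp_term_uminus: "hyp_term (- a) (- b) d s k = hyp_term a b d s k"
  by (simp add: hyp_term_def)

lemma gamma_term_uminus: "gamma_term (- a) (- b) s k = gamma_term a b s k"
  by (simp add: gamma_term_def phase_def add.commute)

text \<open>Changing both signs preserves the cosine and the product of \<open>a\<close> with the
  sine, and merely swaps the two exponentials of the Gamma summand.\<close>

lemma rhs_term_uminus: "rhs_term (- a) (- b) d s k = rhs_term a b d s k"
  unfolding rhs_term_hyp_gamma hyp_term_uminus gamma_term_uminus ..

lemma rhs_term_eq_entire_general:
  assumes "s \<notin> \<nat>" "a \<noteq> 0" "d > 0" "k > 0"
  shows "rhs_term a b d s k = of_real d powr (- s) * rhs_entire (\<bar>a\<bar> * d) (b * sgn a) s k"
proof (cases "a > 0")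
  case True
  then show ?thesis using assms rhs_term_eq_entire[OF assms(1), of "a * d" k b] by (simp add: rhs_term_scale[OF assms(3), of a])
next
  case False
  then have "rhs_term a b d s k = rhs_term (- a) (- b) d s k" and na: "- a > 0" using assms by (auto simp: rhs_term_uminus)
  moreover have "- a * d > 0" using na assms(3) by (rule mult_pos_pos)
  ultimately show ?thesis using assms rhs_term_eq_entire[OF assms(1), of "- a * d" k "- b"]
    by (simp add: rhs_term_scale[OF assms(3), of "- a"] sgn_if)
qed

lemma eventually_at_not_Nats: "\<forall>\<^sub>F s in at z. (s :: complex) \<notin> \<nat>"
proof -
  have "\<not> z islimpt (\<nat> :: complex set)"
  proof (rule discrete_imp_not_islimpt[of 1])
    fix x y :: complex assume "x \<in> \<nat>" "y \<in> \<nat>" "dist y x < 1"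
    then obtain m n where mn: "x = of_nat m" "y = of_nat n" by (auto elim!: Nats_cases)
    have "real_of_int \<bar>int n - int m\<bar> < 1" using \<open>dist y x < 1\<close> unfolding mn dist_of_nat .
    then show "y = x" using mn by simp
  qed simp
  then show ?thesis by (simp add: islimpt_iff_eventually)
qed

text \<open>The naturals are discrete, so in a punctured neighbourhood of any point
  \<open>rhs_term\<close> coincides with an entire function, and removing the singularity returns
  the value of that function.\<close>

lemma rhs_term_ext_eq:
  assumes "a \<noteq> 0" "d > 0" "k > 0"
  shows "rhs_term_ext a b d s k = of_real d powr (- s) * rhs_entire (\<bar>a\<bar> * d) (b * sgn a) s k"
  unfolding rhs_term_ext_def
proof (rule remove_sings_eqI)
  let ?f = "\<lambda>s. of_real d powr (- s) * rhs_entire (\<bar>a\<bar> * d) (b * sgn a) s k"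
  have "?f holomorphic_on UNIV"
    using assms by (intro holomorphic_intros rhs_entire_holomorphic) auto
  then have "isCont ?f s"
    by (meson UNIV_I continuous_on_eq_continuous_at holomorphic_on_imp_continuous_on open_UNIV)
  then have "(?f \<longlongrightarrow> ?f s) (at s)" by (simp add: isCont_def)
  moreover have "\<forall>\<^sub>F z in at s. ?f z = rhs_term a b d z k"
    using eventually_at_not_Nats by eventually_elim (use assms rhs_term_eq_entire_general in auto)
  ultimately show "((\<lambda>s. rhs_term a b d s k) \<longlongrightarrow> ?f s) (at s)"
    by (rule Lim_transform_eventually)
qed

section \<open>The sine product\<close>

lemma tendsto_mult_ln_abs_0: "((\<lambda>t::real. t * ln \<bar>t\<bar>) \<longlongrightarrow> 0) (at 0)"
proof (rule filterlim_split_at)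
  have "((\<lambda>t::real. t * ln t) \<longlongrightarrow> 0) (at_right 0)" by real_asymp
  then show "((\<lambda>t::real. t * ln \<bar>t\<bar>) \<longlongrightarrow> 0) (at_right 0)"
    by (rule Lim_transform_eventually) (auto simp: eventually_at_filter)
  have "((\<lambda>t::real. t * ln (-t)) \<longlongrightarrow> 0) (at_left 0)" by real_asymp
  then show "((\<lambda>t::real. t * ln \<bar>t\<bar>) \<longlongrightarrow> 0) (at_left 0)"
    by (rule Lim_transform_eventually) (auto simp: eventually_at_filter)
qed

lemma isCont_mult_ln_abs: "isCont (\<lambda>t::real. t * ln \<bar>t\<bar>) t"
proof (cases "t = 0")
  case True
  then show ?thesis using tendsto_mult_ln_abs_0 by (simp add: isCont_def)
qed (auto intro!: continuous_intros)

text \<open>The antiderivative (x - p) ln |x - p| - x is continuous across the singularity, so the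
  fundamental theorem applies with \<open>p\<close> as exceptional point.\<close>

lemma ln_abs_absolutely_integrable:
  "(\<lambda>x::real. ln \<bar>x - p\<bar>) absolutely_integrable_on {0..1}"
proof -
  have "((\<lambda>x. ln \<bar>x - p\<bar>) has_integral ((1 - p) * ln \<bar>1 - p\<bar> - 1 - ((0 - p) * ln \<bar>0 - p\<bar> - 0))) {0..1}"
  proof (rule fundamental_theorem_of_calculus_strong[of "{p}"])
    show "continuous_on {0..1} (\<lambda>x. (x - p) * ln \<bar>x - p\<bar> - x)"
    proof (rule continuous_on_diff[OF _ continuous_on_id])
      show "continuous_on {0..1} (\<lambda>x. (x - p) * ln \<bar>x - p\<bar>)"
      proof (rule continuous_on_compose2[of UNIV "\<lambda>t::real. t * ln \<bar>t\<bar>"])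
        show "continuous_on UNIV (\<lambda>t::real. t * ln \<bar>t\<bar>)"
          using isCont_mult_ln_abs by (intro continuous_at_imp_continuous_on) auto
      qed (auto intro!: continuous_intros)
    qed
    fix x assume "x \<in> {0..1} - {p}"
    then have x: "x - p \<noteq> 0" by auto
    \<comment> \<open>Written through the square, the logarithm can be differentiated without a case
      split on the sign.\<close>
    have eq: "ln \<bar>t\<bar> = ln (t\<^sup>2) / 2" for t :: real
      using ln_realpow[of "\<bar>t\<bar>" 2] by (cases "t = 0") auto
    have "((\<lambda>x. (x - p) * (ln ((x - p)\<^sup>2) / 2) - x) has_real_derivative ln ((x - p)\<^sup>2) / 2) (at x)"
    proof -
      have inv: "2 * t / t\<^sup>2 / 2 = inverse t" for t :: real by (simp add: power2_eq_square field_simps)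
      have "((\<lambda>y. ln (y\<^sup>2) / 2) has_real_derivative inverse (x - p)) (at (x - p))"
      proof (rule DERIV_cong)
        show "((\<lambda>y. ln (y\<^sup>2) / 2) has_real_derivative 2 * (x - p) / (x - p)\<^sup>2 / 2) (at (x - p))"
          using x by (auto intro!: derivative_eq_intros simp: divide_simps)
        show "2 * (x - p) / (x - p)\<^sup>2 / 2 = inverse (x - p)" by (rule inv)
      qed
      moreover have "((\<lambda>x. x - p) has_real_derivative 1) (at x)" by (auto intro!: derivative_eq_intros)
      ultimately have "((\<lambda>x. ln ((x - p)\<^sup>2) / 2) has_real_derivative inverse (x - p) * 1) (at x)"
        by (rule DERIV_chain2[where f = "\<lambda>y. ln (y\<^sup>2) / 2" and g = "\<lambda>x. x - p"])
      from DERIV_diff[OF DERIV_mult[OF DERIV_diff[OF DERIV_ident DERIV_const[of p]] this] DERIV_ident]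
      show ?thesis by (rule DERIV_cong) (use x in simp)
    qed
    then show "((\<lambda>x. (x - p) * ln \<bar>x - p\<bar> - x) has_vector_derivative ln \<bar>x - p\<bar>) (at x)"
      unfolding eq by (simp add: has_real_derivative_iff_has_vector_derivative)
  qed auto
  then have int: "(\<lambda>x. ln \<bar>x - p\<bar>) integrable_on {0..1}" by blast
  have le: "ln \<bar>x - p\<bar> \<le> 1 + \<bar>p\<bar>" if "x \<in> {0..1}" for x
  proof (cases "x = p")
    case False
    then have "ln \<bar>x - p\<bar> \<le> \<bar>x - p\<bar> - 1" by (intro ln_le_minus_one) auto
    then show ?thesis using that by auto
  qed auto
  \<comment> \<open>Integrability becomes absolute integrability for nonnegative functions, and a
    constant above the logarithm minus the logarithm is one.\<close>
  have "(\<lambda>x. (1 + \<bar>p\<bar>) - ln \<bar>x - p\<bar>) absolutely_integrable_on {0..1}"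
    using le by (intro nonnegative_absolutely_integrable_1 integrable_diff int) (auto simp: integrable_const_ivl)
  from absolutely_integrable_continuous_real[OF continuous_on_const[of "{0..1}" "1 + \<bar>p\<bar>"]] this
  have "(\<lambda>x. (1 + \<bar>p\<bar>) - ((1 + \<bar>p\<bar>) - ln \<bar>x - p\<bar>)) absolutely_integrable_on {0..1}"
    by (rule set_integral_diff(1))
  moreover have "(\<lambda>x. (1 + \<bar>p\<bar>) - ((1 + \<bar>p\<bar>) - ln \<bar>x - p\<bar>)) = (\<lambda>x. ln \<bar>x - p\<bar>)"
    by (intro ext) simp
  ultimately show ?thesis by (simp only:)
qed

lemma ln_abs_weight_integrable:
  fixes v :: "real \<Rightarrow> complex"
  assumes "continuous_on {0..1} v"
  shows "(\<lambda>x. of_real (ln \<bar>x - p\<bar>) * v x) absolutely_integrable_on {0..1}"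
proof -
  have "bounded (v ` {0..1})"
    using assms by (intro compact_imp_bounded compact_continuous_image) auto
  moreover have "bilinear (\<lambda>(c::complex) r::real. of_real r * c)"
    unfolding bilinear_def by (auto intro!: linearI simp: algebra_simps scaleR_conv_of_real)
  moreover have "v \<in> borel_measurable (lebesgue_on {0..1})"
    using assms by (intro continuous_imp_measurable_on_sets_lebesgue) auto
  ultimately show ?thesis
    using absolutely_integrable_bounded_measurable_product[OF _ _ _ _ ln_abs_absolutely_integrable[of p],
        where h = "\<lambda>(c::complex) r::real. of_real r * c" and f = v] by simp
qed

text \<open>In this normalisation \<open>p = (k - b) / a\<close> is the zero of \<open>a x + b - k\<close>; for \<open>p = 1\<close> the
  junk value \<open>ln 0 = 0\<close> makes the subtracted constant disappear.\<close>

definition log_factor :: "real \<Rightarrow> real \<Rightarrow> int \<Rightarrow> real \<Rightarrow> real" where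
  "log_factor a b k x = ln \<bar>x - (of_int k - b) / a\<bar> - ln \<bar>1 - (of_int k - b) / a\<bar>"

text \<open>A copy of \<open>paired\<close> for other value types: the logarithms are real, their
  moments complex.\<close>

definition rpaired :: "(int \<Rightarrow> 'a::comm_monoid_add) \<Rightarrow> nat \<Rightarrow> 'a" where
  "rpaired f j = (if j = 0 then f 0 else f (int j) + f (- int j))"

lemma sum_rpaired: "(\<Sum>j<Suc N. rpaired f j) = (\<Sum>k\<in>{- int N..int N}. f k)"
proof (induction N)
  case (Suc N)
  have "{- int (Suc N)..int (Suc N)} = insert (- int (Suc N)) (insert (int (Suc N)) {- int N..int N})" by auto
  then have "(\<Sum>k\<in>{- int (Suc N)..int (Suc N)}. f k) = f (- int (Suc N)) + (f (int (Suc N)) + (\<Sum>k\<in>{- int N..int N}. f k))"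
    by simp
  also have "\<dots> = (\<Sum>j<Suc (Suc N). rpaired f j)"
    unfolding Suc.IH[symmetric] by (simp add: rpaired_def add_ac)
  finally show ?case by simp
qed (simp add: rpaired_def)

lemma sum_symmetric_shift_Suc:
  fixes f :: "int \<Rightarrow> real"
  shows "(\<Sum>k\<in>{c + 1 - int N..c + 1 + int N}. f k) - (\<Sum>k\<in>{c - int N..c + int N}. f k)
     = f (c + 1 + int N) - f (c - int N)"
proof -
  have eq: "{c + 1 - int N..c + 1 + int N} \<union> {c - int N} = {c - int N..c + int N} \<union> {c + 1 + int N}" by auto
  have 1: "(\<Sum>k\<in>{c + 1 - int N..c + 1 + int N} \<union> {c - int N}. f k) = (\<Sum>k\<in>{c + 1 - int N..c + 1 + int N}. f k) + f (c - int N)"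
    by (subst sum.union_disjoint) auto
  have 2: "(\<Sum>k\<in>{c - int N..c + int N} \<union> {c + 1 + int N}. f k) = (\<Sum>k\<in>{c - int N..c + int N}. f k) + f (c + 1 + int N)"
    by (subst sum.union_disjoint) auto
  show ?thesis using 1 2 unfolding eq by linarith
qed

text \<open>Moving the window by one step exchanges only its two end summands, which tend to 0; an
  induction in both directions gives every shift. The shift is used to centre the sine product at
  the integer a + b.\<close>

lemma symmetric_sum_recentre:
  fixes f :: "int \<Rightarrow> real"
  assumes f: "(f \<longlongrightarrow> 0) at_top" "(f \<longlongrightarrow> 0) at_bot"
  shows "(\<lambda>N. (\<Sum>k\<in>{c - int N..c + int N}. f k) - (\<Sum>k\<in>{- int N..int N}. f k)) \<longlonglongrightarrow> 0"
proof -
  have up: "filterlim (\<lambda>N. c + int N) at_top sequentially" for c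
    unfolding filterlim_at_top eventually_sequentially
  proof
    fix Z show "\<exists>N. \<forall>n\<ge>N. Z \<le> c + int n" by (rule exI[of _ "nat (Z - c)"]) auto
  qed
  have dn: "filterlim (\<lambda>N. c - int N) at_bot sequentially" for c
    unfolding filterlim_at_bot eventually_sequentially
  proof
    fix Z show "\<exists>N. \<forall>n\<ge>N. c - int n \<le> Z" by (rule exI[of _ "nat (c - Z)"]) auto
  qed
  have st: "(\<lambda>N. (\<Sum>k\<in>{c + 1 - int N..c + 1 + int N}. f k) - (\<Sum>k\<in>{c - int N..c + int N}. f k)) \<longlonglongrightarrow> 0" for c
    unfolding sum_symmetric_shift_Suc
    using tendsto_diff[OF filterlim_compose[OF f(1) up[of "c + 1"]] filterlim_compose[OF f(2) dn[of c]]] by simp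
  show ?thesis
  proof (induction c rule: int_induct[where k = 0])
    case (step1 i)
    from tendsto_add[OF step1(2) st[of i]] show ?case by simp
  next
    case (step2 i)
    from tendsto_diff[OF step2(2) st[of "i - 1"]] show ?case by simp
  qed simp
qed

lemma sum_ln_symmetric:
  fixes u :: real
  shows "(\<Sum>k\<in>{- int N..int N}. ln \<bar>u - of_int k\<bar>) = ln \<bar>u\<bar> + (\<Sum>j=1..N. ln \<bar>u - real j\<bar> + ln \<bar>u + real j\<bar>)"
proof -
  have "(\<Sum>k\<in>{- int N..int N}. ln \<bar>u - of_int k\<bar>) = (\<Sum>j<Suc N. rpaired (\<lambda>k. ln \<bar>u - of_int k\<bar>) j)"
    by (rule sum_rpaired[symmetric])
  also have "\<dots> = ln \<bar>u\<bar> + (\<Sum>j=1..N. ln \<bar>u - real j\<bar> + ln \<bar>u + real j\<bar>)"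
    by (induction N) (auto simp: rpaired_def algebra_simps)
  finally show ?thesis .
qed

text \<open>The logarithm of the partial products in Euler's sine product. The growing sum of
  \<open>2 * ln (real j)\<close> has to be split off, and it cancels when two such limits are
  subtracted.\<close>

lemma sum_ln_symmetric_limit:
  fixes u :: real
  assumes "u \<notin> \<int>"
  shows "(\<lambda>N. (\<Sum>k\<in>{- int N..int N}. ln \<bar>u - of_int k\<bar>) - (\<Sum>j=1..N. 2 * ln (real j))) \<longlonglongrightarrow> ln \<bar>sin (pi * u)\<bar> - ln pi"
proof -
  have u: "u \<noteq> 0" "sin (pi * u) \<noteq> 0"
    using assms sin_integer_2pi Ints_0 by (auto simp: sin_zero_iff_int2)
  have nz: "u - real j \<noteq> 0" "u + real j \<noteq> 0" for j
    using assms by (metis Ints_of_nat eq_iff_diff_eq_0, metis Ints_minus Ints_of_nat add_eq_0_iff2)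
  have "(\<lambda>n. ln \<bar>pi * u * (\<Prod>k=1..n. 1 - u^2 / of_nat k^2)\<bar>) \<longlonglongrightarrow> ln \<bar>sin (pi * u)\<bar>"
    using u(2) by (intro tendsto_ln tendsto_rabs sin_product_formula_real) auto
  then have "(\<lambda>n. ln \<bar>pi * u * (\<Prod>k=1..n. 1 - u^2 / of_nat k^2)\<bar> - ln pi) \<longlonglongrightarrow> ln \<bar>sin (pi * u)\<bar> - ln pi"
    by (rule tendsto_diff[OF _ tendsto_const])
  moreover have "ln \<bar>pi * u * (\<Prod>k=1..n. 1 - u^2 / of_nat k^2)\<bar> - ln pi =
      (\<Sum>k\<in>{- int n..int n}. ln \<bar>u - of_int k\<bar>) - (\<Sum>j=1..n. 2 * ln (real j))" for n
  proof -
    have f: "1 - u^2 / of_nat k^2 = - ((u - real k) * (u + real k)) / (real k * real k)" if "k \<in> {1..n}" for k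
      using that by (simp add: field_simps power2_eq_square)
    have nz1: "1 - u^2 / of_nat k^2 \<noteq> 0" if "k \<in> {1..n}" for k
      unfolding f[OF that] using nz[of k] that by auto
    have "ln \<bar>pi * u * (\<Prod>k=1..n. 1 - u^2 / of_nat k^2)\<bar> = ln pi + ln \<bar>u\<bar> + ln (\<Prod>k=1..n. \<bar>1 - u^2 / of_nat k^2\<bar>)"
      using u nz1 by (subst abs_mult, subst ln_mult) (auto simp: abs_mult ln_mult abs_prod intro!: prod_pos)
    also have "ln (\<Prod>k=1..n. \<bar>1 - u^2 / of_nat k^2\<bar>) = (\<Sum>k=1..n. ln \<bar>1 - u^2 / of_nat k^2\<bar>)"
      using nz1 by (intro ln_prod) auto
    also have "\<dots> = (\<Sum>k=1..n. (ln \<bar>u - real k\<bar> + ln \<bar>u + real k\<bar>) - 2 * ln (real k))"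
    proof (rule sum.cong[OF refl])
      fix k assume k: "k \<in> {1..n}"
      have "\<bar>1 - u^2 / of_nat k^2\<bar> = \<bar>u - real k\<bar> * \<bar>u + real k\<bar> / (real k * real k)"
        unfolding f[OF k] by (simp add: abs_mult abs_divide)
      then show "ln \<bar>1 - u^2 / of_nat k^2\<bar> = (ln \<bar>u - real k\<bar> + ln \<bar>u + real k\<bar>) - 2 * ln (real k)"
        using k nz[of k] by (simp add: ln_div ln_mult)
    qed
    finally show ?thesis unfolding sum_ln_symmetric by (simp add: sum_subtractf)
  qed
  ultimately show ?thesis by simp
qed

text \<open>The value of ln |sin (pi (a x + b))| at x = 1, with ln |x - 1| removed when that point
  is a zero: there |sin (pi (a x + b))| is asymptotic to pi a |x - 1|.\<close>

definition log_const :: "real \<Rightarrow> real \<Rightarrow> real" where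
  "log_const a b = (if a + b \<in> \<int> then ln (pi * a) else ln \<bar>sin (pi * (a + b))\<bar>)"

text \<open>For k = a + b the second logarithm is the default \<open>ln 0 = 0\<close>, and clearing
  the denominator in ln |x - 1| leaves \<open>ln a\<close> behind.\<close>

lemma log_factor_eq:
  assumes "a > 0" "a * x + b \<notin> \<int>"
  shows "log_factor a b k x = ln \<bar>a * x + b - of_int k\<bar> - ln \<bar>a + b - of_int k\<bar> - (if of_int k = a + b then ln a else 0)"
proof -
  have nz: "a * x + b - of_int k \<noteq> 0" using assms(2) by (metis Ints_of_int eq_iff_diff_eq_0)
  have "x - (of_int k - b) / a = (a * x + b - of_int k) / a" "1 - (of_int k - b) / a = (a + b - of_int k) / a"
    using assms(1) by (simp_all add: field_simps)
  then show ?thesis using assms(1) nz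
    by (auto simp: log_factor_def abs_divide ln_div)
qed

lemma log_factor_tendsto_0:
  assumes "a > 0" "a * x + b \<notin> \<int>"
  shows "((\<lambda>k. log_factor a b k x) \<longlongrightarrow> 0) at_top" "((\<lambda>k. log_factor a b k x) \<longlongrightarrow> 0) at_bot"
proof -
  define y A where "y = a * x + b" and "A = a + b"
  have "((\<lambda>r::real. ln (r - y) - ln (r - A)) \<longlongrightarrow> 0) at_top" by real_asymp
  then have "((\<lambda>k::int. ln (of_int k - y) - ln (of_int k - A)) \<longlongrightarrow> 0) at_top"
    by (rule filterlim_compose) (rule filterlim_real_of_int_at_top)
  moreover have "\<forall>\<^sub>F k in at_top. ln (of_int k - y) - ln (of_int k - A) = log_factor a b k x"
    using eventually_gt_at_top[of "\<lceil>max y A\<rceil> :: int"]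
    by eventually_elim (use assms in \<open>auto simp: log_factor_eq y_def[symmetric] A_def[symmetric] less_ceiling_iff ceiling_less_iff\<close>)
  ultimately show "((\<lambda>k. log_factor a b k x) \<longlongrightarrow> 0) at_top" by (rule Lim_transform_eventually)
  have "((\<lambda>r::real. ln (y - r) - ln (A - r)) \<longlongrightarrow> 0) at_bot" by real_asymp
  then have "((\<lambda>k::int. ln (y - of_int k) - ln (A - of_int k)) \<longlongrightarrow> 0) at_bot"
    by (rule filterlim_compose) (rule filterlim_real_of_int_at_bot)
  moreover have "\<forall>\<^sub>F k in at_bot. ln (y - of_int k) - ln (A - of_int k) = log_factor a b k x"
    unfolding eventually_at_bot_linorder
  proof (intro exI[of _ "\<lfloor>min y A\<rfloor> - 1"] allI impI)
    fix k assume "k \<le> \<lfloor>min y A\<rfloor> - 1"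
    then have "of_int k < y" "of_int k < A" by linarith+
    then show "ln (y - of_int k) - ln (A - of_int k) = log_factor a b k x"
      using assms by (auto simp: log_factor_eq y_def[symmetric] A_def[symmetric])
  qed
  ultimately show "((\<lambda>k. log_factor a b k x) \<longlongrightarrow> 0) at_bot" by (rule Lim_transform_eventually)
qed

lemma abs_sin_pi_shift: "\<bar>sin (pi * (u - of_int c))\<bar> = \<bar>sin (pi * u)\<bar>"
  by (cases "even c") (simp_all add: right_diff_distrib sin_diff)

lemma has_integral_Diff_finite:
  fixes f :: "real \<Rightarrow> 'b :: banach"
  assumes "finite Z"
  shows "(f has_integral y) (S - Z) \<longleftrightarrow> (f has_integral y) S"
  by (rule has_integral_spike_set_eq) (auto intro!: negligible_subset[OF negligible_finite[OF assms]])

text \<open>The sine product at a x + b is divided by the one at a + b. The two limits subtract, and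
  the sums centred at \<open>c\<close> are afterwards moved back to the centre 0.\<close>

lemma log_factor_sums:
  assumes a: "a > 0" and y: "a * x + b \<notin> \<int>"
  shows "(\<lambda>j. rpaired (\<lambda>k. log_factor a b k x) j) sums (ln \<bar>sin (pi * (a * x + b))\<bar> - log_const a b)"
proof -
  \<comment> \<open>In the integer case this centre makes \<open>v = 0\<close>; the middle term is
    then \<open>ln 0 = 0\<close>, and the remaining logarithms add up to exactly the subtracted sum
    of \<open>2 * ln (real j)\<close>. Otherwise \<open>v\<close> is a + b itself.\<close>
  define c where "c = (if a + b \<in> \<int> then \<lfloor>a + b\<rfloor> else 0)"
  define u v where "u = a * x + b - of_int c" and "v = a + b - of_int c"
  let ?L = "\<lambda>N u. (\<Sum>k\<in>{- int N..int N}. ln \<bar>u - of_int k\<bar>) - (\<Sum>j=1..N. 2 * ln (real j))"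
  have u: "u \<notin> \<int>" using y unfolding u_def by (metis Ints_add Ints_of_int diff_add_cancel)
  have c: "of_int c = a + b" if "a + b \<in> \<int>" using that by (auto simp: c_def elim!: Ints_cases)
  define e where "e = (if a + b \<in> \<int> then ln a else 0)"
  have sums: "(\<Sum>k\<in>{c - int N..c + int N}. log_factor a b k x) = ?L N u - ?L N v - e" for N
  proof -
    have "(\<Sum>k\<in>{c - int N..c + int N}. log_factor a b k x) = (\<Sum>k\<in>{- int N..int N}. log_factor a b (c + k) x)"
      by (rule sum.reindex_bij_witness[of _ "\<lambda>k. c + k" "\<lambda>k. k - c"]) auto
    also have "\<dots> = (\<Sum>k\<in>{- int N..int N}. ln \<bar>u - of_int k\<bar> - ln \<bar>v - of_int k\<bar> - (if k = 0 then e else 0))"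
    proof (rule sum.cong[OF refl])
      fix k
      have "(of_int (c + k) = a + b) = (k = 0 \<and> a + b \<in> \<int>)"
        using c by (metis Ints_of_int add.right_neutral add_left_cancel of_int_eq_iff)
      then show "log_factor a b (c + k) x = ln \<bar>u - of_int k\<bar> - ln \<bar>v - of_int k\<bar> - (if k = 0 then e else 0)"
        unfolding log_factor_eq[OF a y] by (auto simp: u_def v_def e_def diff_diff_eq)
    qed
    also have "\<dots> = ?L N u - ?L N v - e" by (simp add: sum_subtractf)
    finally show ?thesis .
  qed
  have v: "(\<lambda>N. ?L N v) \<longlonglongrightarrow> (if a + b \<in> \<int> then 0 else ln \<bar>sin (pi * (a + b))\<bar> - ln pi)"
  proof (cases "a + b \<in> \<int>")
    case True
    then have "v = 0" using c by (simp add: v_def)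
    then have "?L N v = 0" for N unfolding \<open>v = 0\<close> sum_ln_symmetric by simp
    then show ?thesis using True by simp
  next
    case False
    then have "v = a + b" by (simp add: v_def c_def)
    then show ?thesis using sum_ln_symmetric_limit[OF False] False by simp
  qed
  have "(\<lambda>N. \<Sum>k\<in>{c - int N..c + int N}. log_factor a b k x) \<longlonglongrightarrow>
      (ln \<bar>sin (pi * u)\<bar> - ln pi) - (if a + b \<in> \<int> then 0 else ln \<bar>sin (pi * (a + b))\<bar> - ln pi) - e"
    unfolding sums by (intro tendsto_diff v sum_ln_symmetric_limit[OF u] tendsto_const)
  also have "(ln \<bar>sin (pi * u)\<bar> - ln pi) - (if a + b \<in> \<int> then 0 else ln \<bar>sin (pi * (a + b))\<bar> - ln pi) - e
      = ln \<bar>sin (pi * (a * x + b))\<bar> - log_const a b"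
    using a by (simp add: log_const_def e_def u_def abs_sin_pi_shift ln_mult)
  finally have "(\<lambda>N. \<Sum>k\<in>{c - int N..c + int N}. log_factor a b k x) \<longlonglongrightarrow> ln \<bar>sin (pi * (a * x + b))\<bar> - log_const a b" .
  from tendsto_diff[OF this symmetric_sum_recentre[OF log_factor_tendsto_0[OF a y], of c]]
  have "(\<lambda>N. \<Sum>k\<in>{- int N..int N}. log_factor a b k x) \<longlonglongrightarrow> ln \<bar>sin (pi * (a * x + b))\<bar> - log_const a b"
    by simp
  then have "(\<lambda>N. \<Sum>j<Suc N. rpaired (\<lambda>k. log_factor a b k x) j) \<longlonglongrightarrow> ln \<bar>sin (pi * (a * x + b))\<bar> - log_const a b"
    unfolding sum_rpaired .
  then show ?thesis unfolding sums_def by (subst (asm) filterlim_sequentially_Suc)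
qed

text \<open>With A = a + b and t = a (x - 1) / (A - k) each factor is ln (1 + t). The linear parts
  for j and -j cancel up to 4 a |A| / j^2, and each quadratic remainder is at most 2 t^2, hence at
  most 8 a^2 / j^2. The threshold on \<open>j\<close> gives |t| \<le> 1/2 and |A - k| \<ge> j /
  2.\<close>

lemma rpaired_log_factor_bound:
  fixes j :: nat
  assumes a: "a > 0" and x: "x \<in> {0..1}" and j: "real j \<ge> 4 * a + 2 * \<bar>a + b\<bar> + 1"
  shows "\<bar>rpaired (\<lambda>k. log_factor a b k x) j\<bar> \<le> (16 * a\<^sup>2 + 4 * a * \<bar>a + b\<bar>) / (real j)\<^sup>2"
proof -
  define A where "A = a + b"
  define t where "t = (\<lambda>k::real. a * (x - 1) / (A - k))"
  have "0 < 4 * a + 2 * \<bar>a + b\<bar> + 1" using a by (intro add_pos_pos add_pos_nonneg) auto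
  then have j0: "real j > 0" using j by (rule order.strict_trans2)
  have Aj: "\<bar>A - k\<bar> \<ge> real j / 2" if "\<bar>k\<bar> = real j" for k
    using that j a unfolding A_def[symmetric] by linarith
  have tb: "\<bar>t k\<bar> \<le> 2 * a / real j" if "\<bar>k\<bar> = real j" for k
  proof -
    have "\<bar>t k\<bar> = a * \<bar>x - 1\<bar> / \<bar>A - k\<bar>" using a by (simp add: t_def abs_mult abs_divide)
    also have "\<dots> \<le> a * 1 / (real j / 2)"
      using a x Aj[OF that] j0 by (intro frac_le mult_left_mono) auto
    finally show ?thesis by (simp add: mult.commute)
  qed
  have "4 * a \<le> 4 * a + (2 * \<bar>a + b\<bar> + 1)" by simp
  also have "\<dots> \<le> real j" using j by (simp add: add.assoc)
  finally have half: "2 * a / real j \<le> 1 / 2" using j0 by (simp add: field_simps)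
  have lf: "log_factor a b k x = ln (1 + t (of_int k))" and lb: "\<bar>ln (1 + t (of_int k)) - t (of_int k)\<bar> \<le> 8 * a\<^sup>2 / (real j)\<^sup>2"
    if k: "\<bar>of_int k\<bar> = real j" for k
  proof -
    have nz: "A - of_int k \<noteq> 0" using Aj[OF k] j0 by auto
    have t12: "\<bar>t (of_int k)\<bar> \<le> 1 / 2" using tb[OF k] half by linarith
    have 1: "1 - (of_int k - b) / a = (A - of_int k) / a" using a by (simp add: A_def field_simps)
    have 2: "x - (of_int k - b) / a = (1 + t (of_int k)) * ((A - of_int k) / a)"
    proof -
      have "t (of_int k) * ((A - of_int k) / a) = x - 1" unfolding t_def using a nz by simp
      then have "(1 + t (of_int k)) * ((A - of_int k) / a) = (A - of_int k) / a + (x - 1)" by (simp only: distrib_right mult_1_left)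
      then show ?thesis unfolding 1[symmetric] by simp
    qed
    show "log_factor a b k x = ln (1 + t (of_int k))"
    proof -
      have t0: "1 + t (of_int k) > 0" using t12 by linarith
      have q: "\<bar>(A - of_int k) / a\<bar> > 0" using nz a by simp
      have "ln \<bar>(1 + t (of_int k)) * ((A - of_int k) / a)\<bar> = ln (1 + t (of_int k)) + ln \<bar>(A - of_int k) / a\<bar>"
        unfolding abs_mult abs_of_pos[OF t0] using t0 q by (rule ln_mult_pos)
      then show ?thesis unfolding log_factor_def 1 2 by simp
    qed
    have "\<bar>ln (1 + t (of_int k)) - t (of_int k)\<bar> \<le> 2 * (t (of_int k))\<^sup>2"
      using t12 by (intro abs_ln_one_plus_x_minus_x_bound) auto
    also have "(t (of_int k))\<^sup>2 \<le> (2 * a / real j)\<^sup>2"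
      using tb[OF k] by (metis abs_ge_zero power2_abs power_mono)
    finally show "\<bar>ln (1 + t (of_int k)) - t (of_int k)\<bar> \<le> 8 * a\<^sup>2 / (real j)\<^sup>2"
      by (simp add: power_divide power_mult_distrib)
  qed
  have tt: "\<bar>t (real j) + t (- real j)\<bar> \<le> 4 * a * \<bar>A\<bar> / (real j)\<^sup>2"
  proof -
    have nz: "A - real j \<noteq> 0" "A + real j \<noteq> 0" using Aj[of "real j"] Aj[of "- real j"] j0 by auto
    have "t (real j) + t (- real j) = 2 * a * A * (x - 1) / ((A - real j) * (A + real j))"
      unfolding t_def using nz by (simp add: field_simps)
    then have "\<bar>t (real j) + t (- real j)\<bar> = 2 * a * \<bar>A\<bar> * \<bar>x - 1\<bar> / (\<bar>A - real j\<bar> * \<bar>A + real j\<bar>)"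
      using a by (simp add: abs_mult abs_divide)
    also have "\<dots> \<le> 2 * a * \<bar>A\<bar> * 1 / (real j * real j / 2)"
    proof (intro frac_le mult_left_mono)
      have "(real j - \<bar>A\<bar>) * (real j + \<bar>A\<bar>) = \<bar>A - real j\<bar> * \<bar>A + real j\<bar>"
      proof -
        have "\<bar>A\<bar> < real j" using j a unfolding A_def[symmetric] by linarith
        then have "A - real j < 0" "A + real j > 0" by auto
        then show ?thesis by (simp add: algebra_simps)
      qed
      moreover have "\<bar>A\<bar> * \<bar>A\<bar> \<le> real j / 2 * (real j / 2)"
        using j a unfolding A_def[symmetric] by (intro mult_mono) auto
      moreover have "(real j - \<bar>A\<bar>) * (real j + \<bar>A\<bar>) = real j * real j - \<bar>A\<bar> * \<bar>A\<bar>" by (simp add: algebra_simps)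
      moreover have "real j / 2 * (real j / 2) = real j * real j / 4" by simp
      moreover have "real j * real j \<ge> 0" by simp
      ultimately show "real j * real j / 2 \<le> \<bar>A - real j\<bar> * \<bar>A + real j\<bar>" by linarith
    qed (use a x j0 in auto)
    finally show ?thesis by (simp add: power2_eq_square)
  qed
  have "rpaired (\<lambda>k. log_factor a b k x) j = ln (1 + t (real j)) + ln (1 + t (- real j))"
    using lf[of "int j"] lf[of "- int j"] j0 by (simp add: rpaired_def)
  moreover have "\<bar>ln (1 + t (real j)) + ln (1 + t (- real j))\<bar> \<le> 8 * a\<^sup>2 / (real j)\<^sup>2 + 8 * a\<^sup>2 / (real j)\<^sup>2 + 4 * a * \<bar>A\<bar> / (real j)\<^sup>2"
    using lb[of "int j"] lb[of "- int j"] tt by (simp add: abs_le_iff)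
  ultimately show ?thesis by (simp add: A_def add_divide_distrib[symmetric] algebra_simps)
qed

lemma finite_integer_crossings:
  assumes "(a::real) > 0"
  shows "finite {x \<in> {0..1}. a * x + b \<in> \<int>}"
proof (rule finite_subset)
  show "{x \<in> {0..1}. a * x + b \<in> \<int>} \<subseteq> (\<lambda>k. (of_int k - b) / a) ` {\<lfloor>b\<rfloor>..\<lceil>a + b\<rceil>}"
  proof
    fix x assume x: "x \<in> {x \<in> {0..1}. a * x + b \<in> \<int>}"
    then obtain k where k: "a * x + b = of_int k" by (auto elim!: Ints_cases)
    have "x = (of_int k - b) / a" using k assms by (simp add: field_simps)
    moreover have "0 \<le> a * x" "a * x \<le> a" using x assms by (auto simp: mult_left_le)
    then have "k \<in> {\<lfloor>b\<rfloor>..\<lceil>a + b\<rceil>}" using k by (auto simp: floor_le_iff le_ceiling_iff)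
    ultimately show "x \<in> (\<lambda>k. (of_int k - b) / a) ` {\<lfloor>b\<rfloor>..\<lceil>a + b\<rceil>}" by blast
  qed
qed simp

lemma log_factor_weight_integrable:
  fixes v :: "real \<Rightarrow> complex"
  assumes "continuous_on {0..1} v"
  shows "(\<lambda>x. of_real (log_factor a b k x) * v x) absolutely_integrable_on {0..1}"
proof -
  have "(\<lambda>x. of_real (ln \<bar>x - (of_int k - b) / a\<bar>) * v x - of_real (ln \<bar>1 - (of_int k - b) / a\<bar>) * v x) absolutely_integrable_on {0..1}"
    using assms by (intro set_integral_diff(1) ln_abs_weight_integrable absolutely_integrable_continuous_real continuous_intros)
  then show ?thesis by (simp add: log_factor_def algebra_simps)
qed

lemma rpaired_of_real_mult: "rpaired (\<lambda>k. of_real (f k) * c) j = of_real (rpaired f j) * (c::complex)"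
  by (simp add: rpaired_def algebra_simps)

text \<open>Dominated convergence for the paired sine product. The finitely many x at which a x + b
  is an integer are discarded, since the product formula for logarithms is available only off
  them.\<close>

lemma log_sin_integral:
  fixes v :: "real \<Rightarrow> complex" and b :: real
  assumes a: "a > 0" and v: "continuous_on {0..1} v" "\<And>x. x \<in> {0..1} \<Longrightarrow> norm (v x) \<le> 1"
  defines "I \<equiv> \<lambda>k. integral {0..1} (\<lambda>x. of_real (log_factor a b k x) * v x)"
  shows "summable (rpaired I)"
    "((\<lambda>x. of_real (ln \<bar>sin (pi * (a * x + b))\<bar> - log_const a b) * v x) has_integral (\<Sum>j. rpaired I j)) {0..1}"
proof -
  define Z where "Z = {x \<in> {0..1}. a * x + b \<in> \<int>}"
  have Z: "finite Z" unfolding Z_def using finite_integer_crossings[OF a] .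
  define f where "f = (\<lambda>j x. of_real (rpaired (\<lambda>k. log_factor a b k x) j) * v x)"
  have fint: "(f j has_integral rpaired I j) {0..1}" and fabs: "f j absolutely_integrable_on {0..1}" for j
  proof -
    have k: "((\<lambda>x. of_real (log_factor a b k x) * v x) has_integral I k) {0..1}"
      "(\<lambda>x. of_real (log_factor a b k x) * v x) absolutely_integrable_on {0..1}" for k
      unfolding I_def using log_factor_weight_integrable[OF v(1), of a b k]
      by (auto simp: set_lebesgue_integral_eq_integral(1) intro!: integrable_integral)
    have f: "f j = (\<lambda>x. rpaired (\<lambda>k. of_real (log_factor a b k x) * v x) j)"
      unfolding f_def rpaired_of_real_mult ..
    show "(f j has_integral rpaired I j) {0..1}"
      unfolding f rpaired_def by (cases "j = 0") (auto intro!: has_integral_add k)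
    show "f j absolutely_integrable_on {0..1}"
      unfolding f rpaired_def by (cases "j = 0") (auto intro!: set_integral_add(1) k)
  qed
  define J where "J = nat \<lceil>4 * a + 2 * \<bar>a + b\<bar> + 1\<rceil>"
  have J: "real j \<ge> 4 * a + 2 * \<bar>a + b\<bar> + 1" if "j \<ge> J" for j
    using that unfolding J_def by linarith
  define K where "K = 16 * a\<^sup>2 + 4 * a * \<bar>a + b\<bar>"
  have K0: "K \<ge> 0" using a by (simp add: K_def)
  have fb: "norm (f j x) \<le> K / (real j)\<^sup>2" if "j \<ge> J" "x \<in> {0..1}" for j x
  proof -
    have "norm (f j x) = \<bar>rpaired (\<lambda>k. log_factor a b k x) j\<bar> * norm (v x)" by (simp add: f_def norm_mult)
    also have "\<dots> \<le> K / (real j)\<^sup>2 * 1"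
      unfolding K_def using rpaired_log_factor_bound[OF a that(2) J[OF that(1)]] v(2)[OF that(2)] by (intro mult_mono) auto
    finally show ?thesis by simp
  qed
  have sK: "summable (\<lambda>j. K / (real j)\<^sup>2)"
    using inverse_power_summable[of 2, where ?'a = real] by (simp add: divide_inverse summable_mult)
  have "norm (rpaired I j) \<le> K / (real j)\<^sup>2" if "j \<ge> J" for j
    using has_integral_bound_real[OF _ _ fint[of j], of "K / (real j)\<^sup>2" "{}"] fb[OF that] K0 by auto
  then show sI: "summable (rpaired I)"
    using sK by (intro summable_comparison_test[OF _ sK]) blast
  \<comment> \<open>The first \<open>J\<close> summands may have logarithmic singularities and are
    dominated by their own moduli; all later ones are dominated by a convergent series of
    constants.\<close>
  define h where "h = (\<lambda>x. (\<Sum>j<J. norm (f j x)) + (\<Sum>j. K / (real j)\<^sup>2))"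
  have hint: "h integrable_on {0..1}"
    unfolding h_def using fabs
    by (intro integrable_add integrable_sum integrable_const_ivl) (auto simp: absolutely_integrable_on_def)
  define F where "F = (\<lambda>N x. \<Sum>j<N. f j x)"
  have Fb: "norm (F N x) \<le> h x" if x: "x \<in> {0..1}" for N x
  proof -
    have "norm (F N x) \<le> (\<Sum>j<N. norm (f j x))" unfolding F_def by (rule norm_sum)
    also have "\<dots> \<le> (\<Sum>j<N. (if j < J then norm (f j x) else 0) + K / (real j)\<^sup>2)"
      using fb[OF _ x] K0 by (intro sum_mono) (auto simp: not_less)
    also have "\<dots> = (\<Sum>j<N. (if j < J then norm (f j x) else 0)) + (\<Sum>j<N. K / (real j)\<^sup>2)" by (rule sum.distrib)
    also have "(\<Sum>j<N. (if j < J then norm (f j x) else 0)) = (\<Sum>j\<in>{..<N} \<inter> {..<J}. norm (f j x))"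
      by (simp add: sum.inter_restrict)
    also have "\<dots> \<le> (\<Sum>j<J. norm (f j x))" by (intro sum_mono2) auto
    also have "(\<Sum>j<N. K / (real j)\<^sup>2) \<le> (\<Sum>j. K / (real j)\<^sup>2)"
      using sK K0 by (intro sum_le_suminf) auto
    finally show ?thesis by (simp add: h_def)
  qed
  have "((\<lambda>x. of_real (ln \<bar>sin (pi * (a * x + b))\<bar> - log_const a b) * v x) has_integral (\<Sum>j. rpaired I j)) ({0..1} - Z)"
  proof (rule has_integral_dominated_convergence)
    show "(F N has_integral (\<Sum>j<N. rpaired I j)) ({0..1} - Z)" for N
      unfolding has_integral_Diff_finite[OF Z] F_def by (intro has_integral_sum fint) auto
    show "h integrable_on {0..1} - Z"
      using hint unfolding integrable_on_def has_integral_Diff_finite[OF Z] .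
    show "\<forall>x\<in>{0..1} - Z. norm (F N x) \<le> h x" for N using Fb by auto
    show "\<forall>x\<in>{0..1} - Z. (\<lambda>N. F N x) \<longlonglongrightarrow> of_real (ln \<bar>sin (pi * (a * x + b))\<bar> - log_const a b) * v x"
    proof
      fix x assume "x \<in> {0..1} - Z"
      then have "a * x + b \<notin> \<int>" by (auto simp: Z_def)
      from log_factor_sums[OF a this]
      have "(\<lambda>j. of_real (rpaired (\<lambda>k. log_factor a b k x) j) * v x) sums (of_real (ln \<bar>sin (pi * (a * x + b))\<bar> - log_const a b) * v x)"
        by (intro sums_mult2 sums_of_real)
      then show "(\<lambda>N. F N x) \<longlonglongrightarrow> of_real (ln \<bar>sin (pi * (a * x + b))\<bar> - log_const a b) * v x"
        unfolding F_def f_def sums_def .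
    qed
    show "(\<lambda>N. \<Sum>j<N. rpaired I j) \<longlonglongrightarrow> (\<Sum>j. rpaired I j)"
      using sI by (rule summable_LIMSEQ)
  qed
  then show "((\<lambda>x. of_real (ln \<bar>sin (pi * (a * x + b))\<bar> - log_const a b) * v x) has_integral (\<Sum>j. rpaired I j)) {0..1}"
    unfolding has_integral_Diff_finite[OF Z] .
qed

section \<open>The Fourier series of the logarithm\<close>

text \<open>For y not an integer this is the sum of exp (2 pi \<i> k y) / k over k \<ge> 1, with
  real part -ln |2 sin (pi y)| and imaginary part pi (1/2 - frac y).\<close>

definition log_kernel :: "real \<Rightarrow> complex" where
  "log_kernel y = - Ln (1 - exp (2 * of_real pi * \<i> * of_real y))"

lemma log_kernel_continuous:
  assumes "Re s < -1"
  shows "continuous_on {0..1} (\<lambda>x. complex_of_real x powr (- s - 1))"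
    "x \<in> {0..1} \<Longrightarrow> norm (complex_of_real x powr (- s - 1)) \<le> 1"
  using assms by (auto intro!: powr_continuous_unit powr_le1 simp: norm_powr_real_powr)

text \<open>The square of the modulus is (1 - r)^2 + 4 r sin^2 (pi y). The lower bound obtained from
  it is free of \<open>r\<close>, so a single integrable logarithm dominates all Abel means.\<close>

lemma norm_one_minus_rexp:
  fixes r y :: real
  assumes r: "0 \<le> r" "r \<le> 1"
  defines "z \<equiv> 1 - of_real r * exp (2 * of_real pi * \<i> * of_real y)"
  shows "\<bar>sin (pi * y)\<bar> \<le> norm z" "norm z \<le> 2" "r = 1 \<Longrightarrow> norm z = 2 * \<bar>sin (pi * y)\<bar>"
proof -
  define S where "S = (sin (pi * y))\<^sup>2"
  have S: "0 \<le> S" "S \<le> 1" by (auto simp: S_def abs_square_le_1)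
  have e: "exp (2 * of_real pi * \<i> * of_real y) = cis (2 * (pi * y))" by (simp add: cis_conv_exp mult_ac)
  have cos2: "cos (2 * (pi * y)) = 1 - 2 * S" unfolding S_def by (rule cos_double_sin)
  have gen: "(1 - r * c)\<^sup>2 + (r * t)\<^sup>2 = 1 - 2 * r * c + r\<^sup>2 * (c\<^sup>2 + t\<^sup>2)" for c t :: real
    by (simp add: power2_eq_square algebra_simps)
  have "(norm z)\<^sup>2 = (1 - r * cos (2 * (pi * y)))\<^sup>2 + (r * sin (2 * (pi * y)))\<^sup>2"
    unfolding z_def e by (simp add: cmod_power2)
  also have "\<dots> = 1 - 2 * r * cos (2 * (pi * y)) + r\<^sup>2 * ((cos (2 * (pi * y)))\<^sup>2 + (sin (2 * (pi * y)))\<^sup>2)"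
    by (rule gen)
  also have "(cos (2 * (pi * y)))\<^sup>2 + (sin (2 * (pi * y)))\<^sup>2 = 1" by simp
  also have "1 - 2 * r * cos (2 * (pi * y)) + r\<^sup>2 * 1 = (1 - r)\<^sup>2 + 4 * r * S" unfolding cos2
    by (simp add: power2_eq_square algebra_simps)
  finally have nz: "(norm z)\<^sup>2 = (1 - r)\<^sup>2 + 4 * r * S" .
  \<comment> \<open>The difference is rearranged into two parts that are visibly nonnegative when
    \<open>r\<close> and \<open>S\<close> lie in the unit interval.\<close>
  have "(1 - r)\<^sup>2 + 4 * r * S - S = (1 - S) * (1 - r)\<^sup>2 + S * (r * (2 + r))"
    by (simp add: power2_eq_square algebra_simps)
  also have "\<dots> \<ge> 0" using S r by simp
  finally have "S \<le> (norm z)\<^sup>2" using nz by simp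
  then have "\<bar>sin (pi * y)\<bar>\<^sup>2 \<le> (norm z)\<^sup>2" unfolding S_def by simp
  then show "\<bar>sin (pi * y)\<bar> \<le> norm z" by (rule power2_le_imp_le) simp
  have "norm z \<le> norm (1 :: complex) + norm (of_real r * exp (2 * of_real pi * \<i> * of_real y))" unfolding z_def by (rule norm_triangle_ineq4)
  then show "norm z \<le> 2" using r unfolding e by (simp add: norm_mult)
  show "norm z = 2 * \<bar>sin (pi * y)\<bar>" if "r = 1"
  proof -
    have "(norm z)\<^sup>2 = (2 * \<bar>sin (pi * y)\<bar>)\<^sup>2" unfolding nz that S_def by (simp add: power_mult_distrib)
    then show ?thesis by (rule power2_eq_imp_eq) auto
  qed
qed

lemma Re_one_minus_rexp:
  fixes r y :: real
  assumes r: "0 \<le> r" "r \<le> 1" and y: "y \<notin> \<int>"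
  shows "Re (1 - of_real r * exp (2 * of_real pi * \<i> * of_real y)) > 0"
proof -
  have e: "exp (2 * of_real pi * \<i> * of_real y) = cis (2 * (pi * y))" by (simp add: cis_conv_exp mult_ac)
  have "sin (pi * y) \<noteq> 0" using y by (auto simp: sin_zero_iff_int2)
  then have c: "cos (2 * (pi * y)) < 1" unfolding cos_double_sin by simp
  have "r * cos (2 * (pi * y)) < 1"
  proof (cases "cos (2 * (pi * y)) \<le> 0")
    case True
    then have "r * cos (2 * (pi * y)) \<le> 0" using r by (simp add: mult_nonneg_nonpos)
    then show ?thesis by simp
  next
    case False
    then have "r * cos (2 * (pi * y)) \<le> 1 * cos (2 * (pi * y))" using r by (intro mult_right_mono) auto
    then show ?thesis using c by simp
  qed
  then show ?thesis unfolding e by simp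
qed

lemma norm_Ln_le: "z \<noteq> 0 \<Longrightarrow> norm (Ln z) \<le> \<bar>ln (norm z)\<bar> + pi"
proof -
  assume z: "z \<noteq> 0"
  have "norm (Ln z) \<le> \<bar>Re (Ln z)\<bar> + \<bar>Im (Ln z)\<bar>" by (rule cmod_le)
  also have "\<bar>Im (Ln z)\<bar> \<le> pi" using mpi_less_Im_Ln[OF z] Im_Ln_le_pi[OF z] by linarith
  finally show ?thesis using z by simp
qed

lemma log_sin_integrable:
  assumes "a > 0"
  shows "(\<lambda>x. ln \<bar>sin (pi * (a * x + b))\<bar>) integrable_on {0..1}"
proof -
  have "((\<lambda>x. of_real (ln \<bar>sin (pi * (a * x + b))\<bar> - log_const a b) * (1::complex)) integrable_on {0..1})"
    using log_sin_integral(2)[OF assms, of "\<lambda>_. 1" b] by (auto simp: integrable_on_def)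
  from integrable_linear[OF this bounded_linear_Re]
  have "(\<lambda>x. ln \<bar>sin (pi * (a * x + b))\<bar> - log_const a b) integrable_on {0..1}" by (simp add: o_def)
  then have "(\<lambda>x. (ln \<bar>sin (pi * (a * x + b))\<bar> - log_const a b) + log_const a b) integrable_on {0..1}"
    by (intro integrable_add) (auto simp: integrable_const_ivl)
  then show ?thesis by simp
qed

lemma log_sin_integrable':
  assumes "a \<noteq> 0"
  shows "(\<lambda>x. ln \<bar>sin (pi * (a * x + b))\<bar>) integrable_on {0..1}"
proof (cases "a > 0")
  case False
  then have "(\<lambda>x. ln \<bar>sin (pi * (- a * x + - b))\<bar>) integrable_on {0..1}"
    using assms by (intro log_sin_integrable) auto
  moreover have "\<bar>sin (pi * (- a * x + - b))\<bar> = \<bar>sin (pi * (a * x + b))\<bar>" for x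
    using sin_minus[of "pi * (a * x + b)"] by (simp add: algebra_simps)
  ultimately show ?thesis by simp
qed (simp add: log_sin_integrable)

lemma finite_integer_crossings':
  assumes "(a::real) \<noteq> 0"
  shows "finite {x \<in> {0..1}. a * x + b \<in> \<int>}"
proof (cases "a > 0")
  case False
  have "finite {x \<in> {0..1}. - a * x + - b \<in> \<int>}" using assms False by (intro finite_integer_crossings) auto
  moreover have "(- a * x + - b \<in> \<int>) = (a * x + b \<in> \<int>)" for x
    using minus_in_Ints_iff[of "a * x + b"] by simp
  ultimately show ?thesis by simp
next
  case True
  then show ?thesis by (rule finite_integer_crossings)
qed

lemma log_kernel_Abel_sums:
  fixes a b :: real
  assumes a: "a \<noteq> 0" and s: "Re s < -1"
  defines "c \<equiv> \<lambda>k. integral {0..1} (\<lambda>x. exp (2 * of_real pi * \<i> * of_real (a * x + b)) ^ k * of_real x powr (- s - 1))"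
  assumes summ: "summable (\<lambda>k. norm (c k / of_nat k))"
  shows "((\<lambda>x. log_kernel (a * x + b) * of_real x powr (- s - 1)) has_integral (\<Sum>k. c k / of_nat k)) {0..1}"
proof -
  define e where "e = (\<lambda>x. exp (2 * of_real pi * \<i> * complex_of_real (a * x + b)))"
  define v where "v = (\<lambda>x. complex_of_real x powr (- s - 1))"
  have ne: "norm (e x) = 1" for x by (simp add: e_def)
  have vc: "continuous_on {0..1} v" and vn: "\<And>x. x \<in> {0..1} \<Longrightarrow> norm (v x) \<le> 1"
    unfolding v_def using log_kernel_continuous[OF s] by auto
  have ec: "continuous_on {0..1} e" unfolding e_def by (intro continuous_intros)
  have ci: "((\<lambda>x. e x ^ k * v x) has_integral c k) {0..1}" for k
  proof -
    have "c k = integral {0..1} (\<lambda>x. e x ^ k * v x)" by (simp add: c_def e_def v_def)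
    then show ?thesis
    by (simp only:) (intro integrable_integral integrable_continuous_real continuous_intros vc ec)
  qed
  define r where "r = (\<lambda>n. 1 - 1 / real (n + 2))"
  have r: "0 \<le> r n" "r n < 1" for n by (auto simp: r_def field_simps)
  have rlim: "r \<longlonglongrightarrow> 1" unfolding r_def by real_asymp
  define G where "G = (\<lambda>n x. - Ln (1 - of_real (r n) * e x) * v x)"
  have nc: "norm (c k) \<le> 1" for k
    using has_integral_bound_real[OF _ _ ci[of k], of 1 "{}"] vn by (auto simp: norm_mult norm_power ne)
  \<comment> \<open>The summand with \<open>k = 0\<close> vanishes because division by zero yields
    0, so the series may start there.\<close>
  have rs: "summable (\<lambda>k. of_real (r n) ^ k * (c k / of_nat k))" for n
  proof (rule summable_comparison_test[OF exI[of _ 0]], intro allI impI)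
    show "summable (\<lambda>k. r n ^ k)" using r by (intro summable_geometric) auto
    fix k :: nat
    have "norm (c k / of_nat k) \<le> 1"
    proof (cases "k = 0")
      case False
      then have "norm (c k) \<le> real k" using nc[of k] by (metis One_nat_def Suc_leI le_trans neq0_conv of_nat_1 of_nat_le_iff order_trans)
      then show ?thesis using False by (simp add: norm_divide)
    qed simp
    then have "r n ^ k * norm (c k / of_nat k) \<le> r n ^ k * 1" using r(1)[of n] by (intro mult_left_mono) auto
    then show "norm (of_real (r n) ^ k * (c k / of_nat k)) \<le> r n ^ k"
      using r(1)[of n] by (simp only: norm_mult norm_power norm_of_real abs_of_nonneg mult_1_right)
  qed
  have Gint: "(G n has_integral (\<Sum>k. of_real (r n) ^ k * (c k / of_nat k))) {0..1}" for n
  proof (rule has_integral_dominated_convergence)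
    show "((\<lambda>x. \<Sum>k<N. of_real (r n) ^ k / of_nat k * (e x ^ k * v x)) has_integral (\<Sum>k<N. of_real (r n) ^ k / of_nat k * c k)) {0..1}" for N
      by (intro has_integral_sum has_integral_mult_right ci) auto
    show "(\<lambda>x::real. 1 / (1 - r n)) integrable_on {0..1}" by (rule integrable_const_ivl)
    show "\<forall>x\<in>{0..1}. norm (\<Sum>k<N. of_real (r n) ^ k / of_nat k * (e x ^ k * v x)) \<le> 1 / (1 - r n)" for N
    proof
      fix x :: real assume x: "x \<in> {0..1}"
      have "norm (\<Sum>k<N. of_real (r n) ^ k / of_nat k * (e x ^ k * v x)) \<le> (\<Sum>k<N. r n ^ k)"
      proof (rule sum_norm_le)
        fix k
        have "norm (of_real (r n) ^ k / of_nat k * (e x ^ k * v x)) = r n ^ k * (norm (v x) / real k)"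
          using r(1)[of n] by (simp add: norm_mult norm_divide norm_power ne)
        also have "\<dots> \<le> r n ^ k * 1"
        proof (intro mult_left_mono)
          show "norm (v x) / real k \<le> 1"
            using vn[OF x] by (cases "k = 0") (auto simp: divide_le_eq intro: order_trans)
        qed (use r in auto)
        finally show "norm (of_real (r n) ^ k / of_nat k * (e x ^ k * v x)) \<le> r n ^ k" by simp
      qed
      also have "\<dots> \<le> (\<Sum>k. r n ^ k)" using r[of n] by (intro sum_le_suminf summable_geometric) auto
      also have "\<dots> = 1 / (1 - r n)" using r[of n] by (intro suminf_geometric) auto
      finally show "norm (\<Sum>k<N. of_real (r n) ^ k / of_nat k * (e x ^ k * v x)) \<le> 1 / (1 - r n)" .
    qed
    show "\<forall>x\<in>{0..1}. (\<lambda>N. \<Sum>k<N. of_real (r n) ^ k / of_nat k * (e x ^ k * v x)) \<longlonglongrightarrow> G n x"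
    proof
      fix x :: real
      have "norm (- (of_real (r n) * e x)) < 1" using r[of n] by (simp add: norm_mult ne)
      from Ln_series[OF this]
      have "(\<lambda>k. (-1) ^ Suc k / of_nat k * (- (of_real (r n) * e x)) ^ k) sums Ln (1 - of_real (r n) * e x)" by simp
      then have "(\<lambda>k. - ((-1) ^ Suc k / of_nat k * (- (of_real (r n) * e x)) ^ k) * v x) sums (- Ln (1 - of_real (r n) * e x) * v x)"
        by (intro sums_mult2 sums_minus)
      moreover have "- ((-1) ^ Suc k / of_nat k * (- (of_real (r n) * e x)) ^ k) * v x = of_real (r n) ^ k / of_nat k * (e x ^ k * v x)" for k
      proof -
        have "(- (of_real (r n) * e x)) ^ k = (-1) ^ k * (of_real (r n) ^ k * e x ^ k)"
          by (metis mult_minus1 power_mult_distrib)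
        moreover have "(-1) ^ k * (-1) ^ k = (1::complex)" by (simp flip: power_add)
        ultimately show ?thesis by (simp add: mult_ac)
      qed
      ultimately show "(\<lambda>N. \<Sum>k<N. of_real (r n) ^ k / of_nat k * (e x ^ k * v x)) \<longlonglongrightarrow> G n x"
        by (simp only: sums_def G_def)
    qed
    show "(\<lambda>N. \<Sum>k<N. of_real (r n) ^ k / of_nat k * c k) \<longlonglongrightarrow> (\<Sum>k. of_real (r n) ^ k * (c k / of_nat k))"
      using summable_LIMSEQ[OF rs[of n]] by simp
  qed
  define Z where "Z = {x \<in> {0..1}. a * x + b \<in> \<int>}"
  have Z: "finite Z" unfolding Z_def using finite_integer_crossings'[OF a] .
  have "((\<lambda>x. log_kernel (a * x + b) * v x) has_integral (\<Sum>k. c k / of_nat k)) ({0..1} - Z)"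
  proof (rule has_integral_dominated_convergence)
    show "(G n has_integral (\<Sum>k. of_real (r n) ^ k * (c k / of_nat k))) ({0..1} - Z)" for n
      using Gint unfolding has_integral_Diff_finite[OF Z] .
    \<comment> \<open>The modulus of the argument of the logarithm lies between |sin (pi (a x + b))|
      and 2, and the imaginary part of the logarithm is at most pi.\<close>
    define h where "h = (\<lambda>x. ln 2 - ln \<bar>sin (pi * (a * x + b))\<bar> + pi)"
    have "h integrable_on {0..1}"
      unfolding h_def by (intro integrable_add integrable_diff integrable_const_ivl log_sin_integrable'[OF a])
    then show "h integrable_on {0..1} - Z"
      unfolding integrable_on_def has_integral_Diff_finite[OF Z] .
    show "\<forall>x\<in>{0..1} - Z. norm (G n x) \<le> h x" for n
    proof
      fix x assume x: "x \<in> {0..1} - Z"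
      define z where "z = 1 - of_real (r n) * e x"
      have y: "a * x + b \<notin> \<int>" using x by (auto simp: Z_def)
      have Sp: "\<bar>sin (pi * (a * x + b))\<bar> > 0" using y by (auto simp: sin_zero_iff_int2)
      have zl: "\<bar>sin (pi * (a * x + b))\<bar> \<le> norm z" and zu: "norm z \<le> 2"
        using norm_one_minus_rexp[of "r n" "a * x + b"] r[of n] by (auto simp: z_def e_def)
      have "ln \<bar>sin (pi * (a * x + b))\<bar> \<le> ln (norm z)"
        by (rule iffD2[OF ln_le_cancel_iff[OF Sp order.strict_trans2[OF Sp zl]] zl])
      moreover have "ln (norm z) \<le> ln 2"
        by (rule iffD2[OF ln_le_cancel_iff[OF order.strict_trans2[OF Sp zl]] zu]) simp
      moreover have "ln \<bar>sin (pi * (a * x + b))\<bar> \<le> 0" using Sp by (simp add: ln_le_zero_iff)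
      moreover have "ln 2 \<ge> (0::real)" by simp
      ultimately have "\<bar>ln (norm z)\<bar> \<le> ln 2 - ln \<bar>sin (pi * (a * x + b))\<bar>" by linarith
      moreover have "norm (Ln z) \<le> \<bar>ln (norm z)\<bar> + pi" using zl Sp by (intro norm_Ln_le) auto
      ultimately have "norm (Ln z) \<le> h x" by (simp add: h_def)
      moreover have "norm (Ln z) * norm (v x) \<le> norm (Ln z) * 1" using vn x by (intro mult_left_mono) auto
      ultimately show "norm (G n x) \<le> h x" by (simp add: G_def z_def norm_mult)
    qed
    show "\<forall>x\<in>{0..1} - Z. (\<lambda>n. G n x) \<longlonglongrightarrow> log_kernel (a * x + b) * v x"
    proof
      fix x assume x: "x \<in> {0..1} - Z"
      have y: "a * x + b \<notin> \<int>" using x by (auto simp: Z_def)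
      have "(\<lambda>n. 1 - of_real (r n) * e x) \<longlonglongrightarrow> 1 - of_real 1 * e x" by (intro tendsto_intros rlim)
      moreover have "1 - of_real 1 * e x \<notin> \<real>\<^sub>\<le>\<^sub>0"
        using Re_one_minus_rexp[of 1, OF _ _ y] unfolding e_def by (auto simp: complex_nonpos_Reals_iff)
      ultimately have "(\<lambda>n. - Ln (1 - of_real (r n) * e x) * v x) \<longlonglongrightarrow> - Ln (1 - of_real 1 * e x) * v x"
        by (intro tendsto_mult tendsto_minus tendsto_Ln tendsto_const)
      then show "(\<lambda>n. G n x) \<longlonglongrightarrow> log_kernel (a * x + b) * v x" by (simp add: G_def log_kernel_def e_def)
    qed
    have "(\<lambda>n. \<Sum>k. of_real (r n) ^ k * (c k / of_nat k)) \<longlonglongrightarrow> (\<Sum>k. c k / of_nat k)"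
    proof -
      have "eventually (\<lambda>n. summable (\<lambda>k. norm (of_real (r n) ^ k * (c k / of_nat k)))) sequentially \<and>
           summable (\<lambda>n. norm (c n / of_nat n)) \<and>
           ((\<lambda>n. suminf (\<lambda>k. of_real (r n) ^ k * (c k / of_nat k))) \<longlonglongrightarrow> suminf (\<lambda>k. c k / of_nat k))"
      proof (rule tannerys_theorem[OF _ _ summ])
        show "(\<lambda>n. of_real (r n) ^ k * (c k / of_nat k)) \<longlonglongrightarrow> c k / of_nat k" for k
        proof -
          have "(\<lambda>n. of_real (r n) ^ k * (c k / of_nat k)) \<longlonglongrightarrow> of_real 1 ^ k * (c k / of_nat k)"
            by (intro tendsto_intros rlim)
          then show ?thesis by simp
        qed
        have "norm (of_real (r n) ^ k * (c k / of_nat k)) \<le> norm (c k / of_nat k)" for k n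
        proof -
          have "r n ^ k * norm (c k / of_nat k) \<le> 1 * norm (c k / of_nat k)"
            using r[of n] by (intro mult_right_mono power_le_one) auto
          then show ?thesis using r(1)[of n] by (simp only: norm_mult norm_power norm_of_real abs_of_nonneg mult_1_left)
        qed
        then show "\<forall>\<^sub>F (k, n) in at_top \<times>\<^sub>F sequentially. norm (of_real (r n) ^ k * (c k / of_nat k)) \<le> norm (c k / of_nat k)"
          by (intro always_eventually) auto
      qed simp
      then show ?thesis by blast
    qed
    then show "(\<lambda>n. \<Sum>k. of_real (r n) ^ k * (c k / of_nat k)) \<longlonglongrightarrow> (\<Sum>k. c k / of_nat k)" .
  qed
  then show ?thesis unfolding has_integral_Diff_finite[OF Z] v_def .
qed

text \<open>Negating y conjugates the kernel. With f the fractional part of y, 1 - exp (2 pi \<i> f)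
  = 2 sin (pi f) exp (\<i> (pi f - pi / 2)), and the angle lies in the principal range, so modulus
  and argument can be read off.\<close>

lemma log_kernel_plus_minus:
  assumes "y \<notin> \<int>"
  shows "log_kernel y + log_kernel (- y) = - of_real (2 * (ln 2 + ln \<bar>sin (pi * y)\<bar>))"
    "log_kernel y - log_kernel (- y) = 2 * \<i> * of_real (pi * (1/2 - frac y))"
proof -
  define z where "z = 1 - exp (2 * of_real pi * \<i> * of_real y)"
  have Rz: "Re z > 0" using Re_one_minus_rexp[of 1 y] assms by (simp add: z_def)
  then have z0: "z \<noteq> 0" by auto
  have Sp: "\<bar>sin (pi * y)\<bar> > 0" using assms by (auto simp: sin_zero_iff_int2)
  have "1 - exp (2 * of_real pi * \<i> * of_real (- y)) = cnj z" by (simp add: z_def exp_cnj)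
  then have m: "log_kernel (- y) = - cnj (Ln z)" "log_kernel y = - Ln z"
    using cnj_Ln[of z] Rz by (auto simp: log_kernel_def z_def[symmetric] complex_nonpos_Reals_iff)
  have "norm z = 2 * \<bar>sin (pi * y)\<bar>" using norm_one_minus_rexp(3)[of 1 y] by (simp add: z_def)
  then have R: "Re (Ln z) = ln 2 + ln \<bar>sin (pi * y)\<bar>" using z0 Sp by (simp add: ln_mult)
  show "log_kernel y + log_kernel (- y) = - of_real (2 * (ln 2 + ln \<bar>sin (pi * y)\<bar>))"
    unfolding m R[symmetric] by (simp add: complex_eq_iff)
  define f where "f = frac y"
  have f: "0 < f" "f < 1" using assms frac_ge_0[of y] frac_lt_1[of y] frac_eq_0_iff[of y] by (auto simp: f_def less_le)
  have "y = f + of_int \<lfloor>y\<rfloor>" by (simp add: f_def frac_def)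
  then have "exp (2 * of_real pi * \<i> * of_real y) = exp (2 * of_real pi * \<i> * of_real f) * exp (of_int \<lfloor>y\<rfloor> * (2 * of_real pi * \<i>))"
    by (metis (no_types, lifting) distrib_left exp_add mult.commute of_real_add of_real_of_int_eq)
  also have "exp (of_int \<lfloor>y\<rfloor> * (2 * of_real pi * \<i>)) = 1" using exp_integer_2pi[of "of_int \<lfloor>y\<rfloor>"] by (simp add: mult_ac)
  finally have ey: "exp (2 * of_real pi * \<i> * of_real y) = exp (2 * of_real pi * \<i> * of_real f)" by simp
  have "exp (of_real (ln (2 * sin (pi * f))) + \<i> * of_real (pi * f - pi / 2)) = z"
  proof -
    have sp: "sin (pi * f) > 0" using f by (intro sin_gt_zero) auto
    have "exp (of_real (ln (2 * sin (pi * f))) + \<i> * of_real (pi * f - pi / 2)) = of_real (2 * sin (pi * f)) * cis (pi * f - pi / 2)"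
      using sp by (simp add: exp_add exp_of_real cis_conv_exp)
    also have "\<dots> = z"
    proof -
      have e: "exp (2 * of_real pi * \<i> * of_real f) = cis (2 * (pi * f))" by (simp add: cis_conv_exp mult_ac)
      have "cos (2 * (pi * f)) = 1 - 2 * (sin (pi * f))\<^sup>2" "sin (2 * (pi * f)) = 2 * sin (pi * f) * cos (pi * f)"
        by (rule cos_double_sin, rule sin_double)
      then show ?thesis unfolding z_def ey e
        by (simp add: complex_eq_iff cos_diff sin_diff power2_eq_square)
    qed
    finally show ?thesis .
  qed
  moreover have "Ln (exp (of_real (ln (2 * sin (pi * f))) + \<i> * of_real (pi * f - pi / 2))) = of_real (ln (2 * sin (pi * f))) + \<i> * of_real (pi * f - pi / 2)"
  proof (rule Ln_exp)
    have "0 < pi * f" "pi * f < pi" using f by auto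
    moreover have "Im (of_real (ln (2 * sin (pi * f))) + \<i> * of_real (pi * f - pi / 2)) = pi * f - pi / 2" by simp
    ultimately show "- pi < Im (of_real (ln (2 * sin (pi * f))) + \<i> * of_real (pi * f - pi / 2))"
      "Im (of_real (ln (2 * sin (pi * f))) + \<i> * of_real (pi * f - pi / 2)) \<le> pi" using pi_gt_zero by linarith+
  qed
  ultimately have "Im (Ln z) = pi * f - pi / 2" by (metis (no_types, lifting) Im_complex_of_real Im_i_times Re_complex_of_real add.left_neutral plus_complex.simps(2))
  then show "log_kernel y - log_kernel (- y) = 2 * \<i> * of_real (pi * (1/2 - frac y))"
    unfolding m f_def[symmetric] by (simp add: complex_eq_iff algebra_simps)
qed

section \<open>The hypergeometric function on the slit\<close>

definition slit_plane :: "complex set" where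
  "slit_plane = {z. \<not> (Im z = 0 \<and> 1 \<le> Re z)}"

text \<open>Euler's integral for the Gauss function with parameters 1, u + 1; u + 2, up to the
  factor u + 1. On the unit disc it is the sum of z^m / (m + u + 1).\<close>

definition geometric_moment :: "complex \<Rightarrow> complex \<Rightarrow> complex" where
  "geometric_moment z u = integral {0..1} (\<lambda>x. of_real x powr u / (1 - z * of_real x))"

lemma slit_planeD:
  assumes "z \<in> slit_plane" "x \<in> {0..1}"
  shows "1 - z * of_real x \<notin> \<real>\<^sub>\<le>\<^sub>0" "1 - z * of_real x \<noteq> 0"
proof -
  show "1 - z * of_real x \<notin> \<real>\<^sub>\<le>\<^sub>0"
  proof
    assume *: "1 - z * of_real x \<in> \<real>\<^sub>\<le>\<^sub>0"
    then have 1: "1 - Re z * x \<le> 0" "Im z * x = 0" by (auto simp: complex_nonpos_Reals_iff)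
    then have x: "x > 0" using assms(2) by (cases "x = 0") auto
    have "1 \<le> Re z"
    proof (rule ccontr)
      assume "\<not> 1 \<le> Re z"
      then have "Re z * x < 1 * x" using x by (intro mult_strict_right_mono) auto
      then show False using 1 assms(2) by auto
    qed
    then show False using 1(2) x assms(1) by (auto simp: slit_plane_def)
  qed
  then show "1 - z * of_real x \<noteq> 0" by auto
qed

lemma open_slit_plane: "open slit_plane"
proof -
  have "slit_plane = (\<lambda>z. 1 - z) -` (- \<real>\<^sub>\<le>\<^sub>0)"
    by (auto simp: slit_plane_def complex_nonpos_Reals_iff)
  moreover have "open ((\<lambda>z::complex. 1 - z) -` (- \<real>\<^sub>\<le>\<^sub>0))"
    by (intro open_vimage continuous_intros) (simp add: open_Compl)
  ultimately show ?thesis by simp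
qed

lemma connected_slit_plane: "connected slit_plane"
proof (rule starlike_imp_connected)
  show "starlike slit_plane"
    unfolding starlike_def
  proof (intro bexI[of _ 0] ballI subsetI)
    fix z y assume z: "z \<in> slit_plane" and y: "y \<in> closed_segment 0 z"
    then obtain u where u: "u \<in> {0..1}" "y = z * of_real u"
      by (auto simp: closed_segment_def scaleR_conv_of_real mult.commute)
    have "1 - y \<notin> \<real>\<^sub>\<le>\<^sub>0" using slit_planeD(1)[OF z u(1)] u(2) by simp
    then show "y \<in> slit_plane" by (auto simp: slit_plane_def complex_nonpos_Reals_iff)
  qed (simp add: slit_plane_def)
qed

lemma geometric_moment_integrable:
  assumes "z \<in> slit_plane" "Re u > 0"
  shows "(\<lambda>x. of_real x powr u / (1 - z * of_real x)) integrable_on {0..1}"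
  using slit_planeD[OF assms(1)] assms(2)
  by (intro integrable_continuous_real continuous_on_divide powr_continuous_unit continuous_intros) auto

text \<open>By compactness |1 - z x| has a positive minimum on the interval; moving \<open>z\<close>
  by less than half of it costs at most half of it.\<close>

lemma slit_plane_lower_bound:
  assumes "z \<in> slit_plane"
  shows "\<exists>r>0. \<exists>c>0. \<forall>w\<in>ball z r. \<forall>x\<in>{0..1}. c \<le> norm (1 - w * of_real x)"
proof -
  have "continuous_on {0..1::real} (\<lambda>x. norm (1 - z * of_real x))" by (intro continuous_intros)
  then obtain x0 where x0: "x0 \<in> {0..1}" "\<And>x. x \<in> {0..1} \<Longrightarrow> norm (1 - z * of_real x0) \<le> norm (1 - z * of_real x)"
    using continuous_attains_inf[of "{0..1::real}" "\<lambda>x. norm (1 - z * of_real x)"] by auto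
  define m where "m = norm (1 - z * of_real x0)"
  have m: "m > 0" unfolding m_def using slit_planeD(2)[OF assms x0(1)] by simp
  have "m / 2 \<le> norm (1 - w * of_real x)" if w: "w \<in> ball z (m/2)" and x: "x \<in> {0..1}" for w x
  proof -
    have "norm ((z - w) * of_real x) \<le> m / 2 * 1"
      unfolding norm_mult using w x m by (intro mult_mono) (auto simp: dist_norm)
    moreover have "norm (1 - z * of_real x) \<le> norm (1 - w * of_real x) + norm ((z - w) * of_real x)"
      using norm_triangle_ineq4[of "1 - w * of_real x" "(z - w) * of_real x"] by (simp add: algebra_simps)
    ultimately show ?thesis using x0(2)[OF x] by (simp add: m_def[symmetric])
  qed
  moreover have "m / 2 > 0" using m by simp
  ultimately show ?thesis by blast
qed

lemma geometric_moment_holomorphic: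
  assumes "Re u > 0"
  shows "(\<lambda>z. geometric_moment z u) holomorphic_on slit_plane"
  unfolding geometric_moment_def
proof (rule holomorphic_on_integral_dominated[OF open_slit_plane])
  show "(\<lambda>z. of_real x powr u / (1 - z * of_real x)) holomorphic_on slit_plane" if "x \<in> {0..1}" for x
    using slit_planeD(2)[OF _ that] by (intro holomorphic_intros) auto
  show "(\<lambda>x. of_real x powr u / (1 - z * of_real x)) integrable_on {0..1}" if "z \<in> slit_plane" for z
    using that assms by (rule geometric_moment_integrable)
  fix z assume "z \<in> slit_plane"
  then obtain r c where rc: "r > 0" "c > 0" "\<And>w x. w \<in> ball z r \<Longrightarrow> x \<in> {0..1} \<Longrightarrow> c \<le> norm (1 - w * of_real x)"
    using slit_plane_lower_bound by meson
  have "norm (of_real x powr u / (1 - w * of_real x)) \<le> 1 / c" if "x \<in> {0..1}" "w \<in> ball z r" for x w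
  proof -
    have "norm (complex_of_real x powr u) \<le> 1" using that assms by (auto simp: norm_powr_real_powr intro!: powr_le1)
    then show ?thesis unfolding norm_divide using rc(3)[OF that(2,1)] rc(2) by (intro frac_le) auto
  qed
  then show "\<exists>r>0. \<exists>h. h integrable_on {0..1} \<and> (\<forall>x\<in>{0..1}. \<forall>w\<in>ball z r \<inter> slit_plane. norm (of_real x powr u / (1 - w * of_real x)) \<le> h x)"
    using rc(1) by (intro exI[of _ r] conjI exI[of _ "\<lambda>_. 1 / c"]) (auto simp: integrable_const_ivl)
qed

lemma unit_disc_subset_slit: "norm z < 1 \<Longrightarrow> z \<in> slit_plane"
  using complex_Re_le_cmod[of z] by (auto simp: slit_plane_def)

lemma geometric_moment_sums:
  assumes z: "norm z < 1" and u: "Re u > 0"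
  shows "(\<lambda>m. z ^ m / (of_nat m + u + 1)) sums geometric_moment z u"
proof -
  have trm: "((\<lambda>x. z ^ m * (of_real x powr u * of_real x ^ m)) has_integral z ^ m / (of_nat m + u + 1)) {0..1}" for m
    using has_integral_mult_right[OF has_integral_powr_unit_mult[of u m], of "z ^ m"] u by (simp add: add_ac)
  have summ: "summable (\<lambda>m. z ^ m / (of_nat m + u + 1))"
  proof (rule summable_comparison_test[OF exI[of _ 0]], intro allI impI)
    show "summable (\<lambda>m. norm z ^ m)" using z by (intro summable_geometric) auto
    fix m
    have "1 \<le> Re (of_nat m + u + 1)" using u by simp
    also have "\<dots> \<le> norm (of_nat m + u + 1)" by (rule complex_Re_le_cmod)
    finally have "norm z ^ m / norm (of_nat m + u + 1) \<le> norm z ^ m / 1" by (intro divide_left_mono) auto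
    then show "norm (z ^ m / (of_nat m + u + 1)) \<le> norm z ^ m" by (simp add: norm_divide norm_power)
  qed
  have "((\<lambda>x. of_real x powr u / (1 - z * of_real x)) has_integral (\<Sum>m. z ^ m / (of_nat m + u + 1))) {0..1}"
  proof (rule has_integral_dominated_convergence)
    show "((\<lambda>x. \<Sum>m<N. z ^ m * (of_real x powr u * of_real x ^ m)) has_integral (\<Sum>m<N. z ^ m / (of_nat m + u + 1))) {0..1}" for N
      by (intro has_integral_sum trm) auto
    show "(\<lambda>x::real. 1 / (1 - norm z)) integrable_on {0..1}" by (rule integrable_const_ivl)
    show "\<forall>x\<in>{0..1}. norm (\<Sum>m<N. z ^ m * (of_real x powr u * of_real x ^ m)) \<le> 1 / (1 - norm z)" for N
    proof
      fix x :: real assume x: "x \<in> {0..1}"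
      have "norm (\<Sum>m<N. z ^ m * (of_real x powr u * of_real x ^ m)) \<le> (\<Sum>m<N. norm z ^ m)"
      proof (rule sum_norm_le)
        fix m
        have "norm (complex_of_real x powr u) \<le> 1" using x u by (auto simp: norm_powr_real_powr intro!: powr_le1)
        moreover have "norm (complex_of_real x ^ m) \<le> 1" using x by (simp add: norm_power power_le_one)
        ultimately have "norm (of_real x powr u * complex_of_real x ^ m) \<le> 1" by (simp add: norm_mult mult_le_one)
        then have "norm (z ^ m) * norm (of_real x powr u * complex_of_real x ^ m) \<le> norm (z ^ m) * 1"
          by (intro mult_left_mono) auto
        then show "norm (z ^ m * (of_real x powr u * of_real x ^ m)) \<le> norm z ^ m" by (simp only: norm_mult norm_power mult_1_right)
      qed
      also have "\<dots> \<le> (\<Sum>m. norm z ^ m)" using z by (intro sum_le_suminf summable_geometric) auto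
      also have "\<dots> = 1 / (1 - norm z)" using z by (intro suminf_geometric) auto
      finally show "norm (\<Sum>m<N. z ^ m * (of_real x powr u * of_real x ^ m)) \<le> 1 / (1 - norm z)" .
    qed
    show "\<forall>x\<in>{0..1}. (\<lambda>N. \<Sum>m<N. z ^ m * (of_real x powr u * of_real x ^ m)) \<longlonglongrightarrow> of_real x powr u / (1 - z * of_real x)"
    proof
      fix x :: real assume x: "x \<in> {0..1}"
      have "norm (z * of_real x) \<le> norm z * 1" unfolding norm_mult using x by (intro mult_left_mono) auto
      then have "norm (z * of_real x) < 1" using z by simp
      from sums_mult[OF geometric_sums[OF this], of "of_real x powr u"]
      show "(\<lambda>N. \<Sum>m<N. z ^ m * (of_real x powr u * of_real x ^ m)) \<longlonglongrightarrow> of_real x powr u / (1 - z * of_real x)"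
        by (simp add: sums_def power_mult_distrib mult_ac)
    qed
    show "(\<lambda>N. \<Sum>m<N. z ^ m / (of_nat m + u + 1)) \<longlonglongrightarrow> (\<Sum>m. z ^ m / (of_nat m + u + 1))"
      using summ by (rule summable_LIMSEQ)
  qed
  then have "geometric_moment z u = (\<Sum>m. z ^ m / (of_nat m + u + 1))" unfolding geometric_moment_def by (rule integral_unique)
  then show ?thesis using summable_sums[OF summ] by simp
qed

text \<open>Splitting off \<open>M\<close> summands raises the exponent under the integral to
  \<open>M - s\<close>, so that every \<open>s\<close> off the naturals is reached with
  \<open>M\<close> large enough.\<close>

definition hyp2F1_moment :: "nat \<Rightarrow> complex \<Rightarrow> complex \<Rightarrow> complex" where
  "hyp2F1_moment M s z = (\<Sum>m<M. z ^ m / (of_nat (Suc m) - s)) + z ^ M * geometric_moment z (of_nat M - s)"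

lemma hyp2F1_moment_sums:
  assumes z: "norm z < 1" and s: "Re s < real M"
  shows "(\<lambda>m. z ^ m / (of_nat (Suc m) - s)) sums hyp2F1_moment M s z"
proof -
  have "(\<lambda>m. z ^ M * (z ^ m / (of_nat m + (of_nat M - s) + 1))) sums (z ^ M * geometric_moment z (of_nat M - s))"
    using s by (intro sums_mult geometric_moment_sums z) auto
  moreover have "z ^ M * (z ^ m / (of_nat m + (of_nat M - s) + 1)) = z ^ (m + M) / (of_nat (Suc (m + M)) - s)" for m
    by (simp add: power_add algebra_simps)
  ultimately have "(\<lambda>m. z ^ (m + M) / (of_nat (Suc (m + M)) - s)) sums (z ^ M * geometric_moment z (of_nat M - s))" by simp
  then show ?thesis unfolding hyp2F1_moment_def by (subst (asm) sums_iff_shift) (simp add: add.commute)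
qed

lemma hyp2F1_moment_holomorphic: "Re s < real M \<Longrightarrow> hyp2F1_moment M s holomorphic_on slit_plane"
  unfolding hyp2F1_moment_def [abs_def] by (intro holomorphic_intros geometric_moment_holomorphic) auto

text \<open>The Pochhammer symbols collapse to (1 - s) / (m + 1 - s). The moment witnesses that a
  branch exists, and the identity theorem from the unit disc to the connected slit plane identifies
  the chosen branch with it.\<close>

lemma hyp2F1_slit_eq_hyp2F1_moment:
  assumes s: "s \<notin> \<nat>" "Re s < real M" and z: "z \<in> slit_plane"
  shows "hyp2F1_slit 1 (1 - s) (2 - s) z = (1 - s) * hyp2F1_moment M s z"
proof -
  have coef: "pochhammer 1 m * pochhammer (1 - s) m / pochhammer (2 - s) m * z ^ m / fact m = (1 - s) * (z ^ m / (of_nat (Suc m) - s))" for m z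
  proof -
    have nz: "1 - s + of_nat j \<noteq> 0" for j using not_Nats_of_nat_diff[OF s(1), of "Suc j"] by (simp add: algebra_simps)
    have "1 - s + 1 + of_nat j \<noteq> 0" for j
    proof -
      have "1 - s + 1 + of_nat j = 1 - s + of_nat (Suc j)" by simp
      then show ?thesis using nz[of "Suc j"] by metis
    qed
    then have "pochhammer (1 - s) m / pochhammer (1 - s + 1) m = (1 - s) / (1 - s + of_nat m)"
      using nz by (intro pochhammer_quotient_Suc) auto
    then have "pochhammer (1 - s) m / pochhammer (2 - s) m = (1 - s) / (of_nat (Suc m) - s)" by (simp add: algebra_simps)
    then have "fact m * (pochhammer (1 - s) m / pochhammer (2 - s) m) * z ^ m / fact m = (1 - s) / (of_nat (Suc m) - s) * z ^ m" by simp
    then show ?thesis by (simp add: pochhammer_fact[symmetric])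
  qed
  let ?P = "\<lambda>f. f holomorphic_on {z. \<not> (Im z = 0 \<and> 1 \<le> Re z)} \<and>
     (\<forall>z. norm z < 1 \<longrightarrow> f z = (\<Sum>m. pochhammer 1 m * pochhammer (1 - s) m / pochhammer (2 - s) m * z ^ m / fact m))"
  have ser: "(\<Sum>m. pochhammer 1 m * pochhammer (1 - s) m / pochhammer (2 - s) m * z ^ m / fact m) = (1 - s) * hyp2F1_moment M s z"
    if "norm z < 1" for z
    unfolding coef using sums_mult[OF hyp2F1_moment_sums[OF that s(2)], of "1 - s"] by (rule sums_unique[symmetric])
  have ex: "?P (\<lambda>z. (1 - s) * hyp2F1_moment M s z)"
    using ser hyp2F1_moment_holomorphic[OF s(2)] by (auto simp: slit_plane_def intro!: holomorphic_intros)
  have P: "?P (hyp2F1_slit 1 (1 - s) (2 - s))"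
    unfolding hyp2F1_slit_def using someI[of ?P, OF ex] .
  show ?thesis
  proof (rule analytic_continuation_open[where s = "ball 0 1" and s' = slit_plane and f = "hyp2F1_slit 1 (1 - s) (2 - s)"])
    show "hyp2F1_slit 1 (1 - s) (2 - s) holomorphic_on slit_plane" using P by (simp add: slit_plane_def)
    show "(\<lambda>z. (1 - s) * hyp2F1_moment M s z) holomorphic_on slit_plane"
      by (intro holomorphic_intros hyp2F1_moment_holomorphic s)
    show "ball 0 1 \<subseteq> slit_plane" using unit_disc_subset_slit by auto
  qed (use P ser z in \<open>auto simp: open_slit_plane connected_slit_plane\<close>)
qed

text \<open>\<open>upper_Ln\<close> extends \<open>Ln\<close> continuously from the open upper half-plane to its boundary; it is
  what \<open>Ln (1 - z * x)\<close> becomes when \<open>z\<close> approaches the slit from below.\<close>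

definition upper_Ln :: "complex \<Rightarrow> complex" where
  "upper_Ln y = Ln (- \<i> * y) + \<i> * of_real (pi / 2)"

lemma upper_Ln_eq_Ln:
  assumes "Im y > 0" shows "upper_Ln y = Ln y"
proof -
  have y: "y \<noteq> 0" using assms by auto
  have "0 < Im (Ln y)" "Im (Ln y) < pi" using Im_Ln_pos_lt_imp Im_Ln_pos_lt[OF y] assms by auto
  then have "Ln (- \<i> * y) = Ln (- \<i>) + Ln y"
    using y by (intro Ln_times_simple) auto
  then show ?thesis by (simp add: upper_Ln_def complex_eq_iff)
qed

lemma upper_Ln_of_real:
  assumes "y \<noteq> 0" shows "upper_Ln (of_real y) = of_real (ln \<bar>y\<bar>) + (if y < 0 then \<i> * of_real pi else 0)"
proof (cases "y < 0")
  case True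
  have "- \<i> * of_real y = of_real \<bar>y\<bar> * \<i>" using True by simp
  then have "Ln (- \<i> * of_real y) = of_real (ln \<bar>y\<bar>) + \<i> * of_real (pi / 2)"
    using Ln_times_of_real[of "\<bar>y\<bar>" \<i>] Ln_of_real[of "\<bar>y\<bar>"] assms by simp
  then show ?thesis using True by (simp add: upper_Ln_def complex_eq_iff)
next
  case False
  have "- \<i> * of_real y = of_real \<bar>y\<bar> * (-\<i>)" using False by simp
  then have "Ln (- \<i> * of_real y) = of_real (ln \<bar>y\<bar>) - \<i> * of_real (pi / 2)"
    using Ln_times_of_real[of "\<bar>y\<bar>" "-\<i>"] Ln_of_real[of "\<bar>y\<bar>"] assms False by (simp add: mult.commute[of _ \<i>])
  then show ?thesis using False by (simp add: upper_Ln_def complex_eq_iff)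
qed

lemma upper_Ln_nonpos: "Im y \<ge> 0 \<Longrightarrow> y \<noteq> 0 \<Longrightarrow> - \<i> * y \<notin> \<real>\<^sub>\<le>\<^sub>0"
  by (auto simp: complex_nonpos_Reals_iff complex_eq_iff)

lemma upper_Ln_deriv:
  assumes "Im y \<ge> 0" "y \<noteq> 0"
  shows "(upper_Ln has_field_derivative inverse y) (at y)"
proof -
  have "((\<lambda>y. Ln (- \<i> * y) + \<i> * of_real (pi / 2)) has_field_derivative inverse y) (at y)"
    using upper_Ln_nonpos[OF assms] assms(2)
    by (auto intro!: derivative_eq_intros simp: field_simps)
  then show ?thesis by (simp add: upper_Ln_def [abs_def])
qed

text \<open>An antiderivative of \<open>upper_Ln\<close> that is continuous at 0, where the
  logarithm itself is singular; 0 is the value of \<open>1 - z * x\<close> that is met inside the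
  interval once \<open>z\<close> is on the slit.\<close>

definition upper_entropy :: "complex \<Rightarrow> complex" where
  "upper_entropy y = y * upper_Ln y - y"

lemma upper_entropy_deriv:
  assumes "Im y \<ge> 0" "y \<noteq> 0"
  shows "(upper_entropy has_field_derivative upper_Ln y) (at y)"
proof -
  have "((\<lambda>y. y * upper_Ln y - y) has_field_derivative upper_Ln y) (at y)"
    using assms(2) by (auto intro!: derivative_eq_intros upper_Ln_deriv[OF assms])
  then show ?thesis by (simp add: upper_entropy_def [abs_def])
qed

text \<open>Only the origin is critical, and there |y| |ln |y|| tends to 0 while the imaginary part
  of the logarithm stays bounded.\<close>

lemma upper_entropy_continuous: "continuous_on {y. Im y \<ge> 0} upper_entropy"
  unfolding continuous_on_eq_continuous_within
proof (intro ballI)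
  fix y assume y: "y \<in> {y. Im y \<ge> 0}"
  show "continuous (at y within {y. Im y \<ge> 0}) upper_entropy"
  proof (cases "y = 0")
    case False
    then show ?thesis using upper_entropy_deriv[of y] y
      by (auto intro: continuous_at_imp_continuous_at_within DERIV_isCont)
  next
    case True
    have "((\<lambda>t::real. t * (\<bar>ln t\<bar> + 2 * pi)) \<longlongrightarrow> 0) (at_right 0)" by real_asymp
    then have "((\<lambda>y::complex. norm y * (\<bar>ln (norm y)\<bar> + 2 * pi)) \<longlongrightarrow> 0) (at 0)"
      by (rule filterlim_compose) (auto simp: filterlim_at eventually_at_filter intro!: tendsto_norm_zero)
    then have "((\<lambda>y. y * upper_Ln y) \<longlongrightarrow> 0) (at 0)"
    proof (rule Lim_null_comparison[rotated])
      show "\<forall>\<^sub>F y in at 0. norm (y * upper_Ln y) \<le> norm y * (\<bar>ln (norm y)\<bar> + 2 * pi)"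
      proof (rule eventually_at_filter[THEN iffD2], intro always_eventually allI impI)
        fix y :: complex assume "y \<noteq> 0"
        then have "norm (Ln (- \<i> * y)) \<le> \<bar>ln (norm y)\<bar> + pi" using norm_Ln_le[of "- \<i> * y"] by (simp add: norm_mult)
        then have "norm (upper_Ln y) \<le> \<bar>ln (norm y)\<bar> + pi + pi / 2"
          unfolding upper_Ln_def using norm_triangle_ineq[of "Ln (- \<i> * y)" "\<i> * of_real (pi / 2)"] by (simp add: norm_mult)
        then have "norm (upper_Ln y) \<le> \<bar>ln (norm y)\<bar> + 2 * pi" using pi_gt_zero by linarith
        then show "norm (y * upper_Ln y) \<le> norm y * (\<bar>ln (norm y)\<bar> + 2 * pi)"
          unfolding norm_mult by (rule mult_left_mono) simp
      qed
    qed
    then have "((\<lambda>y. y * upper_Ln y - y) \<longlongrightarrow> 0 - 0) (at 0)" by (intro tendsto_diff tendsto_ident_at)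
    then have "isCont upper_entropy 0" unfolding isCont_def upper_entropy_def [abs_def] by simp
    then show ?thesis using True by (auto intro: continuous_at_imp_continuous_at_within)
  qed
qed

text \<open>Integration by parts trades the logarithm for the continuous
  \<open>upper_entropy\<close>. The power loses one more degree and must stay continuous at 0, hence
  Re w > 2.\<close>

lemma upper_log_integral:
  assumes w: "Re w > 2" and z: "z \<noteq> 0" "Im z \<le> 0"
  shows "((\<lambda>x. of_real x powr (w - 1) * upper_Ln (1 - z * of_real x)) has_integral
     (integral {0..1} (\<lambda>x. (w - 1) * of_real x powr (w - 2) * upper_entropy (1 - z * of_real x)) - upper_entropy (1 - z)) / z) {0..1}"
proof -
  define F where "F = (\<lambda>x. of_real x powr (w - 1) * upper_entropy (1 - z * of_real x))"
  define E where "E = {x :: real. 1 - z * of_real x = 0} \<union> {0}"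
  have "finite E"
  proof -
    have "{x :: real. 1 - z * of_real x = 0} \<subseteq> {Re (1 / z)}"
      using z(1) by (auto simp: field_simps) (metis Re_complex_of_real mult.commute nonzero_eq_divide_eq)
    then show ?thesis unfolding E_def using finite_subset by auto
  qed
  have im: "0 \<le> Im (1 - z * of_real x)" if "x \<in> {0..1}" for x
    using that z(2) by (simp add: mult_nonpos_nonneg)
  have ce: "continuous_on {0..1} (\<lambda>x::real. upper_entropy (1 - z * of_real x))"
    using im by (intro continuous_on_compose2[OF upper_entropy_continuous] continuous_intros) auto
  have D: "((\<lambda>x. (w - 1) * of_real x powr (w - 2) * upper_entropy (1 - z * of_real x)
        - z * (of_real x powr (w - 1) * upper_Ln (1 - z * of_real x))) has_integral F 1 - F 0) {0..1}"
  proof (rule fundamental_theorem_of_calculus_interior_strong[OF \<open>finite E\<close>])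
    show "continuous_on {0..1} F" unfolding F_def using w by (intro continuous_intros ce powr_continuous_unit) auto
    fix x :: real assume x: "x \<in> {0<..<1} - E"
    then have y: "1 - z * of_real x \<noteq> 0" "0 \<le> Im (1 - z * of_real x)" using im by (auto simp: E_def)
    have "((\<lambda>y. 1 - z * y) has_field_derivative - z) (at (of_real x))" by (auto intro!: derivative_eq_intros)
    from DERIV_chain2[where f = upper_entropy and g = "\<lambda>y. 1 - z * y", OF upper_entropy_deriv[OF y(2,1)] this]
    have d1: "((\<lambda>y. upper_entropy (1 - z * y)) has_field_derivative upper_Ln (1 - z * of_real x) * - z) (at (of_real x))" .
    have d2: "((\<lambda>y. y powr (w - 1)) has_field_derivative (w - 1) * of_real x powr (w - 1 - 1)) (at (of_real x))"
      using x by (intro has_field_derivative_powr) auto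
    have "((\<lambda>y. y powr (w - 1) * upper_entropy (1 - z * y)) has_field_derivative
        (w - 1) * of_real x powr (w - 2) * upper_entropy (1 - z * of_real x)
        - z * (of_real x powr (w - 1) * upper_Ln (1 - z * of_real x))) (at (of_real x))"
      by (rule DERIV_cong[OF DERIV_mult[OF d2 d1]]) (simp add: diff_diff_eq algebra_simps)
    then show "(F has_vector_derivative (w - 1) * of_real x powr (w - 2) * upper_entropy (1 - z * of_real x)
        - z * (of_real x powr (w - 1) * upper_Ln (1 - z * of_real x))) (at x)"
      unfolding F_def by (rule has_vector_derivative_real_field)
  qed auto
  have A: "((\<lambda>x. (w - 1) * of_real x powr (w - 2) * upper_entropy (1 - z * of_real x)) has_integral
      integral {0..1} (\<lambda>x. (w - 1) * of_real x powr (w - 2) * upper_entropy (1 - z * of_real x))) {0..1}"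
    using w by (intro integrable_integral integrable_continuous_real continuous_intros powr_continuous_unit ce) auto
  have F: "F 1 - F 0 = upper_entropy (1 - z)" by (simp add: F_def)
  from has_integral_divide[OF has_integral_diff[OF A D], of z] z(1) show ?thesis
    unfolding F by simp
qed

text \<open>By \<open>upper_log_integral\<close> this reduces to a parameter integral of a jointly
  continuous function, so that passing from the lower half-plane to the slit becomes plain
  continuity.\<close>

lemma upper_log_integral_continuous:
  assumes w: "Re w > 2"
  shows "continuous_on {z. Im z \<le> 0 \<and> z \<noteq> 0} (\<lambda>z. integral {0..1} (\<lambda>x. of_real x powr (w - 1) * upper_Ln (1 - z * of_real x)))"
proof -
  let ?U = "{z. Im z \<le> 0 \<and> z \<noteq> (0::complex)}"
  have "continuous_on ?U (\<lambda>z. integral (cbox 0 1) (\<lambda>x::real. (w - 1) * of_real x powr (w - 2) * upper_entropy (1 - z * of_real x)))"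
  proof (rule integral_continuous_on_param)
    have c1: "continuous_on (?U \<times> cbox 0 (1::real)) (\<lambda>p. upper_entropy (1 - fst p * of_real (snd p)))"
      by (intro continuous_on_compose2[OF upper_entropy_continuous] continuous_intros) (auto simp: mult_nonpos_nonneg)
    have c2: "continuous_on (?U \<times> cbox 0 (1::real)) (\<lambda>p. complex_of_real (snd p) powr (w - 2))"
      using w by (intro continuous_on_compose2[OF powr_continuous_unit[of "w - 2"]] continuous_intros) auto
    show "continuous_on (?U \<times> cbox 0 1) (\<lambda>(z, x). (w - 1) * of_real x powr (w - 2) * upper_entropy (1 - z * of_real x))"
      unfolding case_prod_beta by (intro continuous_on_mult continuous_on_const c1 c2)
  qed
  moreover have "continuous_on ?U (\<lambda>z. upper_entropy (1 - z))"
    by (intro continuous_on_compose2[OF upper_entropy_continuous] continuous_intros) auto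
  ultimately have "continuous_on ?U (\<lambda>z. (integral {0..1} (\<lambda>x. (w - 1) * of_real x powr (w - 2) * upper_entropy (1 - z * of_real x)) - upper_entropy (1 - z)) / z)"
    by (intro continuous_intros) (auto simp: cbox_interval)
  then show ?thesis
    by (rule continuous_on_eq) (rule integral_unique[symmetric], rule upper_log_integral[OF w], auto)
qed

text \<open>Integrate the derivative of x^w Ln (1 - z x) over the unit interval; it vanishes at 0
  and contributes Ln (1 - z) at 1.\<close>

lemma geometric_moment_by_parts:
  assumes z: "z \<in> slit_plane" and w: "Re w > 1"
  shows "((\<lambda>x. of_real x powr (w - 1) * Ln (1 - z * of_real x)) has_integral (z * geometric_moment z w + Ln (1 - z)) / w) {0..1}"
proof -
  have w0: "w \<noteq> 0" using w by auto
  define F where "F = (\<lambda>x. of_real x powr w * Ln (1 - z * of_real x))"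
  note nz = slit_planeD[OF z]
  have cL: "continuous_on {0..1::real} (\<lambda>x. Ln (1 - z * of_real x))"
    using nz by (intro continuous_intros) auto
  have D: "((\<lambda>x. w * (of_real x powr (w - 1) * Ln (1 - z * of_real x)) - z * (of_real x powr w / (1 - z * of_real x))) has_integral F 1 - F 0) {0..1}"
  proof (rule fundamental_theorem_of_calculus_interior)
    show "continuous_on {0..1} F" unfolding F_def using w by (intro continuous_on_mult cL powr_continuous_unit) auto
    fix x :: real assume x: "x \<in> {0<..<1}"
    then have y: "1 - z * of_real x \<notin> \<real>\<^sub>\<le>\<^sub>0" "1 - z * of_real x \<noteq> 0" using nz[of x] by auto
    have "((\<lambda>y. y powr w * Ln (1 - z * y)) has_field_derivative
        w * (of_real x powr (w - 1) * Ln (1 - z * of_real x)) - z * (of_real x powr w / (1 - z * of_real x))) (at (of_real x))"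
      using x y by (auto intro!: derivative_eq_intros simp: divide_inverse mult_ac)
    then show "(F has_vector_derivative w * (of_real x powr (w - 1) * Ln (1 - z * of_real x)) - z * (of_real x powr w / (1 - z * of_real x))) (at x)"
      unfolding F_def by (rule has_vector_derivative_real_field)
  qed auto
  have K: "((\<lambda>x. of_real x powr w / (1 - z * of_real x)) has_integral geometric_moment z w) {0..1}"
    unfolding geometric_moment_def using geometric_moment_integrable[OF z, of w] w by (intro integrable_integral) auto
  have F: "F 1 - F 0 = Ln (1 - z)" by (simp add: F_def)
  from has_integral_divide[OF has_integral_add[OF D has_integral_mult_right[OF K, of z]], of w] w0
  show ?thesis unfolding F by (simp add: add.commute)
qed

lemma has_integral_powr_upper_part:
  assumes p: "0 \<le> p" "p \<le> 1" and w: "Re w > 1"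
  shows "((\<lambda>x. of_real x powr (w - 1) * (if x > p then 1 else 0)) has_integral (1 - of_real p powr w) / w) {0..1}"
proof -
  have w0: "w \<noteq> 0" using w by auto
  have "((\<lambda>x. complex_of_real x powr (w - 1)) has_integral of_real 1 powr w / w - of_real p powr w / w) {p..1}"
  proof (rule fundamental_theorem_of_calculus_interior)
    show "continuous_on {p..1} (\<lambda>x. complex_of_real x powr w / w)"
      using w w0 p by (intro continuous_on_divide continuous_on_subset[OF powr_continuous_unit[of w]] continuous_intros) auto
    fix x :: real assume x: "x \<in> {p<..<1}"
    have "((\<lambda>z. z powr w / w) has_field_derivative of_real x powr (w - 1)) (at (of_real x))"
      using x w0 p by (auto intro!: derivative_eq_intros)
    then show "((\<lambda>x. complex_of_real x powr w / w) has_vector_derivative of_real x powr (w - 1)) (at x)"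
      by (rule has_vector_derivative_real_field)
  qed (use p in auto)
  then have "((\<lambda>x. if x \<in> {p..1} then complex_of_real x powr (w - 1) else 0) has_integral (1 - of_real p powr w) / w) {0..1}"
    using has_integral_restrict[of "{p..1}" "{0..1}" "\<lambda>x. complex_of_real x powr (w - 1)"] p by (simp add: diff_divide_distrib)
  then show ?thesis
    by (rule has_integral_spike[of "{p}", rotated 2]) auto
qed

section \<open>Moments of the shifted logarithm\<close>

text \<open>The moment of a \<open>log_factor\<close> whose zero is \<open>p\<close>; termwise
  integration of the sine product produces these integrals.\<close>

definition log_moment :: "real \<Rightarrow> complex \<Rightarrow> complex" where
  "log_moment p w = integral {0..1} (\<lambda>x. of_real (ln \<bar>x - p\<bar> - ln \<bar>1 - p\<bar>) * of_real x powr (w - 1))"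

lemma log_moment_integrable:
  assumes "Re w > 1"
  shows "(\<lambda>x. of_real (ln \<bar>x - p\<bar> - ln \<bar>1 - p\<bar>) * of_real x powr (w - 1)) absolutely_integrable_on {0..1}"
proof -
  have c: "continuous_on {0..1} (\<lambda>x. complex_of_real x powr (w - 1))" using assms by (intro powr_continuous_unit) auto
  have "(\<lambda>x. of_real (ln \<bar>x - p\<bar>) * of_real x powr (w - 1) - of_real (ln \<bar>1 - p\<bar>) * of_real x powr (w - 1)) absolutely_integrable_on {0..1}"
    by (intro set_integral_diff(1) ln_abs_weight_integrable absolutely_integrable_continuous_real
        continuous_on_mult continuous_on_const c)
  then show ?thesis by (simp add: algebra_simps)
qed

lemma log_moment_holomorphic: "log_moment p holomorphic_on {w. Re w > 1}"
  unfolding log_moment_def [abs_def]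
proof (rule holomorphic_on_integral_dominated[OF open_halfspace_Re_gt])
  show "(\<lambda>w. of_real (ln \<bar>x - p\<bar> - ln \<bar>1 - p\<bar>) * of_real x powr (w - 1)) holomorphic_on {w. Re w > 1}" for x
    by (cases "x = 0") (auto intro!: holomorphic_intros)
  show "(\<lambda>x. of_real (ln \<bar>x - p\<bar> - ln \<bar>1 - p\<bar>) * of_real x powr (w - 1)) integrable_on {0..1}" if "w \<in> {w. Re w > 1}" for w
    using log_moment_integrable[of w p] that by (auto simp: absolutely_integrable_on_def)
  have "(\<lambda>x. ln \<bar>x - p\<bar> - ln \<bar>1 - p\<bar>) absolutely_integrable_on {0..1}"
    by (intro set_integral_diff(1) ln_abs_absolutely_integrable absolutely_integrable_continuous_real continuous_intros)
  then have i: "(\<lambda>x. \<bar>ln \<bar>x - p\<bar> - ln \<bar>1 - p\<bar>\<bar>) integrable_on {0..1}" by (simp add: absolutely_integrable_on_def)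
  have b: "norm (of_real (ln \<bar>x - p\<bar> - ln \<bar>1 - p\<bar>) * complex_of_real x powr (w - 1)) \<le> \<bar>ln \<bar>x - p\<bar> - ln \<bar>1 - p\<bar>\<bar>"
    if "x \<in> {0..1}" "Re w > 1" for x w
  proof -
    have "norm (complex_of_real x powr (w - 1)) \<le> 1" using that by (auto simp: norm_powr_real_powr intro!: powr_le1)
    then show ?thesis unfolding norm_mult norm_of_real by (rule mult_left_le) simp
  qed
  show "\<exists>r>0. \<exists>h. h integrable_on {0..1} \<and> (\<forall>x\<in>{0..1}. \<forall>w\<in>ball z r \<inter> {w. Re w > 1}.
      norm (of_real (ln \<bar>x - p\<bar> - ln \<bar>1 - p\<bar>) * complex_of_real x powr (w - 1)) \<le> h x)" for z
    using i b by (intro exI[of _ 1] conjI exI[of _ "\<lambda>x. \<bar>ln \<bar>x - p\<bar> - ln \<bar>1 - p\<bar>\<bar>"]) auto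
qed

lemma ln_abs_ratio:
  fixes z x :: real
  assumes "z \<noteq> 0" "z \<noteq> 1" "1 - z * x \<noteq> 0"
  shows "ln \<bar>x - 1 / z\<bar> - ln \<bar>1 - 1 / z\<bar> = ln \<bar>1 - z * x\<bar> - ln \<bar>1 - z\<bar>"
proof -
  have "\<bar>x - 1 / z\<bar> = \<bar>1 - z * x\<bar> / \<bar>z\<bar>" "\<bar>1 - 1 / z\<bar> = \<bar>1 - z\<bar> / \<bar>z\<bar>"
    using assms(1) by (simp_all add: abs_divide[symmetric] diff_divide_distrib abs_minus_commute)
  then show ?thesis using assms by (simp add: ln_div)
qed

text \<open>For z < 1 the factor 1 - z x stays positive, so integration by parts involves only real
  logarithms, and the normalisation at x = 1 cancels the boundary term.\<close>

lemma geometric_moment_log_moment: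
  fixes z :: real
  assumes z: "z \<noteq> 0" "z < 1" and w: "Re w > 1"
  shows "of_real z * geometric_moment (of_real z) w = w * log_moment (1 / z) w"
proof -
  have zs: "of_real z \<in> slit_plane" using z by (auto simp: slit_plane_def)
  have w0: "w \<noteq> 0" using w by auto
  have p: "1 - z * x > 0" if "x \<in> {0..1}" for x
    using slit_planeD(1)[OF zs that] by (auto simp: complex_nonpos_Reals_iff not_le)
  have "((\<lambda>x. complex_of_real x powr (w - 1)) has_integral 1 / (w - 1 + 1)) {0..1}"
    using w by (intro has_integral_powr_unit) auto
  from has_integral_diff[OF geometric_moment_by_parts[OF zs w] has_integral_mult_left[OF this, of "of_real (ln (1 - z))"]]
  have "((\<lambda>x. of_real x powr (w - 1) * Ln (1 - of_real z * of_real x) - of_real x powr (w - 1) * of_real (ln (1 - z)))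
      has_integral (of_real z * geometric_moment (of_real z) w + Ln (1 - of_real z)) / w - 1 / w * of_real (ln (1 - z))) {0..1}" by simp
  moreover have "Ln (1 - of_real z) = of_real (ln (1 - z))"
    using Ln_of_real[of "1 - z"] z by simp
  ultimately have "((\<lambda>x. of_real x powr (w - 1) * Ln (1 - of_real z * of_real x) - of_real x powr (w - 1) * of_real (ln (1 - z)))
      has_integral of_real z * geometric_moment (of_real z) w / w) {0..1}" by (simp add: add_divide_distrib)
  moreover have "of_real x powr (w - 1) * Ln (1 - of_real z * of_real x) - of_real x powr (w - 1) * of_real (ln (1 - z)) =
      of_real (ln \<bar>x - 1 / z\<bar> - ln \<bar>1 - 1 / z\<bar>) * of_real x powr (w - 1)" if "x \<in> {0..1}" for x
  proof -
    have "Ln (1 - of_real z * of_real x) = of_real (ln (1 - z * x))" using Ln_of_real[OF p[OF that]] by simp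
    moreover have "ln \<bar>x - 1 / z\<bar> - ln \<bar>1 - 1 / z\<bar> = ln (1 - z * x) - ln (1 - z)"
      using ln_abs_ratio[of z x] z p[OF that] by simp
    ultimately show ?thesis by (simp only: of_real_diff left_diff_distrib right_diff_distrib mult.commute)
  qed
  ultimately have "((\<lambda>x. of_real (ln \<bar>x - 1 / z\<bar> - ln \<bar>1 - 1 / z\<bar>) * of_real x powr (w - 1)) has_integral of_real z * geometric_moment (of_real z) w / w) {0..1}"
    by (rule has_integral_eq[rotated])
  then have "log_moment (1 / z) w = of_real z * geometric_moment (of_real z) w / w" unfolding log_moment_def by (rule integral_unique)
  then show ?thesis using w0 by simp
qed

lemma not_bot_at_lower_half: "at (of_real z) within {w. Im w < 0} \<noteq> bot"
proof -
  have "of_real z islimpt {w. Im w < 0}"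
    unfolding islimpt_approachable
  proof (intro allI impI)
    fix e :: real assume "e > 0"
    then show "\<exists>x'\<in>{w. Im w < 0}. x' \<noteq> complex_of_real z \<and> dist x' (complex_of_real z) < e"
      by (intro bexI[of _ "of_real z - \<i> * of_real (e/2)"]) (auto simp: dist_norm norm_mult complex_eq_iff)
  qed
  then show ?thesis by (simp add: trivial_limit_within)
qed

text \<open>From below the slit, \<open>1 - y * x\<close> lies in the upper half-plane, so for x > 1
  / z the logarithm acquires \<i> pi in the limit. That part integrates to \<i> pi (1 - z^(-w)) / w;
  after multiplication by \<open>w\<close> the boundary term takes away \<i> pi and -\<i> pi z^(-w)
  remains.\<close>

lemma geometric_moment_limit:
  fixes z :: real
  assumes z: "z > 1" and w: "Re w > 2"
  shows "((\<lambda>y. y * geometric_moment y w) \<longlongrightarrow> w * log_moment (1 / z) w - \<i> * of_real pi * of_real z powr (- w)) (at (of_real z) within {w. Im w < 0})"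
proof -
  define W where "W = (\<lambda>y. integral {0..1} (\<lambda>x. of_real x powr (w - 1) * upper_Ln (1 - y * of_real x)))"
  have w0: "w \<noteq> 0" using w by auto
  have K: "y * geometric_moment y w = w * W y - upper_Ln (1 - y)" if y: "Im y < 0" for y
  proof -
    have ys: "y \<in> slit_plane" using y by (auto simp: slit_plane_def)
    have "((\<lambda>x. of_real x powr (w - 1) * upper_Ln (1 - y * of_real x)) has_integral (y * geometric_moment y w + Ln (1 - y)) / w) {0..1}"
    proof (rule has_integral_spike[of "{0}", rotated 2])
      show "((\<lambda>x. of_real x powr (w - 1) * Ln (1 - y * of_real x)) has_integral (y * geometric_moment y w + Ln (1 - y)) / w) {0..1}"
        using geometric_moment_by_parts[OF ys] w by simp
      show "of_real x powr (w - 1) * upper_Ln (1 - y * of_real x) = of_real x powr (w - 1) * Ln (1 - y * of_real x)" if "x \<in> {0..1} - {0}" for x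
        using that y by (subst upper_Ln_eq_Ln) (auto simp: mult_neg_pos)
    qed auto
    then have "W y = (y * geometric_moment y w + Ln (1 - y)) / w" unfolding W_def by (rule integral_unique)
    moreover have "upper_Ln (1 - y) = Ln (1 - y)" using y by (intro upper_Ln_eq_Ln) auto
    ultimately show ?thesis using w0 by simp
  qed
  have "(W \<longlongrightarrow> W (of_real z)) (at (of_real z) within {z. Im z \<le> 0 \<and> z \<noteq> 0})"
    using upper_log_integral_continuous[OF w] z unfolding W_def continuous_on_def by auto
  then have 1: "(W \<longlongrightarrow> W (of_real z)) (at (of_real z) within {w. Im w < 0})"
    by (rule tendsto_within_subset) auto
  have nz: "1 - complex_of_real z \<noteq> 0" using z by (metis of_real_1 of_real_eq_iff less_irrefl right_minus_eq)
  have "isCont upper_Ln (1 - of_real z)" using upper_Ln_deriv[of "1 - of_real z"] nz by (auto intro: DERIV_isCont)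
  then have "((\<lambda>y. upper_Ln (1 - y)) \<longlongrightarrow> upper_Ln (1 - of_real z)) (at (of_real z) within {w. Im w < 0})"
    by (rule isCont_tendsto_compose) (intro tendsto_intros)
  then have "((\<lambda>y. w * W y - upper_Ln (1 - y)) \<longlongrightarrow> w * W (of_real z) - upper_Ln (1 - of_real z)) (at (of_real z) within {w. Im w < 0})"
    by (intro tendsto_intros 1)
  then have 2: "((\<lambda>y. y * geometric_moment y w) \<longlongrightarrow> w * W (of_real z) - upper_Ln (1 - of_real z)) (at (of_real z) within {w. Im w < 0})"
    by (rule Lim_transform_eventually) (auto simp: eventually_at_filter K)
  have U1: "upper_Ln (1 - of_real z) = of_real (ln \<bar>1 - z\<bar>) + \<i> * of_real pi"
    using upper_Ln_of_real[of "1 - z"] z by simp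
  have "((\<lambda>x. of_real x powr (w - 1) * upper_Ln (1 - of_real z * of_real x)) has_integral
      (log_moment (1 / z) w + 1 / w * of_real (ln \<bar>1 - z\<bar>) + (1 - of_real (1 / z) powr w) / w * (\<i> * of_real pi))) {0..1}"
  proof (rule has_integral_spike[of "{1 / z}", rotated 2])
    have A: "((\<lambda>x. of_real (ln \<bar>x - 1 / z\<bar> - ln \<bar>1 - 1 / z\<bar>) * of_real x powr (w - 1)) has_integral log_moment (1 / z) w) {0..1}"
      unfolding log_moment_def using log_moment_integrable[of w "1 / z"] w
      by (intro integrable_integral) (auto simp: absolutely_integrable_on_def)
    have B: "((\<lambda>x. complex_of_real x powr (w - 1)) has_integral 1 / w) {0..1}"
      using has_integral_powr_unit[of "w - 1"] w by simp
    have C: "((\<lambda>x. complex_of_real x powr (w - 1) * (if x > 1 / z then 1 else 0)) has_integral (1 - of_real (1 / z) powr w) / w) {0..1}"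
      using z w by (intro has_integral_powr_upper_part) auto
    from has_integral_add[OF has_integral_add[OF A has_integral_mult_left[OF B, of "of_real (ln \<bar>1 - z\<bar>)"]] has_integral_mult_left[OF C, of "\<i> * of_real pi"]]
    show "((\<lambda>x. of_real (ln \<bar>x - 1 / z\<bar> - ln \<bar>1 - 1 / z\<bar>) * of_real x powr (w - 1) + of_real x powr (w - 1) * of_real (ln \<bar>1 - z\<bar>)
        + of_real x powr (w - 1) * (if x > 1 / z then 1 else 0) * (\<i> * of_real pi)) has_integral
      (log_moment (1 / z) w + 1 / w * of_real (ln \<bar>1 - z\<bar>) + (1 - of_real (1 / z) powr w) / w * (\<i> * of_real pi))) {0..1}" .
    fix x assume "x \<in> {0..1} - {1 / z}"
    then have nz: "1 - z * x \<noteq> 0" and gt: "(x > 1 / z) = (1 - z * x < 0)" using z by (auto simp: field_simps)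
    have "upper_Ln (1 - of_real z * of_real x) = of_real (ln \<bar>1 - z * x\<bar>) + (if 1 - z * x < 0 then \<i> * of_real pi else 0)"
      using upper_Ln_of_real[OF nz] by simp
    then show "of_real x powr (w - 1) * upper_Ln (1 - of_real z * of_real x) =
      of_real (ln \<bar>x - 1 / z\<bar> - ln \<bar>1 - 1 / z\<bar>) * of_real x powr (w - 1) + of_real x powr (w - 1) * of_real (ln \<bar>1 - z\<bar>)
        + of_real x powr (w - 1) * (if x > 1 / z then 1 else 0) * (\<i> * of_real pi)"
    proof -
      have r: "ln \<bar>x - 1 / z\<bar> - ln \<bar>1 - 1 / z\<bar> = ln \<bar>1 - z * x\<bar> - ln \<bar>1 - z\<bar>"
        using z nz by (intro ln_abs_ratio) auto
      define A B where "A = complex_of_real (ln \<bar>1 - z * x\<bar>)" and "B = complex_of_real (ln \<bar>1 - z\<bar>)"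
      assume "upper_Ln (1 - of_real z * of_real x) = of_real (ln \<bar>1 - z * x\<bar>) + (if 1 - z * x < 0 then \<i> * of_real pi else 0)"
      then show ?thesis unfolding gt r of_real_diff A_def[symmetric] B_def[symmetric]
        by (cases "1 - z * x < 0") (simp_all only: if_True if_False, simp_all add: algebra_simps)
    qed
  qed auto
  then have Weq: "W (of_real z) = log_moment (1 / z) w + 1 / w * of_real (ln \<bar>1 - z\<bar>) + (1 - of_real (1 / z) powr w) / w * (\<i> * of_real pi)"
    unfolding W_def by (rule integral_unique)
  have "w * W (of_real z) - upper_Ln (1 - of_real z) = w * log_moment (1 / z) w - \<i> * of_real pi * of_real (1 / z) powr w"
    unfolding U1 Weq using w0 by (simp add: field_simps)
  also have "complex_of_real (1 / z) powr w = of_real z powr (- w)"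
  proof -
    have "Ln (complex_of_real (1 / z)) = - Ln (of_real z)" using z Ln_of_real[of "1 / z"] Ln_of_real[of z] by (simp add: ln_div)
    then show ?thesis using z by (simp add: powr_def)
  qed
  finally show ?thesis using 2 by simp
qed

text \<open>Unites the direct case z < 1 with the limit at x - i0 for z > 1. The imaginary term of
  the second case is the one that the zeta difference in \<open>H\<close> has to compensate.\<close>

lemma hyp2F1_log_moment:
  fixes z :: real
  assumes z: "z \<noteq> 0" "z \<noteq> 1" and s: "s \<notin> \<nat>" "Re s < real M - 2"
  shows "of_real z * (hyp2F1 1 (1 - s) (2 - s) (of_real z) / (1 - s)) = (\<Sum>m<M. of_real z ^ Suc m / (of_nat (Suc m) - s))
    + of_real z ^ M * ((of_nat M - s) * log_moment (1 / z) (of_nat M - s) - (if z > 1 then \<i> * of_real pi * of_real z powr (s - of_nat M) else 0))"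
proof -
  define w where "w = of_nat M - s"
  have w: "Re w > 2" using s by (simp add: w_def)
  have sM: "Re s < real M" using s by simp
  have s1: "1 - s \<noteq> 0" using not_Nats_of_nat_diff[OF s(1), of 1] by simp
  have zPhi: "y * hyp2F1_moment M s y = (\<Sum>m<M. y ^ Suc m / (of_nat (Suc m) - s)) + y ^ M * (y * geometric_moment y w)" for y
    unfolding hyp2F1_moment_def w_def by (simp add: distrib_left sum_distrib_left mult_ac)
  show ?thesis
  proof (cases "z > 1")
    case False
    then have z1: "z < 1" using z by simp
    then have zs: "of_real z \<in> slit_plane" by (auto simp: slit_plane_def)
    have "hyp2F1 1 (1 - s) (2 - s) (of_real z) = (1 - s) * hyp2F1_moment M s (of_real z)"
      using hyp2F1_slit_eq_hyp2F1_moment[OF s(1) sM zs] z1 by (simp add: hyp2F1_def)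
    then have "of_real z * (hyp2F1 1 (1 - s) (2 - s) (of_real z) / (1 - s)) = of_real z * hyp2F1_moment M s (of_real z)" using s1 by simp
    also have "\<dots> = (\<Sum>m<M. of_real z ^ Suc m / (of_nat (Suc m) - s)) + of_real z ^ M * (w * log_moment (1 / z) w)"
      unfolding zPhi using geometric_moment_log_moment[OF z(1) z1, of w] w by simp
    finally show ?thesis using False by (simp add: w_def)
  next
    case True
    let ?F = "at (complex_of_real z) within {w. Im w < 0}"
    define Q where "Q = (\<Sum>m<M. of_real z ^ Suc m / (of_nat (Suc m) - s))
       + of_real z ^ M * (w * log_moment (1 / z) w - \<i> * of_real pi * of_real z powr (- w))"
    have z0: "complex_of_real z \<noteq> 0" using z by simp
    have "((\<lambda>y. (\<Sum>m<M. y ^ Suc m / (of_nat (Suc m) - s)) + y ^ M * (y * geometric_moment y w)) \<longlongrightarrow> Q) ?F"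
      unfolding Q_def
      by (intro tendsto_add tendsto_sum tendsto_divide tendsto_mult tendsto_power tendsto_ident_at tendsto_const
          geometric_moment_limit[OF True w] not_Nats_of_nat_diff s(1))
    then have "((\<lambda>y. (1 - s) / y * (y * hyp2F1_moment M s y)) \<longlongrightarrow> (1 - s) / of_real z * Q) ?F"
      unfolding zPhi[symmetric] using z0 by (intro tendsto_intros) auto
    then have "(hyp2F1_slit 1 (1 - s) (2 - s) \<longlongrightarrow> (1 - s) / of_real z * Q) ?F"
    proof (rule Lim_transform_eventually)
      show "\<forall>\<^sub>F y in ?F. (1 - s) / y * (y * hyp2F1_moment M s y) = hyp2F1_slit 1 (1 - s) (2 - s) y"
      proof (unfold eventually_at_filter, intro always_eventually allI impI)
        fix y assume y: "y \<in> {w. Im w < 0}"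
        then have "y \<in> slit_plane" "y \<noteq> 0" by (auto simp: slit_plane_def)
        then show "(1 - s) / y * (y * hyp2F1_moment M s y) = hyp2F1_slit 1 (1 - s) (2 - s) y"
          using hyp2F1_slit_eq_hyp2F1_moment[OF s(1) sM] by simp
      qed
    qed
    then have "Lim ?F (hyp2F1_slit 1 (1 - s) (2 - s)) = (1 - s) / of_real z * Q"
      by (intro tendsto_Lim not_bot_at_lower_half)
    then have "hyp2F1 1 (1 - s) (2 - s) (of_real z) = (1 - s) / of_real z * Q"
      using True by (simp add: hyp2F1_def)
    then show ?thesis using s1 z0 True by (simp add: Q_def w_def)
  qed
qed

text \<open>The antiderivative is x^w ln x / w - x^w / w^2; it extends continuously by 0 to the left
  end point.\<close>

lemma log_moment_0:
  assumes w: "Re w > 1"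
  shows "log_moment 0 w = - 1 / w\<^sup>2"
proof -
  have w0: "w \<noteq> 0" using w by auto
  have "((\<lambda>x. of_real x powr (w - 1) * Ln (of_real x)) has_integral
      (of_real 1 powr w * Ln (of_real 1) / w - of_real 1 powr w / w\<^sup>2) - (of_real 0 powr w * Ln (of_real 0) / w - of_real 0 powr w / w\<^sup>2)) {0..1}"
  proof (rule fundamental_theorem_of_calculus_interior)
    have c: "continuous_on {0..1} (\<lambda>x::real. of_real x powr (w - 1) * of_real (x * ln \<bar>x\<bar>))"
      using w isCont_mult_ln_abs
      by (intro continuous_on_mult continuous_on_of_real powr_continuous_unit continuous_at_imp_continuous_on) auto
    have "continuous_on {0..1} (\<lambda>x::real. of_real x powr w * Ln (of_real x))"
    proof (rule continuous_on_eq[OF c])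
      fix x :: real assume x: "x \<in> {0..1}"
      show "of_real x powr (w - 1) * of_real (x * ln \<bar>x\<bar>) = of_real x powr w * Ln (of_real x)"
        using x by (cases "x = 0") (auto simp: powr_diff Ln_of_real)
    qed
    then show "continuous_on {0..1} (\<lambda>x::real. of_real x powr w * Ln (of_real x) / w - of_real x powr w / w\<^sup>2)"
      using w w0 by (intro continuous_on_diff continuous_on_divide powr_continuous_unit continuous_on_const) auto
    fix x :: real assume x: "x \<in> {0<..<1}"
    have "((\<lambda>y. y powr w * Ln y / w - y powr w / w\<^sup>2) has_field_derivative of_real x powr (w - 1) * Ln (of_real x)) (at (of_real x))"
      using x w0 by (auto intro!: derivative_eq_intros simp: powr_diff field_simps power2_eq_square)
    then show "((\<lambda>x. of_real x powr w * Ln (of_real x) / w - of_real x powr w / w\<^sup>2) has_vector_derivative of_real x powr (w - 1) * Ln (of_real x)) (at x)"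
      by (rule has_vector_derivative_real_field)
  qed auto
  then have "((\<lambda>x. of_real x powr (w - 1) * Ln (of_real x)) has_integral - 1 / w\<^sup>2) {0..1}" by simp
  then have "((\<lambda>x. of_real (ln \<bar>x - 0\<bar> - ln \<bar>1 - 0\<bar>) * of_real x powr (w - 1)) has_integral - 1 / w\<^sup>2) {0..1}"
    by (rule has_integral_spike[of "{0}", rotated 2]) (auto simp: Ln_of_real)
  then show ?thesis unfolding log_moment_def by (rule integral_unique)
qed

text \<open>Expand ln (1 - x) and integrate: the sum of 1 / (n (w + n)) is the partial fraction
  series of Digamma, and -ln (1 - x) itself dominates the partial sums. At p = 1 the normalising
  constant is the default \<open>ln 0 = 0\<close>.\<close>

lemma log_moment_1:
  assumes w: "Re w > 1"
  shows "log_moment 1 w = - (Digamma (1 + w) + euler_mascheroni) / w"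
proof -
  have w0: "w \<noteq> 0" "1 + w \<noteq> 0" using w by (auto simp: complex_eq_iff)
  have v: "norm (complex_of_real x powr (w - 1)) \<le> 1" if "x \<in> {0..1}" for x
    using that w by (auto simp: norm_powr_real_powr intro!: powr_le1)
  have serR: "(\<lambda>n. x ^ n / real n) sums (- ln (1 - x))" if "x \<in> {0..<1}" for x :: real
  proof -
    have "(\<lambda>n. - ((- (- x)) ^ n) / of_nat n) sums ln (1 + - x)" using that by (intro ln_series') auto
    then have "(\<lambda>n. - (- ((- (- x)) ^ n) / of_nat n)) sums - ln (1 + - x)" by (rule sums_minus)
    then show ?thesis by simp
  qed
  have ser: "(\<lambda>n. complex_of_real (x ^ n / real n)) sums (- of_real (ln (1 - x)))" if "x \<in> {0..<1}" for x
    unfolding of_real_minus[symmetric] by (intro sums_of_real serR that)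
  have D: "(\<lambda>n. - (1 / of_nat n * (1 / (w + of_nat n)))) sums (- (Digamma (1 + w) + euler_mascheroni) / w)"
  proof -
    have "(\<lambda>k. inverse (of_nat (Suc k)) - inverse (1 + w + of_nat k)) sums (Digamma (1 + w) + euler_mascheroni)"
      using summable_sums[OF summable_Digamma[OF w0(2)]] by (simp add: Digamma_def)
    then have "(\<lambda>k. - (inverse (of_nat (Suc k)) - inverse (1 + w + of_nat k)) / w) sums (- (Digamma (1 + w) + euler_mascheroni) / w)"
      by (intro sums_divide sums_minus)
    moreover have "- (inverse (of_nat (Suc k)) - inverse (1 + w + of_nat k)) / w = - (1 / of_nat (Suc k) * (1 / (w + of_nat (Suc k))))" for k
    proof -
      have "Re (w + of_nat (Suc k)) > 0" using w by simp
      then have nz: "w + of_nat (Suc k) \<noteq> 0" by (metis less_irrefl zero_complex.simps(1))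
      have e: "1 + w + of_nat k = w + of_nat (Suc k)" by simp
      have n0: "of_nat (Suc k) \<noteq> (0::complex)" by (rule of_nat_neq_0)
      have "inverse n - inverse (w + n) = w * (1 / n * (1 / (w + n)))" if "n \<noteq> 0" "w + n \<noteq> 0" for n
        using that by (simp add: field_simps)
      from this[OF n0 nz] show ?thesis unfolding e using w0 by (simp del: of_nat_Suc)
    qed
    ultimately have "(\<lambda>k. - (1 / of_nat (Suc k) * (1 / (w + of_nat (Suc k))))) sums (- (Digamma (1 + w) + euler_mascheroni) / w)"
      by (simp only:)
    then show ?thesis by (subst (asm) sums_Suc_iff) simp
  qed
  have "((\<lambda>x. of_real (ln \<bar>x - 1\<bar> - ln \<bar>1 - 1\<bar>) * of_real x powr (w - 1)) has_integral - (Digamma (1 + w) + euler_mascheroni) / w) ({0..1} - {1})"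
  proof (rule has_integral_dominated_convergence)
    show "((\<lambda>x. \<Sum>n<N. - (1 / of_nat n * (of_real x powr (w - 1) * of_real x ^ n))) has_integral (\<Sum>n<N. - (1 / of_nat n * (1 / (w + of_nat n))))) ({0..1} - {1})" for N
    proof -
      have "((\<lambda>x. of_real x powr (w - 1) * of_real x ^ n) has_integral 1 / (w + of_nat n)) {0..1}" for n
        using has_integral_powr_unit_mult[of "w - 1" n] w by simp
      then show ?thesis
        unfolding has_integral_Diff_finite[where Z = "{1::real}", OF finite.insertI[OF finite.emptyI]]
        by (intro has_integral_sum has_integral_neg has_integral_mult_right) auto
    qed
    have "(\<lambda>x::real. - ln \<bar>x - 1\<bar>) integrable_on {0..1}"
      using ln_abs_absolutely_integrable[of 1] by (intro integrable_neg) (auto simp: absolutely_integrable_on_def)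
    then show "(\<lambda>x::real. - ln \<bar>x - 1\<bar>) integrable_on {0..1} - {1}"
      unfolding integrable_on_def has_integral_Diff_finite[where Z = "{1::real}", OF finite.insertI[OF finite.emptyI]] .
    show "\<forall>x\<in>{0..1} - {1}. norm (\<Sum>n<N. - (1 / of_nat n * (of_real x powr (w - 1) * of_real x ^ n))) \<le> - ln \<bar>x - 1\<bar>" for N
    proof
      fix x :: real assume x: "x \<in> {0..1} - {1}"
      have s: "(\<lambda>n. x ^ n / real n) sums (- ln (1 - x))"
        using x by (intro serR) auto
      have "norm (\<Sum>n<N. - (1 / of_nat n * (of_real x powr (w - 1) * of_real x ^ n))) \<le> (\<Sum>n<N. x ^ n / real n)"
      proof (rule sum_norm_le)
        fix n
        have "norm (- (1 / of_nat n * (of_real x powr (w - 1) * of_real x ^ n))) = norm (complex_of_real x powr (w - 1)) * (x ^ n / real n)"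
          using x by (simp add: norm_mult norm_divide norm_power)
        also have "\<dots> \<le> 1 * (x ^ n / real n)" using v[of x] x by (intro mult_right_mono) auto
        finally show "norm (- (1 / of_nat n * (of_real x powr (w - 1) * of_real x ^ n))) \<le> x ^ n / real n" by simp
      qed
      also have "\<dots> \<le> (\<Sum>n. x ^ n / real n)" using sums_summable[OF s] x by (intro sum_le_suminf) auto
      also have "\<dots> = - ln \<bar>x - 1\<bar>" using sums_unique[OF s] x by (simp add: abs_minus_commute)
      finally show "norm (\<Sum>n<N. - (1 / of_nat n * (of_real x powr (w - 1) * of_real x ^ n))) \<le> - ln \<bar>x - 1\<bar>" .
    qed
    show "\<forall>x\<in>{0..1} - {1}. (\<lambda>N. \<Sum>n<N. - (1 / of_nat n * (of_real x powr (w - 1) * of_real x ^ n))) \<longlonglongrightarrow> of_real (ln \<bar>x - 1\<bar> - ln \<bar>1 - 1\<bar>) * of_real x powr (w - 1)"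
    proof
      fix x :: real assume x: "x \<in> {0..1} - {1}"
      have "(\<lambda>n. - of_real (x ^ n / real n) * of_real x powr (w - 1)) sums (- (- of_real (ln (1 - x))) * of_real x powr (w - 1))"
        using x by (intro sums_mult2 sums_minus ser) auto
      moreover have "- of_real (x ^ n / real n) * of_real x powr (w - 1) = - (1 / of_nat n * (of_real x powr (w - 1) * of_real x ^ n))" for n
        by simp
      moreover have "- (- complex_of_real (ln (1 - x))) * of_real x powr (w - 1) = of_real (ln \<bar>x - 1\<bar> - ln \<bar>1 - 1\<bar>) * of_real x powr (w - 1)"
        using x by (simp add: abs_minus_commute)
      ultimately show "(\<lambda>N. \<Sum>n<N. - (1 / of_nat n * (of_real x powr (w - 1) * of_real x ^ n))) \<longlonglongrightarrow> of_real (ln \<bar>x - 1\<bar> - ln \<bar>1 - 1\<bar>) * of_real x powr (w - 1)"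
        by (simp only: sums_def)
    qed
    show "(\<lambda>N. \<Sum>n<N. - (1 / of_nat n * (1 / (w + of_nat n)))) \<longlonglongrightarrow> - (Digamma (1 + w) + euler_mascheroni) / w"
      using D by (simp only: sums_def)
  qed
  then have "((\<lambda>x. of_real (ln \<bar>x - 1\<bar> - ln \<bar>1 - 1\<bar>) * of_real x powr (w - 1)) has_integral - (Digamma (1 + w) + euler_mascheroni) / w) {0..1}"
    unfolding has_integral_Diff_finite[where Z = "{1::real}", OF finite.insertI[OF finite.emptyI]] .
  then show ?thesis unfolding log_moment_def by (rule integral_unique)
qed

section \<open>The series in \<open>H\<close>\<close>

lemma lhs_term_scale: "lhs_term a b d s k = lhs_term (a * d) b 1 s k"
  by (simp add: lhs_term_def)

text \<open>The sign change moves index k to -k, which summation in pairs does not notice.\<close>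

lemma lhs_term_uminus: "lhs_term (- a) (- b) d s (- k) = lhs_term a b d s k"
proof -
  have "(of_int (- k) = - b) = (of_int k = b)" "(of_int (- k) = - a * d + - b) = (of_int k = a * d + b)" by auto
  moreover have "- a * d / (- b - of_int (- k)) = a * d / (b - of_int k)"
    by (metis (no_types, opaque_lifting) minus_diff_minus minus_divide_divide mult_minus_left of_int_minus)
  ultimately show ?thesis unfolding lhs_term_def by simp
qed

lemma paired_lhs_term_uminus: "paired (lhs_term (- a) (- b) d s) j = paired (lhs_term a b d s) j"
  using lhs_term_uminus[of a b d s "int j"] lhs_term_uminus[of a b d s "- int j"] lhs_term_uminus[of a b d s 0]
  by (simp add: paired_def add.commute)

lemma lhs_term_eq:
  assumes k: "of_int k \<noteq> b" "of_int k \<noteq> a + b"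
  shows "lhs_term a b 1 s k = - (of_real (a / (of_int k - b)) * (hyp2F1 1 (1 - s) (2 - s) (of_real (a / (of_int k - b))) / (1 - s))) / s"
proof -
  have e: "- (a * 1 / (b - of_int k)) = a / (of_int k - b)"
    by (metis minus_diff_eq minus_divide_right mult.right_neutral)
  then have e2: "a * 1 / (b - of_int k) = - (a / (of_int k - b))" by linarith
  show ?thesis using k unfolding lhs_term_def e unfolding e2 by (simp add: mult.commute)
qed

text \<open>The reciprocal of the 2F1 argument is the zero of a x + b - k; this is where the
  hypergeometric series meets the sine product.\<close>

lemma lhs_term_formula:
  assumes a: "a > 0" and k: "of_int k \<noteq> b" "of_int k \<noteq> a + b" and s: "s \<notin> \<nat>" "Re s < real M - 2"
  defines "z \<equiv> a / (of_int k - b)"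
  shows "lhs_term a b 1 s k = - ((\<Sum>m<M. of_real z ^ Suc m / (of_nat (Suc m) - s))
    + of_real z ^ M * ((of_nat M - s) * log_moment ((of_int k - b) / a) (of_nat M - s)
      - (if z > 1 then \<i> * of_real pi * of_real z powr (s - of_nat M) else 0))) / s"
proof -
  have z: "z \<noteq> 0" "z \<noteq> 1" using a k by (auto simp: z_def)
  have "1 / z = (of_int k - b) / a" by (simp add: z_def)
  then show ?thesis using hyp2F1_log_moment[OF z s] unfolding lhs_term_eq[OF k] z_def[symmetric] by simp
qed

text \<open>Holomorphy is local, so \<open>M\<close> may be chosen after the point; the explicit
  formula is then singular at naturals only.\<close>

lemma lhs_term_holomorphic:
  assumes a: "a > 0"
  shows "(\<lambda>s. lhs_term a b 1 s k) holomorphic_on - \<nat>"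
proof (cases "of_int k = b \<or> of_int k = a + b")
  case True
  then show ?thesis by (auto simp: lhs_term_def)
next
  case False
  then have k: "of_int k \<noteq> b" "of_int k \<noteq> a + b" by auto
  define z where "z = a / (of_int k - b)"
  have z: "z \<noteq> 0" using a k by (auto simp: z_def)
  have "\<exists>D. ((\<lambda>s. lhs_term a b 1 s k) has_field_derivative D) (at s0)" if s0: "s0 \<in> - \<nat>" for s0
  proof -
    obtain M :: nat where M: "real M > Re s0 + 2" using reals_Archimedean2 by blast
    define A where "A = {s. Re s < real M - 2} - \<nat>"
    have oA: "open A" unfolding A_def by (intro open_Diff open_halfspace_Re_lt closed_Nats)
    have lm: "(\<lambda>s. log_moment ((of_int k - b) / a) (of_nat M - s)) holomorphic_on A"
      by (rule holomorphic_on_compose_gen[OF _ log_moment_holomorphic[of "(of_int k - b) / a"], unfolded o_def])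
         (auto simp: A_def intro!: holomorphic_intros)
    have "(\<lambda>s. - ((\<Sum>m<M. of_real z ^ Suc m / (of_nat (Suc m) - s))
      + of_real z ^ M * ((of_nat M - s) * log_moment ((of_int k - b) / a) (of_nat M - s)
        - (if z > 1 then \<i> * of_real pi * of_real z powr (s - of_nat M) else 0))) / s) holomorphic_on A"
      using z by (cases "z > 1") (auto intro!: holomorphic_intros lm[unfolded A_def] simp: A_def not_Nats_of_nat_diff simp del: of_nat_Suc)
    then have "(\<lambda>s. lhs_term a b 1 s k) holomorphic_on A"
      by (rule holomorphic_transform) (use lhs_term_formula[OF a k, folded z_def] in \<open>auto simp: A_def\<close>)
    moreover have "s0 \<in> A" using s0 M by (auto simp: A_def)
    ultimately show ?thesis using oA by (auto simp: holomorphic_on_open)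
  qed
  then show ?thesis by (simp add: holomorphic_on_open open_Compl_Nats)
qed

text \<open>The first summand of the 2F1 series is of order 1 / k and has to be exhibited, since it
  becomes summable only after pairing. As |z| \<le> 1/2, a geometric series bounds the rest by 2 z^2
  / \<delta>; the second \<delta> comes from dividing by \<open>s\<close>.\<close>

lemma lhs_term_expansion:
  fixes a b d :: real and k :: int and s :: complex
  assumes \<delta>: "\<delta> > 0" "\<And>m. norm (of_nat m - s) \<ge> \<delta>"
    and k: "2 * \<bar>a * d\<bar> \<le> \<bar>of_int k - b\<bar>" "of_int k \<noteq> b"
  defines "z \<equiv> a * d / (of_int k - b)"
  shows "norm (lhs_term a b d s k + of_real z / (1 - s) / s) \<le> 2 * z\<^sup>2 / \<delta>\<^sup>2"
proof (cases "a * d = 0")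
  case True
  then show ?thesis by (auto simp: lhs_term_def z_def)
next
  case False
  have s: "s \<notin> \<nat>" using \<delta> by (auto elim!: Nats_cases) (metis diff_self linorder_not_less norm_zero)
  have kn: "of_int k \<noteq> a * d + b" using k False by auto
  have zb: "\<bar>z\<bar> \<le> 1 / 2" using k by (simp add: z_def abs_divide field_simps)
  obtain M :: nat where M: "Re s < real M" using reals_Archimedean2 by blast
  have nz: "norm (complex_of_real z) < 1" using zb by simp
  define Y where "Y = hyp2F1 1 (1 - s) (2 - s) (of_real z) / (1 - s)"
  have s1: "1 - s \<noteq> 0" using not_Nats_of_nat_diff[OF s, of 1] by simp
  have "\<not> 1 \<le> z" using zb by linarith
  then have "Y = hyp2F1_moment M s (of_real z)"
    unfolding Y_def using hyp2F1_slit_eq_hyp2F1_moment[OF s M unit_disc_subset_slit[OF nz]] s1 by (simp add: hyp2F1_def)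
  then have "(\<lambda>m. of_real z ^ m / (of_nat (Suc m) - s)) sums Y" using hyp2F1_moment_sums[OF nz M] by simp
  then have "(\<lambda>m. of_real z * (of_real z ^ m / (of_nat (Suc m) - s))) sums (of_real z * Y)" by (rule sums_mult)
  then have S: "(\<lambda>m. of_real z ^ Suc m / (of_nat (Suc m) - s)) sums (of_real z * Y)" by (simp del: of_nat_Suc)
  then have S2: "(\<lambda>m. of_real z ^ Suc (Suc m) / (of_nat (Suc (Suc m)) - s)) sums (of_real z * Y - of_real z / (1 - s))"
    by (subst sums_Suc_iff[of "\<lambda>m. of_real z ^ Suc m / (of_nat (Suc m) - s)"]) simp
  have b: "norm (complex_of_real z ^ Suc (Suc m) / (of_nat (Suc (Suc m)) - s)) \<le> z\<^sup>2 / \<delta> * (1/2) ^ m" for m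
  proof -
    have "norm (complex_of_real z ^ Suc (Suc m) / (of_nat (Suc (Suc m)) - s)) = (z\<^sup>2 * \<bar>z\<bar> ^ m) / norm (of_nat (Suc (Suc m)) - s)"
      by (simp add: norm_divide norm_power norm_mult power2_eq_square abs_mult_self_eq mult.assoc[symmetric] del: of_nat_Suc)
    also have "\<dots> \<le> (z\<^sup>2 * (1/2) ^ m) / \<delta>"
      using zb \<delta>(1) \<delta>(2)[of "Suc (Suc m)"]
      by (intro frac_le mult_left_mono power_mono) (auto simp del: of_nat_Suc)
    finally show ?thesis by simp
  qed
  have sm: "summable (\<lambda>m. z\<^sup>2 / \<delta> * (1/2) ^ m :: real)" by (intro summable_mult summable_geometric) auto
  have sn: "summable (\<lambda>m. norm (complex_of_real z ^ Suc (Suc m) / (of_nat (Suc (Suc m)) - s)))"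
    by (rule summable_comparison_test[OF exI[of _ 0] sm]) (intro allI impI, simp only: real_norm_def abs_norm_cancel b)
  have "norm (of_real z * Y - of_real z / (1 - s)) \<le> (\<Sum>m. norm (complex_of_real z ^ Suc (Suc m) / (of_nat (Suc (Suc m)) - s)))"
    unfolding sums_unique[OF S2] by (rule summable_norm[OF sn])
  also have "\<dots> \<le> (\<Sum>m. z\<^sup>2 / \<delta> * (1/2) ^ m)" by (rule suminf_le[OF b sn sm])
  also have "\<dots> = z\<^sup>2 / \<delta> * 2" by (subst suminf_mult) (auto simp: suminf_geometric intro!: summable_geometric)
  finally have R: "norm (of_real z * Y - of_real z / (1 - s)) \<le> 2 * z\<^sup>2 / \<delta>" by (simp add: mult.commute)
  have sn: "norm s \<ge> \<delta>" using \<delta>(2)[of 0] by simp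
  have "lhs_term a b d s k = - (of_real z * Y) / s"
    unfolding Y_def lhs_term_scale[of a b d] z_def using k kn by (intro lhs_term_eq) auto
  then have "lhs_term a b d s k + of_real z / (1 - s) / s = - ((of_real z * Y - of_real z / (1 - s)) / s)"
    by (simp add: diff_divide_distrib)
  then have "norm (lhs_term a b d s k + of_real z / (1 - s) / s) = norm (of_real z * Y - of_real z / (1 - s)) / norm s"
    by (simp add: norm_divide)
  also have "\<dots> \<le> (2 * z\<^sup>2 / \<delta>) / \<delta>" using R sn \<delta>(1) by (intro frac_le) auto
  finally show ?thesis by (simp add: power2_eq_square)
qed

text \<open>The leading parts 1 / (k - b) for k = j and k = -j combine to order 1 / j^2 and account
  for 4 C B; the two remainders account for 8 C^2 each. The threshold on \<open>j\<close> keeps |k -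
  b| above j / 2.\<close>

lemma paired_lhs_term_bound:
  fixes a b d B C :: real and j :: nat and s :: complex
  assumes \<delta>: "\<delta> > 0" "\<And>m. norm (of_nat m - s) \<ge> \<delta>"
    and bC: "\<bar>b\<bar> \<le> B" "\<bar>a * d\<bar> \<le> C" and j: "real j \<ge> 2 * B + 4 * C + 1"
  shows "norm (paired (lhs_term a b d s) j) \<le> (4 * C * B + 16 * C\<^sup>2) / \<delta>\<^sup>2 / (real j)\<^sup>2"
proof -
  define c where "c = a * d"
  have B0: "B \<ge> 0" and C0: "C \<ge> 0" using bC abs_ge_zero order_trans by blast+
  then have j0: "real j > 0" using j by linarith
  define z where "z = (\<lambda>k::real. c / (k - b))"
  have kb: "\<bar>k - b\<bar> \<ge> real j / 2" if "\<bar>k\<bar> = real j" for k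
  proof -
    have "\<bar>k\<bar> \<le> \<bar>k - b\<bar> + \<bar>b\<bar>" by linarith
    then show ?thesis using that j bC(1) B0 C0 by linarith
  qed
  have zb: "\<bar>z k\<bar> \<le> 2 * C / real j" if "\<bar>k\<bar> = real j" for k
  proof -
    have "\<bar>z k\<bar> = \<bar>c\<bar> / \<bar>k - b\<bar>" by (simp add: z_def abs_divide)
    also have "\<dots> \<le> C / (real j / 2)" using kb[OF that] bC(2) j0 C0 by (intro frac_le) (auto simp: c_def)
    finally show ?thesis by (simp add: mult.commute)
  qed
  have ex: "norm (lhs_term a b d s k + of_real (z (of_int k)) / (1 - s) / s) \<le> 8 * C\<^sup>2 / (real j)\<^sup>2 / \<delta>\<^sup>2" if k: "\<bar>of_int k\<bar> = real j" for k
  proof -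
    have "2 * \<bar>a * d\<bar> \<le> \<bar>of_int k - b\<bar>" using kb[OF k] j bC B0 C0 by linarith
    moreover have "of_int k \<noteq> b" using kb[OF k] j0 by auto
    ultimately have "norm (lhs_term a b d s k + of_real (z (of_int k)) / (1 - s) / s) \<le> 2 * (z (of_int k))\<^sup>2 / \<delta>\<^sup>2"
      unfolding z_def c_def by (intro lhs_term_expansion \<delta>)
    also have "\<dots> \<le> 2 * (2 * C / real j)\<^sup>2 / \<delta>\<^sup>2"
      using zb[OF k] by (intro divide_right_mono mult_left_mono) (auto intro: power2_le_iff_abs_le[THEN iffD2] simp: abs_le_square_iff[symmetric] C0)
    finally show ?thesis by (simp add: power_divide power_mult_distrib)
  qed
  have zz: "\<bar>z (real j) + z (- real j)\<bar> \<le> 4 * C * B / (real j)\<^sup>2"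
  proof -
    have nz: "real j - b \<noteq> 0" "- real j - b \<noteq> 0" using kb[of "real j"] kb[of "- real j"] j0 by auto
    have "z (real j) + z (- real j) = c * (- 2 * b) / ((real j - b) * (- real j - b))"
      unfolding z_def using nz by (simp add: add_frac_eq algebra_simps)
    then have "\<bar>z (real j) + z (- real j)\<bar> = \<bar>c\<bar> * (2 * \<bar>b\<bar>) / (\<bar>real j - b\<bar> * \<bar>- real j - b\<bar>)"
      by (simp add: abs_mult abs_divide)
    also have "\<dots> \<le> C * (2 * B) / (real j * real j / 2)"
    proof (intro frac_le mult_mono)
      have bj: "\<bar>b\<bar> \<le> real j / 2" using bC(1) j C0 by linarith
      then have "\<bar>real j - b\<bar> * \<bar>- real j - b\<bar> = (real j - \<bar>b\<bar>) * (real j + \<bar>b\<bar>)"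
      proof -
        have "real j - b > 0" "- real j - b < 0" using bj j0 by auto
        then have "\<bar>real j - b\<bar> * \<bar>- real j - b\<bar> = (real j - b) * (real j + b)" by simp
        also have "\<dots> = (real j - \<bar>b\<bar>) * (real j + \<bar>b\<bar>)" by (simp add: algebra_simps)
        finally show ?thesis .
      qed
      moreover have "(real j - \<bar>b\<bar>) * (real j + \<bar>b\<bar>) = real j * real j - \<bar>b\<bar> * \<bar>b\<bar>" by (simp add: algebra_simps)
      moreover have "\<bar>b\<bar> * \<bar>b\<bar> \<le> real j / 2 * (real j / 2)" using bj by (intro mult_mono) auto
      moreover have "real j / 2 * (real j / 2) = real j * real j / 4" by simp
      moreover have "real j * real j \<ge> 0" by simp
      ultimately show "real j * real j / 2 \<le> \<bar>real j - b\<bar> * \<bar>- real j - b\<bar>" by linarith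
    qed (use bC B0 C0 j0 in \<open>auto simp: c_def\<close>)
    finally show ?thesis by (simp add: power2_eq_square mult_ac)
  qed
  have jn: "j \<noteq> 0" using j0 by auto
  have sn: "norm s \<ge> \<delta>" "norm (1 - s) \<ge> \<delta>" using \<delta>(2)[of 0] \<delta>(2)[of 1] by auto
  define X where "X = (\<lambda>k. lhs_term a b d s k + of_real (z (of_int k)) / (1 - s) / s)"
  have "paired (lhs_term a b d s) j = X (int j) + X (- int j) - of_real (z (real j) + z (- real j)) / (1 - s) / s"
    using jn by (simp add: paired_def X_def add_divide_distrib)
  also have "norm \<dots> \<le> norm (X (int j)) + norm (X (- int j)) + norm (complex_of_real (z (real j) + z (- real j)) / (1 - s) / s)"
    by (rule order_trans[OF norm_triangle_ineq4]) (simp add: norm_triangle_ineq)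
  also have "\<dots> \<le> 8 * C\<^sup>2 / (real j)\<^sup>2 / \<delta>\<^sup>2 + 8 * C\<^sup>2 / (real j)\<^sup>2 / \<delta>\<^sup>2 + 4 * C * B / (real j)\<^sup>2 / \<delta>\<^sup>2"
  proof (intro add_mono)
    show "norm (X (int j)) \<le> 8 * C\<^sup>2 / (real j)\<^sup>2 / \<delta>\<^sup>2" unfolding X_def by (rule ex) simp
    show "norm (X (- int j)) \<le> 8 * C\<^sup>2 / (real j)\<^sup>2 / \<delta>\<^sup>2" unfolding X_def by (rule ex) simp
    have "norm (complex_of_real (z (real j) + z (- real j)) / (1 - s) / s) = \<bar>z (real j) + z (- real j)\<bar> / (norm (1 - s) * norm s)"
      by (simp add: norm_divide norm_mult del: of_real_add)
    also have "\<dots> \<le> (4 * C * B / (real j)\<^sup>2) / (\<delta> * \<delta>)"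
      using zz sn \<delta>(1) B0 C0 by (intro frac_le mult_mono) auto
    finally show "norm (complex_of_real (z (real j) + z (- real j)) / (1 - s) / s) \<le> 4 * C * B / (real j)\<^sup>2 / \<delta>\<^sup>2"
      by (simp add: power2_eq_square)
  qed
  also have "\<dots> = (4 * C * B + 16 * C\<^sup>2) / \<delta>\<^sup>2 / (real j)\<^sup>2" by (simp add: add_divide_distrib mult.commute)
  finally show ?thesis .
qed

lemma summable_inverse_squares: "summable (\<lambda>j. K / (real j)\<^sup>2)"
  using inverse_power_summable[of 2, where ?'a = real] by (simp add: divide_inverse summable_mult)

lemma abs_unif_convergent_onI:
  assumes "\<And>j x. j \<ge> J \<Longrightarrow> x \<in> X \<Longrightarrow> norm (f j x) \<le> g j" "summable g"
  shows "abs_unif_convergent_on X f"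
  unfolding abs_unif_convergent_on_def
proof
  have ev: "\<forall>\<^sub>F j in sequentially. \<forall>x\<in>X. norm (f j x) \<le> g j"
    using eventually_ge_at_top[of J] by eventually_elim (use assms in auto)
  show "uniformly_convergent_on X (\<lambda>N x. \<Sum>j<N. f j x)"
    using Weierstrass_m_test_ev[OF ev assms(2)] by (auto simp: uniformly_convergent_on_def)
  have ev: "\<forall>\<^sub>F j in sequentially. \<forall>x\<in>X. norm (norm (f j x)) \<le> g j"
    using ev by simp
  show "uniformly_convergent_on X (\<lambda>N x. \<Sum>j<N. norm (f j x))"
    using Weierstrass_m_test_ev[OF ev assms(2)] by (auto simp: uniformly_convergent_on_def)
qed

text \<open>A natural above \<epsilon> is kept away from the half-plane Re s < \<epsilon> by the gap
  between \<epsilon> and the next integer; the finitely many others are at distance \<delta> by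
  definition of the region.\<close>

lemma left_region_separated:
  fixes \<epsilon> \<delta> :: real
  assumes "\<epsilon> > 0" "\<delta> > 0"
  shows "\<exists>\<delta>'>0. \<forall>s\<in>left_region \<epsilon> \<delta>. \<forall>m. \<delta>' \<le> norm (of_nat m - s)"
proof -
  define n where "n = nat \<lfloor>\<epsilon>\<rfloor> + 1"
  have n: "real n > \<epsilon>" unfolding n_def by linarith
  have "min \<delta> (real n - \<epsilon>) \<le> norm (of_nat m - s)" if s: "s \<in> left_region \<epsilon> \<delta>" for s m
  proof (cases "real m \<le> \<epsilon>")
    case True
    then show ?thesis using s by (auto simp: left_region_def dist_norm norm_minus_commute min_le_iff_disj)
  next
    case False
    then have "\<lfloor>\<epsilon>\<rfloor> < int m" by (simp add: floor_less_iff)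
    moreover have "0 \<le> \<lfloor>\<epsilon>\<rfloor>" using assms by simp
    ultimately have "m \<ge> n" unfolding n_def by linarith
    then have "real n - \<epsilon> \<le> Re (of_nat m - s)" using s by (auto simp: left_region_def)
    also have "\<dots> \<le> norm (of_nat m - s)" by (rule complex_Re_le_cmod)
    finally show ?thesis by simp
  qed
  moreover have "min \<delta> (real n - \<epsilon>) > 0" using n assms by simp
  ultimately show ?thesis by blast
qed

text \<open>The parameters are functions on an abstract set, so that the claims of uniformity in
  \<open>s\<close>, in \<open>b\<close>, in \<open>a\<close> and \<open>d\<close>, and in all of
  them jointly become instances.\<close>

lemma lhs_abs_unif_convergent:
  assumes "\<epsilon> > 0" "\<delta> > 0"
    and X: "\<And>x. x \<in> X \<Longrightarrow> S x \<in> left_region \<epsilon> \<delta> \<and> \<bar>b x\<bar> \<le> B \<and> \<bar>a x * d x\<bar> \<le> C"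
  shows "abs_unif_convergent_on X (\<lambda>j x. paired (lhs_term (a x) (b x) (d x) (S x)) j)"
proof -
  obtain \<delta>' where \<delta>': "\<delta>' > 0" "\<And>s m. s \<in> left_region \<epsilon> \<delta> \<Longrightarrow> \<delta>' \<le> norm (of_nat m - s)"
    using left_region_separated[OF assms(1,2)] by blast
  show ?thesis
  proof (rule abs_unif_convergent_onI)
    fix j x assume j: "j \<ge> nat \<lceil>2 * B + 4 * C + 1\<rceil>" and x: "x \<in> X"
    have "real j \<ge> 2 * B + 4 * C + 1" using j by linarith
    then show "norm (paired (lhs_term (a x) (b x) (d x) (S x)) j) \<le> (4 * C * B + 16 * C\<^sup>2) / \<delta>'\<^sup>2 / (real j)\<^sup>2"
      using X[OF x] \<delta>' by (intro paired_lhs_term_bound) auto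
  qed (rule summable_inverse_squares)
qed

lemma lhs_term_summable:
  assumes "s \<notin> \<nat>"
  shows "summable (\<lambda>j. norm (paired (lhs_term a b d s) j))"
proof -
  obtain \<delta> where \<delta>: "\<delta> > 0" "\<And>m w. w \<in> ball s \<delta> \<Longrightarrow> norm (of_nat m - w) \<ge> \<delta>"
    using Nats_dist_pos[OF assms] by blast
  show ?thesis
  proof (rule summable_comparison_test)
    show "\<exists>N. \<forall>j\<ge>N. norm (norm (paired (lhs_term a b d s) j)) \<le> (4 * \<bar>a * d\<bar> * \<bar>b\<bar> + 16 * \<bar>a * d\<bar>\<^sup>2) / \<delta>\<^sup>2 / (real j)\<^sup>2"
    proof (intro exI allI impI)
      fix j assume j: "j \<ge> nat \<lceil>2 * \<bar>b\<bar> + 4 * \<bar>a * d\<bar> + 1\<rceil>"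
      have "real j \<ge> 2 * \<bar>b\<bar> + 4 * \<bar>a * d\<bar> + 1" using j by linarith
      then show "norm (norm (paired (lhs_term a b d s) j)) \<le> (4 * \<bar>a * d\<bar> * \<bar>b\<bar> + 16 * \<bar>a * d\<bar>\<^sup>2) / \<delta>\<^sup>2 / (real j)\<^sup>2"
        using paired_lhs_term_bound[of \<delta> s b "\<bar>b\<bar>" a d "\<bar>a * d\<bar>" j] \<delta> by simp
    qed
  qed (rule summable_inverse_squares)
qed

lemma paired_lhs_term_holomorphic:
  assumes "a > 0"
  shows "(\<lambda>s. paired (lhs_term a b 1 s) j) holomorphic_on - \<nat>"
  unfolding paired_def using lhs_term_holomorphic[OF assms] by (cases "j = 0") (auto intro!: holomorphic_intros)

lemma lhs_tail_holomorphic: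
  assumes a: "a > 0"
  shows "(\<lambda>s. \<Sum>j. paired (lhs_term a b 1 s) (j + J)) holomorphic_on - \<nat>"
proof (rule holomorphic_on_suminf_local[OF open_Compl_Nats])
  show "(\<lambda>s. paired (lhs_term a b 1 s) (n + J)) holomorphic_on - \<nat>" for n by (rule paired_lhs_term_holomorphic[OF a])
  fix z :: complex assume "z \<in> - \<nat>"
  then obtain \<delta> where \<delta>: "\<delta> > 0" "\<And>m w. w \<in> ball z \<delta> \<Longrightarrow> norm (of_nat m - w) \<ge> \<delta>"
    using Nats_dist_pos by blast
  define K where "K = (4 * \<bar>a * 1\<bar> * \<bar>b\<bar> + 16 * \<bar>a * 1\<bar>\<^sup>2) / \<delta>\<^sup>2"
  have "norm (paired (lhs_term a b 1 w) (n + J)) \<le> K / (real (n + J))\<^sup>2"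
    if "n \<ge> nat \<lceil>2 * \<bar>b\<bar> + 4 * \<bar>a * 1\<bar> + 1\<rceil>" "w \<in> ball z \<delta>" for n w
  proof -
    have "real (n + J) \<ge> 2 * \<bar>b\<bar> + 4 * \<bar>a * 1\<bar> + 1" using that(1) by linarith
    then show ?thesis unfolding K_def using paired_lhs_term_bound[of \<delta> w b "\<bar>b\<bar>" a 1 "\<bar>a * 1\<bar>" "n + J"] \<delta> that(2) by blast
  qed
  moreover have "summable (\<lambda>n. K / (real (n + J))\<^sup>2)"
    using summable_inverse_squares[of K] by (subst summable_iff_shift) 
  ultimately show "\<exists>r>0. \<exists>M N. summable M \<and> (\<forall>n\<ge>N. \<forall>w\<in>ball z r \<inter> - \<nat>. norm (paired (lhs_term a b 1 w) (n + J)) \<le> M n)"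
    using \<delta>(1) by (intro exI[of _ \<delta>] conjI exI[of _ "\<lambda>n. K / (real (n + J))\<^sup>2"] exI[of _ "nat \<lceil>2 * \<bar>b\<bar> + 4 * \<bar>a * 1\<bar> + 1\<rceil>"]) auto
qed

lemma lhs_sum_holomorphic:
  assumes "a > 0"
  shows "(\<lambda>s. \<Sum>j. paired (lhs_term a b 1 s) j) holomorphic_on - \<nat>"
  using lhs_tail_holomorphic[OF assms, of b 0] by simp

section \<open>Meromorphic continuation of the series in s\<close>

lemma meromorphic_at_transform:
  assumes "f meromorphic_on {z}" "\<forall>\<^sub>F w in at z. f w = g w"
  shows "g meromorphic_on {z}"
  using assms meromorphic_on_cong[of "{z}" f g "{z}"] by auto

text \<open>Multiplication by (s - n)^2 makes \<open>f\<close> bounded near n, so Riemann's theorem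
  removes the singularity of the product and leaves at most a double pole for
  \<open>f\<close>.\<close>

lemma meromorphic_near_Nat:
  fixes n :: nat
  assumes hol: "f holomorphic_on (- \<nat>)"
    and bd: "\<And>s. 0 < dist s (of_nat n) \<Longrightarrow> dist s (of_nat n) < 1 / 2 \<Longrightarrow> norm (f s) \<le> B / (dist s (of_nat n))\<^sup>2"
  shows "f meromorphic_on {of_nat n}"
proof -
  define c where "c = (of_nat n :: complex)"
  define g where "g = (\<lambda>s. (s - c)\<^sup>2 * f s)"
  have sub: "ball c (1/2) - {c} \<subseteq> - \<nat>"
  proof
    fix s assume s: "s \<in> ball c (1/2) - {c}"
    show "s \<in> - \<nat>"
    proof
      assume "s \<in> \<nat>"
      then obtain m where m: "s = of_nat m" by (auto elim: Nats_cases)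
      have "real_of_int \<bar>int n - int m\<bar> < 1 / 2" using s unfolding m c_def mem_ball Diff_iff dist_of_nat by simp
      then have "n = m" by linarith
      then show False using s m c_def by simp
    qed
  qed
  have gh: "g holomorphic_on ball c (1/2) - {c}"
    unfolding g_def by (intro holomorphic_intros holomorphic_on_subset[OF hol sub])
  have "\<forall>\<^sub>F s in at c. norm (g s) \<le> B"
  proof -
    have "\<forall>\<^sub>F s in at c. s \<in> ball c (1/2) - {c}" by (rule eventually_at_in_open) auto
    then show ?thesis
    proof eventually_elim
      case (elim s)
      then have d: "0 < dist s c" "dist s c < 1 / 2" by (auto simp: dist_commute)
      have "norm (g s) = (dist s c)\<^sup>2 * norm (f s)" by (simp add: g_def norm_mult norm_power dist_norm)
      also have "\<dots> \<le> (dist s c)\<^sup>2 * (B / (dist s c)\<^sup>2)"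
        using bd[folded c_def, OF d] by (intro mult_left_mono) auto
      also have "\<dots> = B" using d by simp
      finally show ?case .
    qed
  qed
  then obtain h where h: "h holomorphic_on ball c (1/2)" "\<And>z. z \<in> ball c (1/2) - {c} \<Longrightarrow> h z = g z"
    using holomorphic_on_extend_bounded[OF gh] by (auto simp: interior_open)
  have "h analytic_on {c}"
    using h(1) by (auto simp: analytic_at intro!: exI[of _ "ball c (1/2)"])
  then have "(\<lambda>s. h s / (s - c)\<^sup>2) meromorphic_on {c}"
    by (intro meromorphic_intros analytic_on_imp_meromorphic_on)
  moreover have "\<forall>\<^sub>F s in at c. h s / (s - c)\<^sup>2 = f s"
  proof -
    have "\<forall>\<^sub>F s in at c. s \<in> ball c (1/2) - {c}" by (rule eventually_at_in_open) auto
    then show ?thesis by eventually_elim (auto simp: h(2) g_def)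
  qed
  ultimately show ?thesis unfolding c_def[symmetric] by (rule meromorphic_at_transform)
qed

lemma lhs_term_meromorphic:
  assumes a: "a > 0"
  shows "(\<lambda>s. lhs_term a b 1 s k) meromorphic_on {s0}"
proof (cases "of_int k = b \<or> of_int k = a + b")
  case True
  then show ?thesis by (auto simp: lhs_term_def)
next
  case False
  then have k: "of_int k \<noteq> b" "of_int k \<noteq> a + b" by auto
  define z where "z = a / (of_int k - b)"
  have z: "z \<noteq> 0" using a k by (auto simp: z_def)
  obtain M :: nat where M: "real M > Re s0 + 2" using reals_Archimedean2 by blast
  define A where "A = {s. Re s < real M - 2}"
  have oA: "open A" unfolding A_def by (rule open_halfspace_Re_lt)
  have sA: "s0 \<in> A" using M by (simp add: A_def)
  have "(\<lambda>s. log_moment ((of_int k - b) / a) (of_nat M - s)) holomorphic_on A"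
    by (rule holomorphic_on_compose_gen[OF _ log_moment_holomorphic[of "(of_int k - b) / a"], unfolded o_def])
       (auto simp: A_def intro!: holomorphic_intros)
  then have lm: "(\<lambda>s. log_moment ((of_int k - b) / a) (of_nat M - s)) analytic_on {s0}"
    using oA sA by (auto simp: analytic_at)
  have pw: "(\<lambda>s. if z > 1 then \<i> * of_real pi * of_real z powr (s - of_nat M) else 0) analytic_on {s0}"
    using z by (cases "z > 1") (auto intro!: analytic_intros)
  have "(\<lambda>s. - ((\<Sum>m<M. of_real z ^ Suc m / (of_nat (Suc m) - s))
      + of_real z ^ M * ((of_nat M - s) * log_moment ((of_int k - b) / a) (of_nat M - s)
        - (if z > 1 then \<i> * of_real pi * of_real z powr (s - of_nat M) else 0))) / s) meromorphic_on {s0}"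
    by (intro meromorphic_on_divide meromorphic_on_uminus meromorphic_on_add meromorphic_on_sum meromorphic_on_mult
        meromorphic_on_diff meromorphic_on_const meromorphic_on_id
        analytic_on_imp_meromorphic_on[OF lm] analytic_on_imp_meromorphic_on[OF pw])
  moreover have "\<forall>\<^sub>F s in at s0. - ((\<Sum>m<M. of_real z ^ Suc m / (of_nat (Suc m) - s))
      + of_real z ^ M * ((of_nat M - s) * log_moment ((of_int k - b) / a) (of_nat M - s)
        - (if z > 1 then \<i> * of_real pi * of_real z powr (s - of_nat M) else 0))) / s = lhs_term a b 1 s k"
  proof -
    have "\<forall>\<^sub>F s in at s0. s \<in> A - {s0}" using oA sA by (intro eventually_at_in_open) auto
    then show ?thesis using eventually_at_not_Nats[of s0]
      by eventually_elim (use lhs_term_formula[OF a k, folded z_def] in \<open>auto simp: A_def\<close>)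
  qed
  ultimately show ?thesis by (rule meromorphic_at_transform)
qed

text \<open>Near a natural n the uniform pair bound holds with \<delta> the distance from
  \<open>s\<close> to n, so the tail of the series grows at most like the inverse square of that
  distance; finitely many initial pairs are treated singly.\<close>

lemma lhs_sum_meromorphic_pos:
  assumes a: "a > 0"
  shows "(\<lambda>s. \<Sum>j. paired (lhs_term a b 1 s) j) meromorphic_on UNIV"
  unfolding meromorphic_on_meromorphic_at[of _ UNIV]
proof
  fix s0 :: complex
  show "(\<lambda>s. \<Sum>j. paired (lhs_term a b 1 s) j) meromorphic_on {s0}"
  proof (cases "s0 \<in> \<nat>")
    case False
    then show ?thesis using lhs_sum_holomorphic[OF a, of b] open_Compl_Nats
      by (intro analytic_on_imp_meromorphic_on) (auto simp: analytic_at)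
  next
    case True
    then obtain n where n: "s0 = of_nat n" by (auto elim: Nats_cases)
    \<comment> \<open>The index threshold of \<open>paired_lhs_term_bound\<close> for the present
      values of \<open>a\<close> and \<open>b\<close>.\<close>
    define J where "J = nat \<lceil>2 * \<bar>b\<bar> + 4 * \<bar>a * 1\<bar> + 1\<rceil>"
    define L where "L = 4 * \<bar>a * 1\<bar> * \<bar>b\<bar> + 16 * \<bar>a * 1\<bar>\<^sup>2"
    define T where "T = (\<lambda>s. \<Sum>j. paired (lhs_term a b 1 s) (j + J))"
    have Th: "T holomorphic_on - \<nat>" unfolding T_def by (rule lhs_tail_holomorphic[OF a])
    have sK: "summable (\<lambda>j. K / (real (j + J))\<^sup>2)" for K
      using summable_inverse_squares[of K] by (subst summable_iff_shift)
    have T: "T meromorphic_on {of_nat n}"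
    proof (rule meromorphic_near_Nat[OF Th])
      fix s :: complex assume d: "0 < dist s (of_nat n)" "dist s (of_nat n) < 1 / 2"
      define \<delta> where "\<delta> = dist s (of_nat n)"
      have \<delta>: "\<delta> > 0" using d by (simp add: \<delta>_def)
      have dm: "\<delta> \<le> norm (of_nat m - s)" for m
      proof (cases "m = n")
        case True
        then show ?thesis by (simp add: \<delta>_def dist_norm norm_minus_commute)
      next
        case False
        then have "1 \<le> real_of_int \<bar>int m - int n\<bar>" by linarith
        also have "\<dots> = dist (of_nat m :: complex) (of_nat n)" by (rule dist_of_nat[symmetric])
        also have "\<dots> \<le> dist (of_nat m) s + dist s (of_nat n)" by (rule dist_triangle)
        finally show ?thesis using d by (simp add: \<delta>_def dist_norm)
      qed
      have b: "norm (paired (lhs_term a b 1 s) (j + J)) \<le> L / \<delta>\<^sup>2 / (real (j + J))\<^sup>2" for j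
      proof -
        have "real (j + J) \<ge> 2 * \<bar>b\<bar> + 4 * \<bar>a * 1\<bar> + 1" unfolding J_def by linarith
        then show ?thesis unfolding L_def using paired_lhs_term_bound[of \<delta> s b "\<bar>b\<bar>" a 1 "\<bar>a * 1\<bar>" "j + J"] \<delta> dm by blast
      qed
      have sn: "summable (\<lambda>j. norm (paired (lhs_term a b 1 s) (j + J)))"
        by (rule summable_comparison_test[OF exI[of _ 0] sK[of "L / \<delta>\<^sup>2"]]) (use b in simp)
      have "norm (T s) \<le> (\<Sum>j. norm (paired (lhs_term a b 1 s) (j + J)))" unfolding T_def by (rule summable_norm[OF sn])
      also have "\<dots> \<le> (\<Sum>j. L / \<delta>\<^sup>2 / (real (j + J))\<^sup>2)" by (rule suminf_le[OF b sn sK])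
      also have "\<dots> = (\<Sum>j. 1 / \<delta>\<^sup>2 * (L / (real (j + J))\<^sup>2))" by simp
      also have "\<dots> = 1 / \<delta>\<^sup>2 * (\<Sum>j. L / (real (j + J))\<^sup>2)" by (rule suminf_mult[OF sK])
      finally show "norm (T s) \<le> (\<Sum>j. L / (real (j + J))\<^sup>2) / (dist s (of_nat n))\<^sup>2" by (simp add: \<delta>_def)
    qed
    have P: "(\<lambda>s. paired (lhs_term a b 1 s) j) meromorphic_on {s0}" for j
      unfolding paired_def using lhs_term_meromorphic[OF a] by (cases "j = 0") (auto intro!: meromorphic_on_add)
    have "(\<lambda>s. T s + (\<Sum>j<J. paired (lhs_term a b 1 s) j)) meromorphic_on {s0}"
      using T n by (intro meromorphic_on_add meromorphic_on_sum P) auto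
    moreover have "\<forall>\<^sub>F s in at s0. T s + (\<Sum>j<J. paired (lhs_term a b 1 s) j) = (\<Sum>j. paired (lhs_term a b 1 s) j)"
      using eventually_at_not_Nats[of s0]
    proof eventually_elim
      case (elim s)
      have "summable (paired (lhs_term a b 1 s))" using lhs_term_summable[OF elim] by (rule summable_norm_cancel)
      from suminf_split_initial_segment[OF this, of J] show ?case by (simp add: T_def)
    qed
    ultimately show ?thesis by (rule meromorphic_at_transform)
  qed
qed

lemma paired_lhs_normalise:
  assumes "a \<noteq> 0" "d > 0"
  shows "paired (lhs_term a b d s) j = paired (lhs_term (\<bar>a\<bar> * d) (b * sgn a) 1 s) j"
proof (cases "a > 0")
  case True
  have "paired (lhs_term a b d s) j = paired (lhs_term (a * d) b 1 s) j"
    unfolding paired_def lhs_term_scale[of a b d] ..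
  then show ?thesis using True by simp
next
  case False
  then have "sgn a = -1" "\<bar>a\<bar> = - a" using assms by auto
  moreover have "paired (lhs_term (- a) (- b) d s) j = paired (lhs_term (- a * d) (- b) 1 s) j"
    unfolding paired_def lhs_term_scale[of "- a" "- b" d] ..
  ultimately show ?thesis using paired_lhs_term_uminus[of a b d s j] by (simp only: mult_minus1_right)
qed

section \<open>The logarithmic sine integral and H\<close>

lemma sums_rpaired_finite:
  fixes f :: "int \<Rightarrow> complex"
  assumes F: "finite F" "\<And>k. k \<notin> F \<Longrightarrow> f k = 0"
  shows "rpaired f sums (\<Sum>k\<in>F. f k)"
proof -
  obtain N where N: "\<And>k. k \<in> F \<Longrightarrow> \<bar>k\<bar> \<le> int N"
  proof
    show "\<bar>k\<bar> \<le> int (\<Sum>k\<in>F. nat \<bar>k\<bar>)" if "k \<in> F" for k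
      using member_le_sum[OF that, of "\<lambda>k. nat \<bar>k\<bar>"] F(1) by linarith
  qed
  have "(\<Sum>j<Suc M. rpaired f j) = (\<Sum>k\<in>F. f k)" if "M \<ge> N" for M
  proof -
    have "(\<Sum>k\<in>{- int M..int M}. f k) = (\<Sum>k\<in>F. f k)"
    proof (rule sum.mono_neutral_right)
      show "F \<subseteq> {- int M..int M}" using N that by (force simp: abs_le_iff)
    qed (use F in auto)
    then show ?thesis unfolding sum_rpaired .
  qed
  then have "(\<lambda>M. \<Sum>j<Suc M. rpaired f j) \<longlonglongrightarrow> (\<Sum>k\<in>F. f k)"
    by (intro tendsto_eventually) (auto simp: eventually_sequentially)
  then show ?thesis unfolding sums_def by (subst (asm) filterlim_sequentially_Suc)
qed

text \<open>The zeros of sin (pi (a x + b)) with 0 < x < 1, for positive \<open>a\<close>: the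
  indices for which the 2F1 argument a / (k - b) exceeds 1.\<close>

definition crossings :: "real \<Rightarrow> real \<Rightarrow> int set" where
  "crossings a b = {k. b < of_int k \<and> of_int k < a + b}"

lemma finite_crossings: "finite (crossings a b)"
  by (rule finite_subset[of _ "{\<lfloor>b\<rfloor>..\<lceil>a + b\<rceil>}"]) (auto simp: crossings_def floor_le_iff le_ceiling_iff)

text \<open>The difference of \<open>H a b 1\<close> and \<open>endpoint_excess a b 1\<close>; at the negative integers, where for
  \<open>a + b\<close> an integer the cotangent and \<open>Digamma (1 + s)\<close> have cancelling poles, it is extended by Digamma
  reflection.\<close>

definition H_ext :: "real \<Rightarrow> real \<Rightarrow> complex \<Rightarrow> complex" where
  "H_ext a b s = of_real (ln 2 + log_const a b) / s + (if b \<in> \<int> then 1 / s\<^sup>2 else 0)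
     - (if a + b \<in> \<int> then (Digamma (1 - s) + euler_mascheroni) / s else 0)
     - (\<Sum>j. paired (lhs_term a b 1 s) j)
     + \<i> * of_real pi / s * of_real a powr s * (\<Sum>k\<in>crossings a b. of_real (of_int k - b) powr (- s))"

lemma H_ext_holomorphic:
  assumes a: "a > 0"
  shows "H_ext a b holomorphic_on - \<nat>"
proof -
  have Dn: "1 - s \<notin> \<int>\<^sub>\<le>\<^sub>0" if s: "s \<in> - \<nat>" for s :: complex
  proof
    assume "1 - s \<in> \<int>\<^sub>\<le>\<^sub>0"
    then obtain m where "1 - s = - of_nat m" by (auto elim!: nonpos_Ints_cases')
    then have "s = of_nat (Suc m)" by (simp add: algebra_simps)
    then show False using s by (auto simp: of_nat_in_Nats)
  qed
  have Dg: "(\<lambda>s. Digamma (1 - s)) holomorphic_on - \<nat>"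
    by (rule holomorphic_on_compose_gen[of _ _ Digamma "- \<int>\<^sub>\<le>\<^sub>0", unfolded o_def])
       (use Dn in \<open>auto intro!: holomorphic_intros holomorphic_on_Polygamma\<close>)
  have z: "s \<noteq> 0" if "s \<in> - \<nat>" for s :: complex using that by auto
  have sp: "(\<lambda>s. \<Sum>k\<in>crossings a b. of_real (of_int k - b) powr (- s)) holomorphic_on - \<nat>"
    by (intro holomorphic_on_sum holomorphic_on_powr_right holomorphic_intros) 
  have cases: "(\<lambda>s. if b \<in> \<int> then 1 / s\<^sup>2 else 0) holomorphic_on - \<nat>"
    "(\<lambda>s. if a + b \<in> \<int> then (Digamma (1 - s) + euler_mascheroni) / s else 0) holomorphic_on - \<nat>"
    using z by (cases "b \<in> \<int>"; cases "a + b \<in> \<int>"; auto intro!: holomorphic_intros Dg)+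
  show ?thesis
    unfolding H_ext_def [abs_def] using z a
    by (intro holomorphic_on_add holomorphic_on_diff holomorphic_on_mult holomorphic_on_divide cases sp lhs_sum_holomorphic
        holomorphic_on_const holomorphic_on_id holomorphic_on_powr_right) auto
qed

text \<open>Each moment of a log factor is \<open>lhs_term\<close> minus a correction
  \<open>c k\<close> that is nonzero for finitely many k only: 1 / s^2 for the zero at x = 0, a
  Digamma value for the one at x = 1, and the boundary term of the slit for every crossing. With the
  constant \<open>log_const\<close> they assemble to \<open>H_ext\<close>.\<close>

lemma log_sin_integral_H_ext:
  assumes a: "a > 0" and s: "Re s < -2"
  shows "((\<lambda>x. of_real (ln 2 + ln \<bar>sin (pi * (a * x + b))\<bar>) * of_real x powr (- s - 1)) has_integral - H_ext a b s) {0..1}"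
proof -
  have sN: "s \<notin> \<nat>" using s by (auto elim!: Nats_cases)
  have s0: "s \<noteq> 0" using sN by auto
  define v where "v = (\<lambda>x. complex_of_real x powr (- s - 1))"
  have v: "continuous_on {0..1} v" "\<And>x. x \<in> {0..1} \<Longrightarrow> norm (v x) \<le> 1"
    unfolding v_def using log_kernel_continuous[of s] s by auto
  define I where "I = (\<lambda>k. integral {0..1} (\<lambda>x. of_real (log_factor a b k x) * v x))"
  have I: "I k = log_moment ((of_int k - b) / a) (- s)" for k
    by (simp add: I_def log_moment_def log_factor_def v_def)
  have w: "Re (- s) > 1" using s by simp
  define c where "c = (\<lambda>k. (if of_int k = b then 1 / s\<^sup>2 else 0) - (if of_int k = a + b then (Digamma (1 - s) + euler_mascheroni) / s else 0)
     + (if k \<in> crossings a b then \<i> * of_real pi / s * of_real a powr s * of_real (of_int k - b) powr (- s) else 0))"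
  have Ic: "I k = lhs_term a b 1 s k - c k" for k
  proof -
    consider "of_int k = b" | "of_int k = a + b" | "of_int k \<noteq> b" "of_int k \<noteq> a + b" by blast
    then show ?thesis
    proof cases
      case 1
      then show ?thesis unfolding I using log_moment_0[OF w] a by (auto simp: c_def lhs_term_def crossings_def)
    next
      case 2
      then have "(of_int k - b) / a = 1" using a by simp
      then show ?thesis unfolding I using log_moment_1[OF w] a 2
        by (auto simp: c_def lhs_term_def crossings_def add_divide_distrib diff_divide_distrib)
    next
      case 3
      define z where "z = a / (of_int k - b)"
      have z1: "(z > 1) = (k \<in> crossings a b)"
      proof (cases "of_int k > b")
        case True
        then show ?thesis using a by (auto simp: z_def crossings_def field_simps)
      next
        case False
        then have "z \<le> 0" using a by (simp add: z_def divide_nonneg_nonpos)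
        then show ?thesis using False by (auto simp: crossings_def)
      qed
      have zp: "of_real z powr s = of_real a powr s * of_real (of_int k - b) powr (- s)" if "k \<in> crossings a b"
      proof -
        have kb: "of_int k - b > 0" using that by (simp add: crossings_def)
        have L: "Ln (of_real z) = Ln (of_real a) - Ln (of_real (of_int k - b))"
          using a kb Ln_of_real[of z] Ln_of_real[of a] Ln_of_real[of "of_int k - b"]
          by (simp add: z_def ln_div del: of_real_diff) simp
        have "z \<noteq> 0" using a kb by (simp add: z_def)
        then show ?thesis using a kb by (simp add: powr_def L exp_add[symmetric] algebra_simps del: of_real_diff)
      qed
      \<comment> \<open>No summand needs to be split off: \<open>M = 0\<close> is admissible since
        Re s < -2.\<close>
      have "lhs_term a b 1 s k = - (((0 - s) * log_moment ((of_int k - b) / a) (- s)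
        - (if z > 1 then \<i> * of_real pi * of_real z powr s else 0))) / s"
        using lhs_term_formula[OF a 3 sN, of 0] s by (simp add: z_def)
      also have "\<dots> = I k + (if z > 1 then \<i> * of_real pi * of_real z powr s / s else 0)"
        unfolding I using s0 by (simp add: field_simps)
      also have "(if z > 1 then \<i> * of_real pi * of_real z powr s / s else 0) = c k"
        unfolding z1 using 3 zp by (simp add: c_def mult_ac)
      finally show ?thesis by simp
    qed
  qed
  \<comment> \<open>A finite interval that contains every index with a nonzero correction.\<close>
  define F where "F = {\<lfloor>b\<rfloor>..\<lceil>a + b\<rceil>}"
  have Fsub: "crossings a b \<subseteq> F" by (auto simp: F_def crossings_def floor_le_iff le_ceiling_iff)
  have cs: "rpaired c sums (\<Sum>k\<in>F. c k)"
  proof (rule sums_rpaired_finite)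
    fix k assume k: "k \<notin> F"
    then have "k \<notin> crossings a b" using Fsub by auto
    moreover have "of_int k \<noteq> b" using k a by (auto simp: F_def)
    moreover have "of_int k \<noteq> a + b"
    proof
      assume e: "of_int k = a + b"
      have "\<lfloor>b\<rfloor> \<le> k" "k \<le> \<lceil>a + b\<rceil>" using e a by linarith+
      then show False using k by (simp add: F_def)
    qed
    ultimately show "c k = 0" by (simp add: c_def)
  qed (simp add: F_def)
  have 1: "(\<Sum>k\<in>F. if of_int k = b then 1 / s\<^sup>2 else 0) = (if b \<in> \<int> then 1 / s\<^sup>2 else 0)"
  proof (cases "b \<in> \<int>")
    case True
    then obtain m where m: "b = of_int m" by (auto elim: Ints_cases)
    have "m \<in> F" using m a by (auto simp: F_def le_ceiling_iff)
    then show ?thesis using True m by (simp add: F_def)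
  next
    case False
    then show ?thesis by (auto intro!: sum.neutral) 
  qed
  have 2: "(\<Sum>k\<in>F. if of_int k = a + b then (Digamma (1 - s) + euler_mascheroni) / s else 0) = (if a + b \<in> \<int> then (Digamma (1 - s) + euler_mascheroni) / s else 0)"
  proof (cases "a + b \<in> \<int>")
    case True
    then obtain m where m: "a + b = of_int m" by (auto elim: Ints_cases)
    have "\<lfloor>b\<rfloor> \<le> m" "m \<le> \<lceil>a + b\<rceil>" using m a by linarith+
    then have "m \<in> F" by (simp add: F_def)
    then show ?thesis using True m by (simp add: F_def)
  next
    case False
    then show ?thesis by (auto intro!: sum.neutral) (metis Ints_of_int)
  qed
  have 3: "(\<Sum>k\<in>F. if k \<in> crossings a b then \<i> * of_real pi / s * of_real a powr s * of_real (of_int k - b) powr (- s) else 0)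
      = \<i> * of_real pi / s * of_real a powr s * (\<Sum>k\<in>crossings a b. of_real (of_int k - b) powr (- s))"
  proof -
    have "(\<Sum>k\<in>F. if k \<in> crossings a b then \<i> * of_real pi / s * of_real a powr s * of_real (of_int k - b) powr (- s) else 0)
       = (\<Sum>k\<in>F \<inter> crossings a b. \<i> * of_real pi / s * of_real a powr s * of_real (of_int k - b) powr (- s))"
      by (rule sum.inter_restrict[symmetric]) (simp add: F_def)
    also have "F \<inter> crossings a b = crossings a b" using Fsub by auto
    finally show ?thesis by (simp only: sum_distrib_left)
  qed
  have rI: "rpaired I j = paired (lhs_term a b 1 s) j - rpaired c j" for j
    by (simp add: rpaired_def paired_def Ic)
  have "summable (paired (lhs_term a b 1 s))" using lhs_term_summable[OF sN] by (rule summable_norm_cancel)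
  then have "(\<lambda>j. paired (lhs_term a b 1 s) j - rpaired c j) sums ((\<Sum>j. paired (lhs_term a b 1 s) j) - (\<Sum>k\<in>F. c k))"
    by (intro sums_diff summable_sums cs)
  then have sumI: "(\<Sum>j. rpaired I j) = (\<Sum>j. paired (lhs_term a b 1 s) j) - (\<Sum>k\<in>F. c k)"
    unfolding rI[symmetric] by (rule sums_unique[symmetric])
  have A: "((\<lambda>x. of_real (ln \<bar>sin (pi * (a * x + b))\<bar> - log_const a b) * v x) has_integral (\<Sum>j. rpaired I j)) {0..1}"
    unfolding I_def by (rule log_sin_integral(2)[OF a v])
  have B: "(v has_integral 1 / (- s)) {0..1}"
    unfolding v_def using has_integral_powr_unit[of "- s - 1"] s by simp
  from has_integral_add[OF A has_integral_mult_right[OF B, of "of_real (ln 2 + log_const a b)"]]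
  have "((\<lambda>x. of_real (ln \<bar>sin (pi * (a * x + b))\<bar> - log_const a b) * v x + of_real (ln 2 + log_const a b) * v x) has_integral
     (\<Sum>j. rpaired I j) + of_real (ln 2 + log_const a b) * (1 / (- s))) {0..1}" .
  moreover have "of_real (ln \<bar>sin (pi * (a * x + b))\<bar> - log_const a b) * v x + of_real (ln 2 + log_const a b) * v x
     = of_real (ln 2 + ln \<bar>sin (pi * (a * x + b))\<bar>) * of_real x powr (- s - 1)" for x
    by (simp add: v_def algebra_simps)
  moreover have "(\<Sum>j. rpaired I j) + of_real (ln 2 + log_const a b) * (1 / (- s)) = - H_ext a b s"
    unfolding sumI c_def sum.distrib sum_subtractf 1 2 3 H_ext_def by simp
  ultimately show ?thesis by simp
qed

section \<open>The series of the right-hand side\<close>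

definition head_term :: "complex \<Rightarrow> real \<Rightarrow> real \<Rightarrow> complex \<Rightarrow> nat \<Rightarrow> complex" where
  "head_term \<sigma> a b s k = phase \<sigma> b k * head_ser \<sigma> (2 * pi * a * real k) s / of_nat k"

definition upper_term :: "complex \<Rightarrow> real \<Rightarrow> real \<Rightarrow> complex \<Rightarrow> nat \<Rightarrow> complex" where
  "upper_term \<sigma> a b s k = phase \<sigma> b k * upper_int \<sigma> (2 * pi * a * real k) s / of_nat k"

definition power_term :: "complex \<Rightarrow> real \<Rightarrow> complex \<Rightarrow> nat \<Rightarrow> complex" where
  "power_term \<sigma> b s k = phase \<sigma> b k * of_nat k powr (s - 1)"

definition gamma_factor :: "complex \<Rightarrow> real \<Rightarrow> complex \<Rightarrow> complex" where
  "gamma_factor \<sigma> a s = (- \<sigma>) powr s * of_real (2 * pi * a) powr s * Gamma (- s)"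

text \<open>The incomplete Gamma identity, divided by \<open>k\<close>. As \<open>upper_term\<close>
  is summable for every \<open>s\<close>, all convergence questions for the 1F2 summands pass to the
  elementary series \<open>power_term\<close>.\<close>

lemma head_term_decomp:
  assumes \<sigma>: "\<sigma> \<in> {\<i>, -\<i>}" and a: "a > 0" and s: "s \<notin> \<nat>"
  shows "head_term \<sigma> a b s k = gamma_factor \<sigma> a s * power_term \<sigma> b s k - upper_term \<sigma> a b s k"
proof (cases "k = 0")
  case True
  then show ?thesis by (simp add: head_term_def upper_term_def power_term_def)
next
  case False
  define \<omega> where "\<omega> = 2 * pi * a * real k"
  have \<omega>: "\<omega> > 0" using a False by (simp add: \<omega>_def)
  have "(- \<sigma> * of_real \<omega>) powr s = (- \<sigma>) powr s * of_real \<omega> powr s"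
    using sigma_powr_exp(1)[of "- \<sigma>" \<omega> s] \<sigma> \<omega> by auto
  also have "complex_of_real \<omega> powr s = of_real (2 * pi * a) powr s * of_nat k powr s"
    using powr_times_real[of "of_real (2 * pi * a)" "of_nat k" s] a by (simp add: \<omega>_def)
  finally have "(- \<sigma> * of_real \<omega>) powr s * Gamma (- s) = gamma_factor \<sigma> a s * of_nat k powr s"
    by (simp add: gamma_factor_def)
  then have hs: "head_ser \<sigma> \<omega> s = gamma_factor \<sigma> a s * of_nat k powr s - upper_int \<sigma> \<omega> s"
    using upper_int_formula[OF \<sigma> \<omega> s] by simp
  show ?thesis
    unfolding head_term_def upper_term_def power_term_def \<omega>_def[symmetric] hs
    using False by (simp add: powr_diff diff_divide_distrib right_diff_distrib mult_ac)
qed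

text \<open>The estimate behind \<open>rhs_entire_bound\<close>, kept for each sign separately
  because the sawtooth needs the difference of the two series as well. At \<open>k = 0\<close> both
  sides are 0 through division by zero.\<close>

lemma upper_term_bound:
  fixes \<epsilon> \<delta> :: real
  assumes "\<epsilon> > 0" "\<delta> > 0"
  shows "\<exists>K>0. \<forall>\<sigma>\<in>{\<i>, -\<i>}. \<forall>a\<ge>\<delta>. \<forall>b s k. Re s \<ge> - \<epsilon> \<longrightarrow> \<bar>Im s\<bar> \<le> \<epsilon> \<longrightarrow>
           norm (upper_term \<sigma> a b s k) \<le> K / (real k)\<^sup>2"
proof -
  have p: "2 * pi * \<delta> > 0" using assms by simp
  obtain K where K: "K > 0" "\<And>\<sigma> \<omega> s. \<sigma> \<in> {\<i>, -\<i>} \<Longrightarrow> \<omega> \<ge> 2 * pi * \<delta> \<Longrightarrow> Re s \<ge> - \<epsilon> \<Longrightarrow> \<bar>Im s\<bar> \<le> \<epsilon> \<Longrightarrow>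
      norm (upper_int \<sigma> \<omega> s) \<le> K / \<omega>"
    using upper_int_bound[OF assms(1) p] by metis
  have "norm (upper_term \<sigma> a b s k) \<le> (K / (2 * pi * \<delta>)) / (real k)\<^sup>2"
    if \<sigma>: "\<sigma> \<in> {\<i>, -\<i>}" and a: "a \<ge> \<delta>" and s: "Re s \<ge> - \<epsilon>" "\<bar>Im s\<bar> \<le> \<epsilon>" for \<sigma> a b s k
  proof (cases "k = 0")
    case True
    then show ?thesis by (simp add: upper_term_def)
  next
    case False
    define \<omega> where "\<omega> = 2 * pi * a * real k"
    have "1 * (2 * pi * \<delta>) \<le> real k * (2 * pi * a)" using a False assms by (intro mult_mono) auto
    then have \<omega>: "\<omega> \<ge> 2 * pi * \<delta>" by (simp add: \<omega>_def mult_ac)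
    have "\<delta> * real k \<le> a * real k" using a by (intro mult_right_mono) auto
    then have \<omega>2: "2 * pi * \<delta> * real k \<le> \<omega>" by (simp add: \<omega>_def)
    have "norm (upper_int \<sigma> \<omega> s) \<le> K / \<omega>" using K(2)[OF \<sigma> \<omega> s] .
    also have "\<dots> \<le> K / (2 * pi * \<delta> * real k)"
      using K(1) \<omega>2 assms False by (intro divide_left_mono) (auto intro!: mult_pos_pos order.strict_trans2[OF _ \<omega>2])
    finally have "norm (upper_int \<sigma> \<omega> s) / real k \<le> K / (2 * pi * \<delta> * real k) / real k" by (intro divide_right_mono) auto
    then show ?thesis unfolding upper_term_def \<omega>_def[symmetric]
      using norm_phase[OF \<sigma>] by (simp add: norm_mult norm_divide power2_eq_square)
  qed
  moreover have "K / (2 * pi * \<delta>) > 0" using K p by simp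
  ultimately show ?thesis by blast
qed

lemma upper_term_summable:
  assumes "\<sigma> \<in> {\<i>, -\<i>}" "a > 0"
  shows "summable (\<lambda>k. norm (upper_term \<sigma> a b s k))"
proof -
  have e: "1 + norm s > 0" "Re s \<ge> - (1 + norm s)" "\<bar>Im s\<bar> \<le> 1 + norm s"
    using abs_Re_le_cmod[of s] abs_Im_le_cmod[of s] norm_ge_zero[of s] by linarith+
  obtain K where "\<And>k. norm (upper_term \<sigma> a b s k) \<le> K / (real k)\<^sup>2"
    using upper_term_bound[OF e(1) assms(2)] assms(1) e by (metis order_refl)
  then show ?thesis
    by (intro summable_comparison_test[OF exI[of _ 0] summable_inverse_squares[of K]]) auto
qed

lemma upper_sum_holomorphic:
  assumes \<sigma>: "\<sigma> \<in> {\<i>, -\<i>}" and a: "a > 0"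
  shows "(\<lambda>s. \<Sum>k. upper_term \<sigma> a b s k) holomorphic_on A"
proof -
  have "(\<lambda>s. \<Sum>k. upper_term \<sigma> a b s k) holomorphic_on UNIV"
  proof (rule holomorphic_on_suminf_local)
    fix n
    show "(\<lambda>s. upper_term \<sigma> a b s n) holomorphic_on UNIV"
    proof (cases "n = 0")
      case False
      have "(\<lambda>s. upper_int \<sigma> (2 * pi * a * real n) s) holomorphic_on UNIV"
        using upper_int_holomorphic[OF \<sigma>, of "2 * pi * a * real n"] a False by simp
      then show ?thesis unfolding upper_term_def using False by (intro holomorphic_on_divide holomorphic_on_mult holomorphic_on_const) auto
    qed (simp add: upper_term_def)
  next
    fix z :: complex
    define \<epsilon> where "\<epsilon> = 1 + norm z"
    have \<epsilon>: "\<epsilon> > 0" by (simp add: \<epsilon>_def add_pos_nonneg)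
    obtain K where K: "\<And>s k. Re s \<ge> - \<epsilon> \<Longrightarrow> \<bar>Im s\<bar> \<le> \<epsilon> \<Longrightarrow> norm (upper_term \<sigma> a b s k) \<le> K / (real k)\<^sup>2"
      using upper_term_bound[OF \<epsilon> a] \<sigma> by (metis order_refl)
    have "Re s \<ge> - \<epsilon> \<and> \<bar>Im s\<bar> \<le> \<epsilon>" if "s \<in> ball z 1" for s
    proof -
      have "norm s \<le> \<epsilon>" using that norm_triangle_ineq2[of s z] by (simp add: \<epsilon>_def dist_norm norm_minus_commute)
      then show ?thesis using abs_Re_le_cmod[of s] abs_Im_le_cmod[of s] by linarith
    qed
    then show "\<exists>r>0. \<exists>M N. summable M \<and> (\<forall>n\<ge>N. \<forall>w\<in>ball z r \<inter> UNIV. norm (upper_term \<sigma> a b w n) \<le> M n)"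
      using summable_inverse_squares[of K] K
      by (intro exI[of _ 1] conjI exI[of _ "\<lambda>k. K / (real k)\<^sup>2"] exI[of _ 0]) auto
  qed simp
  then show ?thesis by (rule holomorphic_on_subset) simp
qed

lemma norm_power_term: "\<sigma> \<in> {\<i>, -\<i>} \<Longrightarrow> norm (power_term \<sigma> b s k) = real k powr (Re s - 1)"
  by (simp add: power_term_def norm_mult norm_phase norm_powr_real_powr)

lemma power_term_summable:
  assumes "\<sigma> \<in> {\<i>, -\<i>}" "Re s < 0"
  shows "summable (\<lambda>k. norm (power_term \<sigma> b s k))"
  unfolding norm_power_term[OF assms(1)] using assms(2) by (simp add: summable_real_powr_iff)

lemma head_term_summable:
  assumes \<sigma>: "\<sigma> \<in> {\<i>, -\<i>}" and a: "a > 0" and s: "Re s < 0"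
  shows "summable (\<lambda>k. norm (head_term \<sigma> a b s k))"
proof -
  have sN: "s \<notin> \<nat>" using s by (auto elim!: Nats_cases)
  show ?thesis
  proof (rule summable_comparison_test)
    show "\<exists>N. \<forall>k\<ge>N. norm (norm (head_term \<sigma> a b s k)) \<le> norm (gamma_factor \<sigma> a s) * norm (power_term \<sigma> b s k) + norm (upper_term \<sigma> a b s k)"
      unfolding head_term_decomp[OF \<sigma> a sN]
      by (intro exI[of _ 0] allI impI) (simp, rule order_trans[OF norm_triangle_ineq4], simp add: norm_mult)
    show "summable (\<lambda>k. norm (gamma_factor \<sigma> a s) * norm (power_term \<sigma> b s k) + norm (upper_term \<sigma> a b s k))"
      by (intro summable_add summable_mult power_term_summable[OF \<sigma> s] upper_term_summable[OF \<sigma> a])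
  qed
qed

lemma head_term_sum_decomp:
  assumes \<sigma>: "\<sigma> \<in> {\<i>, -\<i>}" and a: "a > 0" and s: "Re s < 0"
  shows "(\<Sum>k. head_term \<sigma> a b s k) = gamma_factor \<sigma> a s * (\<Sum>k. power_term \<sigma> b s k) - (\<Sum>k. upper_term \<sigma> a b s k)"
proof -
  have sN: "s \<notin> \<nat>" using s by (auto elim!: Nats_cases)
  have "(\<lambda>k. gamma_factor \<sigma> a s * power_term \<sigma> b s k - upper_term \<sigma> a b s k) sums
      (gamma_factor \<sigma> a s * (\<Sum>k. power_term \<sigma> b s k) - (\<Sum>k. upper_term \<sigma> a b s k))"
    by (intro sums_diff sums_mult summable_sums summable_norm_cancel[OF power_term_summable[OF \<sigma> s]]
        summable_norm_cancel[OF upper_term_summable[OF \<sigma> a]])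
  then show ?thesis unfolding head_term_decomp[OF \<sigma> a sN] by (rule sums_unique[symmetric])
qed

text \<open>The Abel coefficients of \<open>log_kernel_Abel_sums\<close> are phases times integrals
  of \<open>head_ser\<close> type. For \<open>k = 0\<close> division by zero makes both sides
  vanish.\<close>

lemma head_term_integral:
  assumes \<sigma>: "\<sigma> \<in> {\<i>, -\<i>}" and a: "a > 0" and s: "Re s < -1"
  shows "integral {0..1} (\<lambda>x. exp (2 * of_real pi * \<sigma> * of_real (a * x + b)) ^ k * of_real x powr (- s - 1)) / of_nat k = head_term \<sigma> a b s k"
proof (cases "k = 0")
  case False
  define \<omega> where "\<omega> = 2 * pi * a * real k"
  have \<omega>: "\<omega> > 0" using a False by (simp add: \<omega>_def)
  have n: "norm \<sigma> = 1" using \<sigma> by auto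
  have e: "exp (2 * of_real pi * \<sigma> * of_real (a * x + b)) ^ k = phase \<sigma> b k * exp (\<sigma> * of_real (\<omega> * x))" for x
    unfolding phase_def exp_of_nat_mult[symmetric] exp_add[symmetric] \<omega>_def by (simp add: algebra_simps)
  have "((\<lambda>x. phase \<sigma> b k * (exp (\<sigma> * of_real (\<omega> * x)) * of_real x powr (- s - 1))) has_integral phase \<sigma> b k * head_ser \<sigma> \<omega> s) {0..1}"
    by (intro has_integral_mult_right head_ser_integral[OF n \<omega> s])
  then have "integral {0..1} (\<lambda>x. exp (2 * of_real pi * \<sigma> * of_real (a * x + b)) ^ k * of_real x powr (- s - 1)) = phase \<sigma> b k * head_ser \<sigma> \<omega> s"
    unfolding e mult.assoc[of "phase \<sigma> b k"] by (rule integral_unique)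
  then show ?thesis by (simp add: head_term_def \<omega>_def)
qed (simp add: head_term_def)

lemma log_kernel_integral_plus:
  assumes a: "a > 0" and s: "Re s < -1"
  shows "((\<lambda>x. log_kernel (a * x + b) * of_real x powr (- s - 1)) has_integral (\<Sum>k. head_term \<i> a b s k)) {0..1}"
proof -
  have "summable (\<lambda>k. norm (head_term \<i> a b s k))" using a s by (intro head_term_summable) auto
  then show ?thesis
    using log_kernel_Abel_sums[of a s b] a s head_term_integral[of \<i> a s b] by simp
qed

text \<open>The Abel summation is applied to -a and -b, which reverses the sign in all
  exponentials.\<close>

lemma log_kernel_integral_minus:
  assumes a: "a > 0" and s: "Re s < -1"
  shows "((\<lambda>x. log_kernel (- (a * x + b)) * of_real x powr (- s - 1)) has_integral (\<Sum>k. head_term (-\<i>) a b s k)) {0..1}"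
proof -
  have e: "exp (2 * of_real pi * \<i> * of_real (- a * x + - b)) = exp (2 * of_real pi * (-\<i>) * of_real (a * x + b))" for x
    by (simp add: algebra_simps)
  have h: "integral {0..1} (\<lambda>x. exp (2 * of_real pi * \<i> * of_real (- a * x + - b)) ^ k * of_real x powr (- s - 1)) / of_nat k = head_term (-\<i>) a b s k" for k
    unfolding e by (rule head_term_integral[OF _ a s]) simp
  have m: "- a * x + - b = - (a * x + b)" for x by simp
  have "summable (\<lambda>k. norm (head_term (-\<i>) a b s k))" using a s by (intro head_term_summable) auto
  then have "((\<lambda>x. log_kernel (- a * x + - b) * of_real x powr (- s - 1)) has_integral (\<Sum>k. head_term (-\<i>) a b s k)) {0..1}"
    using log_kernel_Abel_sums[of "- a" s "- b", unfolded h] a s by simp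
  then show ?thesis unfolding m .
qed

lemma hyp_term_head_terms:
  assumes "s \<notin> \<nat>" "a > 0" "k > 0"
  shows "hyp_term a b 1 s k = - (head_term \<i> a b s k + head_term (-\<i>) a b s k) / 2"
  unfolding hyp_term_head_ser[OF assms] head_term_def
  by (simp only: add_divide_distrib[symmetric] minus_divide_left divide_divide_eq_left mult.commute[of _ 2])

lemma rhs_entire_upper_terms:
  "rhs_entire a b s k = (upper_term \<i> a b s k + upper_term (-\<i>) a b s k) / 2"
  unfolding rhs_entire_def upper_term_def
  by (simp only: add_divide_distrib[symmetric] divide_divide_eq_left mult.commute[of _ 2])

lemma sums_Suc_zero: "f 0 = 0 \<Longrightarrow> (\<lambda>k. f (Suc k)) sums S \<longleftrightarrow> f sums (S :: complex)"
  using sums_Suc_iff[of f S] by simp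

lemma rhs_entire_sums:
  assumes "a > 0"
  shows "(\<lambda>k. rhs_entire a b s (Suc k)) sums (((\<Sum>k. upper_term \<i> a b s k) + (\<Sum>k. upper_term (-\<i>) a b s k)) / 2)"
proof -
  have "(\<lambda>k. rhs_entire a b s k) sums (((\<Sum>k. upper_term \<i> a b s k) + (\<Sum>k. upper_term (-\<i>) a b s k)) / 2)"
    unfolding rhs_entire_upper_terms
    by (intro sums_divide sums_add summable_sums; rule summable_norm_cancel, rule upper_term_summable) (use assms in auto)
  moreover have "rhs_entire a b s 0 = 0" by (simp add: rhs_entire_def)
  ultimately show ?thesis by (simp only: sums_Suc_zero[of "rhs_entire a b s"])
qed

text \<open>Two evaluations of one integral: off finitely many points, minus half the sum of the two
  kernels is ln (2 |sin (pi (a x + b))|), whose moment is known from the sine product.\<close>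

lemma hyp_term_sums_left:
  assumes a: "a > 0" and s: "Re s < -2"
  shows "- ((\<Sum>k. head_term \<i> a b s k) + (\<Sum>k. head_term (-\<i>) a b s k)) / 2 = - H_ext a b s"
proof -
  have s1: "Re s < -1" using s by simp
  define Z where "Z = {x \<in> {0..1}. a * x + b \<in> \<int>}"
  have Z: "finite Z" unfolding Z_def using finite_integer_crossings[OF a] .
  have "((\<lambda>x. (log_kernel (a * x + b) * of_real x powr (- s - 1) + log_kernel (- (a * x + b)) * of_real x powr (- s - 1)) / - 2) has_integral
      ((\<Sum>k. head_term \<i> a b s k) + (\<Sum>k. head_term (-\<i>) a b s k)) / - 2) {0..1}"
    by (intro has_integral_divide has_integral_add log_kernel_integral_plus[OF a s1] log_kernel_integral_minus[OF a s1])
  moreover have "((\<lambda>x. (log_kernel (a * x + b) * of_real x powr (- s - 1) + log_kernel (- (a * x + b)) * of_real x powr (- s - 1)) / - 2) has_integral - H_ext a b s) {0..1}"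
  proof (rule has_integral_spike_finite[OF Z _ log_sin_integral_H_ext[OF a s]])
    fix x assume "x \<in> {0..1} - Z"
    then have y: "a * x + b \<notin> \<int>" by (auto simp: Z_def)
    show "(log_kernel (a * x + b) * of_real x powr (- s - 1) + log_kernel (- (a * x + b)) * of_real x powr (- s - 1)) / - 2 = of_real (ln 2 + ln \<bar>sin (pi * (a * x + b))\<bar>) * of_real x powr (- s - 1)"
    proof -
      have "(- complex_of_real (2 * l) * v) / - 2 = of_real l * v" for l v by simp
      then show ?thesis unfolding distrib_right[symmetric] log_kernel_plus_minus(1)[OF y] .
    qed
  qed
  ultimately have "((\<Sum>k. head_term \<i> a b s k) + (\<Sum>k. head_term (-\<i>) a b s k)) / - 2 = - H_ext a b s"
    by (rule has_integral_unique)
  then show ?thesis by simp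
qed

section \<open>Hurwitz zeta\<close>

text \<open>Off the integers the difference of the two kernels is 2 pi \<i> times the
  sawtooth.\<close>

lemma sawtooth_integral:
  assumes a: "a > 0" and s: "Re s < -1"
  shows "((\<lambda>x. of_real (1/2 - frac (a * x + b)) * of_real x powr (- s - 1)) has_integral
     ((\<Sum>k. head_term \<i> a b s k) - (\<Sum>k. head_term (-\<i>) a b s k)) / (2 * \<i> * of_real pi)) {0..1}"
proof -
  define Z where "Z = {x \<in> {0..1}. a * x + b \<in> \<int>}"
  have Z: "finite Z" unfolding Z_def using finite_integer_crossings[OF a] .
  have A: "((\<lambda>x. (log_kernel (a * x + b) * of_real x powr (- s - 1) - log_kernel (- (a * x + b)) * of_real x powr (- s - 1)) / (2 * \<i> * of_real pi)) has_integral
      ((\<Sum>k. head_term \<i> a b s k) - (\<Sum>k. head_term (-\<i>) a b s k)) / (2 * \<i> * of_real pi)) {0..1}"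
    by (intro has_integral_divide has_integral_diff log_kernel_integral_plus[OF a s] log_kernel_integral_minus[OF a s])
  show ?thesis
  proof (rule has_integral_spike_finite[OF Z _ A])
    fix x assume "x \<in> {0..1} - Z"
    then have y: "a * x + b \<notin> \<int>" by (auto simp: Z_def)
    show "of_real (1/2 - frac (a * x + b)) * of_real x powr (- s - 1) =
      (log_kernel (a * x + b) * of_real x powr (- s - 1) - log_kernel (- (a * x + b)) * of_real x powr (- s - 1)) / (2 * \<i> * of_real pi)"
      unfolding left_diff_distrib[symmetric] log_kernel_plus_minus(2)[OF y] by (simp add: field_simps)
  qed
qed

text \<open>With integer slope N and b in [0, 1) the jumps sit at (i + 1 - b) / N for i < N, and the
  floor of N x + b counts those already passed.\<close>

lemma frac_linear_eq:
  fixes b x :: real and N :: nat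
  assumes b: "0 \<le> b" "b < 1" and N: "N > 0" and x: "x \<in> {0..1}"
    and ne: "\<And>i. i < N \<Longrightarrow> x \<noteq> (real i + (1 - b)) / real N"
  shows "frac (real N * x + b) = real N * x + b - (\<Sum>i<N. if x > (real i + (1 - b)) / real N then 1 else 0)"
proof -
  define y where "y = real N * x + b"
  define m where "m = nat \<lfloor>y\<rfloor>"
  have y0: "y \<ge> 0" using b x by (simp add: y_def)
  have "real N * x \<le> real N * 1" using x by (intro mult_left_mono) auto
  then have y1: "y < real N + 1" using b by (simp add: y_def)
  have my: "real m \<le> y" "y < real m + 1" using y0 by (simp_all add: m_def)
  have mN: "m \<le> N" using my y1 by linarith
  have gt: "(x > (real i + (1 - b)) / real N) = (i < m)" if i: "i < N" for i
  proof -
    have "(x > (real i + (1 - b)) / real N) = (y > real i + 1)"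
      using N by (simp add: y_def divide_less_eq mult.commute) linarith
    moreover have "y \<noteq> real i + 1" using ne[OF i] N by (auto simp: y_def field_simps)
    ultimately show ?thesis using my by linarith
  qed
  have "(\<Sum>i<N. if x > (real i + (1 - b)) / real N then 1 else 0) = (\<Sum>i<N. if i < m then 1 else (0::real))"
    by (rule sum.cong) (use gt in auto)
  also have "\<dots> = (\<Sum>i\<in>{..<N} \<inter> {..<m}. 1)" by (subst sum.inter_restrict) auto
  also have "{..<N} \<inter> {..<m} = {..<m}" using mN by auto
  finally have "(\<Sum>i<N. if x > (real i + (1 - b)) / real N then 1 else 0) = real m" by simp
  moreover have "real m = of_int \<lfloor>y\<rfloor>" using y0 by (simp add: m_def)
  ultimately show ?thesis unfolding y_def[symmetric] frac_def by simp
qed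

text \<open>The moment of 1/2 - frac (N x + b), integrated as a linear function plus
  \<open>N\<close> unit steps. The steps contribute a partial sum of the Hurwitz zeta series,
  rescaled by N.\<close>

definition saw_moment :: "nat \<Rightarrow> real \<Rightarrow> complex \<Rightarrow> complex" where
  "saw_moment N b s = - 1 / (2 * s) - of_nat N / (1 - s) + of_real b / s
     - (\<Sum>i<N. 1 - of_real ((real i + (1 - b)) / real N) powr (- s)) / s"

lemma saw_moment_integral:
  assumes b: "0 \<le> b" "b < 1" and N: "N > 0" and s: "Re s < -1"
  shows "((\<lambda>x. of_real (1/2 - frac (real N * x + b)) * of_real x powr (- s - 1)) has_integral saw_moment N b s) {0..1}"
proof -
  define v where "v = (\<lambda>x. complex_of_real x powr (- s - 1))"
  define P where "P = (\<lambda>i. (real i + (1 - b)) / real N) ` {..<N}"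
  have s0: "s \<noteq> 0" and s1: "1 - s \<noteq> 0" using s by auto
  have A: "(v has_integral - 1 / s) {0..1}" unfolding v_def using has_integral_powr_unit[of "- s - 1"] s by simp
  have B: "((\<lambda>x. v x * of_real x ^ 1) has_integral 1 / (1 - s)) {0..1}"
    unfolding v_def using has_integral_powr_unit_mult[of "- s - 1" 1] s by simp
  have C: "((\<lambda>x. v x * (if x > (real i + (1 - b)) / real N then 1 else 0)) has_integral (1 - of_real ((real i + (1 - b)) / real N) powr (- s)) / (- s)) {0..1}" if "i < N" for i
  proof -
    have "real i + (1 - b) \<le> real N" using that b by linarith
    then show ?thesis unfolding v_def using b s N by (intro has_integral_powr_upper_part[of _ "- s"]) auto
  qed
  have D: "((\<lambda>x. of_real (1/2 - b) * v x - of_nat N * (v x * of_real x ^ 1)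
      + (\<Sum>i<N. v x * (if x > (real i + (1 - b)) / real N then 1 else 0))) has_integral
    of_real (1/2 - b) * (- 1 / s) - of_nat N * (1 / (1 - s)) + (\<Sum>i<N. (1 - of_real ((real i + (1 - b)) / real N) powr (- s)) / (- s))) {0..1}"
    by (intro has_integral_add has_integral_diff has_integral_mult_right A B has_integral_sum C) auto
  have E: "of_real (1/2 - b) * (- 1 / s) - of_nat N * (1 / (1 - s)) + (\<Sum>i<N. (1 - of_real ((real i + (1 - b)) / real N) powr (- s)) / (- s)) = saw_moment N b s"
    unfolding saw_moment_def sum_divide_distrib[symmetric] using s0 s1 by (simp add: field_simps)
  show ?thesis
  proof (rule has_integral_spike_finite[of P, OF _ _ D[unfolded E]])
    show "finite P" by (simp add: P_def)
    fix x assume x: "x \<in> {0..1} - P"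
    have "frac (real N * x + b) = real N * x + b - (\<Sum>i<N. if x > (real i + (1 - b)) / real N then 1 else 0)"
      using x by (intro frac_linear_eq b N) (auto simp: P_def)
    then have fr: "complex_of_real (1/2 - frac (real N * x + b)) = of_real (1/2 - b) - of_nat N * of_real x + (\<Sum>i<N. if x > (real i + (1 - b)) / real N then 1 else 0)"
      by (simp add: of_real_sum if_distrib[of complex_of_real] cong: if_cong)
    show "of_real (1/2 - frac (real N * x + b)) * of_real x powr (- s - 1) =
      of_real (1/2 - b) * v x - of_nat N * (v x * of_real x ^ 1) + (\<Sum>i<N. v x * (if x > (real i + (1 - b)) / real N then 1 else 0))"
      unfolding fr by (simp add: v_def algebra_simps sum_distrib_left)
  qed
qed

text \<open>Since \<open>odd_sum N b s\<close> is \<open>N\<close> to the power \<open>s\<close> times \<open>odd_sum 1 b s\<close>, letting \<open>N\<close> tend to infinity,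
  where the \<open>upper_term\<close> series vanishes, evaluates \<open>odd_sum 1\<close> as a zeta value. As \<open>odd_sum 1\<close> extends
  to all \<open>s\<close>, this yields both the continuation of the zeta function and Hurwitz' formula.\<close>

definition odd_sum :: "nat \<Rightarrow> real \<Rightarrow> complex \<Rightarrow> complex" where
  "odd_sum N b s = ((\<Sum>k. upper_term \<i> (real N) b s k) - (\<Sum>k. upper_term (-\<i>) (real N) b s k)) / (2 * \<i>)
     + of_real pi * saw_moment N b s"

text \<open>When the sawtooth moment is replaced by its Fourier series, \<open>upper_term\<close>
  cancels against the one hidden in \<open>head_term\<close>, and only the Gamma series
  survives.\<close>

lemma odd_sum_left:
  assumes b: "0 \<le> b" "b < 1" and N: "N > 0" and s: "Re s < -1"
  shows "odd_sum N b s = (gamma_factor \<i> (real N) s * (\<Sum>k. power_term \<i> b s k) - gamma_factor (-\<i>) (real N) s * (\<Sum>k. power_term (-\<i>) b s k)) / (2 * \<i>)"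
proof -
  have s': "Re s < 0" and a: "real N > 0" using s N by auto
  have "saw_moment N b s = ((\<Sum>k. head_term \<i> (real N) b s k) - (\<Sum>k. head_term (-\<i>) (real N) b s k)) / (2 * \<i> * of_real pi)"
    by (rule has_integral_unique[OF saw_moment_integral[OF b N s] sawtooth_integral[OF a s]])
  then have sm: "of_real pi * saw_moment N b s = ((\<Sum>k. head_term \<i> (real N) b s k) - (\<Sum>k. head_term (-\<i>) (real N) b s k)) / (2 * \<i>)"
    by simp
  have "\<i> \<in> {\<i>, -\<i>}" "-\<i> \<in> {\<i>, -\<i>}" by auto
  note h = this[THEN head_term_sum_decomp[OF _ a s', of _ b]]
  show ?thesis unfolding odd_sum_def sm h add_divide_distrib[symmetric] by (simp only: algebra_simps) simp
qed

lemma gamma_factor_scale: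
  assumes "a > 0"
  shows "gamma_factor \<sigma> a s = of_real a powr s * gamma_factor \<sigma> 1 s"
  using powr_times_real[of "of_real (2 * pi)" "of_real a" s] assms by (simp add: gamma_factor_def mult_ac)

lemma saw_moment_holomorphic: "N > 0 \<Longrightarrow> 0 \<le> b \<Longrightarrow> b < 1 \<Longrightarrow> saw_moment N b holomorphic_on - {0, 1}"
  unfolding saw_moment_def [abs_def] by (intro holomorphic_intros) auto

lemma odd_sum_holomorphic:
  assumes "N > 0" "0 \<le> b" "b < 1"
  shows "odd_sum N b holomorphic_on - {0, 1}"
  unfolding odd_sum_def [abs_def] using assms
  by (intro holomorphic_on_add holomorphic_on_divide holomorphic_on_diff holomorphic_on_mult holomorphic_on_const
      upper_sum_holomorphic saw_moment_holomorphic) auto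

text \<open>For Re s < -1 the number N enters only through \<open>gamma_factor\<close>, as
  \<open>N powr s\<close>; the identity theorem off 0 and 1 does the rest.\<close>

lemma odd_sum_scale:
  assumes b: "0 \<le> b" "b < 1" and N: "N > 0" and s: "s \<noteq> 0" "s \<noteq> 1"
  shows "odd_sum N b s = of_nat N powr s * odd_sum 1 b s"
proof (rule analytic_continuation_open[where s = "{s. Re s < -1}" and s' = "- {0, 1}" and f = "odd_sum N b" and g = "\<lambda>s. of_nat N powr s * odd_sum 1 b s"])
  show "odd_sum N b holomorphic_on - {0, 1}" by (rule odd_sum_holomorphic[OF N b])
  show "(\<lambda>s. of_nat N powr s * odd_sum 1 b s) holomorphic_on - {0, 1}"
    using N by (intro holomorphic_intros odd_sum_holomorphic b) auto
  show "connected (- {0, 1::complex})"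
    using connected_open_diff_countable[of "UNIV :: complex set" "{0, 1}"] convex_connected[OF convex_UNIV]
    by (simp add: Compl_eq_Diff_UNIV)
  show "{s :: complex. Re s < -1} \<noteq> {}" by (auto intro!: exI[of _ "-2"])
  show "open (- {0, 1::complex})" by (intro open_Compl) auto
  show "odd_sum N b z = of_nat N powr z * odd_sum 1 b z" if "z \<in> {s. Re s < -1}" for z
  proof -
    have z: "Re z < -1" using that by simp
    have V1: "odd_sum 1 b z = (gamma_factor \<i> 1 z * (\<Sum>k. power_term \<i> b z k) - gamma_factor (-\<i>) 1 z * (\<Sum>k. power_term (-\<i>) b z k)) / (2 * \<i>)"
      using odd_sum_left[OF b zero_less_one z] by (simp only: of_nat_1)
    have a: "real N > 0" using N by simp
    show ?thesis
      unfolding odd_sum_left[OF b N z] V1 gamma_factor_scale[OF a, of \<i>] gamma_factor_scale[OF a, of "-\<i>"]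
      by (simp add: algebra_simps diff_divide_distrib)
  qed
qed (use s in \<open>auto simp: open_halfspace_Re_lt\<close>)

text \<open>After division by N^s the \<open>upper_term\<close> series are bounded times N^(-s), and
  the elementary terms of \<open>saw_moment\<close> decay at least like N^(1 - Re s). Only the
  partial sum of the zeta series is left in the limit.\<close>

lemma odd_sum_eq_zeta_sum:
  assumes b: "0 \<le> b" "b < 1" and s: "Re s > 1"
  shows "(\<lambda>i. of_real (real i + (1 - b)) powr (- s)) sums (s / of_real pi * odd_sum 1 b s)"
proof -
  have s0: "s \<noteq> 0" "s \<noteq> 1" using s by auto
  define \<epsilon> where "\<epsilon> = 1 + norm s"
  have \<epsilon>: "\<epsilon> > 0" "Re s \<ge> - \<epsilon>" "\<bar>Im s\<bar> \<le> \<epsilon>"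
    using abs_Re_le_cmod[of s] abs_Im_le_cmod[of s] norm_ge_zero[of s] unfolding \<epsilon>_def by linarith+
  obtain K where K: "K > 0" "\<And>\<sigma> a k. \<sigma> \<in> {\<i>, -\<i>} \<Longrightarrow> a \<ge> 1 \<Longrightarrow> norm (upper_term \<sigma> a b s k) \<le> K / (real k)\<^sup>2"
    using upper_term_bound[OF \<epsilon>(1), of 1] \<epsilon>(2,3) by (metis zero_less_one)
  define L where "L = (\<Sum>k. K / (real k)\<^sup>2)"
  have UL: "norm (\<Sum>k. upper_term \<sigma> (real N) b s k) \<le> L" if "\<sigma> \<in> {\<i>, -\<i>}" "N > 0" for \<sigma> N
  proof -
    have sm: "summable (\<lambda>k. norm (upper_term \<sigma> (real N) b s k))" using that by (intro upper_term_summable) auto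
    have "norm (\<Sum>k. upper_term \<sigma> (real N) b s k) \<le> (\<Sum>k. norm (upper_term \<sigma> (real N) b s k))" by (rule summable_norm[OF sm])
    also have "\<dots> \<le> L" unfolding L_def using K(2)[OF that(1), of "real N"] that(2)
      by (intro suminf_le sm summable_inverse_squares) auto
    finally show ?thesis .
  qed
  define D where "D = (\<lambda>N. ((\<Sum>k. upper_term \<i> (real (Suc N)) b s k) - (\<Sum>k. upper_term (-\<i>) (real (Suc N)) b s k)) / (2 * \<i>))"
  have DL: "norm (D N) \<le> L" for N
    unfolding D_def norm_divide using norm_triangle_ineq4[of "\<Sum>k. upper_term \<i> (real (Suc N)) b s k" "\<Sum>k. upper_term (-\<i>) (real (Suc N)) b s k"]
      UL[of \<i> "Suc N"] UL[of "-\<i>" "Suc N"] by simp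
  define q where "q = (\<lambda>N. complex_of_nat (Suc N) powr (- s))"
  have nq: "norm (q N) = real (Suc N) powr (- Re s)" for N
    unfolding q_def by (subst norm_powr_real_powr) auto
  have q0: "q \<longlonglongrightarrow> 0"
    unfolding tendsto_norm_zero_iff[symmetric, of q] nq using s by real_asymp
  \<comment> \<open>The \<open>N\<close> unit steps contribute a constant each; Re s > 1 is what
    makes their total vanish.\<close>
  have q1: "(\<lambda>N. of_nat (Suc N) * q N) \<longlonglongrightarrow> 0"
  proof -
    have "norm (of_nat (Suc N) * q N) = real (Suc N) * real (Suc N) powr (- Re s)" for N
      unfolding norm_mult nq norm_of_nat ..
    moreover have "(\<lambda>N. real (Suc N) * real (Suc N) powr (- Re s)) \<longlonglongrightarrow> 0" using s by real_asymp
    ultimately show ?thesis by (subst tendsto_norm_zero_iff[symmetric]) simp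
  qed
  have qD: "(\<lambda>N. q N * D N) \<longlonglongrightarrow> 0"
  proof (rule Lim_null_comparison)
    show "\<forall>\<^sub>F N in sequentially. norm (q N * D N) \<le> norm (q N) * L"
      unfolding norm_mult using DL by (intro always_eventually allI mult_left_mono) auto
    show "(\<lambda>N. norm (q N) * L) \<longlonglongrightarrow> 0" using tendsto_mult_left_zero[OF tendsto_norm_zero[OF q0]] .
  qed
  define S where "S = (\<lambda>N. \<Sum>i<Suc N. of_real (real i + (1 - b)) powr (- s))"
  have eq: "S N = s / of_real pi * odd_sum 1 b s - s / of_real pi * (q N * D N) + q N * (1/2) + s / (1 - s) * (of_nat (Suc N) * q N) - of_real b * q N + of_nat (Suc N) * q N" for N
  proof -
    have "q N * of_nat (Suc N) powr s = 1" unfolding q_def powr_add[symmetric] by (simp del: of_nat_Suc)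
    then have Veq: "odd_sum 1 b s = q N * odd_sum (Suc N) b s" unfolding odd_sum_scale[OF b _ s0, of "Suc N", OF zero_less_Suc] by (simp add: mult.assoc[symmetric])
    have VN: "odd_sum (Suc N) b s = D N + of_real pi * saw_moment (Suc N) b s" unfolding odd_sum_def D_def ..
    have V: "odd_sum 1 b s = q N * D N + of_real pi * (q N * saw_moment (Suc N) b s)"
      unfolding Veq VN by (simp only: distrib_left mult.left_commute)
    \<comment> \<open>The factor N^(-s) undoes the scaling of the jump points and restores i + 1 -
      b.\<close>
    have "q N * of_real ((real i + (1 - b)) / real (Suc N)) powr (- s) = of_real (real i + (1 - b)) powr (- s)" for i
    proof -
      have "complex_of_real (real i + (1 - b)) powr (- s) = (of_nat (Suc N) * of_real ((real i + (1 - b)) / real (Suc N))) powr (- s)"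
        by (simp del: of_nat_Suc)
      also have "\<dots> = q N * of_real ((real i + (1 - b)) / real (Suc N)) powr (- s)"
        unfolding q_def using b by (intro powr_times_real) auto
      finally show ?thesis by simp
    qed
    then have SS: "q N * (\<Sum>i<Suc N. 1 - of_real ((real i + (1 - b)) / real (Suc N)) powr (- s)) = of_nat (Suc N) * q N - S N"
      unfolding S_def sum_distrib_left right_diff_distrib sum_subtractf by simp
    have gen: "s * (- u / (2 * s) - v / (1 - s) + c * u / s - W / s) = - u / 2 - s / (1 - s) * v + c * u - W" for u v c W
      using s0 by (simp add: right_diff_distrib distrib_left)
    have M0: "q N * saw_moment (Suc N) b s = - q N / (2 * s) - of_nat (Suc N) * q N / (1 - s) + of_real b * q N / s
        - (q N * (\<Sum>i<Suc N. 1 - of_real ((real i + (1 - b)) / real (Suc N)) powr (- s))) / s"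
      unfolding saw_moment_def by (simp add: algebra_simps del: of_nat_Suc sum.lessThan_Suc)
    have M: "s * (q N * saw_moment (Suc N) b s) = - q N / 2 - s / (1 - s) * (of_nat (Suc N) * q N) + of_real b * q N - (of_nat (Suc N) * q N - S N)"
      unfolding M0 SS by (rule gen)
    have "s / of_real pi * odd_sum 1 b s = s / of_real pi * (q N * D N) + s * (q N * saw_moment (Suc N) b s)"
      unfolding V by (simp add: field_simps)
    then show ?thesis unfolding M by (simp add: algebra_simps del: of_nat_Suc)
  qed
  have "S \<longlonglongrightarrow> s / of_real pi * odd_sum 1 b s - s / of_real pi * 0 + 0 * (1/2) + s / (1 - s) * 0 - of_real b * 0 + 0"
    unfolding eq[abs_def] by (intro tendsto_intros qD q0 q1)
  then have "S \<longlonglongrightarrow> s / of_real pi * odd_sum 1 b s" by simp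
  then show ?thesis unfolding S_def sums_def by (subst (asm) filterlim_sequentially_Suc)
qed

section \<open>Continuation of the zeta function and Hurwitz' formula\<close>

text \<open>This is \<open>s / pi\<close> times \<open>odd_sum 1 (1 - x) s\<close> with the factor
  \<open>s\<close> multiplied in, so that the singularity at 0 has gone and 1 is the only
  exceptional point.\<close>

definition zeta_cont :: "real \<Rightarrow> complex \<Rightarrow> complex" where
  "zeta_cont x s = s / of_real pi * (((\<Sum>k. upper_term \<i> 1 (1 - x) s k) - (\<Sum>k. upper_term (-\<i>) 1 (1 - x) s k)) / (2 * \<i>))
     - 1/2 - s / (1 - s) + of_real (1 - x) - (1 - of_real x powr (- s))"

lemma zeta_cont_eq_odd_sum: "s \<noteq> 0 \<Longrightarrow> zeta_cont x s = s / of_real pi * odd_sum 1 (1 - x) s"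
  unfolding zeta_cont_def odd_sum_def saw_moment_def by (simp add: algebra_simps) (simp add: diff_divide_distrib)

lemma zeta_cont_holomorphic: "x > 0 \<Longrightarrow> zeta_cont x holomorphic_on - {1}"
  unfolding zeta_cont_def [abs_def]
  by (intro holomorphic_on_add holomorphic_on_diff holomorphic_on_mult holomorphic_on_divide holomorphic_on_const holomorphic_on_id
      upper_sum_holomorphic holomorphic_on_powr_right holomorphic_on_minus) auto

lemma hurwitz_zeta_sums_cont:
  assumes x: "0 < x" "x \<le> 1" and s: "Re s > 1"
  shows "(\<lambda>i. of_real (real i + (x + real n)) powr (- s)) sums (zeta_cont x s - (\<Sum>i<n. of_real (x + real i) powr (- s)))"
proof -
  have "s \<noteq> 0" using s by auto
  then have "(\<lambda>i. of_real (real i + x) powr (- s)) sums zeta_cont x s"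
    using odd_sum_eq_zeta_sum[of "1 - x" s] x s zeta_cont_eq_odd_sum[of s x] by simp
  from sums_split_initial_segment[OF this, of n] show ?thesis by (simp add: add_ac)
qed

text \<open>Arguments above 1 are reached by dropping initial summands of the series. The identity
  theorem off 1 then determines the function picked by the choice operator.\<close>

lemma hurwitz_zeta_eq:
  assumes x: "0 < x" "x \<le> 1" and s: "s \<noteq> 1"
  shows "hurwitz_zeta s (x + real n) = zeta_cont x s - (\<Sum>i<n. of_real (x + real i) powr (- s))"
proof -
  let ?P = "\<lambda>f. f holomorphic_on (- {1}) \<and> (\<forall>s. Re s > 1 \<longrightarrow> f s = (\<Sum>k. of_real (real k + (x + real n)) powr (- s)))"
  let ?g = "\<lambda>s. zeta_cont x s - (\<Sum>i<n. of_real (x + real i) powr (- s))"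
  have gh: "?g holomorphic_on - {1}"
    using x by (intro holomorphic_on_diff zeta_cont_holomorphic holomorphic_on_sum holomorphic_on_powr_right holomorphic_on_minus holomorphic_on_id) auto
  have ex: "?P ?g" using gh sums_unique[OF hurwitz_zeta_sums_cont[OF x]] by auto
  define f where "f = (SOME f. ?P f)"
  have f: "?P f" unfolding f_def by (rule someI[of ?P, OF ex])
  have "f s = ?g s"
  proof (rule analytic_continuation_open[where s = "{s. Re s > 1}" and s' = "- {1}" and f = f and g = ?g])
    show "f holomorphic_on - {1}" using f by blast
    show "connected (- {1::complex})"
      using connected_open_diff_countable[of "UNIV :: complex set" "{1}"] convex_connected[OF convex_UNIV]
      by (simp add: Compl_eq_Diff_UNIV)
    show "{s :: complex. Re s > 1} \<noteq> {}" by (auto intro!: exI[of _ "2"])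
    show "f z = ?g z" if "z \<in> {s. Re s > 1}" for z using f ex that by simp
    show "open (- {1::complex})" by (intro open_Compl) auto
  qed (use s gh in \<open>auto simp: open_halfspace_Re_gt\<close>)
  then show ?thesis unfolding hurwitz_zeta_def f_def .
qed

lemma hurwitz_zeta_shift:
  assumes x: "0 < x" "x \<le> 1" and s: "s \<noteq> 1"
  shows "hurwitz_zeta s x - hurwitz_zeta s (x + real n) = (\<Sum>i<n. of_real (x + real i) powr (- s))"
  using hurwitz_zeta_eq[OF assms, of n] hurwitz_zeta_eq[OF assms, of 0] by simp

lemma phase_frac: 
  assumes "\<sigma> \<in> {\<i>, -\<i>}" shows "phase \<sigma> (frac b) k = phase \<sigma> b k"
proof -
  have "cos (2 * pi * (b - of_int m) * real k) = cos (2 * pi * b * real k) \<and> sin (2 * pi * (b - of_int m) * real k) = sin (2 * pi * b * real k)" for m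
  proof -
    have e: "2 * pi * (b - of_int m) * real k = 2 * pi * b * real k - 2 * pi * of_int (m * int k)" by (simp add: algebra_simps)
    have "cos (2 * pi * of_int (m * int k)) = 1" "sin (2 * pi * of_int (m * int k)) = 0"
      using cos_int_2pin[of "m * int k"] sin_int_2pin[of "m * int k"] by (simp_all add: mult_ac)
    then show ?thesis unfolding e cos_diff sin_diff by simp
  qed
  then show ?thesis using assms unfolding frac_def by (auto simp: phase_i)
qed

lemma phase_uminus: "phase \<sigma> (- b) k = phase (- \<sigma>) b k"
  by (simp add: phase_def)

text \<open>Hurwitz' formula: \<open>odd_sum 1\<close> is the zeta value by continuation and the
  Gamma series by \<open>odd_sum_left\<close>. The phases have period 1 in \<open>b\<close>, which
  allows the fractional part.\<close>

lemma zeta_power_sums: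
  assumes s: "Re s < -1"
  shows "(gamma_factor \<i> 1 s * (\<Sum>k. power_term \<i> b s k) - gamma_factor (-\<i>) 1 s * (\<Sum>k. power_term (-\<i>) b s k)) / (2 * \<i>)
     = of_real pi / s * hurwitz_zeta s (1 - frac b)"
proof -
  have s0: "s \<noteq> 0" "s \<noteq> 1" using s by auto
  have p: "power_term \<sigma> b s k = power_term \<sigma> (frac b) s k" if "\<sigma> \<in> {\<i>, -\<i>}" for \<sigma> k
    using phase_frac[OF that] by (simp add: power_term_def)
  have "hurwitz_zeta s (1 - frac b) = s / of_real pi * odd_sum 1 (frac b) s"
    using hurwitz_zeta_eq[of "1 - frac b" s 0] frac_lt_1[of b] frac_ge_0[of b] s0 zeta_cont_eq_odd_sum[of s "1 - frac b"] by simp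
  also have "odd_sum 1 (frac b) s = (gamma_factor \<i> 1 s * (\<Sum>k. power_term \<i> b s k) - gamma_factor (-\<i>) 1 s * (\<Sum>k. power_term (-\<i>) b s k)) / (2 * \<i>)"
    using odd_sum_left[of "frac b" 1 s] frac_lt_1[of b] frac_ge_0[of b] s p[of \<i>] p[of "-\<i>"] by simp
  finally show ?thesis using s0 by simp
qed

text \<open>The formula for \<open>b\<close> and the one for \<open>-b\<close> are two linear equations for the two power
  series with phases \<open>exp (2 pi i b k)\<close> and \<open>exp (- 2 pi i b k)\<close>.\<close>

lemma gamma_power_sums:
  assumes s: "Re s < -1" "s \<notin> \<int>" and a: "a > 0"
  shows "(gamma_factor \<i> a s * (\<Sum>k. power_term \<i> b s k) + gamma_factor (-\<i>) a s * (\<Sum>k. power_term (-\<i>) b s k)) / 2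
     = - (of_real pi * of_real a powr s / s * (hurwitz_zeta s (1 - frac (- b)) / sin (of_real pi * s) + hurwitz_zeta s (1 - frac b) / tan (of_real pi * s)))"
proof -
  \<comment> \<open>\<open>\<i> powr s\<close> equals \<open>q\<close>, and \<open>q^2\<close> is
    exp (\<i> pi s); eliminating one of the two series therefore ends in a division by sin (pi s),
    which needs \<open>s\<close> off the integers.\<close>
  define q where "q = exp (\<i> * of_real pi * s / 2)"
  define F G where "F = of_real (2 * pi) powr s * Gamma (- s) * (\<Sum>k. power_term \<i> b s k)"
    and "G = of_real (2 * pi) powr s * Gamma (- s) * (\<Sum>k. power_term (-\<i>) b s k)"
  define Z Z' where "Z = of_real pi / s * hurwitz_zeta s (1 - frac b)" and "Z' = of_real pi / s * hurwitz_zeta s (1 - frac (- b))"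
  have q0: "q \<noteq> 0" by (simp add: q_def)
  have pi: "\<i> powr s = q" "(-\<i>) powr s = inverse q"
    by (simp_all add: powr_def q_def exp_minus[symmetric] mult_ac)
  have gi: "gamma_factor \<i> 1 s = inverse q * (of_real (2 * pi) powr s * Gamma (- s))" "gamma_factor (-\<i>) 1 s = q * (of_real (2 * pi) powr s * Gamma (- s))"
    by (simp_all add: gamma_factor_def pi)
  have pm: "power_term \<sigma> (- b) s k = power_term (- \<sigma>) b s k" for \<sigma> k by (simp add: power_term_def phase_uminus)
  have e1: "inverse q * F - q * G = 2 * \<i> * Z"
    using zeta_power_sums[OF s(1), of b] unfolding gi F_def G_def Z_def by (simp add: field_simps)
  have e2: "inverse q * G - q * F = 2 * \<i> * Z'"
    using zeta_power_sums[OF s(1), of "- b"] unfolding gi F_def G_def Z'_def pm by (simp add: field_simps)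
  define A B where "A = inverse q * F" and "B = q * G"
  have iq: "inverse q * G = (inverse q)\<^sup>2 * B" "q * F = q\<^sup>2 * A" using q0 by (simp_all add: A_def B_def power2_eq_square)
  have B: "B = A - 2 * \<i> * Z" using e1 by (simp add: A_def B_def algebra_simps)
  have q2: "q\<^sup>2 = exp (\<i> * (of_real pi * s))" "(inverse q)\<^sup>2 = exp (- (\<i> * (of_real pi * s)))"
    by (simp_all add: q_def power2_eq_square exp_add[symmetric] exp_minus[symmetric] mult_ac)
  define S C where "S = sin (of_real pi * s)" and "C = cos (of_real pi * s)"
  have q3: "q\<^sup>2 = C + \<i> * S" "(inverse q)\<^sup>2 = C - \<i> * S"
    unfolding q2 S_def C_def using exp_Euler[of "of_real pi * s"] exp_Euler[of "- (of_real pi * s)"] by simp_all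
  have S0: "S \<noteq> 0"
  proof
    assume "S = 0"
    then obtain n :: int where "of_real pi * s = of_real (of_int n * pi)" unfolding S_def by (auto simp: sin_eq_0)
    then have "s = of_int n" by simp
    then show False using s(2) by simp
  qed
  have h: "(C - \<i> * S) * (A - 2 * \<i> * Z) - (C + \<i> * S) * A = 2 * \<i> * Z'"
    using e2 unfolding iq q3 B .
  have "(C - \<i> * S) * (A - 2 * \<i> * Z) - (C + \<i> * S) * A = 2 * \<i> * (- (S * A) - (C - \<i> * S) * Z)"
    by (simp add: algebra_simps)
  then have "2 * \<i> * (- (S * A) - (C - \<i> * S) * Z) = 2 * \<i> * Z'" using h by simp
  then have "- (S * A) - (C - \<i> * S) * Z = Z'" by (subst (asm) mult_cancel_left) auto
  then have SA: "S * A = - (Z' + (C - \<i> * S) * Z)" by (simp add: algebra_simps)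
  have "S * (A + B) = 2 * (S * A) - 2 * \<i> * S * Z" unfolding B by (simp add: algebra_simps)
  also have "\<dots> = - 2 * (Z' + C * Z)" unfolding SA by (simp add: algebra_simps)
  finally have AB: "A + B = - 2 * (Z' / S + Z * C / S)" using S0 by (simp add: field_simps)
  have "(gamma_factor \<i> a s * (\<Sum>k. power_term \<i> b s k) + gamma_factor (-\<i>) a s * (\<Sum>k. power_term (-\<i>) b s k)) / 2 = of_real a powr s * (A + B) / 2"
    unfolding gamma_factor_scale[OF a, of \<i>] gamma_factor_scale[OF a, of "-\<i>"] gi A_def B_def F_def G_def by (simp add: algebra_simps)
  also have "\<dots> = - (of_real a powr s * (Z' / S + Z * C / S))"
  proof -
    have "c * (- 2 * y) / 2 = - (c * y)" for c y :: complex by simp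
    then show ?thesis unfolding AB .
  qed
  also have "\<dots> = - (of_real pi * of_real a powr s / s * (hurwitz_zeta s (1 - frac (- b)) / S + hurwitz_zeta s (1 - frac b) / (S / C)))"
    unfolding Z_def Z'_def by (simp add: algebra_simps)
  finally show ?thesis unfolding S_def C_def tan_def .
qed

section \<open>The identities\<close>

text \<open>The derivative of Euler's reflection formula: Gamma z Gamma (1 - z) sin (pi z) is
  constantly pi off the integers. The term 1 / s comes from the recurrence for Digamma.\<close>

lemma Digamma_reflection:
  fixes s :: complex
  assumes s: "s \<notin> \<int>"
  shows "Digamma (1 + s) + of_real pi / tan (of_real pi * s) = Digamma (1 - s) + 1 / s"
proof -
  have s0: "s \<noteq> 0" using s by auto
  have sub: "x \<in> \<int>" if "x \<in> \<int>\<^sub>\<le>\<^sub>0" for x :: complex using that by (auto elim!: nonpos_Ints_cases)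
  have nz: "s \<notin> \<int>\<^sub>\<le>\<^sub>0" "1 - s \<notin> \<int>\<^sub>\<le>\<^sub>0"
    using s sub[of s] sub[of "1 - s"] Ints_diff[OF Ints_1, of "1 - s"] by auto
  have si: "sin (of_real pi * s) \<noteq> 0"
  proof
    assume "sin (of_real pi * s) = 0"
    then obtain n :: int where "of_real pi * s = of_real (of_int n * pi)" by (auto simp: sin_eq_0)
    then show False using s by simp
  qed
  define P where "P = (\<lambda>z::complex. Gamma z * Gamma (1 - z) * sin (of_real pi * z))"
  have D1: "(Gamma has_field_derivative Gamma s * Digamma s) (at s)" using nz(1) by (rule has_field_derivative_Gamma)
  have D2: "((\<lambda>z. Gamma (1 - z)) has_field_derivative Gamma (1 - s) * Digamma (1 - s) * - 1) (at s)"
    by (rule DERIV_chain2[where f = Gamma and g = "\<lambda>z. 1 - z", OF has_field_derivative_Gamma[OF nz(2)]])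
       (auto intro!: derivative_eq_intros)
  have D3: "((\<lambda>z. sin (of_real pi * z)) has_field_derivative cos (of_real pi * s) * of_real pi) (at s)"
    by (auto intro!: derivative_eq_intros)
  have DP: "(P has_field_derivative
      (Gamma s * Digamma s * Gamma (1 - s) + Gamma (1 - s) * Digamma (1 - s) * - 1 * Gamma s) * sin (of_real pi * s)
      + cos (of_real pi * s) * of_real pi * (Gamma s * Gamma (1 - s))) (at s)"
    unfolding P_def by (rule DERIV_mult[OF DERIV_mult[OF D1 D2] D3])
  have o: "open (- \<int> :: complex set)" by (simp add: open_Compl)
  have P: "P z = of_real pi" if "z \<in> - \<int>" for z
  proof -
    have "sin (of_real pi * z) \<noteq> 0"
    proof
      assume "sin (of_real pi * z) = 0"
      then obtain n :: int where "of_real pi * z = of_real (of_int n * pi)" by (auto simp: sin_eq_0)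
      then show False using that by simp
    qed
    then show ?thesis unfolding P_def Gamma_reflection_complex by simp
  qed
  have "(P has_field_derivative 0) (at s)"
    by (rule has_field_derivative_transform_within_open[OF DERIV_const[of "of_real pi"] o]) (use s P in auto)
  from DERIV_unique[OF DP this]
  have "Gamma s * Gamma (1 - s) * ((Digamma s - Digamma (1 - s)) * sin (of_real pi * s) + of_real pi * cos (of_real pi * s)) = 0"
    by (simp add: algebra_simps)
  moreover have "Gamma s * Gamma (1 - s) \<noteq> 0" unfolding Gamma_reflection_complex using si by simp
  ultimately have "(Digamma s - Digamma (1 - s)) * sin (of_real pi * s) + of_real pi * cos (of_real pi * s) = 0" by (metis mult_eq_0_iff)
  then have "of_real pi * cos (of_real pi * s) / sin (of_real pi * s) = Digamma (1 - s) - Digamma s"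
  proof -
    assume "(Digamma s - Digamma (1 - s)) * sin (of_real pi * s) + of_real pi * cos (of_real pi * s) = 0"
    from minus_unique[OF this] show ?thesis
      unfolding nonzero_divide_eq_eq[OF si] by (simp add: algebra_simps)
  qed
  moreover have "Digamma (1 + s) = Digamma s + 1 / s" using Digamma_plus1[OF s0] by (simp add: add.commute)
  ultimately show ?thesis by (simp add: tan_def)
qed

lemma LEAST_int_greater: "(LEAST n::int. of_int n > (x::real)) = \<lfloor>x\<rfloor> + 1"
  by (rule Least_equality) linarith+

text \<open>The zeta difference in \<open>H\<close> is the finite sum over floor b < k \<le> floor
  (a + b): the crossings and, if a + b is an integer, the end point k = a + b. The share \<i> pi / s
  of that end point and the cotangent from Digamma reflection are together
  \<open>endpoint_excess\<close>.\<close>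

lemma H_excess_eq_H_ext:
  assumes a: "a > 0" and s: "s \<notin> \<nat>" and e: "a + b \<in> \<int> \<Longrightarrow> s \<notin> \<int>"
  shows "H a b 1 s - endpoint_excess a b 1 s = H_ext a b s"
proof -
  have s0: "s \<noteq> 0" "s \<noteq> 1" using s by auto
  define x where "x = 1 - frac b"
  define m where "m = nat (\<lfloor>a + b\<rfloor> - \<lfloor>b\<rfloor>)"
  have x: "0 < x" "x \<le> 1" using frac_lt_1[of b] frac_ge_0[of b] by (auto simp: x_def)
  have fl: "\<lfloor>b\<rfloor> \<le> \<lfloor>a + b\<rfloor>" using a by (intro floor_mono) simp
  \<comment> \<open>The least integer above a + b is floor (a + b) + 1, so the second zeta argument
    exceeds the first by the integer \<open>m\<close>.\<close>
  have n: "of_int (LEAST n::int. of_int n > \<bar>a\<bar> * 1 + b * sgn a) - b * sgn a = x + real m"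
    using a fl by (simp add: LEAST_int_greater m_def x_def frac_def)
  have bs: "b * sgn a = b" using a by simp
  define E where "E = (\<lambda>k::int. complex_of_real (of_int k - b) powr (- s))"
  have Z: "hurwitz_zeta s (1 - frac (b * sgn a)) - hurwitz_zeta s (of_int (LEAST n::int. of_int n > \<bar>a\<bar> * 1 + b * sgn a) - b * sgn a)
      = (\<Sum>k\<in>{\<lfloor>b\<rfloor> + 1..\<lfloor>a + b\<rfloor>}. E k)"
  proof -
    have "hurwitz_zeta s (1 - frac b) - hurwitz_zeta s (x + real m) = (\<Sum>i<m. of_real (x + real i) powr (- s))"
      unfolding x_def[symmetric] by (rule hurwitz_zeta_shift[OF x s0(2)])
    also have "\<dots> = (\<Sum>k\<in>{\<lfloor>b\<rfloor> + 1..\<lfloor>a + b\<rfloor>}. E k)"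
      by (rule sum.reindex_bij_witness[of _ "\<lambda>k. nat (k - \<lfloor>b\<rfloor> - 1)" "\<lambda>i. \<lfloor>b\<rfloor> + 1 + int i"])
         (use fl in \<open>auto simp: m_def E_def x_def frac_def algebra_simps\<close>)
    finally show ?thesis unfolding bs n[unfolded bs] .
  qed
  have cr: "(\<Sum>k\<in>{\<lfloor>b\<rfloor> + 1..\<lfloor>a + b\<rfloor>}. E k) = (\<Sum>k\<in>crossings a b. E k) + (if a + b \<in> \<int> then of_real a powr (- s) else 0)"
  proof (cases "a + b \<in> \<int>")
    case True
    then obtain K where K: "a + b = of_int K" by (auto elim: Ints_cases)
    have "{\<lfloor>b\<rfloor> + 1..\<lfloor>a + b\<rfloor>} = insert K (crossings a b)"
      using a K by (auto simp: crossings_def) linarith+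
    moreover have "K \<notin> crossings a b" using K by (simp add: crossings_def)
    moreover have "E K = of_real a powr (- s)"
    proof -
      have "of_int K - b = a" using K by simp
      then show ?thesis unfolding E_def by (simp only:)
    qed
    ultimately show ?thesis using True finite_crossings[of a b] by simp
  next
    case False
    have "{\<lfloor>b\<rfloor> + 1..\<lfloor>a + b\<rfloor>} = crossings a b"
    proof (intro set_eqI iffI)
      fix k assume k: "k \<in> {\<lfloor>b\<rfloor> + 1..\<lfloor>a + b\<rfloor>}"
      then have "b < of_int k" "of_int k \<le> a + b" by (auto simp: le_floor_iff) linarith
      moreover have "of_int k \<noteq> a + b" using False by (metis Ints_of_int)
      ultimately show "k \<in> crossings a b" by (simp add: crossings_def)
    next
      fix k assume "k \<in> crossings a b"
      then have "b < of_int k" "of_int k < a + b" by (auto simp: crossings_def)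
      then show "k \<in> {\<lfloor>b\<rfloor> + 1..\<lfloor>a + b\<rfloor>}" by (auto simp: le_floor_iff) linarith
    qed
    then show ?thesis using False by simp
  qed
  have aa: "of_real a powr s * of_real a powr (- s) = (1::complex)" using a by (simp flip: powr_add)
  have lg: "ln ((sin (pi * (a * 1 + b)))\<^sup>2) = 2 * ln \<bar>sin (pi * (a + b))\<bar>" if "a + b \<notin> \<int>"
  proof -
    have "\<bar>sin (pi * (a + b))\<bar> > 0" using that by (auto simp: sin_zero_iff_int2)
    then show ?thesis using ln_realpow[of "\<bar>sin (pi * (a + b))\<bar>" 2] by simp
  qed
  have lp: "1/2 * ln ((pi * a * 1)\<^sup>2) = ln (pi * a)" using ln_realpow[of "pi * a" 2] a by simp
  define T where "T = (\<Sum>j. paired (lhs_term a b 1 s) j)"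
  define X where "X = (\<Sum>k\<in>crossings a b. E k)"
  have H: "H a b 1 s = of_real (ln 2) / s + indicator (- \<int>) (a + b) * of_real (ln ((sin (pi * (a * 1 + b)))\<^sup>2)) / (2 * s)
     + indicator \<int> b * (1 / s\<^sup>2)
     + 1 / s * indicator \<int> (a + b) * (1 / s - Digamma (1 + s) - euler_mascheroni + of_real (ln (pi * a)))
     - T + \<i> * (of_real pi * of_real a powr s / s) * (X + (if a + b \<in> \<int> then of_real a powr (- s) else 0))"
    unfolding H_def Z cr T_def X_def lp using a by simp
  have G: "H_ext a b s = of_real (ln 2 + log_const a b) / s + (if b \<in> \<int> then 1 / s\<^sup>2 else 0)
     - (if a + b \<in> \<int> then (Digamma (1 - s) + euler_mascheroni) / s else 0) - T + \<i> * of_real pi / s * of_real a powr s * X"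
    unfolding H_ext_def T_def X_def E_def ..
  have EE: "endpoint_excess a b 1 s = indicator \<int> (a + b) * (of_real pi / s * (1 / tan (of_real pi * s) + \<i>))"
    by (simp add: endpoint_excess_def)
  show ?thesis
  proof (cases "a + b \<in> \<int>")
    case False
    then show ?thesis unfolding H G EE lg[OF False] using s0
      by (simp add: log_const_def indicator_def add_divide_distrib mult_ac)
  next
    case True
    have D: "Digamma (1 + s) = Digamma (1 - s) + 1 / s - of_real pi / tan (of_real pi * s)"
      using Digamma_reflection[OF e[OF True]] by (simp add: algebra_simps)
    have "\<i> * (of_real pi * of_real a powr s / s) * of_real a powr (- s) = \<i> * of_real pi / s * (of_real a powr s * of_real a powr (- s))" by simp
    also have "\<dots> = \<i> * of_real pi / s" unfolding aa by simp
    finally have i0: "\<i> * (of_real pi * of_real a powr s / s) * of_real a powr (- s) = \<i> * of_real pi / s" .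
    have i: "\<i> * (of_real pi * of_real a powr s / s) * (X + of_real a powr (- s)) = \<i> * of_real pi / s * of_real a powr s * X + \<i> * of_real pi / s"
    proof -
      have "\<i> * (of_real pi * of_real a powr s / s) * X = \<i> * of_real pi / s * of_real a powr s * X" by simp
      then show ?thesis unfolding distrib_left i0 by (simp only:)
    qed
    have gen: "u / s + 0 * l / (2 * s) + i2 * (1 / s\<^sup>2) + 1 / s * 1 * (1 / s - (D + 1 / s - p / t) - g + c) - S + (Y + \<i> * p / s)
        - 1 * (p / s * (1 / t + \<i>)) = (u + c) / s + i2 * (1 / s\<^sup>2) - (D + g) / s - S + Y" for u l i2 D p t g c S Y :: complex
    proof -
      \<comment> \<open>With the reciprocals taken as independent variables the claim is a
        polynomial identity.\<close>
      have "u * w + I2 + w * (w - (D + w - p * r) - g + c) - S + (Y + j * p * w) - p * w * (r + j)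
        = (u + c) * w + I2 - (D + g) * w - S + Y" for w I2 r j :: complex
        by algebra
      from this[of "inverse s" "i2 * inverse (s\<^sup>2)" "inverse t" \<i>] show ?thesis
        by (simp only: divide_inverse mult_1_left mult_1_right mult_zero_left add_0_right)
    qed
    have I: "indicator \<int> (a + b) = (1::complex)" "indicator (- \<int>) (a + b) = (0::complex)" using True by simp_all
    have B: "(if b \<in> \<int> then 1 / s\<^sup>2 else 0) = indicator \<int> b * (1 / s\<^sup>2)" by simp
    have lc: "log_const a b = ln (pi * a)" using True by (simp add: log_const_def)
    show ?thesis unfolding H G EE D I if_P[OF True] i B lc of_real_add by (rule gen)
  qed
qed

text \<open>The series depends on \<open>a * d\<close> alone, the least integer in \<open>H\<close>
  on |a| d, and |a|^s is (|a| d)^s divided by d^s, so a common power of \<open>d\<close> comes out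
  everywhere.\<close>

lemma H_scale:
  assumes "d > 0"
  shows "H a b d s - endpoint_excess a b d s = of_real d powr (- s) * (H (a * d) b 1 s - endpoint_excess (a * d) b 1 s)"
proof -
  define D where "D = complex_of_real d powr s"
  have D0: "D \<noteq> 0" using assms by (simp add: D_def)
  have dm: "complex_of_real d powr (- s) = inverse D" by (simp add: D_def powr_minus)
  have ab: "\<bar>a * d\<bar> = \<bar>a\<bar> * d" "sgn (a * d) = sgn a" using assms by (simp_all add: abs_mult sgn_mult)
  have pw: "of_real (\<bar>a\<bar> * d) powr s = of_real \<bar>a\<bar> powr s * D"
    unfolding D_def using powr_times_real[of "of_real \<bar>a\<bar>" "of_real d" s] assms by simp
  have T: "lhs_term (a * d) b 1 s = lhs_term a b d s" by (rule ext) (rule lhs_term_scale[symmetric])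
  have one: "complex_of_real 1 powr s = 1" by simp
  have pm: "(pi * (a * d))\<^sup>2 = (pi * a * d)\<^sup>2" by (simp only: mult.assoc)
  have gen: "A / (s * D) + i1 * L / (2 * s * D) + i2 * (1 / (s\<^sup>2 * D)) + 1 / (s * D) * i3 * B - 1 / D * S + \<i> * (p * q / s) * W - i3 * (p / (s * D) * t)
    = inverse D * (A / (s * 1) + i1 * L / (2 * s * 1) + i2 * (1 / (s\<^sup>2 * 1)) + 1 / (s * 1) * i3 * B - 1 / 1 * S + \<i> * (p * (q * D) / s) * W - i3 * (p / (s * 1) * t))"
    for A i1 L i2 i3 B S p q W t :: complex
  proof -
    have e: "\<i> * (p * q / s) * W = inverse D * (\<i> * (p * (q * D) / s) * W)" using D0 by simp
    show ?thesis unfolding e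
      by (simp only: divide_inverse inverse_mult_distrib right_diff_distrib distrib_left mult_1_right mult_1_left inverse_1 mult_ac)
  qed
  show ?thesis
    unfolding H_def endpoint_excess_def ab T mult_1_right pw dm pm D_def[symmetric] one
    by (rule gen[unfolded mult_1_right])
qed

text \<open>Signs enter only through |a|, the product of b with the sign of a, squares, membership
  in the integers, and the series, whose pairs are invariant.\<close>

lemma H_uminus: "H (- a) (- b) d s - endpoint_excess (- a) (- b) d s = H a b d s - endpoint_excess a b d s"
proof -
  have i: "indicator A (- x) = (indicator A x :: complex)" if "\<And>x. (- x \<in> A) = (x \<in> A)" for A and x :: real
    using that by (simp add: indicator_def)
  have I: "(- x \<in> \<int>) = (x \<in> \<int>)" "(- x \<in> - \<int>) = (x \<in> - \<int>)" for x :: real by auto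
  have m: "- a * d + - b = - (a * d + b)" "- b * sgn (- a) = b * sgn a" by (simp_all add: sgn_minus)
  have sn: "(sin (pi * - (a * d + b)))\<^sup>2 = (sin (pi * (a * d + b)))\<^sup>2"
    by (simp only: mult_minus_right sin_minus power2_minus)
  have pm: "(pi * - a * d)\<^sup>2 = (pi * a * d)\<^sup>2" by simp
  have T: "(\<Sum>j. paired (lhs_term (- a) (- b) d s) j) = (\<Sum>j. paired (lhs_term a b d s) j)"
    by (simp only: paired_lhs_term_uminus)
  show ?thesis unfolding H_def endpoint_excess_def m T sn pm abs_minus_cancel i[OF I(1)] i[OF I(2)] ..
qed

definition rhs_sum :: "real \<Rightarrow> real \<Rightarrow> complex \<Rightarrow> complex" where
  "rhs_sum a b s = ((\<Sum>k. upper_term \<i> a b s k) + (\<Sum>k. upper_term (-\<i>) a b s k)) / 2"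

definition zeta_part :: "real \<Rightarrow> real \<Rightarrow> complex \<Rightarrow> complex" where
  "zeta_part a b s = of_real pi * of_real a powr s / s * (hurwitz_zeta s (1 - frac (- b)) / sin (of_real pi * s)
     + hurwitz_zeta s (1 - frac b) / tan (of_real pi * s))"

lemma rhs_sum_holomorphic: "a > 0 \<Longrightarrow> rhs_sum a b holomorphic_on A"
  unfolding rhs_sum_def [abs_def]
  by (intro holomorphic_on_divide holomorphic_on_add upper_sum_holomorphic holomorphic_on_const) auto

lemma sin_pi_nonzero:
  fixes s :: complex
  assumes "s \<notin> \<int>" shows "sin (of_real pi * s) \<noteq> 0"
proof
  assume "sin (of_real pi * s) = 0"
  then obtain n :: int where "of_real pi * s = of_real (of_int n * pi)" by (auto simp: sin_eq_0)
  then show False using assms by simp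
qed

lemma hurwitz_zeta_holomorphic:
  assumes "0 < x" "x \<le> 1"
  shows "(\<lambda>s. hurwitz_zeta s x) holomorphic_on - {1}"
proof (rule holomorphic_transform[OF zeta_cont_holomorphic[OF assms(1)]])
  show "zeta_cont x z = hurwitz_zeta z x" if "z \<in> - {1}" for z
    using hurwitz_zeta_eq[OF assms, of z 0] that by simp
qed

lemma zeta_part_holomorphic:
  assumes "a > 0"
  shows "zeta_part a b holomorphic_on - \<int>"
proof -
  have z: "(\<lambda>s. hurwitz_zeta s (1 - frac c)) holomorphic_on - \<int>" for c
    by (rule holomorphic_on_subset[OF hurwitz_zeta_holomorphic]) (use frac_lt_1[of c] frac_ge_0[of c] in auto)
  have s0: "s \<noteq> 0" if "s \<in> - \<int>" for s :: complex using that by auto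
  have "(\<lambda>s. of_real pi * of_real a powr s / s * (hurwitz_zeta s (1 - frac (- b)) / sin (of_real pi * s)
     + hurwitz_zeta s (1 - frac b) * cos (of_real pi * s) / sin (of_real pi * s))) holomorphic_on - \<int>"
    using assms s0 sin_pi_nonzero
    by (intro holomorphic_on_mult holomorphic_on_divide holomorphic_on_add holomorphic_on_const holomorphic_on_id z
        holomorphic_on_powr_right) (auto intro!: holomorphic_intros)
  then show ?thesis unfolding zeta_part_def [abs_def] tan_def by simp
qed

lemma connected_Compl_Ints: "connected (- \<int> :: complex set)"
  using connected_open_diff_countable[of "UNIV :: complex set" \<int>] convex_connected[OF convex_UNIV]
  by (simp add: Compl_eq_Diff_UNIV Ints_def)

text \<open>For Re s < -2 the \<open>upper_term\<close> series is the Gamma series minus the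
  \<open>head_term\<close> series. Hurwitz' formula turns the first into the zeta part, the
  logarithmic integral turns the second into \<open>H_ext\<close>, and both sides continue over the
  connected complement of the integers.\<close>

lemma rhs_sum_identity:
  assumes a: "a > 0" and s: "s \<notin> \<int>"
  shows "rhs_sum a b s = - (H_ext a b s + zeta_part a b s)"
proof (rule analytic_continuation_open[where s = "{s. Re s < -2} - \<int>" and s' = "- \<int>" and f = "rhs_sum a b"
    and g = "\<lambda>s. - (H_ext a b s + zeta_part a b s)"])
  have "H_ext a b holomorphic_on - \<int>"
    by (rule holomorphic_on_subset[OF H_ext_holomorphic[OF a]]) (auto elim!: Nats_cases)
  then show "(\<lambda>s. - (H_ext a b s + zeta_part a b s)) holomorphic_on - \<int>"
    by (intro holomorphic_on_minus holomorphic_on_add zeta_part_holomorphic[OF a])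
  show "open ({s. Re s < -2} - \<int>)" by (intro open_Diff open_halfspace_Re_lt closed_Ints)
  \<comment> \<open>A point of the half-plane outside the integers, needed as the set of agreement
    must be nonempty.\<close>
  have "- 5 / 2 \<notin> (\<int> :: complex set)"
  proof
    assume "- 5 / 2 \<in> (\<int> :: complex set)"
    then obtain n where "- 5 / 2 = (of_int n :: complex)" by (auto elim: Ints_cases)
    then have "of_int (- 5) = (of_int (2 * n) :: complex)" by (simp add: field_simps)
    then have "- 5 = 2 * n" unfolding of_int_eq_iff .
    then show False by presburger
  qed
  then have "- 5 / 2 \<in> {s :: complex. Re s < -2} - \<int>" by simp
  then show "{s :: complex. Re s < -2} - \<int> \<noteq> {}" by blast
  show "rhs_sum a b z = - (H_ext a b z + zeta_part a b z)" if "z \<in> {s. Re s < -2} - \<int>" for z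
  proof -
    have z: "Re z < -2" "Re z < -1" "Re z < 0" "z \<notin> \<int>" using that by auto
    have G: "(gamma_factor \<i> a z * (\<Sum>k. power_term \<i> b z k) + gamma_factor (-\<i>) a z * (\<Sum>k. power_term (-\<i>) b z k)) / 2 = - zeta_part a b z"
      using gamma_power_sums[OF z(2,4) a] by (simp add: zeta_part_def)
    have h: "(\<Sum>k. head_term \<sigma> a b z k) = gamma_factor \<sigma> a z * (\<Sum>k. power_term \<sigma> b z k) - (\<Sum>k. upper_term \<sigma> a b z k)" if "\<sigma> \<in> {\<i>, -\<i>}" for \<sigma>
      using head_term_sum_decomp[OF that a z(3)] .
    have "rhs_sum a b z = (gamma_factor \<i> a z * (\<Sum>k. power_term \<i> b z k) + gamma_factor (-\<i>) a z * (\<Sum>k. power_term (-\<i>) b z k)) / 2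
        + - ((\<Sum>k. head_term \<i> a b z k) + (\<Sum>k. head_term (-\<i>) a b z k)) / 2"
      unfolding rhs_sum_def using h[of \<i>] h[of "-\<i>"] by (simp add: add_divide_distrib[symmetric])
    also have "\<dots> = - (H_ext a b z + zeta_part a b z)"
      unfolding G hyp_term_sums_left[OF a z(1)] by simp
    finally show ?thesis .
  qed
qed (use s in \<open>auto simp: connected_Compl_Ints open_Compl rhs_sum_holomorphic[OF a]\<close>)

section \<open>Conditional convergence to the left of Re s = 1\<close>

text \<open>The mean value inequality on the segment from k to k + 1. The gain of one power of
  \<open>k\<close> is what makes the series after summation by parts absolutely convergent.\<close>

lemma powr_nat_difference_bound:
  fixes k :: nat and w :: complex
  assumes k: "k > 0" and w: "Re w < 1"
  shows "norm (of_nat (Suc k) powr w - of_nat k powr w) \<le> norm w * real k powr (Re w - 1)"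
proof -
  have "norm (complex_of_nat (Suc k) powr w - of_nat k powr w) \<le> norm w * real k powr (Re w - 1) * norm (complex_of_nat (Suc k) - of_nat k)"
  proof (rule field_differentiable_bound[where S = "closed_segment (of_nat k) (of_nat (Suc k))"
        and f = "\<lambda>z. z powr w" and f' = "\<lambda>z. w * z powr (w - 1)"])
    fix z :: complex assume "z \<in> closed_segment (of_nat k) (of_nat (Suc k))"
    then obtain t where t: "0 \<le> t" "t \<le> 1" "z = of_real (real k + t)"
      by (auto simp: closed_segment_def algebra_simps scaleR_conv_of_real)
    have "z \<notin> \<real>\<^sub>\<le>\<^sub>0" using t k by (auto simp: complex_nonpos_Reals_iff)
    then show "((\<lambda>z. z powr w) has_field_derivative w * z powr (w - 1)) (at z within closed_segment (of_nat k) (of_nat (Suc k)))"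
      by (rule has_field_derivative_at_within[OF has_field_derivative_powr])
    have "norm (z powr (w - 1)) = (real k + t) powr (Re w - 1)"
      unfolding t(3) using norm_powr_real_powr[OF Reals_of_real[of "real k + t"], of "w - 1"] t(1) by simp
    also have "\<dots> \<le> real k powr (Re w - 1)" using k t w by (intro powr_mono2') auto
    finally show "norm (w * z powr (w - 1)) \<le> norm w * real k powr (Re w - 1)"
      unfolding norm_mult by (rule mult_left_mono) simp
  qed auto
  then show ?thesis by simp
qed

text \<open>Summation by parts: \<open>(1 - q) * (\<Sum>k. q ^ k * k powr (s - 1))\<close> is rewritten as the absolutely
  convergent series of \<open>q ^ (k + 1)\<close> times the differences of \<open>k powr (s - 1)\<close>.\<close>

lemma power_term_sums_nonint:
  assumes \<sigma>: "\<sigma> \<in> {\<i>, -\<i>}" and b: "b \<notin> \<int>"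
  shows "\<exists>F. F holomorphic_on {s. Re s < 1} \<and> (\<forall>s. Re s < 1 \<longrightarrow> power_term \<sigma> b s sums F s)"
proof -
  define q where "q = exp (\<sigma> * of_real (2 * pi * b))"
  have ph: "phase \<sigma> b k = q ^ k" for k
    unfolding phase_def q_def exp_of_nat_mult[symmetric] by (simp add: mult_ac)
  have nq: "norm q = 1" using norm_phase[OF \<sigma>, of b 1] ph[of 1] by simp
  \<comment> \<open>This is where \<open>b\<close> must not be an integer: the ratio
    \<open>q\<close> of successive phases differs from 1.\<close>
  have q1: "1 - q \<noteq> 0"
  proof -
    have "Re (1 - of_real 1 * exp (2 * of_real pi * \<i> * of_real c)) > 0" if "c \<notin> \<int>" for c
      using that by (intro Re_one_minus_rexp) auto
    from this[of b] this[of "- b"] b show ?thesis using \<sigma> unfolding q_def by (auto simp: mult_ac)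
  qed
  define \<Delta> where "\<Delta> = (\<lambda>k s. complex_of_nat (Suc k) powr (s - 1) - of_nat k powr (s - 1))"
  define D where "D = (\<lambda>s. \<Sum>k. q ^ Suc k * \<Delta> k s)"
  have db: "norm (q ^ Suc k * \<Delta> k s) \<le> norm (s - 1) * real k powr (Re s - 2)" if "k > 0" "Re s < 2" for k s
    using powr_nat_difference_bound[OF that(1), of "s - 1"] that(2) unfolding \<Delta>_def by (simp add: norm_mult norm_power nq del: of_nat_Suc)
  have hol: "D holomorphic_on {s. Re s < 1}"
    unfolding D_def
  proof (rule holomorphic_on_suminf_local[OF open_halfspace_Re_lt])
    show "(\<lambda>s. q ^ Suc n * \<Delta> n s) holomorphic_on {s. Re s < 1}" for n
      unfolding \<Delta>_def by (cases "n = 0") (auto intro!: holomorphic_intros simp del: of_nat_Suc)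
    fix z :: complex assume z: "z \<in> {s. Re s < 1}"
    \<comment> \<open>Half the distance to the line Re s = 1, so that the exponent
      \<open>Re z + r - 2\<close> stays below -1.\<close>
    define r where "r = (1 - Re z) / 2"
    have r: "r > 0" using z by (simp add: r_def)
    have "norm (q ^ Suc n * \<Delta> n w) \<le> (norm z + r + 1) * real n powr (Re z + r - 2)" if "n \<ge> 1" "w \<in> ball z r" for n w
    proof -
      have "norm (w - z) < r" using that(2) by (simp add: dist_norm norm_minus_commute)
      moreover have "norm (w - 1) \<le> norm (w - z) + norm z + 1"
        using norm_triangle_ineq[of "w - z" "z - 1"] norm_triangle_ineq4[of z 1] by simp
      moreover have "Re w \<le> Re z + r" using complex_Re_le_cmod[of "w - z"] calculation(1) by simp
      moreover have "Re z + r < 2" using z field_sum_of_halves[of "1 - Re z"] unfolding r_def mem_Collect_eq by linarith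
      ultimately have c: "norm (w - 1) \<le> norm z + r + 1" "Re w - 2 \<le> Re z + r - 2" "Re w < 2"
        by linarith+
      have "norm (q ^ Suc n * \<Delta> n w) \<le> norm (w - 1) * real n powr (Re w - 2)" using that(1) c by (intro db) auto
      also have "\<dots> \<le> (norm z + r + 1) * real n powr (Re z + r - 2)"
        using c that(1) r by (intro mult_mono powr_mono) (auto intro: add_nonneg_nonneg)
      finally show ?thesis .
    qed
    moreover have "summable (\<lambda>n. (norm z + r + 1) * real n powr (Re z + r - 2))"
    proof (intro summable_mult)
      have "Re z + r - 2 < - 1" using z field_sum_of_halves[of "1 - Re z"] unfolding r_def mem_Collect_eq by linarith
      then show "summable (\<lambda>n. real n powr (Re z + r - 2))" by (simp add: summable_real_powr_iff)
    qed
    ultimately show "\<exists>r>0. \<exists>M N. summable M \<and> (\<forall>n\<ge>N. \<forall>w\<in>ball z r \<inter> {s. Re s < 1}. norm (q ^ Suc n * \<Delta> n w) \<le> M n)"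
      using r by (intro exI[of _ r] conjI exI[of _ "\<lambda>n. (norm z + r + 1) * real n powr (Re z + r - 2)"] exI[of _ 1]) auto
  qed
  have sums: "power_term \<sigma> b s sums (D s / (1 - q))" if s: "Re s < 1" for s
  proof -
    have part: "(1 - q) * (\<Sum>k<N. power_term \<sigma> b s k) = (\<Sum>k<N. q ^ Suc k * \<Delta> k s) - q ^ N * of_nat N powr (s - 1)" for N
    proof (induction N)
      case (Suc N)
      have "S - q ^ N * x + (1 - q) * (q ^ N * x) = S + q ^ Suc N * (y - x) - q ^ Suc N * y" for S x y :: complex
        by (simp add: algebra_simps)
      then show ?case
        unfolding sum.lessThan_Suc distrib_left Suc by (simp only: power_term_def ph \<Delta>_def)
    qed simp
    have "summable (\<lambda>k. q ^ Suc k * \<Delta> k s)"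
    proof (rule summable_comparison_test[OF exI[of _ 1]])
      show "\<forall>n\<ge>1. norm (q ^ Suc n * \<Delta> n s) \<le> norm (s - 1) * real n powr (Re s - 2)" using s by (auto intro!: db simp del: power_Suc)
      show "summable (\<lambda>n. norm (s - 1) * real n powr (Re s - 2))"
        using s by (intro summable_mult) (simp add: summable_real_powr_iff)
    qed
    then have 1: "(\<lambda>N. \<Sum>k<N. q ^ Suc k * \<Delta> k s) \<longlonglongrightarrow> D s" unfolding D_def by (rule summable_LIMSEQ)
    have "(\<lambda>N. real N powr (Re s - 1)) \<longlonglongrightarrow> 0" using s by real_asymp
    moreover have "norm (q ^ N * of_nat N powr (s - 1)) = real N powr (Re s - 1)" for N
      by (simp add: norm_mult norm_power nq norm_powr_real_powr)
    ultimately have 2: "(\<lambda>N. q ^ N * of_nat N powr (s - 1)) \<longlonglongrightarrow> 0"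
      by (subst tendsto_norm_zero_iff[symmetric]) simp
    have "(\<lambda>N. ((\<Sum>k<N. q ^ Suc k * \<Delta> k s) - q ^ N * of_nat N powr (s - 1)) / (1 - q)) \<longlonglongrightarrow> (D s - 0) / (1 - q)"
      using q1 by (intro tendsto_divide tendsto_diff 1 2 tendsto_const) auto
    then show ?thesis unfolding sums_def part[symmetric] using q1 by simp
  qed
  show ?thesis
    by (rule exI[of _ "\<lambda>s. D s / (1 - q)"]) (use sums hol q1 in \<open>auto intro!: holomorphic_intros\<close>)
qed

text \<open>Plain absolute convergence, in the half-plane that is claimed for integer
  \<open>b\<close>, where the phases do not oscillate.\<close>

lemma power_term_sums_int:
  assumes \<sigma>: "\<sigma> \<in> {\<i>, -\<i>}"
  shows "\<exists>F. F holomorphic_on {s. Re s < 0} \<and> (\<forall>s. Re s < 0 \<longrightarrow> power_term \<sigma> b s sums F s)"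
proof (intro exI conjI allI impI)
  show "power_term \<sigma> b s sums (\<Sum>k. power_term \<sigma> b s k)" if "Re s < 0" for s
    by (intro summable_sums summable_norm_cancel[OF power_term_summable[OF \<sigma> that]])
  show "(\<lambda>s. \<Sum>k. power_term \<sigma> b s k) holomorphic_on {s. Re s < 0}"
  proof (rule holomorphic_on_suminf_local[OF open_halfspace_Re_lt])
    show "(\<lambda>s. power_term \<sigma> b s n) holomorphic_on {s. Re s < 0}" for n
      unfolding power_term_def by (cases "n = 0") (auto intro!: holomorphic_intros)
    fix z :: complex assume z: "z \<in> {s. Re s < 0}"
    define r where "r = - Re z / 2"
    have r: "r > 0" using z by (simp add: r_def)
    have "norm (power_term \<sigma> b w n) \<le> real n powr (Re z + r - 1)" if "n \<ge> 1" "w \<in> ball z r" for n w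
    proof -
      have "norm (w - z) < r" using that(2) by (simp add: dist_norm norm_minus_commute)
      then have "Re w \<le> Re z + r" using complex_Re_le_cmod[of "w - z"] by simp
      then show ?thesis unfolding norm_power_term[OF \<sigma>] using that(1) by (intro powr_mono) auto
    qed
    moreover have "summable (\<lambda>n. real n powr (Re z + r - 1))"
      using z by (simp add: summable_real_powr_iff r_def)
    ultimately show "\<exists>r>0. \<exists>M N. summable M \<and> (\<forall>n\<ge>N. \<forall>w\<in>ball z r \<inter> {s. Re s < 0}. norm (power_term \<sigma> b w n) \<le> M n)"
      using r by (intro exI[of _ r] conjI exI[of _ "\<lambda>n. real n powr (Re z + r - 1)"] exI[of _ 1]) auto
  qed
qed

lemma gamma_factor_holomorphic:
  assumes "a > 0" "\<sigma> \<in> {\<i>, -\<i>}"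
  shows "gamma_factor \<sigma> a holomorphic_on - \<nat>"
  unfolding gamma_factor_def [abs_def] using assms
  by (intro holomorphic_intros) (auto simp: uminus_Ints_le_0)

text \<open>The \<open>power_term\<close> series may converge only conditionally; its sum enters as
  a holomorphic function \<open>F\<close>, and no further exchange of limits is made. The value of
  the whole sum is continued from Re s < -2.\<close>

lemma hyp_term_sums:
  assumes a: "a > 0" and s: "Re s < 1 \<and> b \<notin> \<int> \<or> Re s < 0" "s \<noteq> 0"
  shows "(\<lambda>k. hyp_term a b 1 s (Suc k)) sums (- H_ext a b s)"
proof -
  \<comment> \<open>The abscissa of the half-plane. To the left of it the only natural that can
    occur is 0, which \<open>A\<close> removes.\<close>
  define c :: real where "c = (if b \<in> \<int> then 0 else 1)"
  define A where "A = {s. Re s < c} - {0}"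
  have sA: "s \<in> A" using s by (auto simp: A_def c_def)
  have AN: "A \<subseteq> - \<nat>"
  proof
    fix z assume z: "z \<in> A"
    show "z \<in> - \<nat>"
    proof
      assume "z \<in> \<nat>"
      then obtain n where n: "z = of_nat n" by (auto elim: Nats_cases)
      then have "real n < 1" using z by (auto simp: A_def c_def split: if_splits)
      then show False using z n by (simp add: A_def)
    qed
  qed
  have oA: "open A" unfolding A_def by (intro open_Diff open_halfspace_Re_lt) auto
  have cA: "connected A" unfolding A_def
    by (intro connected_open_delete open_halfspace_Re_lt convex_connected convex_halfspace_Re_lt) auto
  have "\<exists>F. F holomorphic_on {s. Re s < c} \<and> (\<forall>s. Re s < c \<longrightarrow> power_term \<sigma> b s sums F s)" if "\<sigma> \<in> {\<i>, -\<i>}" for \<sigma>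
    using power_term_sums_nonint[OF that, of b] power_term_sums_int[OF that, of b] by (cases "b \<in> \<int>") (auto simp: c_def)
  from this[of \<i>] this[of "-\<i>"] obtain F F'
    where F: "F holomorphic_on {s. Re s < c}" "\<And>s. Re s < c \<Longrightarrow> power_term \<i> b s sums F s"
      and F': "F' holomorphic_on {s. Re s < c}" "\<And>s. Re s < c \<Longrightarrow> power_term (-\<i>) b s sums F' s"
    by auto
  define Y where "Y = (\<lambda>s. - ((gamma_factor \<i> a s * F s - (\<Sum>k. upper_term \<i> a b s k)) + (gamma_factor (-\<i>) a s * F' s - (\<Sum>k. upper_term (-\<i>) a b s k))) / 2)"
  have hs: "head_term \<i> a b z sums (gamma_factor \<i> a z * F z - (\<Sum>k. upper_term \<i> a b z k))"
    "head_term (-\<i>) a b z sums (gamma_factor (-\<i>) a z * F' z - (\<Sum>k. upper_term (-\<i>) a b z k))" if "z \<in> A" for z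
  proof -
    have zN: "z \<notin> \<nat>" and zc: "Re z < c" using that AN by (auto simp: A_def)
    have m: "\<i> \<in> {\<i>, -\<i>}" "-\<i> \<in> {\<i>, -\<i>}" by auto
    have u: "upper_term \<sigma> a b z sums (\<Sum>k. upper_term \<sigma> a b z k)" if "\<sigma> \<in> {\<i>, -\<i>}" for \<sigma>
      by (intro summable_sums summable_norm_cancel[OF upper_term_summable[OF that a]])
    have h: "head_term \<sigma> a b z = (\<lambda>k. gamma_factor \<sigma> a z * power_term \<sigma> b z k - upper_term \<sigma> a b z k)" if "\<sigma> \<in> {\<i>, -\<i>}" for \<sigma>
      by (rule ext) (rule head_term_decomp[OF that a zN])
    show "head_term \<i> a b z sums (gamma_factor \<i> a z * F z - (\<Sum>k. upper_term \<i> a b z k))"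
      unfolding h[OF m(1)] by (intro sums_diff sums_mult F(2)[OF zc] u[OF m(1)])
    show "head_term (-\<i>) a b z sums (gamma_factor (-\<i>) a z * F' z - (\<Sum>k. upper_term (-\<i>) a b z k))"
      unfolding h[OF m(2)] by (intro sums_diff sums_mult F'(2)[OF zc] u[OF m(2)])
  qed
  have "Y s = - H_ext a b s"
  proof (rule analytic_continuation_open[where s = "{s. Re s < -2}" and s' = A and f = Y and g = "\<lambda>s. - H_ext a b s"])
    have sub: "A \<subseteq> {s. Re s < c}" by (auto simp: A_def)
    have gf: "gamma_factor \<i> a holomorphic_on A" "gamma_factor (-\<i>) a holomorphic_on A"
      using AN by (auto intro!: holomorphic_on_subset[OF gamma_factor_holomorphic[OF a]])
    show "Y holomorphic_on A"
      unfolding Y_def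
      by (intro holomorphic_on_divide holomorphic_on_minus holomorphic_on_add holomorphic_on_diff holomorphic_on_mult
          gf holomorphic_on_subset[OF F(1) sub] holomorphic_on_subset[OF F'(1) sub] upper_sum_holomorphic a holomorphic_on_const) auto
    show "(\<lambda>s. - H_ext a b s) holomorphic_on A"
      by (intro holomorphic_on_minus holomorphic_on_subset[OF H_ext_holomorphic[OF a] AN])
    show "{s :: complex. Re s < -2} \<noteq> {}" by (auto intro!: exI[of _ "-3"])
    show sub2: "{s. Re s < -2} \<subseteq> A" by (auto simp: A_def c_def)
    show "Y z = - H_ext a b z" if "z \<in> {s. Re s < -2}" for z
    proof -
      have z: "z \<in> A" "Re z < -2" using that sub2 by auto
      have "Y z = - ((\<Sum>k. head_term \<i> a b z k) + (\<Sum>k. head_term (-\<i>) a b z k)) / 2"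
        unfolding Y_def sums_unique[OF hs(1)[OF z(1)]] sums_unique[OF hs(2)[OF z(1)]] ..
      also have "\<dots> = - H_ext a b z" by (rule hyp_term_sums_left[OF a z(2)])
      finally show ?thesis .
    qed
  qed (use oA cA sA in \<open>auto simp: open_halfspace_Re_lt\<close>)
  moreover have "(\<lambda>k. hyp_term a b 1 s (Suc k)) sums Y s"
  proof -
    have sN: "s \<notin> \<nat>" using sA AN by auto
    define f where "f = (\<lambda>k. - (head_term \<i> a b s k + head_term (-\<i>) a b s k) / 2)"
    have "f sums Y s"
      unfolding f_def Y_def by (intro sums_divide sums_minus sums_add hs sA)
    moreover have "f 0 = 0" by (simp add: f_def head_term_def)
    ultimately have "(\<lambda>k. f (Suc k)) sums Y s" by (simp only: sums_Suc_zero[of f])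
    moreover have "f (Suc k) = hyp_term a b 1 s (Suc k)" for k
      unfolding f_def by (rule hyp_term_head_terms[symmetric]) (use sN a in auto)
    ultimately show ?thesis by simp
  qed
  ultimately show ?thesis by simp
qed

section \<open>General parameters and the final statement\<close>

lemma eventually_at_not_Ints: "\<forall>\<^sub>F s in at z. (s :: complex) \<notin> \<int>"
proof -
  have "\<not> z islimpt (\<int> :: complex set)"
  proof (rule discrete_imp_not_islimpt[of 1])
    fix x y :: complex assume "x \<in> \<int>" "y \<in> \<int>" "dist y x < 1"
    then obtain m n where mn: "x = of_int m" "y = of_int n" by (auto elim!: Ints_cases)
    have "real_of_int \<bar>n - m\<bar> < 1" using \<open>dist y x < 1\<close> unfolding mn dist_of_int .
    then show "y = x" using mn by simp
  qed simp
  then show ?thesis by (simp add: islimpt_iff_eventually)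
qed

lemma Ints_mult_sgn_iff:
  assumes "(a :: real) \<noteq> 0"
  shows "b * sgn a \<in> \<int> \<longleftrightarrow> b \<in> \<int>" and "\<bar>a\<bar> * d + b * sgn a \<in> \<int> \<longleftrightarrow> a * d + b \<in> \<int>"
proof -
  consider "sgn a = 1" "\<bar>a\<bar> = a" | "sgn a = - 1" "\<bar>a\<bar> = - a" using assms by (cases "a > 0") auto
  then have "b * sgn a \<in> {b, - b} \<and> \<bar>a\<bar> * d + b * sgn a \<in> {a * d + b, - (a * d + b)}" by cases auto
  moreover have "- x \<in> \<int> \<longleftrightarrow> x \<in> \<int>" for x :: real by simp
  ultimately show "b * sgn a \<in> \<int> \<longleftrightarrow> b \<in> \<int>" "\<bar>a\<bar> * d + b * sgn a \<in> \<int> \<longleftrightarrow> a * d + b \<in> \<int>"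
    by (metis insert_iff singletonD)+
qed

lemma H_excess_normalise:
  assumes "a \<noteq> 0" "d > 0"
  shows "H a b d s - endpoint_excess a b d s = of_real d powr (- s) *
    (H (\<bar>a\<bar> * d) (b * sgn a) 1 s - endpoint_excess (\<bar>a\<bar> * d) (b * sgn a) 1 s)"
proof (cases "a > 0")
  case True
  then show ?thesis using H_scale[OF assms(2), of a b s] by (simp only: abs_of_pos sgn_pos mult_1_right)
next
  case False
  then have n: "\<bar>a\<bar> = - a" "b * sgn a = - b" using assms by auto
  show ?thesis unfolding n H_scale[OF assms(2), of "- a" "- b" s, symmetric] by (rule H_uminus[symmetric])
qed

lemma H_excess_eq:
  assumes "a \<noteq> 0" "d > 0" "s \<notin> \<nat>" "a * d + b \<in> \<int> \<Longrightarrow> s \<notin> \<int>"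
  shows "H a b d s - endpoint_excess a b d s = of_real d powr (- s) * H_ext (\<bar>a\<bar> * d) (b * sgn a) s"
proof -
  have "H (\<bar>a\<bar> * d) (b * sgn a) 1 s - endpoint_excess (\<bar>a\<bar> * d) (b * sgn a) 1 s = H_ext (\<bar>a\<bar> * d) (b * sgn a) s"
    by (rule H_excess_eq_H_ext) (use assms Ints_mult_sgn_iff(2)[OF assms(1)] in auto)
  then show ?thesis by (simp only: H_excess_normalise[OF assms(1,2), of b s])
qed

lemma lhs_excess_eq:
  assumes "a \<noteq> 0" "d > 0" "s \<notin> \<int>"
  shows "lhs a b d s - endpoint_excess a b d s = - (of_real d powr (- s) * rhs_sum (\<bar>a\<bar> * d) (b * sgn a) s)"
proof -
  define Z where "Z = hurwitz_zeta s (1 - frac (- b * sgn a)) / sin (of_real pi * s)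
    + hurwitz_zeta s (1 - frac (b * sgn a)) / tan (of_real pi * s)"
  have sN: "s \<notin> \<nat>" using assms(3) by (auto elim!: Nats_cases)
  have pos: "\<bar>a\<bar> * d > 0" using assms by simp
  have pw: "of_real (\<bar>a\<bar> * d) powr s = of_real \<bar>a\<bar> powr s * complex_of_real d powr s"
    using powr_times_real[of "of_real \<bar>a\<bar>" "of_real d" s] assms by simp
  have d: "complex_of_real d powr (- s) * of_real d powr s = 1" using assms by (simp flip: powr_add)
  have zp: "zeta_part (\<bar>a\<bar> * d) (b * sgn a) s = of_real d powr s * (of_real pi * of_real \<bar>a\<bar> powr s / s * Z)"
    unfolding zeta_part_def pw Z_def mult_minus_left[symmetric] by (simp only: times_divide_eq_left times_divide_eq_right mult_ac)
  have "lhs a b d s - endpoint_excess a b d s = H a b d s - endpoint_excess a b d s + of_real pi * of_real \<bar>a\<bar> powr s / s * Z"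
    unfolding lhs_def Z_def by (simp only: add_diff_eq diff_add_eq)
  also have "H a b d s - endpoint_excess a b d s = of_real d powr (- s) * H_ext (\<bar>a\<bar> * d) (b * sgn a) s"
    by (rule H_excess_eq) (use assms sN in auto)
  also have "of_real pi * of_real \<bar>a\<bar> powr s / s * Z = of_real d powr (- s) * zeta_part (\<bar>a\<bar> * d) (b * sgn a) s"
    unfolding zp mult.assoc[symmetric] d by simp
  also have "of_real d powr (- s) * H_ext (\<bar>a\<bar> * d) (b * sgn a) s + \<dots> = - (of_real d powr (- s) * rhs_sum (\<bar>a\<bar> * d) (b * sgn a) s)"
    unfolding rhs_sum_identity[OF pos assms(3)] by (simp add: algebra_simps)
  finally show ?thesis .
qed

lemma rhs_term_ext_sums:
  assumes "a \<noteq> 0" "d > 0"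
  shows "(\<lambda>k. rhs_term_ext a b d s (Suc k)) sums (of_real d powr (- s) * rhs_sum (\<bar>a\<bar> * d) (b * sgn a) s)"
proof -
  have "\<bar>a\<bar> * d > 0" using assms by simp
  from sums_mult[OF rhs_entire_sums[OF this], of "of_real d powr (- s)" "b * sgn a" s] show ?thesis
    by (simp add: rhs_term_ext_eq[OF assms] rhs_sum_def)
qed

lemma hyp_term_sums_general:
  assumes "a \<noteq> 0" "Re s < 1 \<and> b \<notin> \<int> \<or> Re s < 0" "s \<noteq> 0"
  shows "(\<lambda>k. hyp_term a b 1 s (Suc k)) sums (- H_ext \<bar>a\<bar> (b * sgn a) s)"
proof -
  have "hyp_term \<bar>a\<bar> (b * sgn a) 1 s k = hyp_term a b 1 s k" for k
    using assms(1) hyp_term_uminus[of a b 1 s k] by (cases "a > 0") auto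
  then show ?thesis
    using hyp_term_sums[of "\<bar>a\<bar>" s "b * sgn a"] assms Ints_mult_sgn_iff(1)[OF assms(1)] by simp
qed

text \<open>For d < 1 the factor d^(-s) is unbounded as Re s grows, so the uniform estimate is given
  for the summand multiplied by d^s.\<close>

lemma rhs_term_ext_bound:
  assumes "\<epsilon> > 0" "\<delta> > 0"
  obtains K where "K > 0" "\<And>a b d s k. Re s > - \<epsilon> \<Longrightarrow> \<bar>Im s\<bar> < \<epsilon> \<Longrightarrow> \<delta> \<le> \<bar>a\<bar> \<Longrightarrow> \<delta> \<le> d \<Longrightarrow>
    norm (of_real d powr s * rhs_term_ext a b d s (Suc k)) \<le> K / (real (Suc k))\<^sup>2"
proof -
  obtain K where K: "K > 0" "\<And>a b s k. a \<ge> \<delta> * \<delta> \<Longrightarrow> Re s \<ge> - \<epsilon> \<Longrightarrow> \<bar>Im s\<bar> \<le> \<epsilon> \<Longrightarrow> k > 0 \<Longrightarrow>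
      norm (rhs_entire a b s k) \<le> K / real k ^ 2"
    using rhs_entire_bound[OF assms(1), of "\<delta> * \<delta>"] assms(2) by auto
  show thesis
  proof (rule that[OF K(1)])
    fix a b d :: real and s :: complex and k :: nat
    assume h: "Re s > - \<epsilon>" "\<bar>Im s\<bar> < \<epsilon>" "\<delta> \<le> \<bar>a\<bar>" "\<delta> \<le> d"
    have pos: "a \<noteq> 0" "d > 0" using h assms by auto
    have "complex_of_real d powr s * of_real d powr (- s) = 1" using pos by (simp flip: powr_add)
    then have "of_real d powr s * rhs_term_ext a b d s (Suc k) = rhs_entire (\<bar>a\<bar> * d) (b * sgn a) s (Suc k)"
      unfolding rhs_term_ext_eq[OF pos zero_less_Suc] mult.assoc[symmetric] by simp
    moreover have "\<delta> * \<delta> \<le> \<bar>a\<bar> * d" using h assms by (intro mult_mono) auto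
    ultimately show "norm (of_real d powr s * rhs_term_ext a b d s (Suc k)) \<le> K / (real (Suc k))\<^sup>2"
      using K(2)[of "\<bar>a\<bar> * d" s "Suc k" "b * sgn a"] h by simp
  qed
qed

lemma lhs_sum_meromorphic:
  assumes "a \<noteq> 0" "d > 0"
  shows "(\<lambda>s. \<Sum>j. paired (lhs_term a b d s) j) meromorphic_on UNIV"
  unfolding paired_lhs_normalise[OF assms] by (rule lhs_sum_meromorphic_pos) (use assms in simp)

lemma lhs_sum_holomorphic_general:
  assumes "a \<noteq> 0" "d > 0"
  shows "(\<lambda>s. \<Sum>j. paired (lhs_term a b d s) j) holomorphic_on (- \<nat>)"
  unfolding paired_lhs_normalise[OF assms] by (rule lhs_sum_holomorphic) (use assms in simp)

lemma Re_gt_1_not_Nats: "{s. Re s > 1} - of_nat ` {2..} \<subseteq> - \<nat>"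
proof
  fix s :: complex assume s: "s \<in> {s. Re s > 1} - of_nat ` {2..}"
  show "s \<in> - \<nat>"
  proof
    assume "s \<in> \<nat>"
    then obtain n where n: "s = of_nat n" by (auto elim: Nats_cases)
    then have "n \<in> {2..}" using s by auto
    then show False using s n by blast
  qed
qed

lemma summable_inverse_squares_Suc: "summable (\<lambda>k. K / (real (Suc k))\<^sup>2)"
  using summable_inverse_squares[of K] by (subst summable_Suc_iff)

text \<open>Limits appear where individual summands can be singular although the combination is not:
  at natural \<open>s \<ge> 2\<close>, and in the last identity at negative integers
  \<open>s\<close> with a + b an integer. \<open>sums\<close> states convergence and value at
  once.\<close>

theorem theoremt:
  fixes a b d :: real
  assumes "a \<noteq> 0" and "d > 0"
  shows
    "(\<forall>s. Re s > 1 \<and> s \<notin> \<nat> \<longrightarrow>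
       (\<lambda>k. rhs_term a b d s (Suc k)) sums (- (lhs a b d s - endpoint_excess a b d s))) \<and>
     (\<forall>m::nat. m \<ge> 2 \<longrightarrow>
       ((\<lambda>s. lhs a b d s - endpoint_excess a b d s)
          \<longlongrightarrow> - (\<Sum>k. rhs_term_ext a b d (of_nat m) (Suc k))) (at (of_nat m))) \<and>
     (\<forall>s. s \<notin> \<nat> \<longrightarrow> summable (\<lambda>j. norm (paired (lhs_term a b d s) j))) \<and>
     ((\<lambda>s. \<Sum>j. paired (lhs_term a b d s) j) meromorphic_on UNIV) \<and>
     ((\<lambda>s. \<Sum>j. paired (lhs_term a b d s) j) holomorphic_on ({s. Re s > 1} - of_nat ` {2..})) \<and>
     ((\<lambda>s. \<Sum>j. paired (lhs_term a b d s) j) holomorphic_on (- \<nat>)) \<and>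
     (\<forall>\<epsilon>>0. \<forall>\<delta>>0.
       abs_unif_convergent_on (left_region \<epsilon> \<delta>) (\<lambda>j s. paired (lhs_term a b d s) j)) \<and>
     (\<forall>\<epsilon>>0. \<forall>\<delta>>0. \<forall>B.
       abs_unif_convergent_on
         {(s, b'). s \<in> left_region \<epsilon> \<delta> \<and> b' \<in> away_from_Ints \<delta> \<and> \<bar>b'\<bar> \<le> B}
         (\<lambda>j (s, b'). paired (lhs_term a b' d s) j)) \<and>
     (\<forall>\<epsilon>>0. \<forall>\<delta>>0. \<forall>C.
       abs_unif_convergent_on
         {(s, a', d'). s \<in> left_region \<epsilon> \<delta> \<and> a' \<noteq> 0 \<and> d' > 0 \<and>
            a' * d' + b \<in> away_from_Ints \<delta> \<and> \<bar>a' * d'\<bar> \<le> C}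
         (\<lambda>j (s, a', d'). paired (lhs_term a' b d' s) j)) \<and>
     (\<forall>\<epsilon>>0. \<forall>\<delta>>0. \<forall>B C.
       abs_unif_convergent_on
         {(s, a', b', d'). s \<in> left_region \<epsilon> \<delta> \<and> a' \<noteq> 0 \<and> d' > 0 \<and>
            b' \<in> away_from_Ints \<delta> \<and> \<bar>b'\<bar> \<le> B \<and>
            a' * d' + b' \<in> away_from_Ints \<delta> \<and> \<bar>a' * d'\<bar> \<le> C}
         (\<lambda>j (s, a', b', d'). paired (lhs_term a' b' d' s) j)) \<and>
     ((\<lambda>s. \<Sum>k. rhs_term_ext a b d s (Suc k)) holomorphic_on UNIV) \<and>
     (\<forall>\<epsilon>>0. \<forall>\<delta>>0. \<forall>C M.
       abs_unif_convergent_on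
         {(s, a', b', d'). Re s > - \<epsilon> \<and> \<bar>Im s\<bar> < \<epsilon> \<and>
            \<delta> \<le> \<bar>a'\<bar> \<and> \<bar>a'\<bar> \<le> C \<and> \<delta> \<le> d' \<and> d' \<le> C \<and> norm (of_real d' powr (- s)) \<le> M}
         (\<lambda>k (s, a', b', d'). rhs_term_ext a' b' d' s (Suc k))) \<and>
     (\<forall>\<epsilon>>0. \<forall>\<delta>>0. \<forall>C.
       abs_unif_convergent_on
         {(s, a', b', d'). Re s > - \<epsilon> \<and> \<bar>Im s\<bar> < \<epsilon> \<and>
            \<delta> \<le> \<bar>a'\<bar> \<and> \<bar>a'\<bar> \<le> C \<and> \<delta> \<le> d' \<and> d' \<le> C}
         (\<lambda>k (s, a', b', d'). of_real d' powr s * rhs_term_ext a' b' d' s (Suc k))) \<and>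
     (\<forall>s. (Re s < 1 \<and> b \<notin> \<int> \<or> Re s < 0 \<and> b \<in> \<int>) \<and> s \<noteq> 0 \<and> (a + b \<in> \<int> \<longrightarrow> s \<notin> \<int>) \<longrightarrow>
       (\<lambda>k. hyp_term a b 1 s (Suc k)) sums (- (H a b 1 s - endpoint_excess a b 1 s))) \<and>
     (\<forall>s. a + b \<in> \<int> \<and> s \<in> \<int> \<and> Re s < 0 \<longrightarrow>
       summable (\<lambda>k. hyp_term a b 1 s (Suc k)) \<and>
       ((\<lambda>z. H a b 1 z - endpoint_excess a b 1 z)
          \<longlongrightarrow> - (\<Sum>k. hyp_term a b 1 s (Suc k))) (at s))"
proof (intro conjI allI impI, goal_cases)
  case (1 s)
  then have "s \<notin> \<int>"
  proof (intro notI)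
    assume s: "Re s > 1 \<and> s \<notin> \<nat>" and "s \<in> \<int>"
    then obtain n where n: "s = of_int n" by (auto elim: Ints_cases)
    then have "s = of_nat (nat n)" using s by simp
    then show False using s by (metis of_nat_in_Nats)
  qed
  then have "- (lhs a b d s - endpoint_excess a b d s) = of_real d powr (- s) * rhs_sum (\<bar>a\<bar> * d) (b * sgn a) s"
    by (subst lhs_excess_eq[OF assms]) auto
  moreover have "rhs_term a b d s (Suc k) = rhs_term_ext a b d s (Suc k)" for k
    using rhs_term_eq_entire_general[OF _ assms zero_less_Suc] 1 by (simp add: rhs_term_ext_eq[OF assms zero_less_Suc])
  ultimately show ?case using rhs_term_ext_sums[OF assms, of b s] by simp
next
  case (2 m)
  have "\<bar>a\<bar> * d > 0" using assms by simp
  then have "(\<lambda>s. - (of_real d powr (- s) * rhs_sum (\<bar>a\<bar> * d) (b * sgn a) s)) holomorphic_on UNIV"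
    using assms by (intro holomorphic_intros rhs_sum_holomorphic) auto
  then have "isCont (\<lambda>s. - (of_real d powr (- s) * rhs_sum (\<bar>a\<bar> * d) (b * sgn a) s)) (of_nat m)"
    by (intro continuous_on_interior[OF holomorphic_on_imp_continuous_on]) auto
  then have "((\<lambda>s. - (of_real d powr (- s) * rhs_sum (\<bar>a\<bar> * d) (b * sgn a) s)) \<longlongrightarrow> - (\<Sum>k. rhs_term_ext a b d (of_nat m) (Suc k))) (at (of_nat m))"
    unfolding sums_unique[OF rhs_term_ext_sums[OF assms], symmetric] isCont_def .
  \<comment> \<open>Off the integers, hence in a punctured neighbourhood of \<open>m\<close>, the
    left-hand side is represented by an entire function.\<close>
  moreover have "\<forall>\<^sub>F s in at (of_nat m). - (of_real d powr (- s) * rhs_sum (\<bar>a\<bar> * d) (b * sgn a) s) = lhs a b d s - endpoint_excess a b d s"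
    using eventually_at_not_Ints by eventually_elim (rule lhs_excess_eq[OF assms, symmetric])
  ultimately show ?case by (rule Lim_transform_eventually)
next
  case (3 s)
  then show ?case by (rule lhs_term_summable)
next
  case 4
  show ?case by (rule lhs_sum_meromorphic[OF assms])
next
  case 5
  show ?case by (rule holomorphic_on_subset[OF lhs_sum_holomorphic_general[OF assms] Re_gt_1_not_Nats])
next
  case 6
  show ?case by (rule lhs_sum_holomorphic_general[OF assms])
next
  case (7 \<epsilon> \<delta>)
  show ?case
    using lhs_abs_unif_convergent[OF 7, where X = "left_region \<epsilon> \<delta>" and S = "\<lambda>s. s"
        and a = "\<lambda>_. a" and b = "\<lambda>_. b" and d = "\<lambda>_. d" and B = "\<bar>b\<bar>" and C = "\<bar>a * d\<bar>"] by simp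
next
  case (8 \<epsilon> \<delta> B)
  show ?case unfolding case_prod_unfold
    by (rule lhs_abs_unif_convergent[OF 8, where C = "\<bar>a * d\<bar>" and B = B]) auto
next
  case (9 \<epsilon> \<delta> C)
  show ?case unfolding case_prod_unfold
    by (rule lhs_abs_unif_convergent[OF 9, where C = C and B = "\<bar>b\<bar>"]) auto
next
  case (10 \<epsilon> \<delta> B C)
  show ?case unfolding case_prod_unfold
    by (rule lhs_abs_unif_convergent[OF 10, where C = C and B = B]) auto
next
  case 11
  have "\<bar>a\<bar> * d > 0" using assms by simp
  then show ?case unfolding sums_unique[OF rhs_term_ext_sums[OF assms], symmetric]
    using assms by (intro holomorphic_intros rhs_sum_holomorphic) auto
next
  case (12 \<epsilon> \<delta> C M)
  obtain K where K: "K > 0" "\<And>a b d s k. Re s > - \<epsilon> \<Longrightarrow> \<bar>Im s\<bar> < \<epsilon> \<Longrightarrow> \<delta> \<le> \<bar>a\<bar> \<Longrightarrow> \<delta> \<le> d \<Longrightarrow>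
      norm (of_real d powr s * rhs_term_ext a b d s (Suc k)) \<le> K / (real (Suc k))\<^sup>2"
    using rhs_term_ext_bound[OF 12] by blast
  \<comment> \<open>The bound \<open>M\<close> on d^(-s) undoes the normalisation by d^s in
    \<open>rhs_term_ext_bound\<close>.\<close>
  have "norm (rhs_term_ext a' b' d' s (Suc k)) \<le> M * K / (real (Suc k))\<^sup>2"
    if "Re s > - \<epsilon>" "\<bar>Im s\<bar> < \<epsilon>" "\<delta> \<le> \<bar>a'\<bar>" "\<delta> \<le> d'" "norm (of_real d' powr (- s)) \<le> M" for a' b' d' s k
  proof -
    have "d' > 0" using that 12 by simp
    then have "complex_of_real d' powr (- s) * of_real d' powr s = 1" by (simp flip: powr_add)
    then have "rhs_term_ext a' b' d' s (Suc k) = of_real d' powr (- s) * (of_real d' powr s * rhs_term_ext a' b' d' s (Suc k))"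
      by (simp only: mult.assoc[symmetric] mult_1_left)
    then have "norm (rhs_term_ext a' b' d' s (Suc k)) = norm (of_real d' powr (- s)) * norm (of_real d' powr s * rhs_term_ext a' b' d' s (Suc k))"
      by (metis norm_mult)
    also have "\<dots> \<le> M * (K / (real (Suc k))\<^sup>2)"
      using K(1) that order_trans[OF norm_ge_zero that(5)] by (intro mult_mono K(2)) auto
    finally show ?thesis by simp
  qed
  then show ?case
    by (intro abs_unif_convergent_onI[where J = 0, OF _ summable_inverse_squares_Suc[of "M * K"]]) auto
next
  case (13 \<epsilon> \<delta> C)
  obtain K where K: "K > 0" "\<And>a b d s k. Re s > - \<epsilon> \<Longrightarrow> \<bar>Im s\<bar> < \<epsilon> \<Longrightarrow> \<delta> \<le> \<bar>a\<bar> \<Longrightarrow> \<delta> \<le> d \<Longrightarrow>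
      norm (of_real d powr s * rhs_term_ext a b d s (Suc k)) \<le> K / (real (Suc k))\<^sup>2"
    using rhs_term_ext_bound[OF 13] by blast
  show ?case
    by (intro abs_unif_convergent_onI[where J = 0, OF _ summable_inverse_squares_Suc[of K]]) (use K(2) in \<open>auto simp del: of_nat_Suc\<close>)
next
  case (14 s)
  have N: "s \<notin> \<nat>"
  proof
    assume "s \<in> \<nat>"
    then obtain n where "s = of_nat n" by (auto elim: Nats_cases)
    then show False using 14 by auto
  qed
  have "H a b 1 s - endpoint_excess a b 1 s = H_ext \<bar>a\<bar> (b * sgn a) s"
    using H_excess_eq[OF assms(1) zero_less_one N, of b] 14 by simp
  moreover have "(\<lambda>k. hyp_term a b 1 s (Suc k)) sums (- H_ext \<bar>a\<bar> (b * sgn a) s)"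
    using 14 by (intro hyp_term_sums_general assms(1)) auto
  ultimately show ?case by (simp only:)
next
  case (15 s)
  have "(\<lambda>k. hyp_term a b 1 s (Suc k)) sums (- H_ext \<bar>a\<bar> (b * sgn a) s)"
    using 15 by (intro hyp_term_sums_general assms(1)) auto
  then show ?case by (rule sums_summable)
next
  case (16 s)
  have N: "s \<notin> \<nat>" using 16 by (auto elim!: Nats_cases)
  have sm: "(\<lambda>k. hyp_term a b 1 s (Suc k)) sums (- H_ext \<bar>a\<bar> (b * sgn a) s)"
    using 16 by (intro hyp_term_sums_general assms(1)) auto
  \<comment> \<open>\<open>H_ext\<close> is continuous at negative integers, where Digamma (1 + s)
    and the cotangent have poles; agreement off the integers then gives the limit.\<close>
  have "H_ext \<bar>a\<bar> (b * sgn a) holomorphic_on - \<nat>" using assms by (intro H_ext_holomorphic) simp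
  then have "continuous_on (- \<nat>) (H_ext \<bar>a\<bar> (b * sgn a))" by (rule holomorphic_on_imp_continuous_on)
  then have "isCont (H_ext \<bar>a\<bar> (b * sgn a)) s" using N open_Compl_Nats by (simp add: continuous_on_eq_continuous_at)
  then have "(H_ext \<bar>a\<bar> (b * sgn a) \<longlongrightarrow> - (\<Sum>k. hyp_term a b 1 s (Suc k))) (at s)"
    unfolding sums_unique[OF sm, symmetric] isCont_def by simp
  moreover have "\<forall>\<^sub>F z in at s. H_ext \<bar>a\<bar> (b * sgn a) z = H a b 1 z - endpoint_excess a b 1 z"
    using eventually_at_not_Ints
  proof eventually_elim
    case (elim z)
    then have "z \<notin> \<nat>" by (auto elim!: Nats_cases)
    then show ?case using H_excess_eq[OF assms(1) zero_less_one, of z b] elim by simp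
  qed
  ultimately show ?case by (rule Lim_transform_eventually)
qed

end
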